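(* Let $k$ be an algebraically closed field and let $\mathcal{C}$ be a finite tensor category over $k$ satisfying the finiteness condition $\mathbf{Fg}$. An object $X$ of $\mathcal{C}$ is projective if and only if $\dim V_{\mathcal{C}}(X)=0$.
   Context: A finite tensor category over $k$ (algebraically closed, arbitrary characteristic) is a $k$-linear abelian category $\mathcal{C}$ that is locally finite (finite dimensional morphism spaces, all objects of finite length), has finitely many isomorphism classes of simple objects and enough projectives, and is equipped with a monoidal structure $\otimes$, bilinear on morphisms, with simple unit object $\mathbf{1}$, such that every object has left and right duals (rigidity). Then $\otimes$ is exact in each variable, tensoring a projective object with any object gives a projective object, and projective and injective objects coincide. Cohomology. $\operatorname{Ext}^*_{\mathcal{C}}(X,Y)=\bigoplus_{n\ge 0}\operatorname{Ext}^n_{\mathcal{C}}(X,Y)$, and $\operatorname{H}^*(\mathcal{C})=\operatorname{Ext}^*_{\mathcal{C}}(\mathbf{1},\mathbf{1})$ is the cohomology ring (with Yoneda product), a graded-commutative $k$-algebra with $\operatorname{H}^0(\mathcal{C})=k$. The exact functor $-\otimes X$ induces a homomorphism of graded algebras $\varphi_X:\operatorname{H}^*(\mathcal{C})\to \operatorname{Ext}^*_{\mathcal{C}}(X,X)$, and $\operatorname{H}^*(\mathcal{C})$ acts on $\operatorname{Ext}^*_{\mathcal{C}}(X,Y)$ on the left via $\varphi_Y$ and on the right via $\varphi_X$, followed by Yoneda composition; the two actions agree up to sign. Put $\operatorname{H}^{\bullet}(\mathcal{C})=\operatorname{H}^*(\mathcal{C})$ if $\operatorname{char} k=2$, and $\operatorname{H}^{\bullet}(\mathcal{C})=\operatorname{H}^{2*}(\mathcal{C})=\bigoplus_{n\ge0}\operatorname{H}^{2n}(\mathcal{C})$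 otherwise; this is a commutative graded ring with unique maximal homogeneous ideal $\mathfrak{m}_0$ (the positive degree part). Condition $\mathbf{Fg}$: the ring $\operatorname{H}^*(\mathcal{C})$ is finitely generated, and $\operatorname{Ext}^*_{\mathcal{C}}(X,X)$ is a finitely generated $\operatorname{H}^*(\mathcal{C})$-module for all objects $X$. Support varieties. $I_{\mathcal{C}}(X)$ is the annihilator of $\operatorname{Ext}^*_{\mathcal{C}}(X,X)$ in $\operatorname{H}^{\bullet}(\mathcal{C})$, and $V_{\mathcal{C}}(X)=\{\mathfrak{m}_0\}\cup\{\mathfrak{m}\in\operatorname{MaxSpec}\operatorname{H}^{\bullet}(\mathcal{C}) : I_{\mathcal{C}}(X)\subseteq\mathfrak{m}\}$. Its dimension $\dim V_{\mathcal{C}}(X)$ is the Krull dimension of $\operatorname{H}^{\bullet}(\mathcal{C})/I_{\mathcal{C}}(X)$, equivalently the rate of growth of this quotient as a graded vector space, i.e. the smallest integer $c\ge0$ such that for some real $b$ the dimension of its degree $n$ part is at most $bn^{c-1}$ for all positive integers $n$ (so it is $0$ when the quotient is the zero ring). *)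

theory Defs
  imports "HOL-Algebra.Algebra" "HOL-Library.Extended_Nat"
begin

(* In HOL-Algebra \<open>X\<close> denotes the polynomial indeterminate; here it is an object variable. *)
no_notation var (\<open>X\<index>\<close>)


section \<open>Categories\<close>

record ('o, 'm) category =
  Obj :: "'o set"
  Arr :: "'m set"
  Dom :: "'m \<Rightarrow> 'o"
  Cod :: "'m \<Rightarrow> 'o"
  Ide :: "'o \<Rightarrow> 'm"
  Comp :: "'m \<Rightarrow> 'm \<Rightarrow> 'm" (infixr \<open>\<bullet>\<index>\<close> 70)

definition homset where
  "homset C X Y = {f \<in> Arr C. Dom C f = X \<and> Cod C f = Y}"

locale category =
  fixes C (structure)
  assumes Dom_Obj: "f \<in> Arr C \<Longrightarrow> Dom C f \<in> Obj C"
    and Cod_Obj: "f \<in> Arr C \<Longrightarrow> Cod C f \<in> Obj C"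
    and Ide_hom: "X \<in> Obj C \<Longrightarrow> Ide C X \<in> homset C X X"
    and Comp_hom: "\<lbrakk>g \<in> homset C Y Z; f \<in> homset C X Y\<rbrakk> \<Longrightarrow> g \<bullet> f \<in> homset C X Z"
    and Comp_assoc:
      "\<lbrakk>h \<in> homset C Y Z; g \<in> homset C X Y; f \<in> homset C W X\<rbrakk> \<Longrightarrow> (h \<bullet> g) \<bullet> f = h \<bullet> (g \<bullet> f)"
    and Comp_Ide: "f \<in> homset C X Y \<Longrightarrow> f \<bullet> Ide C X = f"
    and Ide_Comp: "f \<in> homset C X Y \<Longrightarrow> Ide C Y \<bullet> f = f"

definition monic where
  "monic C f \<longleftrightarrow> f \<in> Arr C \<and>
     (\<forall>W. \<forall>g \<in> homset C W (Dom C f). \<forall>h \<in> homset C W (Dom C f). f \<bullet> g = f \<bullet> h \<longrightarrow> g = h)"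
  for C (structure)

definition epic where
  "epic C f \<longleftrightarrow> f \<in> Arr C \<and>
     (\<forall>W. \<forall>g \<in> homset C (Cod C f) W. \<forall>h \<in> homset C (Cod C f) W. g \<bullet> f = h \<bullet> f \<longrightarrow> g = h)"
  for C (structure)

definition inverse_arrows where
  "inverse_arrows C f g \<longleftrightarrow> f \<in> Arr C \<and> g \<in> homset C (Cod C f) (Dom C f) \<and>
     g \<bullet> f = Ide C (Dom C f) \<and> f \<bullet> g = Ide C (Cod C f)"
  for C (structure)

definition iso_arrow where
  "iso_arrow C f \<longleftrightarrow> (\<exists>g. inverse_arrows C f g)"

definition inv_arrow where
  "inv_arrow C f = (THE g. inverse_arrows C f g)"

definition isomorphic_obj where
  "isomorphic_obj C X Y \<longleftrightarrow> (\<exists>f \<in> homset C X Y. iso_arrow C f)"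

definition zero_obj where
  "zero_obj C Z \<longleftrightarrow> Z \<in> Obj C \<and>
     (\<forall>X \<in> Obj C. (\<exists>!f. f \<in> homset C X Z) \<and> (\<exists>!f. f \<in> homset C Z X))"

definition projective_obj where
  "projective_obj C P \<longleftrightarrow> P \<in> Obj C \<and>
     (\<forall>e f. epic C e \<and> f \<in> homset C P (Cod C e) \<longrightarrow> (\<exists>g \<in> homset C P (Dom C e). e \<bullet> g = f))"
  for C (structure)

definition simple_obj where
  "simple_obj C S \<longleftrightarrow> S \<in> Obj C \<and> \<not> zero_obj C S \<and>
     (\<forall>i. monic C i \<and> Cod C i = S \<longrightarrow> zero_obj C (Dom C i) \<or> iso_arrow C i)"

definition enough_projectives where
  "enough_projectives C \<longleftrightarrow>
     (\<forall>X \<in> Obj C. \<exists>e. epic C e \<and> Cod C e = X \<and> projective_obj C (Dom C e))"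

definition finitely_many_simples where
  "finitely_many_simples C \<longleftrightarrow>
     (\<exists>T. finite T \<and> T \<subseteq> Obj C \<and> (\<forall>S. simple_obj C S \<longrightarrow> (\<exists>S' \<in> T. isomorphic_obj C S S')))"


section \<open>Linear abelian categories\<close>

text \<open>
  \<^term>\<open>HomMod C X Y\<close> is the vector space of morphisms from \<^term>\<open>X\<close> to \<^term>\<open>Y\<close>. The ring
  components \<^term>\<open>monoid.mult\<close> and \<^term>\<open>monoid.one\<close> that a module record also carries are never used.
\<close>

record ('o, 'm, 'k) linear_category = "('o, 'm) category" +
  HomMod :: "'o \<Rightarrow> 'o \<Rightarrow> ('k, 'm) module"

abbreviation zero_arrow where
  "zero_arrow C X Y \<equiv> \<zero>\<^bsub>HomMod C X Y\<^esub>"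

locale linear_category = K?: field K + category C for K and C (structure) +
  assumes HomMod_module: "\<lbrakk>X \<in> Obj C; Y \<in> Obj C\<rbrakk> \<Longrightarrow> module K (HomMod C X Y)"
    and HomMod_carrier: "\<lbrakk>X \<in> Obj C; Y \<in> Obj C\<rbrakk> \<Longrightarrow> carrier (HomMod C X Y) = homset C X Y"
    and Comp_add_left:
      "\<lbrakk>g \<in> homset C Y Z; h \<in> homset C Y Z; f \<in> homset C X Y\<rbrakk> \<Longrightarrow>
       (g \<oplus>\<^bsub>HomMod C Y Z\<^esub> h) \<bullet> f = g \<bullet> f \<oplus>\<^bsub>HomMod C X Z\<^esub> h \<bullet> f"
    and Comp_add_right:
      "\<lbrakk>h \<in> homset C Y Z; f \<in> homset C X Y; g \<in> homset C X Y\<rbrakk> \<Longrightarrow>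
       h \<bullet> (f \<oplus>\<^bsub>HomMod C X Y\<^esub> g) = h \<bullet> f \<oplus>\<^bsub>HomMod C X Z\<^esub> h \<bullet> g"
    and Comp_smult_left:
      "\<lbrakk>a \<in> carrier K; g \<in> homset C Y Z; f \<in> homset C X Y\<rbrakk> \<Longrightarrow>
       (a \<odot>\<^bsub>HomMod C Y Z\<^esub> g) \<bullet> f = a \<odot>\<^bsub>HomMod C X Z\<^esub> (g \<bullet> f)"
    and Comp_smult_right:
      "\<lbrakk>a \<in> carrier K; g \<in> homset C Y Z; f \<in> homset C X Y\<rbrakk> \<Longrightarrow>
       g \<bullet> (a \<odot>\<^bsub>HomMod C X Y\<^esub> f) = a \<odot>\<^bsub>HomMod C X Z\<^esub> (g \<bullet> f)"

definition is_kernel where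
  "is_kernel C k f \<longleftrightarrow> f \<in> Arr C \<and> k \<in> Arr C \<and> Cod C k = Dom C f \<and>
     f \<bullet> k = zero_arrow C (Dom C k) (Cod C f) \<and>
     (\<forall>W. \<forall>g \<in> homset C W (Dom C f). f \<bullet> g = zero_arrow C W (Cod C f) \<longrightarrow>
        (\<exists>!u. u \<in> homset C W (Dom C k) \<and> k \<bullet> u = g))"
  for C (structure)

definition is_cokernel where
  "is_cokernel C q f \<longleftrightarrow> f \<in> Arr C \<and> q \<in> Arr C \<and> Dom C q = Cod C f \<and>
     q \<bullet> f = zero_arrow C (Dom C f) (Cod C q) \<and>
     (\<forall>W. \<forall>g \<in> homset C (Cod C f) W. g \<bullet> f = zero_arrow C (Dom C f) W \<longrightarrow>
        (\<exists>!u. u \<in> homset C (Cod C q) W \<and> u \<bullet> q = g))"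
  for C (structure)

definition is_biproduct where
  "is_biproduct C X Y B i j p q \<longleftrightarrow>
     i \<in> homset C X B \<and> j \<in> homset C Y B \<and> p \<in> homset C B X \<and> q \<in> homset C B Y \<and>
     p \<bullet> i = Ide C X \<and> q \<bullet> j = Ide C Y \<and> q \<bullet> i = zero_arrow C X Y \<and> p \<bullet> j = zero_arrow C Y X \<and>
     i \<bullet> p \<oplus>\<^bsub>HomMod C B B\<^esub> j \<bullet> q = Ide C B"
  for C (structure)

locale linear_abelian_category = linear_category +
  assumes zero_obj_exists: "\<exists>Z. zero_obj C Z"
    and biproduct_exists: "\<lbrakk>X \<in> Obj C; Y \<in> Obj C\<rbrakk> \<Longrightarrow> \<exists>B i j p q. is_biproduct C X Y B i j p q"
    and kernel_exists: "f \<in> Arr C \<Longrightarrow> \<exists>k. is_kernel C k f"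
    and cokernel_exists: "f \<in> Arr C \<Longrightarrow> \<exists>q. is_cokernel C q f"
    and monic_is_kernel: "monic C i \<Longrightarrow> \<exists>f. is_kernel C i f"
    and epic_is_cokernel: "epic C p \<Longrightarrow> \<exists>f. is_cokernel C p f"

text \<open>In an abelian category, the first rule says: if \<open>0 \<rightarrow> A \<rightarrow> X \<rightarrow> S \<rightarrow> 0\<close> is exact with \<open>S\<close>
  simple and \<open>A\<close> of finite length, then \<open>X\<close> has finite length.\<close>

inductive finite_length for C where
  step: "\<lbrakk>finite_length C (Dom C i); monic C i; is_cokernel C p i; simple_obj C (Cod C p)\<rbrakk>
         \<Longrightarrow> finite_length C (Cod C i)"
| zero: "zero_obj C Z \<Longrightarrow> finite_length C Z"

text \<open>Only the action of the carrier of \<open>R\<close> on \<open>M\<close> enters, so this also makes sense for left modules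
  over noncommutative rings, where the locale \<^locale>\<open>module\<close> does not apply.\<close>

definition fin_gen_module where
  "fin_gen_module R M \<longleftrightarrow>
     (\<exists>B. finite B \<and> B \<subseteq> carrier M \<and> (\<forall>N. submodule N R M \<and> B \<subseteq> N \<longrightarrow> N = carrier M))"


section \<open>Finite tensor categories\<close>

text \<open>\<^term>\<open>Assoc C X Y Z\<close> goes from \<open>(X \<otimes> Y) \<otimes> Z\<close> to \<open>X \<otimes> (Y \<otimes> Z)\<close>; \<^term>\<open>LUnit C X\<close> and
  \<^term>\<open>RUnit C X\<close> go from \<open>1 \<otimes> X\<close> and \<open>X \<otimes> 1\<close> to \<open>X\<close>.\<close>

record ('o, 'm, 'k) tensor_category = "('o, 'm, 'k) linear_category" +
  TensorO :: "'o \<Rightarrow> 'o \<Rightarrow> 'o" (infixr \<open>\<boxtimes>\<index>\<close> 75)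
  TensorA :: "'m \<Rightarrow> 'm \<Rightarrow> 'm" (infixr \<open>\<star>\<index>\<close> 75)
  UnitO :: "'o"
  Assoc :: "'o \<Rightarrow> 'o \<Rightarrow> 'o \<Rightarrow> 'm"
  LUnit :: "'o \<Rightarrow> 'm"
  RUnit :: "'o \<Rightarrow> 'm"

locale monoidal_category = category +
  assumes TensorO_Obj: "\<lbrakk>X \<in> Obj C; Y \<in> Obj C\<rbrakk> \<Longrightarrow> X \<boxtimes> Y \<in> Obj C"
    and UnitO_Obj: "UnitO C \<in> Obj C"
    and TensorA_hom:
      "\<lbrakk>f \<in> homset C X X'; g \<in> homset C Y Y'\<rbrakk> \<Longrightarrow> f \<star> g \<in> homset C (X \<boxtimes> Y) (X' \<boxtimes> Y')"
    and TensorA_Ide: "\<lbrakk>X \<in> Obj C; Y \<in> Obj C\<rbrakk> \<Longrightarrow> Ide C X \<star> Ide C Y = Ide C (X \<boxtimes> Y)"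
    and TensorA_Comp:
      "\<lbrakk>f \<in> homset C X X'; f' \<in> homset C X' X''; g \<in> homset C Y Y'; g' \<in> homset C Y' Y''\<rbrakk> \<Longrightarrow>
       (f' \<bullet> f) \<star> (g' \<bullet> g) = (f' \<star> g') \<bullet> (f \<star> g)"
    and Assoc_hom:
      "\<lbrakk>X \<in> Obj C; Y \<in> Obj C; Z \<in> Obj C\<rbrakk> \<Longrightarrow>
       Assoc C X Y Z \<in> homset C ((X \<boxtimes> Y) \<boxtimes> Z) (X \<boxtimes> (Y \<boxtimes> Z))"
    and Assoc_iso: "\<lbrakk>X \<in> Obj C; Y \<in> Obj C; Z \<in> Obj C\<rbrakk> \<Longrightarrow> iso_arrow C (Assoc C X Y Z)"
    and Assoc_natural:
      "\<lbrakk>f \<in> homset C X X'; g \<in> homset C Y Y'; h \<in> homset C Z Z'\<rbrakk> \<Longrightarrow>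
       Assoc C X' Y' Z' \<bullet> ((f \<star> g) \<star> h) = (f \<star> (g \<star> h)) \<bullet> Assoc C X Y Z"
    and LUnit_hom: "X \<in> Obj C \<Longrightarrow> LUnit C X \<in> homset C (UnitO C \<boxtimes> X) X"
    and LUnit_iso: "X \<in> Obj C \<Longrightarrow> iso_arrow C (LUnit C X)"
    and LUnit_natural:
      "f \<in> homset C X Y \<Longrightarrow> LUnit C Y \<bullet> (Ide C (UnitO C) \<star> f) = f \<bullet> LUnit C X"
    and RUnit_hom: "X \<in> Obj C \<Longrightarrow> RUnit C X \<in> homset C (X \<boxtimes> UnitO C) X"
    and RUnit_iso: "X \<in> Obj C \<Longrightarrow> iso_arrow C (RUnit C X)"
    and RUnit_natural:
      "f \<in> homset C X Y \<Longrightarrow> RUnit C Y \<bullet> (f \<star> Ide C (UnitO C)) = f \<bullet> RUnit C X"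
    and pentagon:
      "\<lbrakk>W \<in> Obj C; X \<in> Obj C; Y \<in> Obj C; Z \<in> Obj C\<rbrakk> \<Longrightarrow>
       Assoc C W X (Y \<boxtimes> Z) \<bullet> Assoc C (W \<boxtimes> X) Y Z =
       (Ide C W \<star> Assoc C X Y Z) \<bullet> Assoc C W (X \<boxtimes> Y) Z \<bullet> (Assoc C W X Y \<star> Ide C Z)"
    and triangle:
      "\<lbrakk>X \<in> Obj C; Y \<in> Obj C\<rbrakk> \<Longrightarrow>
       (Ide C X \<star> LUnit C Y) \<bullet> Assoc C X (UnitO C) Y = RUnit C X \<star> Ide C Y"

text \<open>\<open>D\<close> is a left dual of \<open>X\<close>, equivalently \<open>X\<close> is a right dual of \<open>D\<close>: the two zigzag
  composites are identities, up to the unit isomorphisms.\<close>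

definition is_left_dual where
  "is_left_dual C D X \<longleftrightarrow> D \<in> Obj C \<and> X \<in> Obj C \<and>
     (\<exists>ev \<in> homset C (D \<boxtimes> X) (UnitO C). \<exists>coev \<in> homset C (UnitO C) (X \<boxtimes> D).
        RUnit C X \<bullet> (Ide C X \<star> ev) \<bullet> Assoc C X D X \<bullet> (coev \<star> Ide C X) = LUnit C X \<and>
        LUnit C D \<bullet> (ev \<star> Ide C D) \<bullet> inv_arrow C (Assoc C D X D) \<bullet> (Ide C D \<star> coev) = RUnit C D)"
  for C (structure)

locale finite_tensor_category = linear_abelian_category + monoidal_category +
  assumes hom_finite_dim: "\<lbrakk>X \<in> Obj C; Y \<in> Obj C\<rbrakk> \<Longrightarrow> fin_gen_module K (HomMod C X Y)"
    and all_finite_length: "X \<in> Obj C \<Longrightarrow> finite_length C X"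
    and finitely_many_simples: "finitely_many_simples C"
    and enough_projectives: "enough_projectives C"
    and TensorA_add_left:
      "\<lbrakk>f \<in> homset C X X'; f' \<in> homset C X X'; g \<in> homset C Y Y'\<rbrakk> \<Longrightarrow>
       (f \<oplus>\<^bsub>HomMod C X X'\<^esub> f') \<star> g = f \<star> g \<oplus>\<^bsub>HomMod C (X \<boxtimes> Y) (X' \<boxtimes> Y')\<^esub> f' \<star> g"
    and TensorA_add_right:
      "\<lbrakk>f \<in> homset C X X'; g \<in> homset C Y Y'; g' \<in> homset C Y Y'\<rbrakk> \<Longrightarrow>
       f \<star> (g \<oplus>\<^bsub>HomMod C Y Y'\<^esub> g') = f \<star> g \<oplus>\<^bsub>HomMod C (X \<boxtimes> Y) (X' \<boxtimes> Y')\<^esub> f \<star> g'"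
    and TensorA_smult_left:
      "\<lbrakk>a \<in> carrier K; f \<in> homset C X X'; g \<in> homset C Y Y'\<rbrakk> \<Longrightarrow>
       (a \<odot>\<^bsub>HomMod C X X'\<^esub> f) \<star> g = a \<odot>\<^bsub>HomMod C (X \<boxtimes> Y) (X' \<boxtimes> Y')\<^esub> (f \<star> g)"
    and TensorA_smult_right:
      "\<lbrakk>a \<in> carrier K; f \<in> homset C X X'; g \<in> homset C Y Y'\<rbrakk> \<Longrightarrow>
       f \<star> (a \<odot>\<^bsub>HomMod C Y Y'\<^esub> g) = a \<odot>\<^bsub>HomMod C (X \<boxtimes> Y) (X' \<boxtimes> Y')\<^esub> (f \<star> g)"
    and UnitO_simple: "simple_obj C (UnitO C)"
    and left_dual_exists: "X \<in> Obj C \<Longrightarrow> \<exists>D. is_left_dual C D X"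
    and right_dual_exists: "X \<in> Obj C \<Longrightarrow> \<exists>D. is_left_dual C X D"


section \<open>Ext groups\<close>

text \<open>The image of \<open>f\<close> is the kernel of \<open>g\<close>.\<close>

definition exact_at where
  "exact_at C f g \<longleftrightarrow> (\<exists>e k. epic C e \<and> is_kernel C k g \<and> Cod C e = Dom C k \<and> f = k \<bullet> e)"
  for C (structure)

text \<open>
  A projective resolution \<open>\<dots> \<rightarrow> P\<^sub>2 \<rightarrow> P\<^sub>1 \<rightarrow> P\<^sub>0 \<rightarrow> X \<rightarrow> 0\<close> is encoded as the sequence \<open>d\<close> of all its
  arrows: \<open>d 0\<close> is the augmentation \<open>P\<^sub>0 \<rightarrow> X\<close>, \<open>d (Suc n)\<close> is the differential \<open>P\<^sub>n\<^sub>+\<^sub>1 \<rightarrow> P\<^sub>n\<close>, and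
  \<open>P\<^sub>n\<close> is the domain of \<open>d n\<close>.
\<close>

definition is_projective_resolution where
  "is_projective_resolution C X d \<longleftrightarrow>
     epic C (d 0) \<and> Cod C (d 0) = X \<and>
     (\<forall>n::nat. projective_obj C (Dom C (d n))) \<and> (\<forall>n. exact_at C (d (Suc n)) (d n))"

definition res where
  "res C X = (SOME d. is_projective_resolution C X d)"

definition resO where
  "resO C X n = Dom C (res C X n)"

definition cocycles where
  "cocycles C n X Y =
     {f \<in> homset C (resO C X n) Y. f \<bullet> res C X (Suc n) = zero_arrow C (resO C X (Suc n)) Y}"
  for C (structure)

definition coboundaries where
  "coboundaries C n X Y =
     (case n of 0 \<Rightarrow> {zero_arrow C (resO C X 0) Y}
      | Suc m \<Rightarrow> (\<lambda>h. h \<bullet> res C X (Suc m)) ` homset C (resO C X m) Y)"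
  for C (structure)

definition ext_class where
  "ext_class C n X Y f = coboundaries C n X Y +>\<^bsub>HomMod C (resO C X n) Y\<^esub> f"

text \<open>\<open>Ext\<^sup>n(X, Y)\<close> as the cohomology of \<open>Hom(P, Y)\<close>, \<open>P\<close> the chosen projective resolution of \<open>X\<close>.
  Again \<^term>\<open>monoid.mult\<close> and \<^term>\<open>monoid.one\<close> are unused.\<close>

definition Ext :: "('o, 'm, 'k, 'z) linear_category_scheme \<Rightarrow> nat \<Rightarrow> 'o \<Rightarrow> 'o \<Rightarrow> ('k, 'm set) module"
  where
  "Ext C n X Y =
     \<lparr>carrier = ext_class C n X Y ` cocycles C n X Y,
      monoid.mult = undefined,
      monoid.one = undefined,
      ring.zero = ext_class C n X Y (zero_arrow C (resO C X n) Y),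
      ring.add = (\<lambda>\<xi> \<eta>. \<xi> <+>\<^bsub>HomMod C (resO C X n) Y\<^esub> \<eta>),
      smult = (\<lambda>a \<xi>. \<Union>f\<in>\<xi>. ext_class C n X Y (a \<odot>\<^bsub>HomMod C (resO C X n) Y\<^esub> f))\<rparr>"

text \<open>The chain maps of degree \<open>n\<close> from the resolution of \<open>X\<close> to that of \<open>Y\<close> lifting a cocycle
  \<open>f : P\<^sub>n \<rightarrow> Y\<close>.\<close>

definition lifts where
  "lifts C n X Y f =
     {\<phi>. (\<forall>i. \<phi> i \<in> homset C (resO C X (n + i)) (resO C Y i)) \<and>
          res C Y 0 \<bullet> \<phi> 0 = f \<and>
          (\<forall>i. res C Y (Suc i) \<bullet> \<phi> (Suc i) = \<phi> i \<bullet> res C X (Suc (n + i)))}"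
  for C (structure)

text \<open>
  The Yoneda product \<open>Ext\<^sup>m(Y, Z) \<times> Ext\<^sup>n(X, Y) \<rightarrow> Ext\<^sup>m\<^sup>+\<^sup>n(X, Z)\<close>. The class obtained does not depend on
  representatives and lifts, so all the classes in the union coincide. Lifts commute with the
  differentials on the nose; the other usual convention changes products by \<open>(-1)\<^sup>m\<^sup>n\<close>.
\<close>

definition yoneda where
  "yoneda C m n X Y Z \<xi> \<eta> =
     (\<Union>g\<in>\<xi>. \<Union>f\<in>\<eta>. \<Union>\<phi>\<in>lifts C n X Y f. ext_class C (m + n) X Z (g \<bullet> \<phi> m))"
  for C (structure)

text \<open>\<open>Ext\<^sup>*(X, X)\<close>: elements of the direct sum are finitely supported families.\<close>

definition Ext_ring ::
  "('o, 'm, 'k, 'z) linear_category_scheme \<Rightarrow> 'o \<Rightarrow> (nat \<Rightarrow> 'm set) ring" where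
  "Ext_ring C X =
     \<lparr>carrier = {a. (\<forall>n. a n \<in> carrier (Ext C n X X)) \<and> finite {n. a n \<noteq> \<zero>\<^bsub>Ext C n X X\<^esub>}},
      monoid.mult = (\<lambda>a b n. \<Oplus>\<^bsub>Ext C n X X\<^esub>i\<in>{..n}. yoneda C i (n - i) X X X (a i) (b (n - i))),
      monoid.one = (\<lambda>n. if n = 0 then ext_class C 0 X X (res C X 0) else \<zero>\<^bsub>Ext C n X X\<^esub>),
      ring.zero = (\<lambda>n. \<zero>\<^bsub>Ext C n X X\<^esub>),
      ring.add = (\<lambda>a b n. a n \<oplus>\<^bsub>Ext C n X X\<^esub> b n)\<rparr>"


section \<open>Cohomology ring and its action\<close>

definition cohomology_ring where
  "cohomology_ring C = Ext_ring C (UnitO C)"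

text \<open>
  Tensoring the resolution of \<open>1\<close> with \<open>X\<close> and composing with the left unit isomorphism gives a
  projective resolution of \<open>X\<close>; these are the chain maps to it from the chosen resolution
  lifting the identity of \<open>X\<close>.
\<close>

definition tensor_lifts where
  "tensor_lifts C X =
     {\<phi>. (\<forall>i. \<phi> i \<in> homset C (resO C X i) (resO C (UnitO C) i \<boxtimes> X)) \<and>
          LUnit C X \<bullet> (res C (UnitO C) 0 \<star> Ide C X) \<bullet> \<phi> 0 = res C X 0 \<and>
          (\<forall>i. (res C (UnitO C) (Suc i) \<star> Ide C X) \<bullet> \<phi> (Suc i) = \<phi> i \<bullet> res C X (Suc i))}"
  for C (structure)

text \<open>The homomorphism \<open>\<phi>\<^sub>X : H\<^sup>*(C) \<rightarrow> Ext\<^sup>*(X, X)\<close> induced by the exact functor \<open>- \<otimes> X\<close>.\<close>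

definition phi where
  "phi C X h =
     (\<lambda>n. \<Union>f\<in>h n. \<Union>\<phi>\<in>tensor_lifts C X. ext_class C n X X (LUnit C X \<bullet> (f \<star> Ide C X) \<bullet> \<phi> n))"
  for C (structure)

definition Ext_module ::
  "('o, 'm, 'k, 'z) tensor_category_scheme \<Rightarrow> 'o \<Rightarrow> (nat \<Rightarrow> 'm set, nat \<Rightarrow> 'm set) module" where
  "Ext_module C X =
     ring.extend (Ext_ring C X) \<lparr>smult = (\<lambda>h \<xi>. phi C X h \<otimes>\<^bsub>Ext_ring C X\<^esub> \<xi>)\<rparr>"

text \<open>Finite generation of the cohomology ring is meant as an algebra over the ground field: as an
  abstract ring, already its degree zero part \<open>k\<close> need not be finitely generated.\<close>

definition cohomology_scalars where
  "cohomology_scalars K C =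
     (\<lambda>a n. a \<odot>\<^bsub>Ext C n (UnitO C) (UnitO C)\<^esub> \<one>\<^bsub>cohomology_ring C\<^esub> n) ` carrier K"

definition Fg where
  "Fg K C \<longleftrightarrow>
     (\<exists>G. finite G \<and> G \<subseteq> carrier (cohomology_ring C) \<and>
        generate_ring (cohomology_ring C) (G \<union> cohomology_scalars K C) = carrier (cohomology_ring C)) \<and>
     (\<forall>X \<in> Obj C. fin_gen_module (cohomology_ring C) (Ext_module C X))"


section \<open>Support varieties\<close>

text \<open>The condition \<open>1 + 1 = 0\<close> says that the field \<open>K\<close> has characteristic two.\<close>

definition even_cohomology_ring where
  "even_cohomology_ring K C =
     (if \<one>\<^bsub>K\<^esub> \<oplus>\<^bsub>K\<^esub> \<one>\<^bsub>K\<^esub> = \<zero>\<^bsub>K\<^esub> then cohomology_ring C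
      else cohomology_ring C
        \<lparr>carrier := {h \<in> carrier (cohomology_ring C).
           \<forall>n. odd n \<longrightarrow> h n = \<zero>\<^bsub>Ext C n (UnitO C) (UnitO C)\<^esub>}\<rparr>)"

definition irrelevant_ideal where
  "irrelevant_ideal K C =
     {h \<in> carrier (even_cohomology_ring K C). h 0 = \<zero>\<^bsub>Ext C 0 (UnitO C) (UnitO C)\<^esub>}"

definition support_ideal where
  "support_ideal K C X =
     {h \<in> carrier (even_cohomology_ring K C).
        \<forall>\<xi> \<in> carrier (Ext_module C X). h \<odot>\<^bsub>Ext_module C X\<^esub> \<xi> = \<zero>\<^bsub>Ext_module C X\<^esub>}"

definition support_variety where
  "support_variety K C X =
     {irrelevant_ideal K C} \<union>
     {M. maximalideal M (even_cohomology_ring K C) \<and> support_ideal K C X \<subseteq> M}"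

text \<open>The supremum of the empty set is \<open>0\<close>, so the zero ring has Krull dimension \<open>0\<close> here.\<close>

definition krull_dim :: "('a, 'b) ring_scheme \<Rightarrow> enat" where
  "krull_dim R =
     Sup (enat ` {n. \<exists>P. (\<forall>i\<le>n. primeideal (P i) R) \<and> (\<forall>i<n. P i \<subset> P (Suc i))})"

text \<open>The dimension of \<^term>\<open>support_variety K C X\<close>, which by definition is that of its
  coordinate ring.\<close>

definition dim_support_variety where
  "dim_support_variety K C X = krull_dim (even_cohomology_ring K C Quot support_ideal K C X)"

end

theory Submission
  imports Defs
begin

text \<open>
  If \<open>X\<close> is projective, then \<open>Ext\<^sup>n(X, X) = 0\<close> for \<open>n > 0\<close>, so the coordinate ring of the support
  variety is a quotient of the division ring \<open>End(1)\<close> and has Krull dimension zero.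

  Conversely, in a commutative ring of Krull dimension zero every \<open>a\<close> satisfies \<open>a\<^sup>n = a\<^sup>n\<^sup>+\<^sup>1 g\<close> for some
  \<open>n\<close> and \<open>g\<close>; comparing degrees, homogeneous elements of positive degree of the cohomology ring are nilpotent
  modulo the kernel of \<open>\<phi>\<^sub>X\<close>. As the ring is finitely generated and graded commutative, \<open>\<phi>\<^sub>X\<close> vanishes in all
  large degrees. For simple \<open>S\<close> and \<open>M = X \<oplus> S\<close>, finite generation of \<open>Ext\<^sup>*(M, M)\<close> together with
  the naturality of \<open>\<phi>\<close> then gives \<open>Ext\<^sup>n(M, X) = 0\<close> for large \<open>n\<close>, uniformly in \<open>S\<close>. So \<open>X\<close> has finite injective
  dimension. Every object \<open>Y\<close> embeds in \<open>(Y \<otimes> P) \<otimes> P\<^sup>*\<close>, where \<open>P\<close> is projective and maps onto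
  the unit; this object is both projective and injective, and splitting cosyzygies one at a time shows that \<open>X\<close>
  is projective.

  Graded commutativity comes from a diagonal approximation \<open>P \<rightarrow> P \<otimes> P\<close> on the resolution of the unit.
\<close>

section \<open>Categories and duals\<close>

text \<open>The main obstacle is that \<open>Fg\<close> only speaks about self-extensions
  \<open>Ext_module C M\<close>, while splitting cosyzygies asks for the vanishing of Ext from each
  simple S to X. Passing to M = X \<oplus> S makes those groups part of the self-extensions of M;
  but only \<open>phi C X\<close>, not \<open>phi C M\<close>, is known to vanish in large degrees.
  Composing with the projection M \<rightarrow> X repairs this, since naturality turns the action
  through \<open>phi C M\<close> into the action through \<open>phi C X\<close>. A second mismatch
  is parity: outside characteristic two the support ideal lies in the even part, whereas the
  generators in \<open>Fg\<close> may have odd components. Squares of odd elements are even, and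
  graded commutativity allows the powers of one letter in a monomial to be collected up to sign. The
  recurring technical cost is well-definedness, as products and \<open>phi\<close> are unions over
  representatives and lifts. A single comparison theorem for chain maps into an arbitrary exact
  resolution covers both the chosen resolutions and the tensored ones P \<otimes> X.\<close>

lemma homI: "\<lbrakk>f \<in> Arr C; Dom C f = X; Cod C f = Y\<rbrakk> \<Longrightarrow> f \<in> homset C X Y"
  by (simp add: homset_def)

lemma homD:
  assumes "f \<in> homset C X Y"
  shows "f \<in> Arr C" "Dom C f = X" "Cod C f = Y"
  using assms by (simp_all add: homset_def)

context category
begin

lemma hom_Obj:
  assumes "f \<in> homset C X Y"
  shows "X \<in> Obj C" "Y \<in> Obj C"
  using assms Dom_Obj Cod_Obj by (auto simp: homset_def)

lemma Ide_simps [simp]: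
  assumes "X \<in> Obj C"
  shows "Ide C X \<in> Arr C" "Dom C (Ide C X) = X" "Cod C (Ide C X) = X"
  using Ide_hom[OF assms] by (auto simp: homset_def)

lemma Comp_simps [simp]:
  assumes "f \<in> Arr C" "g \<in> Arr C" "Dom C g = Cod C f"
  shows "g \<bullet> f \<in> Arr C" "Dom C (g \<bullet> f) = Dom C f" "Cod C (g \<bullet> f) = Cod C g"
  using Comp_hom[of g "Cod C f" "Cod C g" f "Dom C f"] assms by (auto simp: homset_def)

lemma Comp_assoc' [simp]:
  assumes "f \<in> Arr C" "g \<in> Arr C" "h \<in> Arr C" "Dom C g = Cod C f" "Dom C h = Cod C g"
  shows "(h \<bullet> g) \<bullet> f = h \<bullet> (g \<bullet> f)"
  using Comp_assoc[of h "Cod C g" "Cod C h" g "Cod C f" f "Dom C f"] assms by (auto simp: homset_def)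

lemma Comp_Ide' [simp]: "\<lbrakk>f \<in> Arr C; Dom C f = X\<rbrakk> \<Longrightarrow> f \<bullet> Ide C X = f"
  using Comp_Ide[of f X "Cod C f"] by (auto simp: homset_def)

lemma Ide_Comp' [simp]: "\<lbrakk>f \<in> Arr C; Cod C f = Y\<rbrakk> \<Longrightarrow> Ide C Y \<bullet> f = f"
  using Ide_Comp[of f "Dom C f" Y] by (auto simp: homset_def)

text \<open>Simplification nests composites to the right by \<open>Comp_assoc'\<close>, so a known
  product \<open>a \<bullet> b\<close> gets hidden inside
  \<open>a \<bullet> (b \<bullet> x)\<close>; this makes such an equation applicable again.\<close>

lemma Comp_reassoc:
  assumes "a \<bullet> b = c" "a \<in> Arr C" "b \<in> Arr C" "x \<in> Arr C" "Dom C a = Cod C b" "Dom C b = Cod C x"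
  shows "a \<bullet> (b \<bullet> x) = c \<bullet> x"
  using assms Comp_assoc' by metis

lemma inverse_arrows_unique: "\<lbrakk>inverse_arrows C f g; inverse_arrows C f h\<rbrakk> \<Longrightarrow> g = h"
  unfolding inverse_arrows_def by (metis Comp_Ide Comp_assoc Ide_Comp homI)

lemma inv_arrow:
  assumes "iso_arrow C f"
  shows "inverse_arrows C f (inv_arrow C f)"
  using assms inverse_arrows_unique unfolding iso_arrow_def inv_arrow_def
  by (metis (mono_tags, lifting) theI)

lemma iso_arrowD:
  assumes "iso_arrow C f"
  shows "f \<in> Arr C" "inv_arrow C f \<in> Arr C" "Dom C (inv_arrow C f) = Cod C f"
    "Cod C (inv_arrow C f) = Dom C f"
    "inv_arrow C f \<bullet> f = Ide C (Dom C f)" "f \<bullet> inv_arrow C f = Ide C (Cod C f)"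
  using inv_arrow[OF assms] by (auto simp: inverse_arrows_def homset_def)

lemma inv_arrow_eq: "inverse_arrows C f g \<Longrightarrow> inv_arrow C f = g"
  using inverse_arrows_unique inv_arrow iso_arrow_def by metis

lemma inverse_arrows_sym: "inverse_arrows C f g \<Longrightarrow> inverse_arrows C g f"
  by (auto simp: inverse_arrows_def homset_def)

lemma iso_cancel_left:
  assumes "iso_arrow C f" "g \<in> Arr C" "h \<in> Arr C" "Cod C g = Dom C f" "Cod C h = Dom C f"
    "f \<bullet> g = f \<bullet> h"
  shows "g = h"
proof -
  note inv = iso_arrowD[OF assms(1)]
  have "x = inv_arrow C f \<bullet> (f \<bullet> x)" if "x \<in> Arr C" "Cod C x = Dom C f" for x
    using Comp_reassoc[OF inv(5)] that inv by simp
  then show ?thesis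
    using assms by metis
qed

lemma iso_cancel_right:
  assumes "iso_arrow C f" "g \<in> Arr C" "h \<in> Arr C" "Dom C g = Cod C f" "Dom C h = Cod C f"
    "g \<bullet> f = h \<bullet> f"
  shows "g = h"
proof -
  note inv = iso_arrowD[OF assms(1)]
  have "x = (x \<bullet> f) \<bullet> inv_arrow C f" if "x \<in> Arr C" "Dom C x = Cod C f" for x
    using that inv by simp
  then show ?thesis
    using assms by metis
qed

lemma epicD: "\<lbrakk>epic C e; g \<in> Arr C; h \<in> Arr C; Dom C g = Cod C e; Dom C h = Cod C e; 
   g \<bullet> e = h \<bullet> e\<rbrakk> \<Longrightarrow> g = h"
  unfolding epic_def homset_def by simp (metis Comp_simps(3))

lemma monicD: "\<lbrakk>monic C e; g \<in> Arr C; h \<in> Arr C; Cod C g = Dom C e; Cod C h = Dom C e; 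
   e \<bullet> g = e \<bullet> h\<rbrakk> \<Longrightarrow> g = h"
  unfolding monic_def homset_def by simp (metis Comp_simps(2))

lemma epicI: "e \<in> Arr C \<Longrightarrow> (\<And>g h. \<lbrakk>g \<in> Arr C; h \<in> Arr C; Dom C g = Cod C e; Dom C h = Cod C e; 
   g \<bullet> e = h \<bullet> e; Cod C g = Cod C h\<rbrakk> \<Longrightarrow> g = h) \<Longrightarrow> epic C e"
  unfolding epic_def homset_def by simp

lemma monicI: "e \<in> Arr C \<Longrightarrow> (\<And>g h. \<lbrakk>g \<in> Arr C; h \<in> Arr C; Cod C g = Dom C e; Cod C h = Dom C e; 
   e \<bullet> g = e \<bullet> h; Dom C g = Dom C h\<rbrakk> \<Longrightarrow> g = h) \<Longrightarrow> monic C e"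
  unfolding monic_def homset_def by simp

lemma epic_Arr: "epic C e \<Longrightarrow> e \<in> Arr C" by (simp add: epic_def)
lemma monic_Arr: "monic C e \<Longrightarrow> e \<in> Arr C" by (simp add: monic_def)

lemma iso_epic: "iso_arrow C f \<Longrightarrow> epic C f"
  by (rule epicI) (auto intro: iso_cancel_right simp: iso_arrowD)

lemma epic_Comp:
  assumes "epic C f" "epic C g" "Dom C g = Cod C f"
  shows "epic C (g \<bullet> f)"
proof (rule epicI)
  show "g \<bullet> f \<in> Arr C" using assms epic_Arr by simp
  fix a b assume "a \<in> Arr C" "b \<in> Arr C" "Dom C a = Cod C (g \<bullet> f)" "Dom C b = Cod C (g \<bullet> f)"
    "a \<bullet> (g \<bullet> f) = b \<bullet> (g \<bullet> f)"
  then have "(a \<bullet> g) \<bullet> f = (b \<bullet> g) \<bullet> f" "a \<in> Arr C" "b \<in> Arr C" "Dom C a = Cod C g" "Dom C b = Cod C g"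
    using assms epic_Arr by auto
  then show "a = b"
    using epicD[OF assms(1), of "a \<bullet> g" "b \<bullet> g"] epicD[OF assms(2), of a b] assms epic_Arr by auto
qed

lemma projective_lift:
  assumes "projective_obj C P" "epic C e" "f \<in> homset C P (Cod C e)"
  obtains g where "g \<in> homset C P (Dom C e)" "e \<bullet> g = f"
  using assms unfolding projective_obj_def by blast

lemma projective_retract:
  assumes "projective_obj C P" "s \<in> homset C Y P" "r \<in> homset C P Y" "r \<bullet> s = Ide C Y"
  shows "projective_obj C Y"
  unfolding projective_obj_def
proof (intro conjI allI impI)
  show "Y \<in> Obj C" using assms(2) hom_Obj by blast
  fix e f assume ef: "epic C e \<and> f \<in> homset C Y (Cod C e)"
  then obtain g where g: "g \<in> homset C P (Dom C e)" "e \<bullet> g = f \<bullet> r"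
    using projective_lift[OF assms(1), of e "f \<bullet> r"] Comp_hom assms(3) by blast
  have "e \<bullet> (g \<bullet> s) = f"
    using g ef homD[OF assms(2)] homD[OF assms(3)] homD[OF g(1)] assms(4) epic_Arr
    by (simp add: Comp_reassoc[OF g(2)] homset_def)
  then show "\<exists>g\<in>homset C Y (Dom C e). e \<bullet> g = f"
    using Comp_hom[OF g(1) assms(2)] by blast
qed

end

section \<open>Coherence of the unit constraints\<close>

context monoidal_category
begin

abbreviation "I \<equiv> UnitO C"

lemmas UnitO_Obj' [simp] = UnitO_Obj
lemmas TensorO_Obj' [simp] = TensorO_Obj

lemma Tensor_simps [simp]:
  assumes "f \<in> Arr C" "g \<in> Arr C"
  shows "f \<star> g \<in> Arr C" "Dom C (f \<star> g) = Dom C f \<boxtimes> Dom C g" "Cod C (f \<star> g) = Cod C f \<boxtimes> Cod C g"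
  using TensorA_hom[of f "Dom C f" "Cod C f" g "Dom C g" "Cod C g"] assms by (auto simp: homset_def)

lemma interchange:
  assumes "f \<in> Arr C" "g \<in> Arr C" "f' \<in> Arr C" "g' \<in> Arr C" "Dom C f' = Cod C f" "Dom C g' = Cod C g"
  shows "(f' \<star> g') \<bullet> (f \<star> g) = (f' \<bullet> f) \<star> (g' \<bullet> g)"
  using TensorA_Comp[of f "Dom C f" "Cod C f" f' "Cod C f'" g "Dom C g" "Cod C g" g' "Cod C g'"] assms
  by (auto simp: homset_def)

lemma Assoc_simps [simp]:
  assumes "X \<in> Obj C" "Y \<in> Obj C" "Z \<in> Obj C"
  shows "Assoc C X Y Z \<in> Arr C" "Dom C (Assoc C X Y Z) = (X \<boxtimes> Y) \<boxtimes> Z"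
    "Cod C (Assoc C X Y Z) = X \<boxtimes> (Y \<boxtimes> Z)"
  using Assoc_hom[OF assms] by (auto simp: homset_def)

abbreviation "Assoc' X Y Z \<equiv> inv_arrow C (Assoc C X Y Z)"
abbreviation "RUnit' X \<equiv> inv_arrow C (RUnit C X)"
abbreviation "LUnit' X \<equiv> inv_arrow C (LUnit C X)"

lemma Assoc'_simps [simp]:
  assumes "X \<in> Obj C" "Y \<in> Obj C" "Z \<in> Obj C"
  shows "Assoc' X Y Z \<in> Arr C" "Cod C (Assoc' X Y Z) = (X \<boxtimes> Y) \<boxtimes> Z"
    "Dom C (Assoc' X Y Z) = X \<boxtimes> (Y \<boxtimes> Z)"
    "Assoc' X Y Z \<bullet> Assoc C X Y Z = Ide C ((X \<boxtimes> Y) \<boxtimes> Z)"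
    "Assoc C X Y Z \<bullet> Assoc' X Y Z = Ide C (X \<boxtimes> (Y \<boxtimes> Z))"
  using iso_arrowD[OF Assoc_iso[OF assms]] assms by auto

lemma Unit_simps [simp]:
  assumes "X \<in> Obj C"
  shows "LUnit C X \<in> Arr C" "Dom C (LUnit C X) = I \<boxtimes> X" "Cod C (LUnit C X) = X"
    "RUnit C X \<in> Arr C" "Dom C (RUnit C X) = X \<boxtimes> I" "Cod C (RUnit C X) = X"
  using LUnit_hom[OF assms] RUnit_hom[OF assms] by (auto simp: homset_def)

lemma Unit'_simps [simp]:
  assumes "X \<in> Obj C"
  shows "LUnit' X \<in> Arr C" "Cod C (LUnit' X) = I \<boxtimes> X" "Dom C (LUnit' X) = X"
    "LUnit' X \<bullet> LUnit C X = Ide C (I \<boxtimes> X)" "LUnit C X \<bullet> LUnit' X = Ide C X"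
    "RUnit' X \<in> Arr C" "Cod C (RUnit' X) = X \<boxtimes> I" "Dom C (RUnit' X) = X"
    "RUnit' X \<bullet> RUnit C X = Ide C (X \<boxtimes> I)" "RUnit C X \<bullet> RUnit' X = Ide C X"
  using iso_arrowD[OF LUnit_iso[OF assms]] iso_arrowD[OF RUnit_iso[OF assms]] assms by auto

lemma Assoc_nat:
  assumes "f \<in> Arr C" "g \<in> Arr C" "h \<in> Arr C" 
    "Dom C f = X" "Dom C g = Y" "Dom C h = Z" "Cod C f = X'" "Cod C g = Y'" "Cod C h = Z'"
  shows "Assoc C X' Y' Z' \<bullet> ((f \<star> g) \<star> h) = (f \<star> (g \<star> h)) \<bullet> Assoc C X Y Z"
  using Assoc_natural[of f X X' g Y Y' h Z Z'] assms by (auto simp: homset_def)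

lemma LUnit_nat:
  assumes "f \<in> Arr C" "Dom C f = X" "Cod C f = Y"
  shows "LUnit C Y \<bullet> (Ide C I \<star> f) = f \<bullet> LUnit C X"
  using LUnit_natural[of f X Y] assms by (auto simp: homset_def)

lemma RUnit_nat:
  assumes "f \<in> Arr C" "Dom C f = X" "Cod C f = Y"
  shows "RUnit C Y \<bullet> (f \<star> Ide C I) = f \<bullet> RUnit C X"
  using RUnit_natural[of f X Y] assms by (auto simp: homset_def)

lemma Assoc'_nat:
  assumes "f \<in> Arr C" "g \<in> Arr C" "h \<in> Arr C" 
    "Dom C f = X" "Dom C g = Y" "Dom C h = Z" "Cod C f = X'" "Cod C g = Y'" "Cod C h = Z'"
  shows "Assoc' X' Y' Z' \<bullet> (f \<star> (g \<star> h)) = ((f \<star> g) \<star> h) \<bullet> Assoc' X Y Z"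
proof -
  have O: "X \<in> Obj C" "Y \<in> Obj C" "Z \<in> Obj C" "X' \<in> Obj C" "Y' \<in> Obj C" "Z' \<in> Obj C"
    using assms Dom_Obj Cod_Obj by auto
  have "Assoc' X' Y' Z' \<bullet> (((f \<star> (g \<star> h)) \<bullet> Assoc C X Y Z) \<bullet> Assoc' X Y Z) =
    Assoc' X' Y' Z' \<bullet> ((Assoc C X' Y' Z' \<bullet> ((f \<star> g) \<star> h)) \<bullet> Assoc' X Y Z)"
    using Assoc_nat[OF assms] by simp
  then show ?thesis using O assms
    by (simp add: Comp_reassoc[OF Assoc'_simps(4)])
qed

lemma RUnit'_nat:
  assumes "f \<in> Arr C" "Dom C f = X" "Cod C f = Y"
  shows "RUnit' Y \<bullet> f = (f \<star> Ide C I) \<bullet> RUnit' X"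
proof -
  have O: "X \<in> Obj C" "Y \<in> Obj C" using assms Dom_Obj Cod_Obj by auto
  have "RUnit' Y \<bullet> ((f \<bullet> RUnit C X) \<bullet> RUnit' X) = RUnit' Y \<bullet> ((RUnit C Y \<bullet> (f \<star> Ide C I)) \<bullet> RUnit' X)"
    using RUnit_nat[OF assms] by simp
  then show ?thesis using O assms
    by (simp add: Comp_reassoc[OF Unit'_simps(9)])
qed

text \<open>Naturality of \<open>RUnit\<close> makes \<open>f \<star> Ide C I\<close> conjugate to
  f, so equations of arrows may be tested after tensoring with the unit.\<close>

lemma unit_faithful:
  assumes "f \<in> homset C X Y" "g \<in> homset C X Y" "f \<star> Ide C I = g \<star> Ide C I"
  shows "f = g"
proof -
  have "f \<bullet> RUnit C X = g \<bullet> RUnit C X"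
    using RUnit_nat[of f X Y] RUnit_nat[of g X Y] assms by (auto simp: homset_def)
  then show ?thesis
    using iso_cancel_right[OF RUnit_iso] assms hom_Obj(1)[OF assms(1)]
    by (auto simp: homset_def)
qed

lemma unit_faithful_left:
  assumes "f \<in> homset C X Y" "g \<in> homset C X Y" "Ide C I \<star> f = Ide C I \<star> g"
  shows "f = g"
proof -
  have "f \<bullet> LUnit C X = g \<bullet> LUnit C X"
    using LUnit_nat[of f X Y] LUnit_nat[of g X Y] assms by (auto simp: homset_def)
  then show ?thesis
    using iso_cancel_right[OF LUnit_iso] assms hom_Obj(1)[OF assms(1)]
    by (auto simp: homset_def)
qed

text \<open>Kelly's argument that this triangle follows from the two axioms: tensor both sides with
  the unit, where the pentagon for X, Y, I, I, the triangle axiom and naturality of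
  \<open>Assoc\<close> connect them; then cancel the invertible \<open>Assoc C X Y I\<close> and use
  \<open>unit_faithful\<close>.\<close>

lemma RUnit_Tensor:
  assumes X: "X \<in> Obj C" and Y: "Y \<in> Obj C"
  shows "RUnit C (X \<boxtimes> Y) = (Ide C X \<star> RUnit C Y) \<bullet> Assoc C X Y I"
proof (rule unit_faithful)
  note [simp] = X Y
  have "Assoc C X Y I \<bullet> (RUnit C (X \<boxtimes> Y) \<star> Ide C I) =
      Assoc C X Y I \<bullet> ((Ide C (X \<boxtimes> Y) \<star> LUnit C I) \<bullet> Assoc C (X \<boxtimes> Y) I I)"
    by (simp add: triangle)
  also have "\<dots> = (Assoc C X Y I \<bullet> ((Ide C X \<star> Ide C Y) \<star> LUnit C I)) \<bullet> Assoc C (X \<boxtimes> Y) I I"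
    by (simp add: TensorA_Ide)
  also have "\<dots> = ((Ide C X \<star> (Ide C Y \<star> LUnit C I)) \<bullet> Assoc C X Y (I \<boxtimes> I)) \<bullet> Assoc C (X \<boxtimes> Y) I I"
    by (subst Assoc_nat[where X=X and Y=Y and Z="I \<boxtimes> I"]) simp_all
  also have "\<dots> = (Ide C X \<star> (Ide C Y \<star> LUnit C I)) \<bullet> (Assoc C X Y (I \<boxtimes> I) \<bullet> Assoc C (X \<boxtimes> Y) I I)"
    by simp
  also have "\<dots> = (Ide C X \<star> (Ide C Y \<star> LUnit C I)) \<bullet> (Ide C X \<star> Assoc C Y I I) 
      \<bullet> Assoc C X (Y \<boxtimes> I) I \<bullet> (Assoc C X Y I \<star> Ide C I)"
    by (simp add: pentagon)
  also have "\<dots> = ((Ide C X \<star> (Ide C Y \<star> LUnit C I)) \<bullet> (Ide C X \<star> Assoc C Y I I)) 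
      \<bullet> Assoc C X (Y \<boxtimes> I) I \<bullet> (Assoc C X Y I \<star> Ide C I)"
    by simp
  also have "\<dots> = (Ide C X \<star> (RUnit C Y \<star> Ide C I)) \<bullet> Assoc C X (Y \<boxtimes> I) I \<bullet> (Assoc C X Y I \<star> Ide C I)"
    by (subst interchange) (simp_all add: triangle)
  also have "\<dots> = ((Ide C X \<star> (RUnit C Y \<star> Ide C I)) \<bullet> Assoc C X (Y \<boxtimes> I) I) \<bullet> (Assoc C X Y I \<star> Ide C I)"
    by simp
  also have "\<dots> = (Assoc C X Y I \<bullet> ((Ide C X \<star> RUnit C Y) \<star> Ide C I)) \<bullet> (Assoc C X Y I \<star> Ide C I)"
    by (subst Assoc_nat[where X=X and Y="Y \<boxtimes> I" and Z=I]) simp_all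
  also have "\<dots> = Assoc C X Y I \<bullet> (((Ide C X \<star> RUnit C Y) \<star> Ide C I) \<bullet> (Assoc C X Y I \<star> Ide C I))"
    by simp
  also have "\<dots> = Assoc C X Y I \<bullet> (((Ide C X \<star> RUnit C Y) \<bullet> Assoc C X Y I) \<star> Ide C I)"
    by (subst interchange) simp_all
  finally show "RUnit C (X \<boxtimes> Y) \<star> Ide C I = ((Ide C X \<star> RUnit C Y) \<bullet> Assoc C X Y I) \<star> Ide C I"
    by (rule iso_cancel_left[OF Assoc_iso[OF X Y UnitO_Obj], rotated -1]) simp_all
qed (use assms in \<open>auto intro!: homI\<close>)

text \<open>Naturality of \<open>RUnit\<close> at the arrow \<open>RUnit C I\<close> identifies
  \<open>RUnit C I \<star> Ide C I\<close> with \<open>RUnit C (I \<boxtimes> I)\<close>. The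
  triangle axiom expresses the former by \<open>LUnit C I\<close>, and \<open>RUnit_Tensor\<close>
  the latter by \<open>RUnit C I\<close>. The equality is what makes \<open>phi_unit\<close>
  work.\<close>

lemma LUnit_eq_RUnit: "LUnit C I = RUnit C I"
proof (rule unit_faithful_left)
  have "RUnit C I \<bullet> (RUnit C I \<star> Ide C I) = RUnit C I \<bullet> RUnit C (I \<boxtimes> I)"
    by (rule RUnit_nat) simp_all
  then have "RUnit C I \<star> Ide C I = RUnit C (I \<boxtimes> I)"
    by (rule iso_cancel_left[OF RUnit_iso[OF UnitO_Obj], rotated -1]) simp_all
  then have "(Ide C I \<star> LUnit C I) \<bullet> Assoc C I I I = (Ide C I \<star> RUnit C I) \<bullet> Assoc C I I I"
    using triangle[of I I] RUnit_Tensor[of I I] by simp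
  then show "Ide C I \<star> LUnit C I = Ide C I \<star> RUnit C I"
    by (rule iso_cancel_right[OF Assoc_iso[OF UnitO_Obj UnitO_Obj UnitO_Obj], rotated -1]) simp_all
qed (auto intro!: homI)

end

section \<open>Duals as adjunctions between tensor functors\<close>

context monoidal_category
begin

lemma interchange':
  assumes "f \<in> Arr C" "g \<in> Arr C" "f' \<in> Arr C" "g' \<in> Arr C" "x \<in> Arr C"
    "Dom C f' = Cod C f" "Dom C g' = Cod C g" "Cod C x = Dom C f \<boxtimes> Dom C g"
  shows "(f' \<star> g') \<bullet> ((f \<star> g) \<bullet> x) = ((f' \<bullet> f) \<star> (g' \<bullet> g)) \<bullet> x"
  by (rule Comp_reassoc[OF interchange]) (use assms in auto)

lemma Tensor_Comp_Ide:
  assumes "f \<in> Arr C" "g \<in> Arr C" "Dom C g = Cod C f" "X \<in> Obj C"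
  shows "(g \<bullet> f) \<star> Ide C X = (g \<star> Ide C X) \<bullet> (f \<star> Ide C X)"
    "Ide C X \<star> (g \<bullet> f) = (Ide C X \<star> g) \<bullet> (Ide C X \<star> f)"
  using assms by (simp_all add: interchange)

text \<open>With D a left dual of X, this is the unit of the adjunction in which - \<otimes> X is
  left adjoint to - \<otimes> D, and \<open>counit_of\<close> is its counit.\<close>

definition unit_of where
  "unit_of D X coev W = Assoc' W X D \<bullet> ((Ide C W \<star> coev) \<bullet> RUnit' W)"

definition counit_of where
  "counit_of D X ev B = RUnit C B \<bullet> ((Ide C B \<star> ev) \<bullet> Assoc C B D X)"

context
  fixes D X ev coev
  assumes D: "D \<in> Obj C" and X: "X \<in> Obj C"
    and ev: "ev \<in> homset C (D \<boxtimes> X) I" and coev: "coev \<in> homset C I (X \<boxtimes> D)"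
    and zig: "RUnit C X \<bullet> (Ide C X \<star> ev) \<bullet> Assoc C X D X \<bullet> (coev \<star> Ide C X) = LUnit C X"
    and zag: "LUnit C D \<bullet> (ev \<star> Ide C D) \<bullet> Assoc' D X D \<bullet> (Ide C D \<star> coev) = RUnit C D"
begin

lemmas dfacts = D X homD[OF ev] homD[OF coev]

lemma unit_of_simps:
  assumes "W \<in> Obj C"
  shows "unit_of D X coev W \<in> Arr C" "Dom C (unit_of D X coev W) = W"
    "Cod C (unit_of D X coev W) = (W \<boxtimes> X) \<boxtimes> D"
  using assms dfacts by (simp_all add: unit_of_def)

lemma counit_of_simps:
  assumes "B \<in> Obj C"
  shows "counit_of D X ev B \<in> Arr C" "Cod C (counit_of D X ev B) = B"
    "Dom C (counit_of D X ev B) = (B \<boxtimes> D) \<boxtimes> X"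
  using assms dfacts by (simp_all add: counit_of_def)

lemma unit_of_natural:
  assumes g: "g \<in> Arr C" "Dom C g = W" "Cod C g = W'"
  shows "((g \<star> Ide C X) \<star> Ide C D) \<bullet> unit_of D X coev W = unit_of D X coev W' \<bullet> g"
proof -
  have [simp]: "W \<in> Obj C" "W' \<in> Obj C" using g Dom_Obj Cod_Obj by auto
  note [simp] = dfacts g
  have "((g \<star> Ide C X) \<star> Ide C D) \<bullet> unit_of D X coev W
     = (((g \<star> Ide C X) \<star> Ide C D) \<bullet> Assoc' W X D) \<bullet> ((Ide C W \<star> coev) \<bullet> RUnit' W)"
    by (simp add: unit_of_def)
  also have "\<dots> = (Assoc' W' X D \<bullet> (g \<star> (Ide C X \<star> Ide C D))) \<bullet> ((Ide C W \<star> coev) \<bullet> RUnit' W)"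
    by (subst Assoc'_nat[where X=W and Y=X and Z=D]) simp_all
  also have "\<dots> = Assoc' W' X D \<bullet> ((g \<star> coev) \<bullet> RUnit' W)"
    by (simp add: interchange' TensorA_Ide)
  also have "\<dots> = Assoc' W' X D \<bullet> ((Ide C W' \<star> coev) \<bullet> ((g \<star> Ide C I) \<bullet> RUnit' W))"
    by (simp add: interchange')
  also have "\<dots> = Assoc' W' X D \<bullet> ((Ide C W' \<star> coev) \<bullet> (RUnit' W' \<bullet> g))"
    by (subst RUnit'_nat[where X=W]) simp_all
  finally show ?thesis by (simp add: unit_of_def)
qed

lemma counit_of_natural:
  assumes g: "g \<in> Arr C" "Dom C g = B" "Cod C g = B'"
  shows "counit_of D X ev B' \<bullet> ((g \<star> Ide C D) \<star> Ide C X) = g \<bullet> counit_of D X ev B"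
proof -
  have [simp]: "B \<in> Obj C" "B' \<in> Obj C" using g Dom_Obj Cod_Obj by auto
  note [simp] = dfacts g
  have "counit_of D X ev B' \<bullet> ((g \<star> Ide C D) \<star> Ide C X)
      = RUnit C B' \<bullet> ((Ide C B' \<star> ev) \<bullet> (Assoc C B' D X \<bullet> ((g \<star> Ide C D) \<star> Ide C X)))"
    by (simp add: counit_of_def)
  also have "\<dots> = RUnit C B' \<bullet> ((Ide C B' \<star> ev) \<bullet> ((g \<star> (Ide C D \<star> Ide C X)) \<bullet> Assoc C B D X))"
    by (subst Assoc_nat[where X=B and Y=D and Z=X]) simp_all
  also have "\<dots> = RUnit C B' \<bullet> ((g \<star> ev) \<bullet> Assoc C B D X)"
    by (simp add: interchange' TensorA_Ide)
  also have "\<dots> = (RUnit C B' \<bullet> (g \<star> Ide C I)) \<bullet> ((Ide C B \<star> ev) \<bullet> Assoc C B D X)"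
    by (simp add: interchange')
  also have "\<dots> = (g \<bullet> RUnit C B) \<bullet> ((Ide C B \<star> ev) \<bullet> Assoc C B D X)"
    by (subst RUnit_nat[where X=B]) simp_all
  finally show ?thesis by (simp add: counit_of_def)
qed

text \<open>The pentagon for W, X, D, X and naturality move the associators outwards until the
  middle of the composite is W tensored with the zigzag \<open>zig\<close>; the triangle axiom then
  cancels the remaining unit constraints.\<close>

lemma counit_unit:
  assumes W: "W \<in> Obj C"
  shows "counit_of D X ev (W \<boxtimes> X) \<bullet> (unit_of D X coev W \<star> Ide C X) = Ide C (W \<boxtimes> X)"
proof -
  note [simp] = dfacts W
  let ?i = "Ide C W"
  have e1: "Assoc C (W \<boxtimes> X) D X \<bullet> (Assoc' W X D \<star> Ide C X) =
      Assoc' W X (D \<boxtimes> X) \<bullet> ((?i \<star> Assoc C X D X) \<bullet> Assoc C W (X \<boxtimes> D) X)" (is "?l = ?r")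
  proof -
    have "Assoc' W X (D \<boxtimes> X) \<bullet> ((Assoc C W X (D \<boxtimes> X) \<bullet> Assoc C (W \<boxtimes> X) D X) \<bullet> (Assoc' W X D \<star> Ide C X))
      = Assoc' W X (D \<boxtimes> X) \<bullet> (((?i \<star> Assoc C X D X) \<bullet> Assoc C W (X \<boxtimes> D) X \<bullet> (Assoc C W X D \<star> Ide C X)) \<bullet> (Assoc' W X D \<star> Ide C X))"
      by (subst pentagon) simp_all
    also have "\<dots> = ?r"
      by (simp add: interchange TensorA_Ide)
    finally show ?thesis
      by (simp add: Comp_reassoc[OF Assoc'_simps(4)])
  qed
  have e2: "Assoc C W (X \<boxtimes> D) X \<bullet> ((?i \<star> coev) \<star> Ide C X) = (?i \<star> (coev \<star> Ide C X)) \<bullet> Assoc C W I X"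
    by (rule Assoc_nat) simp_all
  have e3: "(Ide C (W \<boxtimes> X) \<star> ev) \<bullet> Assoc' W X (D \<boxtimes> X) = Assoc' W X I \<bullet> (?i \<star> (Ide C X \<star> ev))"
    using Assoc'_nat[of ?i "Ide C X" ev W X "D \<boxtimes> X" W X I] by (simp add: TensorA_Ide)
  have e4: "RUnit C (W \<boxtimes> X) \<bullet> Assoc' W X I = ?i \<star> RUnit C X"
    by (simp add: RUnit_Tensor)
  have "counit_of D X ev (W \<boxtimes> X) \<bullet> (unit_of D X coev W \<star> Ide C X) =
    RUnit C (W \<boxtimes> X) \<bullet> ((Ide C (W \<boxtimes> X) \<star> ev) \<bullet> ((Assoc C (W \<boxtimes> X) D X \<bullet> (Assoc' W X D \<star> Ide C X)) \<bullet>
       (((?i \<star> coev) \<star> Ide C X) \<bullet> (RUnit' W \<star> Ide C X))))"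
    by (simp add: unit_of_def counit_of_def Tensor_Comp_Ide)
  also have "\<dots> = RUnit C (W \<boxtimes> X) \<bullet> (((Ide C (W \<boxtimes> X) \<star> ev) \<bullet> Assoc' W X (D \<boxtimes> X)) \<bullet> ((?i \<star> Assoc C X D X) \<bullet> 
     ((Assoc C W (X \<boxtimes> D) X \<bullet> ((?i \<star> coev) \<star> Ide C X)) \<bullet> (RUnit' W \<star> Ide C X))))"
    by (simp add: e1)
  also have "\<dots> = (RUnit C (W \<boxtimes> X) \<bullet> Assoc' W X I) \<bullet> ((?i \<star> (Ide C X \<star> ev)) \<bullet> ((?i \<star> Assoc C X D X) \<bullet> 
     ((?i \<star> (coev \<star> Ide C X)) \<bullet> (Assoc C W I X \<bullet> (RUnit' W \<star> Ide C X)))))"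
    by (simp add: e2 e3)
  also have "\<dots> = (?i \<star> (RUnit C X \<bullet> (Ide C X \<star> ev) \<bullet> Assoc C X D X \<bullet> (coev \<star> Ide C X))) \<bullet> (Assoc C W I X \<bullet> (RUnit' W \<star> Ide C X))"
    by (simp add: e4 Tensor_Comp_Ide)
  also have "\<dots> = (?i \<star> LUnit C X) \<bullet> (Assoc C W I X \<bullet> (RUnit' W \<star> Ide C X))"
    by (simp only: zig)
  also have "\<dots> = ((?i \<star> LUnit C X) \<bullet> Assoc C W I X) \<bullet> (RUnit' W \<star> Ide C X)"
    by simp
  also have "\<dots> = (RUnit C W \<star> Ide C X) \<bullet> (RUnit' W \<star> Ide C X)"
    by (simp only: triangle W X)
  also have "\<dots> = Ide C (W \<boxtimes> X)"
    by (simp add: interchange TensorA_Ide)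
  finally show ?thesis .
qed

text \<open>The same for the other zigzag: the pentagon for B, D, X, D exposes \<open>zag\<close>
  inside B \<otimes> -.\<close>

lemma unit_counit:
  assumes B: "B \<in> Obj C"
  shows "(counit_of D X ev B \<star> Ide C D) \<bullet> unit_of D X coev (B \<boxtimes> D) = Ide C (B \<boxtimes> D)"
proof -
  note [simp] = dfacts B
  let ?i = "Ide C B"
  have e1: "(Assoc C B D X \<star> Ide C D) \<bullet> Assoc' (B \<boxtimes> D) X D =
     Assoc' B (D \<boxtimes> X) D \<bullet> ((?i \<star> Assoc' D X D) \<bullet> Assoc C B D (X \<boxtimes> D))" (is "?l = ?r")
  proof -
    have "(?i \<star> Assoc C D X D) \<bullet> (Assoc C B (D \<boxtimes> X) D \<bullet> ?l) = Assoc C B D (X \<boxtimes> D)"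
      using arg_cong[OF pentagon[of B D X D], of "\<lambda>x. x \<bullet> Assoc' (B \<boxtimes> D) X D"] by simp
    then have "Assoc' B (D \<boxtimes> X) D \<bullet> ((?i \<star> Assoc' D X D) \<bullet> ((?i \<star> Assoc C D X D) \<bullet> (Assoc C B (D \<boxtimes> X) D \<bullet> ?l))) = ?r"
      by simp
    then show ?thesis
      by (simp add: interchange' TensorA_Ide Comp_reassoc[OF Assoc'_simps(4)])
  qed
  have e2: "((?i \<star> ev) \<star> Ide C D) \<bullet> Assoc' B (D \<boxtimes> X) D = Assoc' B I D \<bullet> (?i \<star> (ev \<star> Ide C D))"
    by (rule Assoc'_nat[symmetric]) simp_all
  have e3: "Assoc C B D (X \<boxtimes> D) \<bullet> (Ide C (B \<boxtimes> D) \<star> coev) = (?i \<star> (Ide C D \<star> coev)) \<bullet> Assoc C B D I"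
    using Assoc_nat[of ?i "Ide C D" coev B D I B D "X \<boxtimes> D"] by (simp add: TensorA_Ide)
  have e4: "Assoc C B D I \<bullet> RUnit' (B \<boxtimes> D) = ?i \<star> RUnit' D"
  proof -
    have "Assoc C B D I \<bullet> RUnit' (B \<boxtimes> D) = (?i \<star> RUnit' D) \<bullet> ((?i \<star> RUnit C D) \<bullet> (Assoc C B D I \<bullet> RUnit' (B \<boxtimes> D)))"
      by (simp add: interchange' TensorA_Ide)
    also have "\<dots> = (?i \<star> RUnit' D) \<bullet> (RUnit C (B \<boxtimes> D) \<bullet> RUnit' (B \<boxtimes> D))"
      by (subst RUnit_Tensor) (simp_all del: Unit'_simps(10))
    finally show ?thesis by simp
  qed
  have e5: "(RUnit C B \<star> Ide C D) \<bullet> Assoc' B I D = ?i \<star> LUnit C D"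
    by (simp add: triangle[symmetric])
  have "(counit_of D X ev B \<star> Ide C D) \<bullet> unit_of D X coev (B \<boxtimes> D) =
    (RUnit C B \<star> Ide C D) \<bullet> (((?i \<star> ev) \<star> Ide C D) \<bullet> (((Assoc C B D X \<star> Ide C D) \<bullet> Assoc' (B \<boxtimes> D) X D) \<bullet>
    ((Ide C (B \<boxtimes> D) \<star> coev) \<bullet> RUnit' (B \<boxtimes> D))))"
    by (simp add: unit_of_def counit_of_def Tensor_Comp_Ide)
  also have "\<dots> = (RUnit C B \<star> Ide C D) \<bullet> ((((?i \<star> ev) \<star> Ide C D) \<bullet> Assoc' B (D \<boxtimes> X) D) \<bullet> ((?i \<star> Assoc' D X D) \<bullet>
    ((Assoc C B D (X \<boxtimes> D) \<bullet> (Ide C (B \<boxtimes> D) \<star> coev)) \<bullet> RUnit' (B \<boxtimes> D))))"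
    by (simp add: e1)
  also have "\<dots> = ((RUnit C B \<star> Ide C D) \<bullet> Assoc' B I D) \<bullet> ((?i \<star> (ev \<star> Ide C D)) \<bullet> ((?i \<star> Assoc' D X D) \<bullet>
    ((?i \<star> (Ide C D \<star> coev)) \<bullet> (Assoc C B D I \<bullet> RUnit' (B \<boxtimes> D)))))"
    by (simp add: e2 e3)
  also have "\<dots> = (?i \<star> (LUnit C D \<bullet> (ev \<star> Ide C D) \<bullet> Assoc' D X D \<bullet> (Ide C D \<star> coev))) \<bullet> (?i \<star> RUnit' D)"
    by (simp add: e4 e5 Tensor_Comp_Ide)
  also have "\<dots> = Ide C (B \<boxtimes> D)"
    by (simp add: zag interchange TensorA_Ide)
  finally show ?thesis .
qed

end

text \<open>The exactness arguments below use duality only through this adjunction, so that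
  associators, evaluations and coevaluations drop out of them.\<close>

lemma dual_adjunction:
  assumes "is_left_dual C D X"
  obtains \<eta> \<epsilon> where
    "\<And>W. W \<in> Obj C \<Longrightarrow> \<eta> W \<in> homset C W ((W \<boxtimes> X) \<boxtimes> D)"
    "\<And>B. B \<in> Obj C \<Longrightarrow> \<epsilon> B \<in> homset C ((B \<boxtimes> D) \<boxtimes> X) B"
    "\<And>g W W'. g \<in> homset C W W' \<Longrightarrow> ((g \<star> Ide C X) \<star> Ide C D) \<bullet> \<eta> W = \<eta> W' \<bullet> g"
    "\<And>g B B'. g \<in> homset C B B' \<Longrightarrow> \<epsilon> B' \<bullet> ((g \<star> Ide C D) \<star> Ide C X) = g \<bullet> \<epsilon> B"
    "\<And>W. W \<in> Obj C \<Longrightarrow> \<epsilon> (W \<boxtimes> X) \<bullet> (\<eta> W \<star> Ide C X) = Ide C (W \<boxtimes> X)"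
    "\<And>B. B \<in> Obj C \<Longrightarrow> (\<epsilon> B \<star> Ide C D) \<bullet> \<eta> (B \<boxtimes> D) = Ide C (B \<boxtimes> D)"
proof -
  obtain ev coev where DX: "D \<in> Obj C" "X \<in> Obj C" "ev \<in> homset C (D \<boxtimes> X) I" "coev \<in> homset C I (X \<boxtimes> D)"
     "RUnit C X \<bullet> (Ide C X \<star> ev) \<bullet> Assoc C X D X \<bullet> (coev \<star> Ide C X) = LUnit C X"
     "LUnit C D \<bullet> (ev \<star> Ide C D) \<bullet> Assoc' D X D \<bullet> (Ide C D \<star> coev) = RUnit C D"
    using assms unfolding is_left_dual_def by blast
  have hom: "unit_of D X coev W \<in> homset C W ((W \<boxtimes> X) \<boxtimes> D)"
    "counit_of D X ev W \<in> homset C ((W \<boxtimes> D) \<boxtimes> X) W" if "W \<in> Obj C" for W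
    using unit_of_simps[OF DX that] counit_of_simps[OF DX that] by (simp_all add: homset_def)
  have nat: "((g \<star> Ide C X) \<star> Ide C D) \<bullet> unit_of D X coev W = unit_of D X coev W' \<bullet> g"
    "counit_of D X ev W' \<bullet> ((g \<star> Ide C D) \<star> Ide C X) = g \<bullet> counit_of D X ev W"
    if "g \<in> homset C W W'" for g W W'
    using unit_of_natural[OF DX homD[OF that]] counit_of_natural[OF DX homD[OF that]] .
  show ?thesis
    by (rule that[of "unit_of D X coev" "counit_of D X ev"])
      (rule hom nat counit_unit[OF DX] unit_counit[OF DX]; assumption)+
qed

text \<open>A left adjoint preserves epis: the transpose of
  \<open>k \<bullet> (e \<star> Ide C X)\<close> is the transpose of k composed with e, and an arrow
  is recovered from its transpose.\<close>

lemma tensor_epic: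
  assumes "is_left_dual C D X" "epic C e"
  shows "epic C (e \<star> Ide C X)"
proof (rule dual_adjunction[OF assms(1)])
  fix \<eta> \<epsilon>
  assume \<eta>: "\<And>W. W \<in> Obj C \<Longrightarrow> \<eta> W \<in> homset C W ((W \<boxtimes> X) \<boxtimes> D)"
    and \<epsilon>: "\<And>B. B \<in> Obj C \<Longrightarrow> \<epsilon> B \<in> homset C ((B \<boxtimes> D) \<boxtimes> X) B"
    and n\<eta>: "\<And>g W W'. g \<in> homset C W W' \<Longrightarrow> ((g \<star> Ide C X) \<star> Ide C D) \<bullet> \<eta> W = \<eta> W' \<bullet> g"
    and n\<epsilon>: "\<And>g B B'. g \<in> homset C B B' \<Longrightarrow> \<epsilon> B' \<bullet> ((g \<star> Ide C D) \<star> Ide C X) = g \<bullet> \<epsilon> B"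
    and t: "\<And>W. W \<in> Obj C \<Longrightarrow> \<epsilon> (W \<boxtimes> X) \<bullet> (\<eta> W \<star> Ide C X) = Ide C (W \<boxtimes> X)"
  have O[simp]: "X \<in> Obj C" "D \<in> Obj C" using assms(1) by (auto simp: is_left_dual_def)
  have e[simp]: "e \<in> Arr C" using assms(2) epic_Arr by blast
  let ?A = "Dom C e" let ?B = "Cod C e"
  have AB[simp]: "?A \<in> Obj C" "?B \<in> Obj C" using Dom_Obj Cod_Obj by auto
  show ?thesis
  proof (rule epicI)
    fix g h assume gh: "g \<in> Arr C" "h \<in> Arr C" "Dom C g = Cod C (e \<star> Ide C X)" "Dom C h = Cod C (e \<star> Ide C X)"
      "g \<bullet> (e \<star> Ide C X) = h \<bullet> (e \<star> Ide C X)" "Cod C g = Cod C h"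
    note [simp] = gh(1,2) gh(3,4)[simplified] homD[OF \<eta>] homD[OF \<epsilon>]
    have sh: "((k \<star> Ide C D) \<bullet> \<eta> ?B) \<bullet> e = ((k \<bullet> (e \<star> Ide C X)) \<star> Ide C D) \<bullet> \<eta> ?A"
      if k: "k \<in> Arr C" "Dom C k = ?B \<boxtimes> X" for k
      using n\<eta>[of e ?A ?B] k by (simp add: Tensor_Comp_Ide homset_def)
    have "((g \<star> Ide C D) \<bullet> \<eta> ?B) \<bullet> e = ((h \<star> Ide C D) \<bullet> \<eta> ?B) \<bullet> e"
      using sh[of g] sh[of h] gh(5) by simp
    then have eq: "(g \<star> Ide C D) \<bullet> \<eta> ?B = (h \<star> Ide C D) \<bullet> \<eta> ?B"
      by (rule epicD[OF assms(2), rotated -1]) simp_all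
    have fl: "k = \<epsilon> (Cod C k) \<bullet> (((k \<star> Ide C D) \<bullet> \<eta> ?B) \<star> Ide C X)"
      if k: "k \<in> Arr C" "Dom C k = ?B \<boxtimes> X" for k
    proof -
      have [simp]: "Cod C k \<in> Obj C" using k Cod_Obj by blast
      have "\<epsilon> (Cod C k) \<bullet> (((k \<star> Ide C D) \<bullet> \<eta> ?B) \<star> Ide C X) = 
         (\<epsilon> (Cod C k) \<bullet> ((k \<star> Ide C D) \<star> Ide C X)) \<bullet> (\<eta> ?B \<star> Ide C X)"
        using k by (simp add: Tensor_Comp_Ide)
      also have "\<dots> = k \<bullet> (\<epsilon> (?B \<boxtimes> X) \<bullet> (\<eta> ?B \<star> Ide C X))"
        using n\<epsilon>[of k "?B \<boxtimes> X" "Cod C k"] k by (simp add: homset_def)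
      finally show ?thesis using t[of ?B] k by simp
    qed
    have "g = \<epsilon> (Cod C g) \<bullet> (((g \<star> Ide C D) \<bullet> \<eta> ?B) \<star> Ide C X)"
      by (rule fl) simp_all
    also have "\<dots> = \<epsilon> (Cod C h) \<bullet> (((h \<star> Ide C D) \<bullet> \<eta> ?B) \<star> Ide C X)"
      by (simp only: eq gh(6))
    also have "\<dots> = h"
      by (rule fl[symmetric]) simp_all
    finally show "g = h" .
  qed simp
qed

text \<open>A left adjoint preserves projectives when its right adjoint preserves epis. The right
  adjoint of - \<otimes> X is - \<otimes> D, and the second dual E is what makes
  \<open>tensor_epic\<close> apply to it.\<close>

lemma tensor_projective:
  assumes "is_left_dual C D X" "is_left_dual C E D" "projective_obj C P"
  shows "projective_obj C (P \<boxtimes> X)"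
proof (rule dual_adjunction[OF assms(1)])
  fix \<eta> \<epsilon>
  assume \<eta>: "\<And>W. W \<in> Obj C \<Longrightarrow> \<eta> W \<in> homset C W ((W \<boxtimes> X) \<boxtimes> D)"
    and \<epsilon>: "\<And>B. B \<in> Obj C \<Longrightarrow> \<epsilon> B \<in> homset C ((B \<boxtimes> D) \<boxtimes> X) B"
    and n\<eta>: "\<And>g W W'. g \<in> homset C W W' \<Longrightarrow> ((g \<star> Ide C X) \<star> Ide C D) \<bullet> \<eta> W = \<eta> W' \<bullet> g"
    and n\<epsilon>: "\<And>g B B'. g \<in> homset C B B' \<Longrightarrow> \<epsilon> B' \<bullet> ((g \<star> Ide C D) \<star> Ide C X) = g \<bullet> \<epsilon> B"
    and t: "\<And>W. W \<in> Obj C \<Longrightarrow> \<epsilon> (W \<boxtimes> X) \<bullet> (\<eta> W \<star> Ide C X) = Ide C (W \<boxtimes> X)"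
  have O[simp]: "X \<in> Obj C" "D \<in> Obj C" using assms(1) by (auto simp: is_left_dual_def)
  have P[simp]: "P \<in> Obj C" using assms(3) by (simp add: projective_obj_def)
  show ?thesis unfolding projective_obj_def
  proof (intro conjI allI impI)
    fix e f assume ef: "epic C e \<and> f \<in> homset C (P \<boxtimes> X) (Cod C e)"
    then have e[simp]: "e \<in> Arr C" using epic_Arr by blast
    let ?A = "Dom C e" let ?B = "Cod C e"
    have AB[simp]: "?A \<in> Obj C" "?B \<in> Obj C" using Dom_Obj Cod_Obj by auto
    note [simp] = homD[OF \<eta>] homD[OF \<epsilon>] homD[OF conjunct2[OF ef]]
    have "epic C (e \<star> Ide C D)" using tensor_epic[OF assms(2)] ef by blast
    moreover have "(f \<star> Ide C D) \<bullet> \<eta> P \<in> homset C P (Cod C (e \<star> Ide C D))"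
      by (intro homI) simp_all
    ultimately obtain g where g: "g \<in> homset C P (Dom C (e \<star> Ide C D))"
      "(e \<star> Ide C D) \<bullet> g = (f \<star> Ide C D) \<bullet> \<eta> P"
      using projective_lift[OF assms(3)] by blast
    note [simp] = homD[OF g(1)]
    have "e \<bullet> (\<epsilon> ?A \<bullet> (g \<star> Ide C X)) = (e \<bullet> \<epsilon> ?A) \<bullet> (g \<star> Ide C X)"
      by simp
    also have "\<dots> = (\<epsilon> ?B \<bullet> ((e \<star> Ide C D) \<star> Ide C X)) \<bullet> (g \<star> Ide C X)"
      using n\<epsilon>[of e ?A ?B] by (simp add: homset_def)
    also have "\<dots> = \<epsilon> ?B \<bullet> (((e \<star> Ide C D) \<bullet> g) \<star> Ide C X)"
      by (simp add: Tensor_Comp_Ide)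
    also have "\<dots> = (\<epsilon> ?B \<bullet> ((f \<star> Ide C D) \<star> Ide C X)) \<bullet> (\<eta> P \<star> Ide C X)"
      unfolding g(2) by (simp add: Tensor_Comp_Ide)
    also have "\<dots> = f \<bullet> (\<epsilon> (P \<boxtimes> X) \<bullet> (\<eta> P \<star> Ide C X))"
      using n\<epsilon>[of f "P \<boxtimes> X" ?B] by (simp add: homset_def)
    also have "\<dots> = f" using t[of P] by simp
    finally show "\<exists>g\<in>homset C (P \<boxtimes> X) (Dom C e). e \<bullet> g = f"
      by (intro bexI[of _ "\<epsilon> ?A \<bullet> (g \<star> Ide C X)"] homI) simp_all
  qed simp
qed

end

text \<open>The reversed tensor product exchanges left and right duals and so turns statements about \<open>- \<otimes> X\<close>
  into statements about \<open>X \<otimes> -\<close>.\<close>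

definition rev_tensor ::
  "('o, 'm, 'k, 'z) tensor_category_scheme \<Rightarrow> ('o, 'm, 'k, 'z) tensor_category_scheme" where
  "rev_tensor C = C\<lparr>TensorO := \<lambda>X Y. TensorO C Y X, TensorA := \<lambda>f g. TensorA C g f,
     Assoc := \<lambda>X Y Z. inv_arrow C (Assoc C Z Y X), LUnit := RUnit C, RUnit := LUnit C\<rparr>"

lemma rev_tensor_simps [simp]:
  "Obj (rev_tensor C) = Obj C" "Arr (rev_tensor C) = Arr C" "Dom (rev_tensor C) = Dom C"
  "Cod (rev_tensor C) = Cod C" "Ide (rev_tensor C) = Ide C" "Comp (rev_tensor C) = Comp C"
  "TensorO (rev_tensor C) X Y = TensorO C Y X" "TensorA (rev_tensor C) f g = TensorA C g f"
  "UnitO (rev_tensor C) = UnitO C" "Assoc (rev_tensor C) X Y Z = inv_arrow C (Assoc C Z Y X)"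
  "LUnit (rev_tensor C) = RUnit C" "RUnit (rev_tensor C) = LUnit C"
  "homset (rev_tensor C) = homset C" "epic (rev_tensor C) = epic C"
  "iso_arrow (rev_tensor C) = iso_arrow C" "inv_arrow (rev_tensor C) = inv_arrow C"
  "projective_obj (rev_tensor C) = projective_obj C"
  by (auto simp: rev_tensor_def homset_def epic_def iso_arrow_def inv_arrow_def inverse_arrows_def
      projective_obj_def fun_eq_iff)

context monoidal_category
begin

lemma Assoc'_hom:
  assumes "X \<in> Obj C" "Y \<in> Obj C" "Z \<in> Obj C"
  shows "Assoc' X Y Z \<in> homset C (X \<boxtimes> (Y \<boxtimes> Z)) ((X \<boxtimes> Y) \<boxtimes> Z)"
  using assms by (intro homI) simp_all

lemma Assoc'_iso:
  assumes "X \<in> Obj C" "Y \<in> Obj C" "Z \<in> Obj C"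
  shows "iso_arrow C (Assoc' X Y Z)"
  using inverse_arrows_sym[OF inv_arrow[OF Assoc_iso[OF assms]]] by (auto simp: iso_arrow_def)

lemma Assoc'_natural:
  assumes "f \<in> homset C X X'" "g \<in> homset C Y Y'" "h \<in> homset C Z Z'"
  shows "Assoc' X' Y' Z' \<bullet> (f \<star> (g \<star> h)) = ((f \<star> g) \<star> h) \<bullet> Assoc' X Y Z"
  using assms by (intro Assoc'_nat) (simp_all add: homset_def)

lemma Assoc'_triangle:
  assumes "X \<in> Obj C" "Y \<in> Obj C"
  shows "(RUnit C Y \<star> Ide C X) \<bullet> Assoc' Y I X = Ide C Y \<star> LUnit C X"
  using assms by (simp add: triangle[symmetric])

text \<open>The two sides are inverse to the two sides of the pentagon for Z, Y, X, W.\<close>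

lemma Assoc'_pentagon:
  assumes [simp]: "W \<in> Obj C" "X \<in> Obj C" "Y \<in> Obj C" "Z \<in> Obj C"
  shows "Assoc' (Z \<boxtimes> Y) X W \<bullet> Assoc' Z Y (X \<boxtimes> W) =
     (Assoc' Z Y X \<star> Ide C W) \<bullet> (Assoc' Z (Y \<boxtimes> X) W \<bullet> (Ide C Z \<star> Assoc' Y X W))" (is "?l = ?r")
proof -
  have "?l = ?l \<bullet> (((Ide C Z \<star> Assoc C Y X W) \<bullet> Assoc C Z (Y \<boxtimes> X) W \<bullet> (Assoc C Z Y X \<star> Ide C W)) \<bullet> ?r)"
    by (simp add: interchange interchange' TensorA_Ide Comp_reassoc[OF Assoc'_simps(5)])
  also have "\<dots> = ?l \<bullet> ((Assoc C Z Y (X \<boxtimes> W) \<bullet> Assoc C (Z \<boxtimes> Y) X W) \<bullet> ?r)"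
    by (simp only: pentagon assms)
  also have "\<dots> = ?r"
    by (simp add: Comp_reassoc[OF Assoc'_simps(4)])
  finally show ?thesis .
qed

lemma rev_monoidal: "monoidal_category (rev_tensor C)"
  apply unfold_locales
                      apply (simp_all only: rev_tensor_simps)
                      apply (rule Dom_Obj Cod_Obj Ide_hom Comp_hom Comp_assoc Comp_Ide Ide_Comp
      TensorO_Obj UnitO_Obj TensorA_hom TensorA_Ide TensorA_Comp Assoc'_hom Assoc'_iso
      Assoc'_natural LUnit_hom LUnit_iso LUnit_natural RUnit_hom RUnit_iso RUnit_natural
      Assoc'_pentagon Assoc'_triangle; assumption)+
  done

text \<open>The reversed associator is the inverse one, so the two zigzag equations of a left dual
  trade places.\<close>

lemma rev_dual: "is_left_dual (rev_tensor C) D X \<longleftrightarrow> is_left_dual C X D"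
proof (cases "X \<in> Obj C \<and> D \<in> Obj C")
  case True
  then have eq: "inv_arrow C (Assoc' D X D) = Assoc C D X D"
    using inv_arrow_eq[OF inverse_arrows_sym[OF inv_arrow[OF Assoc_iso]]] by blast
  show ?thesis
    unfolding is_left_dual_def by (simp only: rev_tensor_simps eq conj_ac)
qed (auto simp: is_left_dual_def)

lemma left_tensor_epic:
  assumes "is_left_dual C X D" "epic C e"
  shows "epic C (Ide C X \<star> e)"
  using monoidal_category.tensor_epic[OF rev_monoidal, of D X e] assms
  by (simp only: rev_dual rev_tensor_simps)

lemma left_tensor_projective:
  assumes "is_left_dual C X D" "is_left_dual C D E" "projective_obj C P"
  shows "projective_obj C (X \<boxtimes> P)"
  using monoidal_category.tensor_projective[OF rev_monoidal, of D X E P] assms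
  by (simp only: rev_dual rev_tensor_simps)

end

section \<open>Chain maps between resolutions\<close>

text \<open>Composition, tensoring, \<open>phi_part\<close> and Yoneda products are first shown to
  preserve sums; zero, negatives and differences follow here once for all of them.\<close>

lemma additive_map:
  assumes G: "abelian_group G" and H: "abelian_group H"
    and closed: "\<And>x. x \<in> carrier G \<Longrightarrow> h x \<in> carrier H"
    and add: "\<And>x y. \<lbrakk>x \<in> carrier G; y \<in> carrier G\<rbrakk> \<Longrightarrow> h (x \<oplus>\<^bsub>G\<^esub> y) = h x \<oplus>\<^bsub>H\<^esub> h y"
  shows "h \<zero>\<^bsub>G\<^esub> = \<zero>\<^bsub>H\<^esub>"
    and "x \<in> carrier G \<Longrightarrow> h (\<ominus>\<^bsub>G\<^esub> x) = \<ominus>\<^bsub>H\<^esub> h x"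
    and "\<lbrakk>x \<in> carrier G; y \<in> carrier G\<rbrakk> \<Longrightarrow> h (x \<ominus>\<^bsub>G\<^esub> y) = h x \<ominus>\<^bsub>H\<^esub> h y"
proof -
  interpret abelian_group_hom G H h
    using assms by (intro abelian_group_homI group_hom.intro group_hom_axioms.intro)
      (auto simp: hom_def abelian_group.a_group)
  show "h \<zero>\<^bsub>G\<^esub> = \<zero>\<^bsub>H\<^esub>" by simp
  show neg: "h (\<ominus>\<^bsub>G\<^esub> x) = \<ominus>\<^bsub>H\<^esub> h x" if "x \<in> carrier G" for x using that by simp
  show "h (x \<ominus>\<^bsub>G\<^esub> y) = h x \<ominus>\<^bsub>H\<^esub> h y" if "x \<in> carrier G" "y \<in> carrier G" for x y
    using that by (simp add: a_minus_def)
qed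

context linear_category
begin

lemma hom_group: "\<lbrakk>X \<in> Obj C; Y \<in> Obj C\<rbrakk> \<Longrightarrow> abelian_group (HomMod C X Y)"
  using HomMod_module module.axioms(2) by blast

lemma hom_group': "f \<in> homset C X Y \<Longrightarrow> abelian_group (HomMod C X Y)"
  using hom_group hom_Obj by blast

lemma hom_carrier: "f \<in> homset C X Y \<Longrightarrow> carrier (HomMod C X Y) = homset C X Y"
  using HomMod_carrier hom_Obj by blast

lemma hom_mem: "f \<in> homset C X Y \<Longrightarrow> f \<in> carrier (HomMod C X Y)"
  using hom_carrier by blast

lemma zero_hom: "\<lbrakk>X \<in> Obj C; Y \<in> Obj C\<rbrakk> \<Longrightarrow> zero_arrow C X Y \<in> homset C X Y"
  using hom_group[of X Y] HomMod_carrier[of X Y] abelian_monoid.zero_closed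
    abelian_group.axioms(1) by metis

lemma zero_simps [simp]:
  assumes "X \<in> Obj C" "Y \<in> Obj C"
  shows "zero_arrow C X Y \<in> Arr C" "Dom C (zero_arrow C X Y) = X" "Cod C (zero_arrow C X Y) = Y"
  using zero_hom[OF assms] by (auto simp: homset_def)

context
  fixes f g X Y
  assumes f: "f \<in> homset C X Y" and g: "g \<in> homset C X Y"
begin

interpretation H: abelian_group "HomMod C X Y" using hom_group'[OF f] .

lemma add_hom: "f \<oplus>\<^bsub>HomMod C X Y\<^esub> g \<in> homset C X Y"
  using H.a_closed[OF hom_mem[OF f] hom_mem[OF g]] hom_carrier[OF f] by blast
lemma minus_hom: "f \<ominus>\<^bsub>HomMod C X Y\<^esub> g \<in> homset C X Y"
  using H.minus_closed[OF hom_mem[OF f] hom_mem[OF g]] hom_carrier[OF f] by blast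
lemma minus_zero_iff: "f \<ominus>\<^bsub>HomMod C X Y\<^esub> g = zero_arrow C X Y \<longleftrightarrow> f = g"
  using hom_mem[OF f] hom_mem[OF g] by (metis H.minus_equality H.minus_minus H.r_neg H.a_inv_closed a_minus_def)
end

lemma neg_hom: "f \<in> homset C X Y \<Longrightarrow> \<ominus>\<^bsub>HomMod C X Y\<^esub> f \<in> homset C X Y"
  using abelian_group.a_inv_closed[OF hom_group'] hom_carrier by blast

lemma minus_self: "f \<in> homset C X Y \<Longrightarrow> f \<ominus>\<^bsub>HomMod C X Y\<^esub> f = zero_arrow C X Y"
  using minus_zero_iff by blast

lemma minus_zero:
  assumes f: "f \<in> homset C X Y"
  shows "f \<ominus>\<^bsub>HomMod C X Y\<^esub> zero_arrow C X Y = f"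
proof -
  interpret H: abelian_group "HomMod C X Y" using hom_group'[OF f] .
  have "f \<in> carrier (HomMod C X Y)" using f hom_carrier[OF f] by simp
  then show ?thesis
    using H.minus_equality[OF H.l_zero[OF H.zero_closed]] by (simp add: a_minus_def)
qed

context
  fixes h Y Z assumes h: "h \<in> homset C Y Z"
begin

lemma Comp_additive_right:
  assumes X: "X \<in> Obj C"
  shows "h \<bullet> zero_arrow C X Y = zero_arrow C X Z"
    and "f \<in> homset C X Y \<Longrightarrow> h \<bullet> (\<ominus>\<^bsub>HomMod C X Y\<^esub> f) = \<ominus>\<^bsub>HomMod C X Z\<^esub> (h \<bullet> f)"
    and "\<lbrakk>f \<in> homset C X Y; g \<in> homset C X Y\<rbrakk> \<Longrightarrow>
      h \<bullet> (f \<ominus>\<^bsub>HomMod C X Y\<^esub> g) = (h \<bullet> f) \<ominus>\<^bsub>HomMod C X Z\<^esub> (h \<bullet> g)"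
  using additive_map[of "HomMod C X Y" "HomMod C X Z" "\<lambda>f. h \<bullet> f"]
    hom_group[OF X] hom_Obj[OF h] HomMod_carrier[OF X] Comp_hom[OF h] Comp_add_right[OF h] by auto

lemma Comp_additive_left:
  assumes W: "W \<in> Obj C"
  shows "zero_arrow C Z W \<bullet> h = zero_arrow C Y W"
    and "f \<in> homset C Z W \<Longrightarrow> (\<ominus>\<^bsub>HomMod C Z W\<^esub> f) \<bullet> h = \<ominus>\<^bsub>HomMod C Y W\<^esub> (f \<bullet> h)"
    and "\<lbrakk>f \<in> homset C Z W; g \<in> homset C Z W\<rbrakk> \<Longrightarrow>
      (f \<ominus>\<^bsub>HomMod C Z W\<^esub> g) \<bullet> h = (f \<bullet> h) \<ominus>\<^bsub>HomMod C Y W\<^esub> (g \<bullet> h)"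
  using additive_map[of "HomMod C Z W" "HomMod C Y W" "\<lambda>f. f \<bullet> h"]
    hom_group[OF _ W] hom_Obj[OF h] HomMod_carrier[OF _ W] Comp_hom[OF _ h] Comp_add_left[OF _ _ h] by auto

end

lemma Comp_zero [simp]:
  assumes "h \<in> Arr C" "X \<in> Obj C"
  shows "Dom C h = Y \<Longrightarrow> h \<bullet> zero_arrow C X Y = zero_arrow C X (Cod C h)"
    and "Cod C h = Y \<Longrightarrow> zero_arrow C Y X \<bullet> h = zero_arrow C (Dom C h) X"
  using Comp_additive_right(1)[of h Y "Cod C h" X] Comp_additive_left(1)[of h "Dom C h" Y X] assms
  by (auto simp: homset_def)

end

section \<open>Kernels, exactness and Schur's lemma in abelian categories\<close>

definition injective_obj where
  "injective_obj C J \<longleftrightarrow> J \<in> Obj C \<and>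
     (\<forall>i f. monic C i \<and> f \<in> homset C (Dom C i) J \<longrightarrow> (\<exists>g \<in> homset C (Cod C i) J. g \<bullet> i = f))"
  for C (structure)

context linear_abelian_category
begin

lemma kernelD:
  assumes "is_kernel C k f"
  shows "f \<in> Arr C" "k \<in> Arr C" "Cod C k = Dom C f" "f \<bullet> k = zero_arrow C (Dom C k) (Cod C f)"
  using assms by (auto simp: is_kernel_def)

lemma kernel_factor:
  assumes "is_kernel C k f" "g \<in> homset C W (Dom C f)" "f \<bullet> g = zero_arrow C W (Cod C f)"
  obtains u where "u \<in> homset C W (Dom C k)" "k \<bullet> u = g"
  using assms unfolding is_kernel_def by blast

lemma cokernelD:
  assumes "is_cokernel C q f"
  shows "f \<in> Arr C" "q \<in> Arr C" "Dom C q = Cod C f" "q \<bullet> f = zero_arrow C (Dom C f) (Cod C q)"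
  using assms by (auto simp: is_cokernel_def)

lemma cokernel_factor:
  assumes "is_cokernel C q f" "g \<in> homset C (Cod C f) W" "g \<bullet> f = zero_arrow C (Dom C f) W"
  obtains u where "u \<in> homset C (Cod C q) W" "u \<bullet> q = g"
  using assms unfolding is_cokernel_def by blast

lemma kernel_monic:
  assumes "is_kernel C k f"
  shows "monic C k"
proof (rule monicI)
  fix g h assume gh: "g \<in> Arr C" "h \<in> Arr C" "Cod C g = Dom C k" "Cod C h = Dom C k"
    "k \<bullet> g = k \<bullet> h" "Dom C g = Dom C h"
  note k = kernelD[OF assms]
  have "k \<bullet> g \<in> homset C (Dom C g) (Dom C f)" using gh k by (auto intro!: homI)
  moreover have "f \<bullet> (k \<bullet> g) = zero_arrow C (Dom C g) (Cod C f)"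
    using Comp_reassoc[OF k(4), of g] gh k Cod_Obj by simp
  ultimately have "\<exists>!u. u \<in> homset C (Dom C g) (Dom C k) \<and> k \<bullet> u = k \<bullet> g"
    using assms unfolding is_kernel_def by blast
  then show "g = h" using gh by (metis homI)
qed (use kernelD[OF assms] in simp)

lemma cokernel_epic:
  assumes "is_cokernel C q f"
  shows "epic C q"
proof (rule epicI)
  fix g h assume gh: "g \<in> Arr C" "h \<in> Arr C" "Dom C g = Cod C q" "Dom C h = Cod C q"
    "g \<bullet> q = h \<bullet> q" "Cod C g = Cod C h"
  note q = cokernelD[OF assms]
  have "g \<bullet> q \<in> homset C (Cod C f) (Cod C g)" using gh q by (auto intro!: homI)
  moreover have "(g \<bullet> q) \<bullet> f = zero_arrow C (Dom C f) (Cod C g)"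
    using gh q Dom_Obj by simp
  ultimately have "\<exists>!u. u \<in> homset C (Cod C q) (Cod C g) \<and> u \<bullet> q = g \<bullet> q"
    using assms unfolding is_cokernel_def by blast
  then show "g = h" using gh by (metis homI)
qed (use cokernelD[OF assms] in simp)

text \<open>An epi e is the cokernel of some f, and f factors through the kernel k of e; so an arrow
  that kills k kills f and factors through e.\<close>

lemma epic_factor:
  assumes e: "epic C e" and k: "is_kernel C k e"
    and g: "g \<in> homset C (Dom C e) W" "g \<bullet> k = zero_arrow C (Dom C k) W"
  obtains u where "u \<in> homset C (Cod C e) W" "u \<bullet> e = g"
proof -
  obtain f where f: "is_cokernel C e f" using epic_is_cokernel[OF e] by blast
  note ff = cokernelD[OF f] and kk = kernelD[OF k] and gg = homD[OF g(1)]
  have O: "W \<in> Obj C" "Dom C e \<in> Obj C" using hom_Obj[OF g(1)] by auto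
  obtain v where v: "v \<in> homset C (Dom C f) (Dom C k)" "k \<bullet> v = f"
    using kernel_factor[OF k, of f "Dom C f"] ff by (auto intro: homI)
  have "g \<bullet> f = zero_arrow C (Dom C f) W"
    using v g(2) kk gg ff O homD[OF v(1)]  Comp_reassoc[OF g(2), of v] by simp
  then show thesis
    using cokernel_factor[OF f, of g W] that g(1) ff by auto
qed

text \<open>The monic i is the kernel of some f. As f composes with i to zero, it factors as
  \<open>v \<bullet> q\<close> through the cokernel, so whatever q kills is killed by f.\<close>

lemma monic_kernel_of_cokernel:
  assumes i: "monic C i" and q: "is_cokernel C q i"
  shows "is_kernel C i q"
proof -
  obtain f where f: "is_kernel C i f" using monic_is_kernel[OF i] by blast
  note ff = kernelD[OF f] and qq = cokernelD[OF q]
  obtain v where v: "v \<in> homset C (Cod C q) (Cod C f)" "v \<bullet> q = f"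
    using cokernel_factor[OF q, of f "Cod C f"] ff by (auto intro: homI)
  show ?thesis unfolding is_kernel_def
  proof (intro conjI allI ballI impI)
    fix W g assume g: "g \<in> homset C W (Dom C q)" "q \<bullet> g = zero_arrow C W (Cod C q)"
    have "W \<in> Obj C" using hom_Obj g by blast
    then have "v \<bullet> (q \<bullet> g) = zero_arrow C W (Cod C f)"
      using g homD[OF v(1)] Cod_Obj by simp
    then have "f \<bullet> g = zero_arrow C W (Cod C f)"
      using v(2) homD[OF v(1)] homD[OF g(1)] qq by (metis Comp_assoc')
    then show "\<exists>!u. u \<in> homset C W (Dom C i) \<and> i \<bullet> u = g"
      using f g qq ff unfolding is_kernel_def by auto
  qed (use qq in auto)
qed

lemma exact_atD:
  assumes "exact_at C f g"
  shows "f \<in> Arr C" "g \<in> Arr C" "Cod C f = Dom C g" "g \<bullet> f = zero_arrow C (Dom C f) (Cod C g)"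
proof -
  obtain e k where ek: "epic C e" "is_kernel C k g" "Cod C e = Dom C k" "f = k \<bullet> e"
    using assms unfolding exact_at_def by blast
  note k = kernelD[OF ek(2)] and e = epic_Arr[OF ek(1)]
  show "f \<in> Arr C" "g \<in> Arr C" "Cod C f = Dom C g" using ek k e by auto
  show "g \<bullet> f = zero_arrow C (Dom C f) (Cod C g)"
    using ek k e Cod_Obj by (simp add: Comp_reassoc[OF k(4)])
qed

lemma exact_lift:
  assumes fg: "exact_at C f g" and P: "projective_obj C P"
    and h: "h \<in> homset C P (Dom C g)" "g \<bullet> h = zero_arrow C P (Cod C g)"
  obtains u where "u \<in> homset C P (Dom C f)" "f \<bullet> u = h"
proof -
  obtain e k where ek: "epic C e" "is_kernel C k g" "Cod C e = Dom C k" "f = k \<bullet> e"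
    using fg unfolding exact_at_def by blast
  note k = kernelD[OF ek(2)] and e = epic_Arr[OF ek(1)]
  obtain v where v: "v \<in> homset C P (Dom C k)" "k \<bullet> v = h"
    using kernel_factor[OF ek(2) h] .
  then obtain u where u: "u \<in> homset C P (Dom C e)" "e \<bullet> u = v"
    using projective_lift[OF P ek(1), of v] ek(3) by auto
  have "f \<bullet> u = h" using ek u v k e homD[OF u(1)] by simp
  then show thesis using that[of u] u ek k e by simp
qed

text \<open>Exactness at g and h factors g as an epi e' followed by a kernel k'. Since a kills the
  kernel of g, it descends along e', and injectivity of J extends the result along the monic
  k'.\<close>

lemma exact_extend_injective:
  assumes fg: "exact_at C f g" and gh: "exact_at C g h" and J: "injective_obj C J"
    and a: "a \<in> homset C (Dom C g) J" "a \<bullet> f = zero_arrow C (Dom C f) J"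
  obtains b where "b \<in> homset C (Cod C g) J" "b \<bullet> g = a"
proof -
  obtain e k where ek: "epic C e" "is_kernel C k g" "Cod C e = Dom C k" "f = k \<bullet> e"
    using fg unfolding exact_at_def by blast
  obtain e' k' where ek': "epic C e'" "is_kernel C k' h" "Cod C e' = Dom C k'" "g = k' \<bullet> e'"
    using gh unfolding exact_at_def by blast
  note k = kernelD[OF ek(2)] and e = epic_Arr[OF ek(1)]
  note k' = kernelD[OF ek'(2)] and e' = epic_Arr[OF ek'(1)]
  have de: "Dom C e' = Dom C g" using ek' k' e' by simp
  have J': "J \<in> Obj C" using J by (simp add: injective_obj_def)
  \<comment> \<open>As k' is monic, g and its epi part e' have the same kernel.\<close>
  have ke': "is_kernel C k e'"
    unfolding is_kernel_def
  proof (intro conjI ballI allI impI)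
    have dk: "Dom C e' = Cod C k" "Dom C k \<in> Obj C" "Dom C k' \<in> Obj C"
      using de k k' Dom_Obj by simp_all
    have "k' \<bullet> (e' \<bullet> k) = g \<bullet> k"
      unfolding ek'(4) using Comp_assoc'[OF k(2) e' k'(2) dk(1) ek'(3)[symmetric]] by simp
    also have "\<dots> = k' \<bullet> zero_arrow C (Dom C k) (Cod C e')"
      using k(4) k'(2) dk ek'(3) Comp_simps(3)[OF e' k'(2)] ek'(4) by simp
    finally show "e' \<bullet> k = zero_arrow C (Dom C k) (Cod C e')"
      by (rule monicD[OF kernel_monic[OF ek'(2)], rotated -1])
       (use k(2) e' k'(2) dk ek'(3) in auto)
    fix W x assume x: "x \<in> homset C W (Dom C e')" "e' \<bullet> x = zero_arrow C W (Cod C e')"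
    have W: "W \<in> Obj C" using hom_Obj x by blast
    have "g \<bullet> x = k' \<bullet> (e' \<bullet> x)"
      unfolding ek'(4) using Comp_assoc'[of x e' k'] e' k'(2) ek'(3) homD[OF x(1)] by simp
    also have "\<dots> = zero_arrow C W (Cod C g)"
      using x(2) W k'(2) e' ek'(3) Comp_simps(3)[OF e' k'(2)] ek'(4) by simp
    finally have "g \<bullet> x = zero_arrow C W (Cod C g)" .
    then show "\<exists>!u. u \<in> homset C W (Dom C k) \<and> k \<bullet> u = x"
      using ek(2) x de unfolding is_kernel_def by auto
  qed (use e' k de in auto)
  have "(a \<bullet> k) \<bullet> e = zero_arrow C (Dom C k) J \<bullet> e"
    using a k e ek homD[OF a(1)] J' by simp
  then have "a \<bullet> k = zero_arrow C (Dom C k) J"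
    by (rule epicD[OF ek(1), rotated -1]) (use a k e ek homD[OF a(1)] J' Dom_Obj in auto)
  then obtain a' where a': "a' \<in> homset C (Cod C e') J" "a' \<bullet> e' = a"
    using epic_factor[OF ek'(1) ke', of a J] a(1) de by auto
  then obtain b where b: "b \<in> homset C (Cod C k') J" "b \<bullet> k' = a'"
    using J kernel_monic[OF ek'(2)] ek'(3) unfolding injective_obj_def by auto
  have "b \<bullet> g = a"
    using ek' k' e' a' b homD[OF b(1)] by (metis Comp_assoc')
  then show thesis using that[of b] b ek' k' e' by simp
qed

lemma exact_cover:
  assumes "enough_projectives C" "g \<in> Arr C"
  obtains f where "projective_obj C (Dom C f)" "exact_at C f g"
proof -
  obtain k where k: "is_kernel C k g" using kernel_exists[OF assms(2)] by blast
  then obtain e where e: "epic C e" "Cod C e = Dom C k" "projective_obj C (Dom C e)"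
    using assms(1) Dom_Obj kernelD[OF k] unfolding enough_projectives_def by blast
  have "Dom C (k \<bullet> e) = Dom C e" using kernelD[OF k] e epic_Arr by simp
  moreover have "exact_at C (k \<bullet> e) g" using k e unfolding exact_at_def by blast
  ultimately show thesis using that e by metis
qed

lemma projective_resolution_exists:
  assumes "enough_projectives C" "X \<in> Obj C"
  shows "\<exists>d. is_projective_resolution C X d"
proof -
  obtain e where e: "epic C e" "Cod C e = X" "projective_obj C (Dom C e)"
    using assms unfolding enough_projectives_def by blast
  have "\<exists>d. \<forall>n. (d n \<in> Arr C \<and> projective_obj C (Dom C (d n)) \<and> (n = 0 \<longrightarrow> d n = e)) \<and>
     exact_at C (d (Suc n)) (d n)"
  proof (rule dependent_nat_choice)
    show "\<exists>x. x \<in> Arr C \<and> projective_obj C (Dom C x) \<and> (0 = (0::nat) \<longrightarrow> x = e)"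
      using e epic_Arr by auto
    fix x and n :: nat
    assume "x \<in> Arr C \<and> projective_obj C (Dom C x) \<and> (n = 0 \<longrightarrow> x = e)"
    then obtain y where "projective_obj C (Dom C y)" "exact_at C y x"
      using exact_cover[OF assms(1)] by blast
    then show "\<exists>y. (y \<in> Arr C \<and> projective_obj C (Dom C y) \<and> (Suc n = 0 \<longrightarrow> y = e)) \<and> exact_at C y x"
      using exact_atD(1) by auto
  qed
  then obtain d where d: "\<And>n. d n \<in> Arr C \<and> projective_obj C (Dom C (d n)) \<and> (n = 0 \<longrightarrow> d n = e)"
    "\<And>n. exact_at C (d (Suc n)) (d n)" by blast
  have "is_projective_resolution C X d"
    unfolding is_projective_resolution_def using d e by simp
  then show ?thesis by blast
qed

text \<open>Schur's lemma: an invertible kernel would make f zero, so by simplicity the kernel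
  object is zero and f is monic; a monic into S from a nonzero object is invertible.\<close>

lemma simple_endo_iso:
  assumes S: "simple_obj C S" and f: "f \<in> homset C S S" "f \<noteq> zero_arrow C S S"
  shows "iso_arrow C f"
proof -
  have S': "S \<in> Obj C" using S by (simp add: simple_obj_def)
  note ff = homD[OF f(1)]
  obtain k where k: "is_kernel C k f" using kernel_exists ff by blast
  note kk = kernelD[OF k]
  have "\<not> iso_arrow C k"
  proof
    assume "iso_arrow C k"
    moreover have "f \<bullet> k = zero_arrow C S S \<bullet> k" using kk ff S' by simp
    ultimately show False
      using iso_cancel_right[of k f "zero_arrow C S S"] kk ff S' f(2) by simp
  qed
  then have z: "zero_obj C (Dom C k)"
    using S kernel_monic[OF k] kk ff unfolding simple_obj_def by auto
  have "monic C f"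
  proof (rule monicI)
    fix g h assume gh: "g \<in> Arr C" "h \<in> Arr C" "Cod C g = Dom C f" "Cod C h = Dom C f"
      "f \<bullet> g = f \<bullet> h" "Dom C g = Dom C h"
    let ?W = "Dom C g"
    have W: "?W \<in> Obj C" using gh Dom_Obj by blast
    have g: "g \<in> homset C ?W S" and h: "h \<in> homset C ?W S" using gh ff by (auto intro: homI)
    have "f \<bullet> (g \<ominus>\<^bsub>HomMod C ?W S\<^esub> h) = zero_arrow C ?W S"
      using Comp_additive_right(3)[OF f(1) W g h] gh(5) minus_self[OF Comp_hom[OF f(1) h]] by simp
    then obtain u where u: "u \<in> homset C ?W (Dom C k)" "k \<bullet> u = g \<ominus>\<^bsub>HomMod C ?W S\<^esub> h"
      using kernel_factor[OF k, of "g \<ominus>\<^bsub>HomMod C ?W S\<^esub> h" ?W] minus_hom[OF g h] ff by auto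
    have kO: "Dom C k \<in> Obj C" using kk Dom_Obj by blast
    have "u = zero_arrow C ?W (Dom C k)"
      using z u(1) zero_hom[OF W kO] W unfolding zero_obj_def by blast
    then have "g \<ominus>\<^bsub>HomMod C ?W S\<^esub> h = zero_arrow C ?W S"
      using u(2) kk ff W by auto
    then show "g = h" using minus_zero_iff[OF g h] by simp
  qed (use ff in simp)
  moreover have "\<not> zero_obj C S" using S by (simp add: simple_obj_def)
  ultimately show ?thesis using S ff unfolding simple_obj_def by metis
qed

end

section \<open>The comparison theorem for resolutions\<close>

definition resolves where
  "resolves C Y q \<longleftrightarrow> epic C (q 0) \<and> Cod C (q 0) = Y \<and> (\<forall>n::nat. exact_at C (q (Suc n)) (q n))"

text \<open>The target q may be any exact sequence over its end, so that \<open>lifts\<close> (q the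
  chosen resolution) and \<open>tensor_lifts\<close> (q the resolution of the unit tensored with an
  object) are both instances.\<close>

definition clift where
  "clift C d n q f = {\<phi>. (\<forall>i. \<phi> i \<in> homset C (Dom C (d (n + i))) (Dom C (q i))) \<and> q 0 \<bullet> \<phi> 0 = f \<and>
      (\<forall>i::nat. q (Suc i) \<bullet> \<phi> (Suc i) = \<phi> i \<bullet> d (Suc (n + i)))}"
  for C (structure)

definition cob where
  "cob C d n W = (case n of 0 \<Rightarrow> {zero_arrow C (Dom C (d 0)) W}
     | Suc m \<Rightarrow> (\<lambda>h. h \<bullet> d (Suc m)) ` homset C (Dom C (d m)) W)"
  for C (structure)

context linear_abelian_category
begin

lemma resolvesD:
  assumes "resolves C Y q"
  shows "q n \<in> Arr C" "Cod C (q 0) = Y" "Cod C (q (Suc n)) = Dom C (q n)"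
    "q n \<bullet> q (Suc n) = zero_arrow C (Dom C (q (Suc n))) (Cod C (q n))"
    "q n \<in> homset C (Dom C (q n)) (Cod C (q n))"
    "Y \<in> Obj C" "Dom C (q n) \<in> Obj C" "Cod C (q n) \<in> Obj C"
  using assms exact_atD[of "q (Suc n)" "q n"] Cod_Obj[of "q 0"] epic_Arr Dom_Obj Cod_Obj
  by (auto simp: resolves_def intro!: homI)

lemma cliftD:
  assumes "\<phi> \<in> clift C d n q f"
  shows "\<phi> i \<in> homset C (Dom C (d (n + i))) (Dom C (q i))" "q 0 \<bullet> \<phi> 0 = f"
    "q (Suc i) \<bullet> \<phi> (Suc i) = \<phi> i \<bullet> d (Suc (n + i))"
  using assms by (auto simp: clift_def)

context
  fixes X d
  assumes d: "resolves C X d" and proj: "\<And>n. projective_obj C (Dom C (d n))"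
begin

lemma clift_exists:
  assumes q: "resolves C Y q" and f: "f \<in> homset C (Dom C (d n)) Y"
    "f \<bullet> d (Suc n) = zero_arrow C (Dom C (d (Suc n))) Y"
  shows "\<exists>\<phi>. \<phi> \<in> clift C d n q f"
proof -
  \<comment> \<open>The last conjunct is the cycle condition that lets the next component be lifted
    through \<open>q (Suc i)\<close>; it is carried along because the choice at each stage sees only
    the component just built.\<close>
  let ?P = "\<lambda>i x. x \<in> homset C (Dom C (d (n + i))) (Dom C (q i)) \<and> (i = 0 \<longrightarrow> q 0 \<bullet> x = f) \<and>
     q i \<bullet> (x \<bullet> d (Suc (n + i))) = zero_arrow C (Dom C (d (Suc (n + i)))) (Cod C (q i))"
  note D = resolvesD[OF d] and Q = resolvesD[OF q]
  have "\<exists>\<phi>. \<forall>i. ?P i (\<phi> i) \<and> q (Suc i) \<bullet> \<phi> (Suc i) = \<phi> i \<bullet> d (Suc (n + i))"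
  proof (rule dependent_nat_choice)
    obtain x where x: "x \<in> homset C (Dom C (d n)) (Dom C (q 0))" "q 0 \<bullet> x = f"
      using projective_lift[OF proj[of n], of "q 0" f] q f unfolding resolves_def by auto
    have "q 0 \<bullet> (x \<bullet> d (Suc n)) = zero_arrow C (Dom C (d (Suc n))) (Cod C (q 0))"
      using Comp_reassoc[OF x(2), of "d (Suc n)"] f Q D homD[OF x(1)] by simp
    then show "\<exists>x. ?P 0 x" using x by auto
  next
    fix x i assume x: "?P i x"
    have m: "x \<bullet> d (Suc (n + i)) \<in> homset C (Dom C (d (Suc (n + i)))) (Dom C (q i))"
      using x D by (auto intro!: homI simp: homset_def)
    obtain y where y: "y \<in> homset C (Dom C (d (Suc (n + i)))) (Dom C (q (Suc i)))"
      "q (Suc i) \<bullet> y = x \<bullet> d (Suc (n + i))"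
      using exact_lift[OF _ proj m] x q unfolding resolves_def by blast
    have xx: "x \<in> Arr C" "Dom C x = Dom C (d (n + i))" "Cod C x = Dom C (q i)"
      using x by (auto simp: homset_def)
    have "q (Suc i) \<bullet> (y \<bullet> d (Suc (Suc (n + i)))) = (x \<bullet> d (Suc (n + i))) \<bullet> d (Suc (Suc (n + i)))"
      using Comp_reassoc[OF y(2), of "d (Suc (Suc (n + i)))"] homD[OF y(1)] Q D by simp
    also have "\<dots> = zero_arrow C (Dom C (d (Suc (Suc (n + i))))) (Cod C (q (Suc i)))"
      using xx D Q by simp
    finally show "\<exists>y. ?P (Suc i) y \<and> q (Suc i) \<bullet> y = x \<bullet> d (Suc (n + i))"
      using y by auto
  qed
  then obtain \<phi> where \<phi>: "\<And>i. ?P i (\<phi> i)" "\<And>i. q (Suc i) \<bullet> \<phi> (Suc i) = \<phi> i \<bullet> d (Suc (n + i))"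
    by blast
  have "\<phi> \<in> clift C d n q f" unfolding clift_def using \<phi>(1) \<phi>(1)[of 0] \<phi>(2) by blast
  then show ?thesis by blast
qed

text \<open>A lift of a coboundary is null-homotopic, and composing the homotopy formula with a
  cocycle leaves a coboundary.\<close>

lemma clift_null:
  assumes q: "resolves C Y q" and \<psi>: "\<psi> \<in> clift C d n q c" and c: "c \<in> cob C d n Y"
    and g: "g \<in> homset C (Dom C (q m)) W" "g \<bullet> q (Suc m) = zero_arrow C (Dom C (q (Suc m))) W"
  shows "g \<bullet> \<psi> m \<in> cob C d (n + m) W"
proof -
  note D = resolvesD[OF d] and Q = resolvesD[OF q] and \<Psi> = cliftD[OF \<psi>]
  have WO: "W \<in> Obj C" using hom_Obj g by blast
  \<comment> \<open>t plays the part of the homotopy term coming from degree -1: it lifts c through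
    the augmentation, vanishes on boundaries and is itself a coboundary. It is zero for n = 0; for c
    = \<open>h \<bullet> d (Suc k)\<close> it is \<open>s \<bullet> d (Suc k)\<close> with s lifting
    h.\<close>
  obtain t where t: "t \<in> homset C (Dom C (d n)) (Dom C (q 0))" "q 0 \<bullet> t = c"
    "t \<bullet> d (Suc n) = zero_arrow C (Dom C (d (Suc n))) (Dom C (q 0))" "t \<in> cob C d n (Dom C (q 0))"
  proof (cases n)
    case 0
    then show ?thesis
      using that[of "zero_arrow C (Dom C (d 0)) (Dom C (q 0))"] c D Q zero_hom[OF D(7) Q(7)]
      by (simp add: cob_def)
  next
    case (Suc k)
    then obtain h where h: "h \<in> homset C (Dom C (d k)) Y" "c = h \<bullet> d (Suc k)"
      using c by (auto simp: cob_def)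
    obtain s where s: "s \<in> homset C (Dom C (d k)) (Dom C (q 0))" "q 0 \<bullet> s = h"
      using projective_lift[OF proj[of k], of "q 0" h] q h unfolding resolves_def by auto
    have sd: "s \<bullet> d (Suc k) \<in> homset C (Dom C (d (Suc k))) (Dom C (q 0))"
      using homD[OF s(1)] D by (intro homI) simp_all
    note [simp] = homD[OF s(1)] D Q
    show ?thesis
      using that[of "s \<bullet> d (Suc k)"] s(1) sd Suc h Comp_reassoc[OF s(2), of "d (Suc k)"]
      by (simp add: cob_def)
  qed
  note tt = homD[OF t(1)]
  let ?H = "\<lambda>i. HomMod C (Dom C (d (n + i))) (Dom C (q i))"
  \<comment> \<open>s is the homotopy: \<open>q (Suc i) \<bullet> s i\<close> is
    \<open>\<psi> i\<close> minus the preceding term, which is t for i = 0 and the previous s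
    composed with the differential afterwards. The last conjunct again provides the cycle condition
    for the next choice.\<close>
  let ?P = "\<lambda>i s. s \<in> homset C (Dom C (d (n + i))) (Dom C (q (Suc i))) \<and>
     (i = 0 \<longrightarrow> q 1 \<bullet> s = \<psi> 0 \<ominus>\<^bsub>?H 0\<^esub> t) \<and>
     q (Suc i) \<bullet> (s \<bullet> d (Suc (n + i))) = \<psi> i \<bullet> d (Suc (n + i))"
  let ?Q = "\<lambda>i s s'. q (Suc (Suc i)) \<bullet> s' = \<psi> (Suc i) \<ominus>\<^bsub>?H (Suc i)\<^esub> s \<bullet> d (Suc (n + i))"
  have "\<exists>s. \<forall>i. ?P i (s i) \<and> ?Q i (s i) (s (Suc i))"
  proof (rule dependent_nat_choice)
    have \<psi>0: "\<psi> 0 \<in> homset C (Dom C (d n)) (Dom C (q 0))" using \<Psi>(1)[of 0] by simp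
    have cc: "c \<in> homset C (Dom C (d n)) Y" using Comp_hom[OF Q(5)[of 0] \<psi>0] \<Psi>(2) Q(2) by simp
    have m: "\<psi> 0 \<ominus>\<^bsub>?H 0\<^esub> t \<in> homset C (Dom C (d n)) (Dom C (q 0))"
      using minus_hom[OF \<psi>0 t(1)] by simp
    have "q 0 \<bullet> (\<psi> 0 \<ominus>\<^bsub>?H 0\<^esub> t) = zero_arrow C (Dom C (d n)) (Cod C (q 0))"
      using Comp_additive_right(3)[OF Q(5)[of 0] D(7) \<psi>0 t(1)] \<Psi>(2) t(2) Q(2) minus_self[OF cc]
      by simp
    then obtain s where s: "s \<in> homset C (Dom C (d n)) (Dom C (q 1))" "q 1 \<bullet> s = \<psi> 0 \<ominus>\<^bsub>?H 0\<^esub> t"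
      using exact_lift[OF _ proj m] q unfolding resolves_def by force
    have p: "\<psi> 0 \<bullet> d (Suc n) \<in> homset C (Dom C (d (Suc n))) (Dom C (q 0))"
      using Comp_hom[OF \<psi>0, of "d (Suc n)"] D by (simp add: homset_def)
    have dn: "d (Suc n) \<in> homset C (Dom C (d (Suc n))) (Dom C (d n))" using D by (auto intro!: homI)
    have "q 1 \<bullet> (s \<bullet> d (Suc n)) = (\<psi> 0 \<ominus>\<^bsub>?H 0\<^esub> t) \<bullet> d (Suc n)"
      using Comp_reassoc[OF s(2), of "d (Suc n)"] homD[OF s(1)] D Q by simp
    also have "\<dots> = \<psi> 0 \<bullet> d (Suc n)"
      using Comp_additive_left(3)[OF dn Q(7) \<psi>0 t(1)] t(3) minus_zero[OF p] by simp
    finally show "\<exists>s. ?P 0 s" using s by auto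
  next
    fix s i assume s: "?P i s"
    then have sh: "s \<in> homset C (Dom C (d (n + i))) (Dom C (q (Suc i)))" by blast
    have ds: "d (Suc (n + i)) \<in> homset C (Dom C (d (Suc (n + i)))) (Dom C (d (n + i)))"
      and dss: "d (Suc (Suc (n + i))) \<in> homset C (Dom C (d (Suc (Suc (n + i))))) (Dom C (d (Suc (n + i))))"
      using D by (auto intro!: homI)
    have \<psi>s: "\<psi> (Suc i) \<in> homset C (Dom C (d (Suc (n + i)))) (Dom C (q (Suc i)))"
      using \<Psi>(1)[of "Suc i"] by simp
    note sd = Comp_hom[OF sh ds]
    note m = minus_hom[OF \<psi>s sd]
    have pi: "\<psi> i \<bullet> d (Suc (n + i)) \<in> homset C (Dom C (d (Suc (n + i)))) (Dom C (q i))"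
      using Comp_hom[OF \<Psi>(1) ds] .
    have "q (Suc i) \<bullet> (\<psi> (Suc i) \<ominus>\<^bsub>?H (Suc i)\<^esub> s \<bullet> d (Suc (n + i))) =
        zero_arrow C (Dom C (d (Suc (n + i)))) (Cod C (q (Suc i)))"
      using Comp_additive_right(3)[OF Q(5) D(7) \<psi>s sd] \<Psi>(3)[of i] s minus_self[OF pi] Q(3) by simp
    then obtain s' where s': "s' \<in> homset C (Dom C (d (Suc (n + i)))) (Dom C (q (Suc (Suc i))))"
      "q (Suc (Suc i)) \<bullet> s' = \<psi> (Suc i) \<ominus>\<^bsub>?H (Suc i)\<^esub> s \<bullet> d (Suc (n + i))"
      using exact_lift[OF _ proj m] q unfolding resolves_def by force
    have p: "\<psi> (Suc i) \<bullet> d (Suc (Suc (n + i))) \<in> homset C (Dom C (d (Suc (Suc (n + i))))) (Dom C (q (Suc i)))"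
      using Comp_hom[OF \<psi>s dss] .
    have z: "(s \<bullet> d (Suc (n + i))) \<bullet> d (Suc (Suc (n + i))) =
       zero_arrow C (Dom C (d (Suc (Suc (n + i))))) (Dom C (q (Suc i)))"
      using homD[OF sh] D Q by simp
    have "q (Suc (Suc i)) \<bullet> (s' \<bullet> d (Suc (Suc (n + i)))) =
       (\<psi> (Suc i) \<ominus>\<^bsub>?H (Suc i)\<^esub> s \<bullet> d (Suc (n + i))) \<bullet> d (Suc (Suc (n + i)))"
      using Comp_reassoc[OF s'(2), of "d (Suc (Suc (n + i)))"] homD[OF s'(1)] D Q by simp
    also have "\<dots> = \<psi> (Suc i) \<bullet> d (Suc (Suc (n + i)))"
      using Comp_additive_left(3)[OF dss Q(7) \<psi>s sd] z minus_zero[OF p] by simp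
    finally show "\<exists>y. ?P (Suc i) y \<and> ?Q i s y"
      using s' by (intro exI[of _ s']) simp
  qed
  then obtain s where s: "\<And>i. ?P i (s i)" "\<And>i. ?Q i (s i) (s (Suc i))" by blast
  \<comment> \<open>The cocycle g kills \<open>q (Suc m) \<bullet> s m\<close>, so after composing
    with g only the preceding homotopy term u survives.\<close>
  have key: "g \<bullet> \<psi> m = g \<bullet> u"
    if u: "u \<in> homset C (Dom C (d (n + m))) (Dom C (q m))" and eq: "q (Suc m) \<bullet> s m = \<psi> m \<ominus>\<^bsub>?H m\<^esub> u" for u
  proof -
    have sm: "s m \<in> homset C (Dom C (d (n + m))) (Dom C (q (Suc m)))" using s by blast
    have "g \<bullet> (q (Suc m) \<bullet> s m) = zero_arrow C (Dom C (d (n + m))) W"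
      using Comp_reassoc[OF g(2), of "s m"] homD[OF g(1)] homD[OF sm] Q WO by simp
    then have "g \<bullet> \<psi> m \<ominus>\<^bsub>HomMod C (Dom C (d (n + m))) W\<^esub> g \<bullet> u = zero_arrow C (Dom C (d (n + m))) W"
      using eq Comp_additive_right(3)[OF g(1) D(7) \<Psi>(1) u] by simp
    then show ?thesis
      using minus_zero_iff[OF Comp_hom[OF g(1) \<Psi>(1)] Comp_hom[OF g(1) u]] by simp
  qed
  show ?thesis
  proof (cases m)
    case 0
    then have eq: "g \<bullet> \<psi> m = g \<bullet> t" using key[of t] t(1) s(1)[of 0] by simp
    show ?thesis
    proof (cases n)
      case 0
      then show ?thesis using eq \<open>m = 0\<close> t(4) homD[OF g(1)] D by (simp add: cob_def)
    next
      case (Suc k)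
      then obtain h where h: "h \<in> homset C (Dom C (d k)) (Dom C (q 0))" "t = h \<bullet> d (Suc k)"
        using t(4) by (auto simp: cob_def)
      have "g \<bullet> t = (g \<bullet> h) \<bullet> d (Suc k)"
        using h homD[OF g(1)] homD[OF h(1)] D \<open>m = 0\<close> by simp
      moreover have "g \<bullet> h \<in> homset C (Dom C (d k)) W" using Comp_hom g(1) h(1) \<open>m = 0\<close> by blast
      ultimately show ?thesis using eq Suc \<open>m = 0\<close> by (auto simp: cob_def)
    qed
  next
    case (Suc j)
    have sj: "s j \<in> homset C (Dom C (d (n + j))) (Dom C (q m))" using s(1)[of j] Suc by simp
    have dj: "d (Suc (n + j)) \<in> homset C (Dom C (d (n + m))) (Dom C (d (n + j)))"
      using D Suc by (auto intro!: homI)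
    have "g \<bullet> \<psi> m = g \<bullet> (s j \<bullet> d (Suc (n + j)))"
      using key[OF Comp_hom[OF sj dj]] s(2)[of j] Suc by simp
    also have "\<dots> = (g \<bullet> s j) \<bullet> d (Suc (n + j))"
      using homD[OF g(1)] homD[OF sj] D by simp
    finally show ?thesis
      using Suc Comp_hom[OF g(1) sj] by (auto simp: cob_def)
  qed
qed

text \<open>The difference of two lifts lifts the difference of the cocycles, so
  \<open>clift_null\<close> gives independence of the lift and of the representative at the same
  time.\<close>

lemma clift_unique:
  assumes q: "resolves C Y q" and \<phi>: "\<phi> \<in> clift C d n q f" "\<phi>' \<in> clift C d n q f'"
    and c: "f \<ominus>\<^bsub>HomMod C (Dom C (d n)) Y\<^esub> f' \<in> cob C d n Y"
    and g: "g \<in> homset C (Dom C (q m)) W" "g \<bullet> q (Suc m) = zero_arrow C (Dom C (q (Suc m))) W"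
  shows "g \<bullet> \<phi> m \<ominus>\<^bsub>HomMod C (Dom C (d (n + m))) W\<^esub> g \<bullet> \<phi>' m \<in> cob C d (n + m) W"
proof -
  note D = resolvesD[OF d] and Q = resolvesD[OF q] and \<Phi> = cliftD[OF \<phi>(1)] and \<Phi>' = cliftD[OF \<phi>(2)]
  define \<psi> where "\<psi> i = \<phi> i \<ominus>\<^bsub>HomMod C (Dom C (d (n + i))) (Dom C (q i))\<^esub> \<phi>' i" for i
  have "\<psi> \<in> clift C d n q (f \<ominus>\<^bsub>HomMod C (Dom C (d n)) Y\<^esub> f')"
    unfolding clift_def
  proof (intro CollectI conjI allI)
    show "\<psi> i \<in> homset C (Dom C (d (n + i))) (Dom C (q i))" for i
      unfolding \<psi>_def using minus_hom[OF \<Phi>(1) \<Phi>'(1)] .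
    show "q 0 \<bullet> \<psi> 0 = f \<ominus>\<^bsub>HomMod C (Dom C (d n)) Y\<^esub> f'"
      unfolding \<psi>_def using Comp_additive_right(3)[OF Q(5) D(7) \<Phi>(1)[of 0] \<Phi>'(1)[of 0]] \<Phi>(2) \<Phi>'(2) Q(2)
      by simp
    fix i
    have ds: "d (Suc (n + i)) \<in> homset C (Dom C (d (Suc (n + i)))) (Dom C (d (n + i)))"
      using D by (auto intro!: homI)
    show "q (Suc i) \<bullet> \<psi> (Suc i) = \<psi> i \<bullet> d (Suc (n + i))"
      unfolding \<psi>_def
      using Comp_additive_right(3)[OF Q(5) D(7) \<Phi>(1)[of "Suc i"] \<Phi>'(1)[of "Suc i"]]
       Comp_additive_left(3)[OF ds Q(7) \<Phi>(1)[of i] \<Phi>'(1)[of i]] \<Phi>(3)[of i] \<Phi>'(3)[of i] Q(3)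
      by simp
  qed
  from clift_null[OF q this c g] show ?thesis
    unfolding \<psi>_def using Comp_additive_right(3)[OF g(1) D(7) \<Phi>(1) \<Phi>'(1)] by simp
qed

end

end

section \<open>Exactness of the tensor product\<close>

context finite_tensor_category
begin

lemma Tensor_zero [simp]:
  assumes "X \<in> Obj C" "Y \<in> Obj C" "f \<in> Arr C"
  shows "zero_arrow C X Y \<star> f = zero_arrow C (X \<boxtimes> Dom C f) (Y \<boxtimes> Cod C f)"
    and "f \<star> zero_arrow C X Y = zero_arrow C (Dom C f \<boxtimes> X) (Cod C f \<boxtimes> Y)"
proof -
  have f: "f \<in> homset C (Dom C f) (Cod C f)" and O: "Dom C f \<in> Obj C" "Cod C f \<in> Obj C"
    using assms Dom_Obj Cod_Obj by (auto intro: homI)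
  show "zero_arrow C X Y \<star> f = zero_arrow C (X \<boxtimes> Dom C f) (Y \<boxtimes> Cod C f)"
    using additive_map(1)[of "HomMod C X Y" "HomMod C (X \<boxtimes> Dom C f) (Y \<boxtimes> Cod C f)" "\<lambda>g. g \<star> f"]
      assms O hom_group HomMod_carrier TensorA_hom[OF _ f] TensorA_add_left[OF _ _ f] by simp
  show "f \<star> zero_arrow C X Y = zero_arrow C (Dom C f \<boxtimes> X) (Cod C f \<boxtimes> Y)"
    using additive_map(1)[of "HomMod C X Y" "HomMod C (Dom C f \<boxtimes> X) (Cod C f \<boxtimes> Y)" "\<lambda>g. f \<star> g"]
      assms O hom_group HomMod_carrier TensorA_hom[OF f] TensorA_add_right[OF f] by simp
qed

lemma tensor_epic': "\<lbrakk>epic C e; X \<in> Obj C\<rbrakk> \<Longrightarrow> epic C (e \<star> Ide C X)"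
  using tensor_epic left_dual_exists by blast

lemma left_tensor_epic': "\<lbrakk>epic C e; X \<in> Obj C\<rbrakk> \<Longrightarrow> epic C (Ide C X \<star> e)"
  using left_tensor_epic right_dual_exists by blast

lemma dual_Obj: "is_left_dual C D X \<Longrightarrow> D \<in> Obj C" "is_left_dual C D X \<Longrightarrow> X \<in> Obj C"
  by (auto simp: is_left_dual_def)

lemma tensor_projective': "\<lbrakk>projective_obj C P; X \<in> Obj C\<rbrakk> \<Longrightarrow> projective_obj C (P \<boxtimes> X)"
  using tensor_projective left_dual_exists dual_Obj by metis

lemma left_tensor_projective': "\<lbrakk>projective_obj C P; X \<in> Obj C\<rbrakk> \<Longrightarrow> projective_obj C (X \<boxtimes> P)"
  using left_tensor_projective right_dual_exists dual_Obj by metis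

text \<open>Every D is a left dual of some X, so - \<otimes> D is a right adjoint and preserves
  kernels: an arrow into \<open>Dom C f \<boxtimes> D\<close> is transposed, factored through k and
  transposed back.\<close>

lemma tensor_kernel:
  assumes k: "is_kernel C k f" and D: "D \<in> Obj C"
  shows "is_kernel C (k \<star> Ide C D) (f \<star> Ide C D)"
proof -
  obtain X where dual: "is_left_dual C D X" using right_dual_exists[OF D] by blast
  have X: "X \<in> Obj C" using dual dual_Obj by blast
  note kk = kernelD[OF k]
  have O: "Dom C k \<in> Obj C" "Dom C f \<in> Obj C" "Cod C f \<in> Obj C" using kk Dom_Obj Cod_Obj by auto
  show ?thesis
  proof (rule dual_adjunction[OF dual])
    fix \<eta> \<epsilon>
    assume \<eta>: "\<And>W. W \<in> Obj C \<Longrightarrow> \<eta> W \<in> homset C W ((W \<boxtimes> X) \<boxtimes> D)"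
      and \<epsilon>: "\<And>B. B \<in> Obj C \<Longrightarrow> \<epsilon> B \<in> homset C ((B \<boxtimes> D) \<boxtimes> X) B"
      and n\<eta>: "\<And>g W W'. g \<in> homset C W W' \<Longrightarrow> ((g \<star> Ide C X) \<star> Ide C D) \<bullet> \<eta> W = \<eta> W' \<bullet> g"
      and n\<epsilon>: "\<And>g B B'. g \<in> homset C B B' \<Longrightarrow> \<epsilon> B' \<bullet> ((g \<star> Ide C D) \<star> Ide C X) = g \<bullet> \<epsilon> B"
      and t: "\<And>B. B \<in> Obj C \<Longrightarrow> (\<epsilon> B \<star> Ide C D) \<bullet> \<eta> (B \<boxtimes> D) = Ide C (B \<boxtimes> D)"
    note [simp] = homD[OF \<eta>] homD[OF \<epsilon>] X D O kk(1,2)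
    \<comment> \<open>Transposing twice returns u, by the triangle identity
      \<open>t\<close>.\<close>
    have flat: "u = (\<epsilon> B \<star> Ide C D) \<bullet> (((u \<star> Ide C X) \<star> Ide C D) \<bullet> \<eta> W)"
      if u: "u \<in> homset C W (B \<boxtimes> D)" and B: "B \<in> Obj C" for u W B
    proof -
      note [simp] = homD[OF u] B hom_Obj(1)[OF u]
      show ?thesis
        using Comp_reassoc[OF t[OF B], of u] by (simp add: n\<eta>[OF u])
    qed
    have mon: "u = v"
      if uv: "u \<in> homset C W (Dom C k \<boxtimes> D)" "v \<in> homset C W (Dom C k \<boxtimes> D)"
        "(k \<star> Ide C D) \<bullet> u = (k \<star> Ide C D) \<bullet> v" for u v W
    proof -
      have h: "k \<bullet> (\<epsilon> (Dom C k) \<bullet> (w \<star> Ide C X)) = \<epsilon> (Cod C k) \<bullet> (((k \<star> Ide C D) \<bullet> w) \<star> Ide C X)"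
        if w: "w \<in> homset C W (Dom C k \<boxtimes> D)" for w
      proof -
        note [simp] = homD[OF w] hom_Obj(1)[OF w]
        have [simp]: "Cod C k \<in> Obj C" using kk by simp
        have nk: "\<epsilon> (Cod C k) \<bullet> ((k \<star> Ide C D) \<star> Ide C X) = k \<bullet> \<epsilon> (Dom C k)"
          by (rule n\<epsilon>) (simp add: homset_def)
        have "\<epsilon> (Cod C k) \<bullet> (((k \<star> Ide C D) \<bullet> w) \<star> Ide C X) =
           (\<epsilon> (Cod C k) \<bullet> ((k \<star> Ide C D) \<star> Ide C X)) \<bullet> (w \<star> Ide C X)"
          by (simp add: Tensor_Comp_Ide)
        then show ?thesis unfolding nk by simp
      qed
      note [simp] = homD[OF uv(1)] homD[OF uv(2)] hom_Obj(1)[OF uv(1)]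
      have "k \<bullet> (\<epsilon> (Dom C k) \<bullet> (u \<star> Ide C X)) = k \<bullet> (\<epsilon> (Dom C k) \<bullet> (v \<star> Ide C X))"
        using h[OF uv(1)] h[OF uv(2)] uv(3) by simp
      then have eq: "\<epsilon> (Dom C k) \<bullet> (u \<star> Ide C X) = \<epsilon> (Dom C k) \<bullet> (v \<star> Ide C X)"
        by (rule monicD[OF kernel_monic[OF k], rotated -1]) simp_all
      have "u = ((\<epsilon> (Dom C k) \<bullet> (u \<star> Ide C X)) \<star> Ide C D) \<bullet> \<eta> W"
        using flat[OF uv(1)] by (simp add: Tensor_Comp_Ide)
      also have "\<dots> = v"
        unfolding eq using flat[OF uv(2)] by (simp add: Tensor_Comp_Ide)
      finally show ?thesis .
    qed
    show ?thesis
      unfolding is_kernel_def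
    proof (intro conjI ballI allI impI)
      show "(f \<star> Ide C D) \<bullet> (k \<star> Ide C D) = zero_arrow C (Dom C (k \<star> Ide C D)) (Cod C (f \<star> Ide C D))"
        using kk by (simp add: interchange)
      fix W g assume g: "g \<in> homset C W (Dom C (f \<star> Ide C D))"
        "(f \<star> Ide C D) \<bullet> g = zero_arrow C W (Cod C (f \<star> Ide C D))"
      note [simp] = homD[OF g(1)] hom_Obj(1)[OF g(1)]
      have g1: "g \<in> homset C W (Dom C f \<boxtimes> D)" using g(1) by simp
      let ?g = "\<epsilon> (Dom C f) \<bullet> (g \<star> Ide C X)"
      have "f \<bullet> ?g = (f \<bullet> \<epsilon> (Dom C f)) \<bullet> (g \<star> Ide C X)" by simp
      also have "\<dots> = (\<epsilon> (Cod C f) \<bullet> ((f \<star> Ide C D) \<star> Ide C X)) \<bullet> (g \<star> Ide C X)"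
        using n\<epsilon>[of f "Dom C f" "Cod C f"] by (simp add: homset_def)
      also have "\<dots> = \<epsilon> (Cod C f) \<bullet> (((f \<star> Ide C D) \<bullet> g) \<star> Ide C X)"
        by (simp add: Tensor_Comp_Ide)
      also have "\<dots> = zero_arrow C (W \<boxtimes> X) (Cod C f)"
        unfolding g(2) by simp
      finally have z: "f \<bullet> ?g = zero_arrow C (W \<boxtimes> X) (Cod C f)" .
      have gh: "?g \<in> homset C (W \<boxtimes> X) (Dom C f)" by (intro homI) simp_all
      obtain u where u: "u \<in> homset C (W \<boxtimes> X) (Dom C k)" "k \<bullet> u = ?g"
        using kernel_factor[OF k gh z] .
      note [simp] = homD[OF u(1)]
      let ?v = "(u \<star> Ide C D) \<bullet> \<eta> W"
      have v: "?v \<in> homset C W (Dom C k \<boxtimes> D)" by (intro homI) simp_all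
      have "(k \<star> Ide C D) \<bullet> ?v = ((k \<bullet> u) \<star> Ide C D) \<bullet> \<eta> W"
        using kk by (simp add: Tensor_Comp_Ide)
      also have "\<dots> = g"
        unfolding u(2) using flat[OF g1] by (simp add: Tensor_Comp_Ide)
      finally have v2: "(k \<star> Ide C D) \<bullet> ?v = g" .
      show "\<exists>!u. u \<in> homset C W (Dom C (k \<star> Ide C D)) \<and> (k \<star> Ide C D) \<bullet> u = g"
        using v v2 mon by (intro ex1I[of _ ?v]) auto
    qed (use kk in auto)
  qed
qed

lemma tensor_exact:
  assumes "exact_at C f g" "X \<in> Obj C"
  shows "exact_at C (f \<star> Ide C X) (g \<star> Ide C X)"
proof -
  obtain e k where ek: "epic C e" "is_kernel C k g" "Cod C e = Dom C k" "f = k \<bullet> e"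
    using assms(1) unfolding exact_at_def by blast
  then have "f \<star> Ide C X = (k \<star> Ide C X) \<bullet> (e \<star> Ide C X)"
    using Tensor_Comp_Ide kernelD epic_Arr assms by simp
  then show ?thesis
    unfolding exact_at_def
    using tensor_epic'[OF ek(1) assms(2)] tensor_kernel[OF ek(2) assms(2)] ek(3)
      kernelD[OF ek(2)] epic_Arr[OF ek(1)] assms(2)
    by (intro exI[of _ "e \<star> Ide C X"] exI[of _ "k \<star> Ide C X"]) simp
qed

lemma kernel_iso:
  assumes k: "is_kernel C k f" and l: "iso_arrow C l" "Dom C l = Cod C f"
  shows "is_kernel C k (l \<bullet> f)"
proof -
  note kk = kernelD[OF k] and ll = iso_arrowD[OF l(1)]
  show ?thesis
    unfolding is_kernel_def
  proof (intro conjI ballI allI impI)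
    show "(l \<bullet> f) \<bullet> k = zero_arrow C (Dom C k) (Cod C (l \<bullet> f))"
      using kk ll l Dom_Obj by simp
    fix W g assume g: "g \<in> homset C W (Dom C (l \<bullet> f))" "(l \<bullet> f) \<bullet> g = zero_arrow C W (Cod C (l \<bullet> f))"
    have W: "W \<in> Obj C" using hom_Obj(1)[OF g(1)] .
    have g1: "g \<in> homset C W (Dom C f)" using g(1) kk ll l by simp
    have "l \<bullet> (f \<bullet> g) = l \<bullet> zero_arrow C W (Cod C f)"
      using g(2) homD[OF g1] kk ll l W Cod_Obj by simp
    then have "f \<bullet> g = zero_arrow C W (Cod C f)"
      by (rule iso_cancel_left[OF l(1), rotated -1]) (use homD[OF g1] kk ll l W Cod_Obj in simp_all)
    then show "\<exists>!u. u \<in> homset C W (Dom C k) \<and> k \<bullet> u = g"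
      using k g1 unfolding is_kernel_def by blast
  qed (use kk ll l in auto)
qed

text \<open>Lets the left unit isomorphism be composed onto the augmentation of a tensored
  resolution.\<close>

lemma exact_iso:
  assumes "exact_at C f g" "iso_arrow C l" "Dom C l = Cod C g"
  shows "exact_at C f (l \<bullet> g)"
  using assms kernel_iso unfolding exact_at_def by metis

text \<open>Arrows into B \<otimes> D correspond to arrows from - \<otimes> P to B. For a monic i
  with cokernel q, the target of \<open>q \<star> Ide C P\<close> is projective, so tensoring with P
  splits the sequence, and the transposed arrow extends along a retraction of
  \<open>i \<star> Ide C P\<close>.\<close>

lemma injective_tensor_dual:
  assumes dual: "is_left_dual C D P" and P: "projective_obj C P" and B: "B \<in> Obj C"
  shows "injective_obj C (B \<boxtimes> D)"
proof (rule dual_adjunction[OF dual])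
  fix \<eta> \<epsilon>
  assume \<eta>: "\<And>W. W \<in> Obj C \<Longrightarrow> \<eta> W \<in> homset C W ((W \<boxtimes> P) \<boxtimes> D)"
    and \<epsilon>: "\<And>B. B \<in> Obj C \<Longrightarrow> \<epsilon> B \<in> homset C ((B \<boxtimes> D) \<boxtimes> P) B"
    and n\<eta>: "\<And>g W W'. g \<in> homset C W W' \<Longrightarrow> ((g \<star> Ide C P) \<star> Ide C D) \<bullet> \<eta> W = \<eta> W' \<bullet> g"
    and t: "\<And>B. B \<in> Obj C \<Longrightarrow> (\<epsilon> B \<star> Ide C D) \<bullet> \<eta> (B \<boxtimes> D) = Ide C (B \<boxtimes> D)"
  have O: "P \<in> Obj C" "D \<in> Obj C" using dual_Obj dual by auto
  note [simp] = homD[OF \<eta>] homD[OF \<epsilon>] B O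
  show ?thesis unfolding injective_obj_def
  proof (intro conjI allI impI)
    fix i f assume "monic C i \<and> f \<in> homset C (Dom C i) (B \<boxtimes> D)"
    then have i: "monic C i" and f: "f \<in> homset C (Dom C i) (B \<boxtimes> D)" by auto
    have [simp]: "i \<in> Arr C" "Dom C i \<in> Obj C" "Cod C i \<in> Obj C"
      using i monic_Arr Dom_Obj Cod_Obj by auto
    obtain q where q: "is_cokernel C q i" using cokernel_exists \<open>i \<in> Arr C\<close> by blast
    note qq = cokernelD[OF q]
    have Q[simp]: "q \<in> Arr C" "Dom C q = Cod C i" "Cod C q \<in> Obj C" using qq Cod_Obj by auto
    note [simp] = homD[OF f]
    have ki: "is_kernel C (i \<star> Ide C P) (q \<star> Ide C P)"
      by (rule tensor_kernel[OF monic_kernel_of_cokernel[OF i q]]) simp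
    obtain s where s: "s \<in> homset C (Cod C q \<boxtimes> P) (Cod C i \<boxtimes> P)"
      "(q \<star> Ide C P) \<bullet> s = Ide C (Cod C q \<boxtimes> P)"
      using projective_lift[OF left_tensor_projective'[OF P], of "Cod C q" "q \<star> Ide C P" "Ide C (Cod C q \<boxtimes> P)"]
        tensor_epic'[OF cokernel_epic[OF q], of P] Ide_hom[of "Cod C q \<boxtimes> P"] by auto
    note [simp] = homD[OF s(1)]
    let ?M = "Cod C i \<boxtimes> P" let ?q = "q \<star> Ide C P"
    have id: "Ide C ?M \<in> homset C ?M ?M" and sq: "s \<bullet> ?q \<in> homset C ?M ?M"
      and qh: "?q \<in> homset C ?M (Cod C q \<boxtimes> P)"
      by (auto intro!: homI)
    \<comment> \<open>The endomorphism 1 - sq is killed by \<open>q \<star> Ide C P\<close>, so it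
      factors through the kernel; the factor r is the retraction.\<close>
    let ?w = "Ide C ?M \<ominus>\<^bsub>HomMod C ?M ?M\<^esub> s \<bullet> ?q"
    have "?q \<bullet> ?w = ?q \<ominus>\<^bsub>HomMod C ?M (Cod C q \<boxtimes> P)\<^esub> ?q"
      using Comp_additive_right(3)[OF qh _ id sq] Comp_reassoc[OF s(2), of ?q] by simp
    then have "?q \<bullet> ?w = zero_arrow C ?M (Cod C q \<boxtimes> P)" using minus_self[OF qh] by simp
    then obtain r where r: "r \<in> homset C ?M (Dom C i \<boxtimes> P)" "(i \<star> Ide C P) \<bullet> r = ?w"
      using kernel_factor[OF ki, of ?w ?M] minus_hom[OF id sq] by auto
    note [simp] = homD[OF r(1)]
    have ih: "i \<star> Ide C P \<in> homset C (Dom C i \<boxtimes> P) ?M" by (intro homI) simp_all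
    have "(i \<star> Ide C P) \<bullet> (r \<bullet> (i \<star> Ide C P)) = ?w \<bullet> (i \<star> Ide C P)"
      using Comp_reassoc[OF r(2), of "i \<star> Ide C P"] by simp
    also have "\<dots> = (i \<star> Ide C P) \<ominus>\<^bsub>HomMod C (Dom C i \<boxtimes> P) ?M\<^esub> zero_arrow C (Dom C i \<boxtimes> P) ?M"
      using Comp_additive_left(3)[OF ih _ id sq] qq by (simp add: interchange)
    also have "\<dots> = (i \<star> Ide C P) \<bullet> Ide C (Dom C i \<boxtimes> P)"
      using minus_zero[OF ih] by simp
    finally have ri: "r \<bullet> (i \<star> Ide C P) = Ide C (Dom C i \<boxtimes> P)"
      by (rule monicD[OF kernel_monic[OF ki], rotated -1]) simp_all
    let ?f = "\<epsilon> B \<bullet> (f \<star> Ide C P)"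
    let ?g = "((?f \<bullet> r) \<star> Ide C D) \<bullet> \<eta> (Cod C i)"
    have "?g \<bullet> i = ((?f \<bullet> r) \<star> Ide C D) \<bullet> (((i \<star> Ide C P) \<star> Ide C D) \<bullet> \<eta> (Dom C i))"
      using n\<eta>[of i "Dom C i" "Cod C i"] by (simp add: homset_def)
    also have "\<dots> = ((?f \<bullet> (r \<bullet> (i \<star> Ide C P))) \<star> Ide C D) \<bullet> \<eta> (Dom C i)"
      by (simp add: Tensor_Comp_Ide)
    also have "\<dots> = (\<epsilon> B \<star> Ide C D) \<bullet> (((f \<star> Ide C P) \<star> Ide C D) \<bullet> \<eta> (Dom C i))"
      unfolding ri by (simp add: Tensor_Comp_Ide)
    also have "\<dots> = ((\<epsilon> B \<star> Ide C D) \<bullet> \<eta> (B \<boxtimes> D)) \<bullet> f"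
      using n\<eta>[OF f] by simp
    also have "\<dots> = f" by (simp add: t)
    finally show "\<exists>g\<in>homset C (Cod C i) (B \<boxtimes> D). g \<bullet> i = f"
      by (intro bexI[of _ ?g] homI) simp_all
  qed simp
qed

text \<open>The embedding is the adjunction unit. By the triangle identity, arrows that it
  identifies agree after tensoring with P; and tensoring with P is faithful because P maps onto the
  unit.\<close>

lemma embed_projective_injective:
  assumes Y: "Y \<in> Obj C"
  obtains J \<iota> where "projective_obj C J" "injective_obj C J" "\<iota> \<in> homset C Y J" "monic C \<iota>"
proof -
  obtain \<pi> where \<pi>: "epic C \<pi>" "Cod C \<pi> = I" "projective_obj C (Dom C \<pi>)"
    using enough_projectives UnitO_Obj unfolding enough_projectives_def by blast
  let ?P = "Dom C \<pi>"
  have P[simp]: "?P \<in> Obj C" "\<pi> \<in> Arr C" using \<pi> epic_Arr Dom_Obj by auto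
  obtain D where dual: "is_left_dual C D ?P" using left_dual_exists P by blast
  have D[simp]: "D \<in> Obj C" using dual dual_Obj by blast
  show thesis
  proof (rule dual_adjunction[OF dual])
    fix \<eta> \<epsilon>
    assume \<eta>: "\<And>W. W \<in> Obj C \<Longrightarrow> \<eta> W \<in> homset C W ((W \<boxtimes> ?P) \<boxtimes> D)"
      and \<epsilon>: "\<And>B. B \<in> Obj C \<Longrightarrow> \<epsilon> B \<in> homset C ((B \<boxtimes> D) \<boxtimes> ?P) B"
      and n\<eta>: "\<And>g W W'. g \<in> homset C W W' \<Longrightarrow> ((g \<star> Ide C ?P) \<star> Ide C D) \<bullet> \<eta> W = \<eta> W' \<bullet> g"
      and n\<epsilon>: "\<And>g B B'. g \<in> homset C B B' \<Longrightarrow> \<epsilon> B' \<bullet> ((g \<star> Ide C D) \<star> Ide C ?P) = g \<bullet> \<epsilon> B"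
      and t: "\<And>W. W \<in> Obj C \<Longrightarrow> \<epsilon> (W \<boxtimes> ?P) \<bullet> (\<eta> W \<star> Ide C ?P) = Ide C (W \<boxtimes> ?P)"
    note [simp] = homD[OF \<eta>] homD[OF \<epsilon>] Y
    have "monic C (\<eta> Y)"
    proof (rule monicI)
      fix g h assume gh: "g \<in> Arr C" "h \<in> Arr C" "Cod C g = Dom C (\<eta> Y)" "Cod C h = Dom C (\<eta> Y)"
        "\<eta> Y \<bullet> g = \<eta> Y \<bullet> h" "Dom C g = Dom C h"
      let ?W = "Dom C g"
      have [simp]: "?W \<in> Obj C" using gh Dom_Obj by blast
      have fl: "u \<star> Ide C ?P = \<epsilon> (Y \<boxtimes> ?P) \<bullet> ((\<eta> Y \<bullet> u) \<star> Ide C ?P)" if u: "u \<in> homset C ?W Y" for u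
      proof -
        note [simp] = homD[OF u]
        have "\<epsilon> (Y \<boxtimes> ?P) \<bullet> ((\<eta> Y \<bullet> u) \<star> Ide C ?P) = (\<epsilon> (Y \<boxtimes> ?P) \<bullet> (\<eta> Y \<star> Ide C ?P)) \<bullet> (u \<star> Ide C ?P)"
          by (simp add: Tensor_Comp_Ide)
        then show ?thesis by (simp add: t)
      qed
      have g: "g \<in> homset C ?W Y" and h: "h \<in> homset C ?W Y" using gh by (auto intro: homI)
      have eq: "g \<star> Ide C ?P = h \<star> Ide C ?P" using fl[OF g] fl[OF h] gh(5) by metis
      \<comment> \<open>Sliding u past \<pi> turns equality after tensoring with P into equality
        after tensoring with the unit, since \<open>Ide C ?W \<star> \<pi>\<close> is epic.\<close>
      have sl: "(u \<star> Ide C I) \<bullet> (Ide C ?W \<star> \<pi>) = (Ide C Y \<star> \<pi>) \<bullet> (u \<star> Ide C ?P)" if "u \<in> homset C ?W Y" for u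
        using homD[OF that] \<pi>(2) by (simp add: interchange)
      have "(g \<star> Ide C I) \<bullet> (Ide C ?W \<star> \<pi>) = (h \<star> Ide C I) \<bullet> (Ide C ?W \<star> \<pi>)"
        using sl[OF g] sl[OF h] eq by simp
      then have "g \<star> Ide C I = h \<star> Ide C I"
        by (rule epicD[OF left_tensor_epic'[OF \<pi>(1)], rotated -1])
          (use homD[OF g] homD[OF h] \<pi>(2) in simp_all)
      then show "g = h" using unit_faithful[OF g h] by blast
    qed simp
    moreover have "projective_obj C ((Y \<boxtimes> ?P) \<boxtimes> D)"
      using tensor_projective'[OF left_tensor_projective'[OF \<pi>(3) Y] D] .
    moreover have "injective_obj C ((Y \<boxtimes> ?P) \<boxtimes> D)"
      using injective_tensor_dual[OF dual \<pi>(3)] by simp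
    ultimately show thesis using that \<eta>[OF Y] by blast
  qed
qed

end

section \<open>Ext groups and Yoneda products\<close>

text \<open>Yoneda products, \<open>phi\<close> and scalar multiplication are unions over
  representatives and lifts; they are evaluated by showing that a choice exists and that all choices
  give the same class.\<close>

lemma UN_const: "\<lbrakk>A \<noteq> {}; \<And>x. x \<in> A \<Longrightarrow> f x = c\<rbrakk> \<Longrightarrow> (\<Union>x\<in>A. f x) = c"
  by auto

lemma additive_subgroupI':
  assumes "abelian_group G" "S \<subseteq> carrier G" "\<zero>\<^bsub>G\<^esub> \<in> S"
    "\<And>x. x \<in> S \<Longrightarrow> \<ominus>\<^bsub>G\<^esub> x \<in> S" "\<And>x y. \<lbrakk>x \<in> S; y \<in> S\<rbrakk> \<Longrightarrow> x \<oplus>\<^bsub>G\<^esub> y \<in> S"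
  shows "additive_subgroup S G"
proof -
  interpret abelian_group G by fact
  have "subgroup S (add_monoid G)"
    by (rule add.subgroupI) (use assms in \<open>auto simp: a_inv_def\<close>)
  then show ?thesis by (simp add: additive_subgroup_def)
qed

text \<open>The chosen resolution P of the unit tensored with X, with the augmentation corrected by
  \<open>LUnit C X\<close> so that it resolves X rather than I \<otimes> X.\<close>

definition tensor_res where
  "tensor_res C X i = (case i of 0 \<Rightarrow> LUnit C X \<bullet> (res C (UnitO C) 0 \<star> Ide C X)
     | Suc j \<Rightarrow> res C (UnitO C) (Suc j) \<star> Ide C X)"
  for C (structure)

definition phi_part where
  "phi_part C X n \<xi> =
     (\<Union>f\<in>\<xi>. \<Union>\<phi>\<in>tensor_lifts C X. ext_class C n X X (LUnit C X \<bullet> (f \<star> Ide C X) \<bullet> \<phi> n))"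
  for C (structure)

lemma phi_eq_parts: "phi C X h = (\<lambda>n. phi_part C X n (h n))"
  by (simp add: phi_def phi_part_def)

section \<open>Ext groups of the chosen resolutions\<close>

context finite_tensor_category
begin

lemma res_resolution:
  assumes "X \<in> Obj C"
  shows "is_projective_resolution C X (res C X)"
  unfolding res_def using projective_resolution_exists[OF enough_projectives assms] by (rule someI_ex)

lemma res_resolves: "X \<in> Obj C \<Longrightarrow> resolves C X (res C X)"
  using res_resolution[of X] by (simp add: resolves_def is_projective_resolution_def)

lemma res_projective: "X \<in> Obj C \<Longrightarrow> projective_obj C (Dom C (res C X n))"
  using res_resolution[of X] by (simp add: is_projective_resolution_def)

lemma resO_Obj [simp]: "X \<in> Obj C \<Longrightarrow> resO C X n \<in> Obj C"
  using resolvesD(7)[OF res_resolves] by (simp add: resO_def)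

lemma res_simps [simp]:
  assumes "X \<in> Obj C"
  shows "res C X n \<in> Arr C" "Dom C (res C X n) = resO C X n" "Cod C (res C X 0) = X"
    "Cod C (res C X (Suc n)) = resO C X n"
    "res C X n \<bullet> res C X (Suc n) = zero_arrow C (resO C X (Suc n)) (Cod C (res C X n))"
  using resolvesD[OF res_resolves[OF assms]] by (auto simp: resO_def)

lemma lifts_clift: "lifts C n X Y f = clift C (res C X) n (res C Y) f"
  by (simp add: lifts_def clift_def resO_def)

lemma coboundaries_cob: "coboundaries C n X Y = cob C (res C X) n Y"
  by (cases n) (simp_all add: coboundaries_def cob_def resO_def)

lemma cocyclesD:
  assumes "f \<in> cocycles C n X Y"
  shows "f \<in> homset C (resO C X n) Y" "f \<in> Arr C" "Dom C f = resO C X n" "Cod C f = Y"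
    "f \<bullet> res C X (Suc n) = zero_arrow C (resO C X (Suc n)) Y"
  using assms by (auto simp: cocycles_def homset_def)

lemma cocyclesI:
  "\<lbrakk>f \<in> homset C (resO C X n) Y; f \<bullet> res C X (Suc n) = zero_arrow C (resO C X (Suc n)) Y\<rbrakk>
    \<Longrightarrow> f \<in> cocycles C n X Y"
  by (simp add: cocycles_def)

lemma lifts_exist:
  assumes "X \<in> Obj C" "Y \<in> Obj C" "f \<in> cocycles C n X Y"
  obtains \<phi> where "\<phi> \<in> lifts C n X Y f"
  using clift_exists[OF res_resolves[OF assms(1)] res_projective[OF assms(1)] res_resolves[OF assms(2)]
      cocyclesD(1,5)[OF assms(3), folded res_simps(2)[OF assms(1)]]]
  unfolding lifts_clift by blast

lemma augmentation_cocycle: "X \<in> Obj C \<Longrightarrow> res C X 0 \<in> cocycles C 0 X X"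
  by (intro cocyclesI homI) simp_all

lemma cocycle_Comp:
  assumes "f \<in> cocycles C n X Y" "h \<in> homset C Y Z" "X \<in> Obj C"
  shows "h \<bullet> f \<in> cocycles C n X Z"
proof (rule cocyclesI)
  note f = cocyclesD[OF assms(1)] and h = homD[OF assms(2)]
  show "h \<bullet> f \<in> homset C (resO C X n) Z" using Comp_hom[OF assms(2) f(1)] .
  show "(h \<bullet> f) \<bullet> res C X (Suc n) = zero_arrow C (resO C X (Suc n)) Z"
    using f h assms(3) by simp
qed

context
  fixes X Y and n :: nat
  assumes X: "X \<in> Obj C" and Y: "Y \<in> Obj C"
begin

abbreviation (input) "H \<equiv> HomMod C (resO C X n) Y"

interpretation H: abelian_group H
  using hom_group X Y by simp

lemma H_carrier: "carrier H = homset C (resO C X n) Y"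
  using HomMod_carrier X Y by simp

lemma res_Suc_hom: "res C X (Suc n) \<in> homset C (resO C X (Suc n)) (resO C X n)"
  using X by (auto intro: homI)

lemma cocycles_subgroup: "additive_subgroup (cocycles C n X Y) H"
proof (rule additive_subgroupI')
  show "abelian_group H" by unfold_locales
  show "cocycles C n X Y \<subseteq> carrier H" using H_carrier by (auto simp: cocycles_def)
  show "zero_arrow C (resO C X n) Y \<in> cocycles C n X Y"
    using X Y by (intro cocyclesI homI) simp_all
  interpret H': abelian_group "HomMod C (resO C X (Suc n)) Y" using hom_group X Y by simp
  show "\<ominus>\<^bsub>H\<^esub> f \<in> cocycles C n X Y" if "f \<in> cocycles C n X Y" for f
    using cocyclesD[OF that] neg_hom Comp_additive_left(2)[OF res_Suc_hom Y, of f]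
      H'.minus_equality[OF H'.l_zero[OF H'.zero_closed]] by (intro cocyclesI) simp_all
  show "f \<oplus>\<^bsub>H\<^esub> g \<in> cocycles C n X Y" if "f \<in> cocycles C n X Y" "g \<in> cocycles C n X Y" for f g
    using cocyclesD[OF that(1)] cocyclesD[OF that(2)] add_hom
      Comp_add_left[OF _ _ res_Suc_hom, of f Y g] by (intro cocyclesI) simp_all
qed

lemma coboundaries_subgroup: "additive_subgroup (coboundaries C n X Y) H"
proof (rule additive_subgroupI')
  show "abelian_group H" by unfold_locales
  show "coboundaries C n X Y \<subseteq> carrier H"
  proof (cases n)
    case 0
    then show ?thesis using X Y H.zero_closed by (simp add: coboundaries_def)
  next
    case (Suc m)
    have "res C X (Suc m) \<in> homset C (resO C X n) (resO C X m)" using X Suc by (auto intro: homI)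
    then show ?thesis using Suc Comp_hom H_carrier by (auto simp: coboundaries_def)
  qed
  have "zero_arrow C (resO C X n) Y \<in> coboundaries C n X Y \<and>
    (\<forall>f \<in> coboundaries C n X Y. \<ominus>\<^bsub>H\<^esub> f \<in> coboundaries C n X Y) \<and>
    (\<forall>f \<in> coboundaries C n X Y. \<forall>g \<in> coboundaries C n X Y. f \<oplus>\<^bsub>H\<^esub> g \<in> coboundaries C n X Y)"
  proof (cases n)
    case 0
    moreover have "\<ominus>\<^bsub>H\<^esub> \<zero>\<^bsub>H\<^esub> = \<zero>\<^bsub>H\<^esub>" "\<zero>\<^bsub>H\<^esub> \<oplus>\<^bsub>H\<^esub> \<zero>\<^bsub>H\<^esub> = \<zero>\<^bsub>H\<^esub>"
      using H.minus_equality[OF H.l_zero[OF H.zero_closed]] by simp_all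
    ultimately show ?thesis
      by (simp add: coboundaries_def)
  next
    case (Suc m)
    have r: "res C X (Suc m) \<in> homset C (resO C X n) (resO C X m)" using X Suc by (auto intro: homI)
    have z: "zero_arrow C (resO C X m) Y \<in> homset C (resO C X m) Y" using X Y by (intro zero_hom) simp_all
    have "zero_arrow C (resO C X n) Y \<in> coboundaries C n X Y"
      using Suc X Y z by (auto simp: coboundaries_def intro!: image_eqI[of _ _ "zero_arrow C (resO C X m) Y"])
    moreover have "\<ominus>\<^bsub>H\<^esub> f \<in> coboundaries C n X Y" if f: "f \<in> coboundaries C n X Y" for f
    proof -
      obtain h where h: "h \<in> homset C (resO C X m) Y" "f = h \<bullet> res C X (Suc m)"
        using f Suc by (auto simp: coboundaries_def)
      then show ?thesis
        using Suc Comp_additive_left(2)[OF r Y h(1), symmetric] neg_hom[OF h(1)]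
        by (auto simp: coboundaries_def)
    qed
    moreover have "f \<oplus>\<^bsub>H\<^esub> g \<in> coboundaries C n X Y"
      if fg: "f \<in> coboundaries C n X Y" "g \<in> coboundaries C n X Y" for f g
    proof -
      obtain h k where h: "h \<in> homset C (resO C X m) Y" "f = h \<bullet> res C X (Suc m)"
        and k: "k \<in> homset C (resO C X m) Y" "g = k \<bullet> res C X (Suc m)"
        using fg Suc by (auto simp: coboundaries_def)
      then show ?thesis
        using Suc Comp_add_left[OF h(1) k(1) r, symmetric] add_hom[OF h(1) k(1)]
        by (auto simp: coboundaries_def)
    qed
    ultimately show ?thesis by blast
  qed
  then show "\<zero>\<^bsub>H\<^esub> \<in> coboundaries C n X Y"
    "\<And>f. f \<in> coboundaries C n X Y \<Longrightarrow> \<ominus>\<^bsub>H\<^esub> f \<in> coboundaries C n X Y"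
    "\<And>f g. \<lbrakk>f \<in> coboundaries C n X Y; g \<in> coboundaries C n X Y\<rbrakk> \<Longrightarrow> f \<oplus>\<^bsub>H\<^esub> g \<in> coboundaries C n X Y"
    by blast+
qed

lemma coboundaries_cocycles: "coboundaries C n X Y \<subseteq> cocycles C n X Y"
proof
  fix f assume f: "f \<in> coboundaries C n X Y"
  then have fh: "f \<in> homset C (resO C X n) Y"
    using additive_subgroup.a_subset[OF coboundaries_subgroup] H_carrier by blast
  show "f \<in> cocycles C n X Y"
  proof (rule cocyclesI[OF fh])
    show "f \<bullet> res C X (Suc n) = zero_arrow C (resO C X (Suc n)) Y"
    proof (cases n)
      case 0
      then show ?thesis using f X Y by (simp add: coboundaries_def)
    next
      case (Suc m)
      then show ?thesis using f X Y by (auto simp: coboundaries_def homset_def)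
    qed
  qed
qed

interpretation B: abelian_subgroup "coboundaries C n X Y" H
  by (rule abelian_subgroupI3[OF coboundaries_subgroup]) unfold_locales

lemma cocycles_closed:
  assumes "f \<in> cocycles C n X Y" "g \<in> cocycles C n X Y"
  shows "f \<oplus>\<^bsub>H\<^esub> g \<in> cocycles C n X Y" "\<ominus>\<^bsub>H\<^esub> f \<in> cocycles C n X Y" "f \<ominus>\<^bsub>H\<^esub> g \<in> cocycles C n X Y"
  using assms additive_subgroup.a_closed[OF cocycles_subgroup]
    additive_subgroup.a_inv_closed[OF cocycles_subgroup] by (auto simp: a_minus_def)

lemma zero_cocycle: "zero_arrow C (resO C X n) Y \<in> cocycles C n X Y"
  using additive_subgroup.zero_closed[OF cocycles_subgroup] by simp

lemma cocycle_carrier: "f \<in> cocycles C n X Y \<Longrightarrow> f \<in> carrier H"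
  using H_carrier by (auto simp: cocycles_def)

lemma ext_class_self: "f \<in> cocycles C n X Y \<Longrightarrow> f \<in> ext_class C n X Y f"
  unfolding ext_class_def using B.a_rcos_self[OF cocycle_carrier] .

lemma ext_class_mem_iff:
  "\<lbrakk>f \<in> cocycles C n X Y; g \<in> carrier H\<rbrakk> \<Longrightarrow>
    g \<in> ext_class C n X Y f \<longleftrightarrow> g \<ominus>\<^bsub>H\<^esub> f \<in> coboundaries C n X Y"
  unfolding ext_class_def using B.a_rcos_module cocycle_carrier by (simp add: a_minus_def)

lemma ext_class_eq_iff:
  assumes "f \<in> cocycles C n X Y" "g \<in> cocycles C n X Y"
  shows "ext_class C n X Y g = ext_class C n X Y f \<longleftrightarrow> g \<ominus>\<^bsub>H\<^esub> f \<in> coboundaries C n X Y"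
  using ext_class_mem_iff[OF assms(1) cocycle_carrier[OF assms(2)]] ext_class_self[OF assms(2)]
    B.a_repr_independence'[of g f] cocycle_carrier[OF assms(1)]
  unfolding ext_class_def by auto

text \<open>Classes are cosets of arrows; every arrow met in a union over a class is again a cocycle
  representing that class.\<close>

lemma ext_class_memD:
  assumes "f \<in> cocycles C n X Y" "g \<in> ext_class C n X Y f"
  shows "g \<in> cocycles C n X Y" "ext_class C n X Y g = ext_class C n X Y f"
proof -
  have g: "g \<in> carrier H"
    using assms B.a_elemrcos_carrier cocycle_carrier unfolding ext_class_def by blast
  then have "g \<ominus>\<^bsub>H\<^esub> f \<in> coboundaries C n X Y" using ext_class_mem_iff assms by blast
  then have "(g \<ominus>\<^bsub>H\<^esub> f) \<oplus>\<^bsub>H\<^esub> f \<in> cocycles C n X Y"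
    using coboundaries_cocycles assms(1) cocycles_closed(1) by blast
  moreover have "(g \<ominus>\<^bsub>H\<^esub> f) \<oplus>\<^bsub>H\<^esub> f = g"
    using g cocycle_carrier[OF assms(1)] by (simp add: a_minus_def H.a_assoc H.l_neg)
  ultimately show gc: "g \<in> cocycles C n X Y" by simp
  show "ext_class C n X Y g = ext_class C n X Y f"
    using B.a_repr_independence'[of g f] assms(2) cocycle_carrier[OF assms(1)]
    unfolding ext_class_def by simp
qed

lemma Ext_E:
  assumes "\<xi> \<in> carrier (Ext C n X Y)"
  obtains f where "f \<in> cocycles C n X Y" "\<xi> = ext_class C n X Y f"
  using assms by (auto simp: Ext_def)

lemma Ext_I: "f \<in> cocycles C n X Y \<Longrightarrow> ext_class C n X Y f \<in> carrier (Ext C n X Y)"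
  by (simp add: Ext_def)

lemma Ext_zero: "\<zero>\<^bsub>Ext C n X Y\<^esub> = ext_class C n X Y (zero_arrow C (resO C X n) Y)"
  by (simp add: Ext_def)

lemma Ext_add:
  "\<lbrakk>f \<in> cocycles C n X Y; g \<in> cocycles C n X Y\<rbrakk> \<Longrightarrow>
    ext_class C n X Y f \<oplus>\<^bsub>Ext C n X Y\<^esub> ext_class C n X Y g = ext_class C n X Y (f \<oplus>\<^bsub>H\<^esub> g)"
  using B.a_rcos_sum[of f g] cocycle_carrier by (simp add: Ext_def ext_class_def)

lemma Ext_group: "abelian_group (Ext C n X Y)"
proof (rule abelian_groupI)
  fix a b c assume "a \<in> carrier (Ext C n X Y)" "b \<in> carrier (Ext C n X Y)" "c \<in> carrier (Ext C n X Y)"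
  then obtain f g h where fgh: "f \<in> cocycles C n X Y" "a = ext_class C n X Y f"
     "g \<in> cocycles C n X Y" "b = ext_class C n X Y g" "h \<in> cocycles C n X Y" "c = ext_class C n X Y h"
    using Ext_E by metis
  then show "a \<oplus>\<^bsub>Ext C n X Y\<^esub> b \<oplus>\<^bsub>Ext C n X Y\<^esub> c = a \<oplus>\<^bsub>Ext C n X Y\<^esub> (b \<oplus>\<^bsub>Ext C n X Y\<^esub> c)"
    using cocycle_carrier by (simp add: Ext_add cocycles_closed H.a_assoc)
next
  fix a b assume "a \<in> carrier (Ext C n X Y)" "b \<in> carrier (Ext C n X Y)"
  then obtain f g where fg: "f \<in> cocycles C n X Y" "a = ext_class C n X Y f"
     "g \<in> cocycles C n X Y" "b = ext_class C n X Y g"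
    using Ext_E by metis
  then show "a \<oplus>\<^bsub>Ext C n X Y\<^esub> b \<in> carrier (Ext C n X Y)"
    by (simp add: Ext_add cocycles_closed Ext_I)
  from fg show "a \<oplus>\<^bsub>Ext C n X Y\<^esub> b = b \<oplus>\<^bsub>Ext C n X Y\<^esub> a"
    using cocycle_carrier by (simp add: Ext_add H.a_comm)
next
  show "\<zero>\<^bsub>Ext C n X Y\<^esub> \<in> carrier (Ext C n X Y)"
    using Ext_zero Ext_I zero_cocycle by simp
  fix a assume "a \<in> carrier (Ext C n X Y)"
  then obtain f where f: "f \<in> cocycles C n X Y" "a = ext_class C n X Y f"
    using Ext_E by metis
  show "\<zero>\<^bsub>Ext C n X Y\<^esub> \<oplus>\<^bsub>Ext C n X Y\<^esub> a = a"
    using f cocycle_carrier[OF f(1)] by (simp add: Ext_zero Ext_add zero_cocycle)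
  have "ext_class C n X Y (\<ominus>\<^bsub>H\<^esub> f) \<oplus>\<^bsub>Ext C n X Y\<^esub> a = \<zero>\<^bsub>Ext C n X Y\<^esub>"
    using f cocycle_carrier[OF f(1)] by (simp add: Ext_zero Ext_add cocycles_closed H.l_neg)
  then show "\<exists>b\<in>carrier (Ext C n X Y). b \<oplus>\<^bsub>Ext C n X Y\<^esub> a = \<zero>\<^bsub>Ext C n X Y\<^esub>"
    using Ext_I cocycles_closed(2)[OF f(1) f(1)] by blast
qed

lemma Ext_neg:
  assumes "f \<in> cocycles C n X Y"
  shows "\<ominus>\<^bsub>Ext C n X Y\<^esub> ext_class C n X Y f = ext_class C n X Y (\<ominus>\<^bsub>H\<^esub> f)"
  using abelian_group.minus_equality[OF Ext_group, of "ext_class C n X Y (\<ominus>\<^bsub>H\<^esub> f)" "ext_class C n X Y f"]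
   assms cocycle_carrier[OF assms] cocycles_closed(2)[OF assms assms] by (simp add: Ext_zero Ext_add H.l_neg Ext_I)

lemma Ext_zero_iff:
  assumes "f \<in> cocycles C n X Y"
  shows "ext_class C n X Y f = \<zero>\<^bsub>Ext C n X Y\<^esub> \<longleftrightarrow> f \<in> coboundaries C n X Y"
  using ext_class_eq_iff[OF zero_cocycle assms] minus_zero[OF cocyclesD(1)[OF assms]] by (simp add: Ext_zero)

lemma Ext_smult:
  assumes a: "a \<in> carrier K" and f: "f \<in> cocycles C n X Y"
  shows "a \<odot>\<^bsub>H\<^esub> f \<in> cocycles C n X Y"
    "a \<odot>\<^bsub>Ext C n X Y\<^esub> ext_class C n X Y f = ext_class C n X Y (a \<odot>\<^bsub>H\<^esub> f)"
proof -
  interpret M: module K H using HomMod_module X Y by simp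
  interpret M': module K "HomMod C (resO C X (Suc n)) Y" using HomMod_module X Y by simp
  have sm: "a \<odot>\<^bsub>H\<^esub> g \<in> cocycles C n X Y" if g: "g \<in> cocycles C n X Y" for g
    using cocyclesD[OF g] M.smult_closed[OF a cocycle_carrier[OF g]] H_carrier a M'.smult_r_null[OF a]
      Comp_smult_left[OF a cocyclesD(1)[OF g] res_Suc_hom] by (intro cocyclesI) simp_all
  then show "a \<odot>\<^bsub>H\<^esub> f \<in> cocycles C n X Y" using f by blast
  \<comment> \<open>Scaling preserves coboundaries, so the class of the multiple does not depend on
    the representative g.\<close>
  have "ext_class C n X Y (a \<odot>\<^bsub>H\<^esub> g) = ext_class C n X Y (a \<odot>\<^bsub>H\<^esub> f)" if g: "g \<in> ext_class C n X Y f" for g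
  proof -
    have gc: "g \<in> cocycles C n X Y" using ext_class_memD[OF f g] by blast
    have d: "g \<ominus>\<^bsub>H\<^esub> f \<in> coboundaries C n X Y"
      using ext_class_mem_iff[OF f cocycle_carrier[OF gc]] g by simp
    have "a \<odot>\<^bsub>H\<^esub> (g \<ominus>\<^bsub>H\<^esub> f) \<in> coboundaries C n X Y"
    proof (cases n)
      case 0
      then show ?thesis using d a M.smult_r_null[OF a] by (simp add: coboundaries_def)
    next
      case (Suc m)
      interpret N: module K "HomMod C (resO C X m) Y" using HomMod_module X Y by simp
      obtain h where h: "h \<in> homset C (resO C X m) Y" "g \<ominus>\<^bsub>H\<^esub> f = h \<bullet> res C X (Suc m)"
        using d Suc by (auto simp: coboundaries_def)
      have "res C X (Suc m) \<in> homset C (resO C X n) (resO C X m)" using X Suc by (auto intro: homI)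
      from Comp_smult_left[OF a h(1) this]
      have "a \<odot>\<^bsub>H\<^esub> (g \<ominus>\<^bsub>H\<^esub> f) = (a \<odot>\<^bsub>HomMod C (resO C X m) Y\<^esub> h) \<bullet> res C X (Suc m)"
        unfolding h(2) by simp
      moreover have "a \<odot>\<^bsub>HomMod C (resO C X m) Y\<^esub> h \<in> homset C (resO C X m) Y"
        using N.smult_closed[OF a] HomMod_carrier[of "resO C X m" Y] X Y h(1) by simp
      ultimately show ?thesis using Suc by (auto simp: coboundaries_def)
    qed
    moreover have "a \<odot>\<^bsub>H\<^esub> (g \<ominus>\<^bsub>H\<^esub> f) = a \<odot>\<^bsub>H\<^esub> g \<ominus>\<^bsub>H\<^esub> a \<odot>\<^bsub>H\<^esub> f"
      using a cocycle_carrier[OF gc] cocycle_carrier[OF f]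
      by (simp add: a_minus_def M.smult_r_distr M.smult_r_minus)
    ultimately show ?thesis using ext_class_eq_iff[OF sm[OF f] sm[OF gc]] by simp
  qed
  moreover have "ext_class C n X Y f \<noteq> {}" using ext_class_self f by blast
  ultimately have "(\<Union>g\<in>ext_class C n X Y f. ext_class C n X Y (a \<odot>\<^bsub>H\<^esub> g)) = ext_class C n X Y (a \<odot>\<^bsub>H\<^esub> f)"
    by (intro UN_const)
  then show "a \<odot>\<^bsub>Ext C n X Y\<^esub> ext_class C n X Y f = ext_class C n X Y (a \<odot>\<^bsub>H\<^esub> f)"
    unfolding Ext_def by (simp only: module.select_convs)
qed

end

section \<open>Yoneda products: well-definedness, bilinearity, associativity\<close>

lemma clift_comp:
  assumes \<phi>: "\<phi> \<in> clift C d n q f" and \<tau>: "\<tau> \<in> clift C q m r g"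
    and d: "resolves C X d" and q: "resolves C Y q" and r: "resolves C Z r"
  shows "(\<lambda>i. \<tau> i \<bullet> \<phi> (m + i)) \<in> clift C d (n + m) r (g \<bullet> \<phi> m)"
  unfolding clift_def
proof (intro CollectI conjI allI)
  note D = resolvesD[OF d] and Q = resolvesD[OF q] and R = resolvesD[OF r]
  note \<Phi> = cliftD[OF \<phi>] and T = cliftD[OF \<tau>]
  fix i
  show "\<tau> i \<bullet> \<phi> (m + i) \<in> homset C (Dom C (d (n + m + i))) (Dom C (r i))"
    using Comp_hom[OF T(1)[of i] \<Phi>(1)[of "m + i"]] by (simp add: add.assoc)
  note [simp] = homD[OF T(1)] homD[OF \<Phi>(1)] D(1,3) Q(1,3) R(1,3)
  show "r 0 \<bullet> \<tau> 0 \<bullet> \<phi> (m + 0) = g \<bullet> \<phi> m"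
    using Comp_reassoc[OF T(2), of "\<phi> m"] by simp
  have "r (Suc i) \<bullet> \<tau> (Suc i) \<bullet> \<phi> (m + Suc i) = (\<tau> i \<bullet> q (Suc (m + i))) \<bullet> \<phi> (Suc (m + i))"
    using Comp_reassoc[OF T(3)[of i], of "\<phi> (Suc (m + i))"] by simp
  also have "\<dots> = \<tau> i \<bullet> (\<phi> (m + i) \<bullet> d (Suc (n + (m + i))))"
    using \<Phi>(3)[of "m + i"] by simp
  finally show "r (Suc i) \<bullet> \<tau> (Suc i) \<bullet> \<phi> (m + Suc i) = (\<tau> i \<bullet> \<phi> (m + i)) \<bullet> d (Suc (n + m + i))"
    by (simp add: add.assoc)
qed

lemma lift_cocycle:
  assumes X: "X \<in> Obj C" and q: "resolves C Y q" and \<phi>: "\<phi> \<in> clift C (res C X) n q f"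
    and g: "g \<in> homset C (Dom C (q m)) W" "g \<bullet> q (Suc m) = zero_arrow C (Dom C (q (Suc m))) W"
  shows "g \<bullet> \<phi> m \<in> cocycles C (m + n) X W"
proof (rule cocyclesI)
  note Q = resolvesD[OF q] and \<Phi> = cliftD[OF \<phi>]
  show "g \<bullet> \<phi> m \<in> homset C (resO C X (m + n)) W"
    using Comp_hom[OF g(1) \<Phi>(1)] by (simp add: resO_def add.commute)
  note [simp] = homD[OF g(1)] homD[OF \<Phi>(1)] Q(1,3) X hom_Obj(2)[OF g(1)]
  have "(g \<bullet> \<phi> m) \<bullet> res C X (Suc (m + n)) = g \<bullet> (q (Suc m) \<bullet> \<phi> (Suc m))"
    using \<Phi>(3)[of m] by (simp add: add.commute)
  also have "\<dots> = zero_arrow C (resO C X (Suc (m + n))) W"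
    using Comp_reassoc[OF g(2), of "\<phi> (Suc m)"] Q(7) by (simp add: add.commute)
  finally show "(g \<bullet> \<phi> m) \<bullet> res C X (Suc (m + n)) = zero_arrow C (resO C X (Suc (m + n))) W" .
qed

lemma lift_class_unique:
  assumes X: "X \<in> Obj C" and q: "resolves C Y q"
    and \<phi>: "\<phi> \<in> clift C (res C X) n q f" "\<phi>' \<in> clift C (res C X) n q f'"
    and f: "f \<in> cocycles C n X Y" "f' \<in> cocycles C n X Y" "ext_class C n X Y f = ext_class C n X Y f'"
    and g: "g \<in> homset C (Dom C (q m)) W" "g \<bullet> q (Suc m) = zero_arrow C (Dom C (q (Suc m))) W"
  shows "ext_class C (m + n) X W (g \<bullet> \<phi> m) = ext_class C (m + n) X W (g \<bullet> \<phi>' m)"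
proof -
  have Y: "Y \<in> Obj C" and W: "W \<in> Obj C" using resolvesD(6)[OF q] hom_Obj(2)[OF g(1)] by auto
  have "f \<ominus>\<^bsub>HomMod C (resO C X n) Y\<^esub> f' \<in> coboundaries C n X Y"
    using ext_class_eq_iff[OF X Y f(2) f(1)] f(3) by simp
  then have "g \<bullet> \<phi> m \<ominus>\<^bsub>HomMod C (resO C X (m + n)) W\<^esub> g \<bullet> \<phi>' m \<in> coboundaries C (m + n) X W"
    using clift_unique[OF res_resolves[OF X] res_projective[OF X] q \<phi> _ g]
    by (simp add: coboundaries_cob resO_def add.commute)
  then show ?thesis
    using ext_class_eq_iff[OF X W lift_cocycle[OF X q \<phi>(2) g] lift_cocycle[OF X q \<phi>(1) g]] by simp
qed

text \<open>A difference of the form \<open>h \<bullet> q (Suc k)\<close>, composed with the lift,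
  becomes \<open>(h \<bullet> \<phi> k) \<bullet> res C X (Suc (k + n))\<close>, because \<phi>
  commutes with the differentials.\<close>

lemma lift_class_unique_left:
  assumes X: "X \<in> Obj C" and q: "resolves C Y q" and \<phi>: "\<phi> \<in> clift C (res C X) n q f"
    and g: "g \<in> homset C (Dom C (q m)) W" "g \<bullet> q (Suc m) = zero_arrow C (Dom C (q (Suc m))) W"
    and g': "g' \<in> homset C (Dom C (q m)) W" "g' \<bullet> q (Suc m) = zero_arrow C (Dom C (q (Suc m))) W"
    and gg': "g \<ominus>\<^bsub>HomMod C (Dom C (q m)) W\<^esub> g' \<in> cob C q m W"
  shows "ext_class C (m + n) X W (g \<bullet> \<phi> m) = ext_class C (m + n) X W (g' \<bullet> \<phi> m)"
proof -
  note Q = resolvesD[OF q] and \<Phi> = cliftD[OF \<phi>]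
  have W: "W \<in> Obj C" using hom_Obj(2)[OF g(1)] by auto
  have signed_add: "\<phi> m \<in> homset C (resO C X (m + n)) (Dom C (q m))"
    using \<Phi>(1)[of m] by (simp add: resO_def add.commute)
  have "g \<bullet> \<phi> m \<ominus>\<^bsub>HomMod C (resO C X (m + n)) W\<^esub> g' \<bullet> \<phi> m = 
     (g \<ominus>\<^bsub>HomMod C (Dom C (q m)) W\<^esub> g') \<bullet> \<phi> m"
    using Comp_additive_left(3)[OF signed_add W g(1) g'(1)] by simp
  also have "\<dots> \<in> coboundaries C (m + n) X W"
  proof (cases m)
    case 0
    then have "g \<ominus>\<^bsub>HomMod C (Dom C (q m)) W\<^esub> g' = zero_arrow C (Dom C (q m)) W"
      using gg' by (simp add: cob_def)
    then have "(g \<ominus>\<^bsub>HomMod C (Dom C (q m)) W\<^esub> g') \<bullet> \<phi> m = zero_arrow C (resO C X (m + n)) W"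
      using homD[OF signed_add] W by simp
    then show ?thesis
      using additive_subgroup.zero_closed[OF coboundaries_subgroup[OF X W]] by simp
  next
    case (Suc k)
    then obtain h where h: "h \<in> homset C (Dom C (q k)) W"
      "g \<ominus>\<^bsub>HomMod C (Dom C (q m)) W\<^esub> g' = h \<bullet> q (Suc k)"
      using gg' by (auto simp: cob_def)
    note [simp] = homD[OF h(1)] Q(1,3) homD[OF \<Phi>(1)] X
    have "(g \<ominus>\<^bsub>HomMod C (Dom C (q m)) W\<^esub> g') \<bullet> \<phi> m = h \<bullet> (q (Suc k) \<bullet> \<phi> (Suc k))"
      unfolding Suc h(2)[unfolded Suc] by simp
    also have "\<dots> = (h \<bullet> \<phi> k) \<bullet> res C X (Suc (k + n))"
      using \<Phi>(3)[of k] by (simp add: add.commute)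
    also have "\<dots> \<in> coboundaries C (m + n) X W"
    proof -
      have "h \<bullet> \<phi> k \<in> homset C (resO C X (k + n)) W"
        using Comp_hom[OF h(1) \<Phi>(1)] by (simp add: add.commute)
      then show ?thesis using Suc by (simp add: coboundaries_def)
    qed
    finally show ?thesis .
  qed
  finally show ?thesis
    using ext_class_eq_iff[OF X W lift_cocycle[OF X q \<phi> g'] lift_cocycle[OF X q \<phi> g]] by simp
qed

text \<open>The choices are changed one after the other: \<open>lift_class_unique_left\<close>
  handles the outer cocycle, \<open>lift_class_unique\<close> the inner cocycle together with its
  lift.\<close>

lemma yoneda_eq:
  assumes X: "X \<in> Obj C" and Y: "Y \<in> Obj C" and Z: "Z \<in> Obj C"
    and g: "g \<in> cocycles C m Y Z" and f: "f \<in> cocycles C n X Y" and \<phi>: "\<phi> \<in> lifts C n X Y f"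
  shows "yoneda C m n X Y Z (ext_class C m Y Z g) (ext_class C n X Y f) = ext_class C (m + n) X Z (g \<bullet> \<phi> m)"
  unfolding yoneda_def
proof (intro UN_const)
  show "ext_class C m Y Z g \<noteq> {}" "ext_class C n X Y f \<noteq> {}"
    using ext_class_self[OF Y Z g] ext_class_self[OF X Y f] by auto
  fix g' f' assume g': "g' \<in> ext_class C m Y Z g" and f': "f' \<in> ext_class C n X Y f"
  note gc = ext_class_memD[OF Y Z g g'] and fc = ext_class_memD[OF X Y f f']
  show "lifts C n X Y f' \<noteq> {}" using lifts_exist[OF X Y fc(1)] by blast
  fix \<phi>' assume \<phi>': "\<phi>' \<in> lifts C n X Y f'"
  note G = cocyclesD[OF g, folded res_simps(2)[OF Y]] and G' = cocyclesD[OF gc(1), folded res_simps(2)[OF Y]]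
  have "ext_class C (m + n) X Z (g' \<bullet> \<phi>' m) = ext_class C (m + n) X Z (g \<bullet> \<phi>' m)"
    using ext_class_eq_iff[OF Y Z g gc(1)] gc(2) Y
    by (intro lift_class_unique_left[OF X res_resolves[OF Y] \<phi>'[unfolded lifts_clift] G'(1,5) G(1,5)])
      (simp add: coboundaries_cob)
  also have "\<dots> = ext_class C (m + n) X Z (g \<bullet> \<phi> m)"
    by (rule lift_class_unique[OF X res_resolves[OF Y] \<phi>'[unfolded lifts_clift] \<phi>[unfolded lifts_clift] fc(1) f fc(2) G(1,5)])
  finally show "ext_class C (m + n) X Z (g' \<bullet> \<phi>' m) = ext_class C (m + n) X Z (g \<bullet> \<phi> m)" .
qed

end

context finite_tensor_category
begin

lemma yoneda_E:
  assumes X: "X \<in> Obj C" and Y: "Y \<in> Obj C" and Z: "Z \<in> Obj C"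
    and "\<xi> \<in> carrier (Ext C m Y Z)" "\<eta> \<in> carrier (Ext C n X Y)"
  obtains g f \<phi> where "g \<in> cocycles C m Y Z" "\<xi> = ext_class C m Y Z g"
    "f \<in> cocycles C n X Y" "\<eta> = ext_class C n X Y f" "\<phi> \<in> clift C (res C X) n (res C Y) f"
  using Ext_E[OF Y Z assms(4)] Ext_E[OF X Y assms(5)] lifts_exist[OF X Y] lifts_clift by metis

lemma yoneda_cocycle:
  assumes "X \<in> Obj C" "Y \<in> Obj C" "g \<in> cocycles C m Y Z" "\<phi> \<in> clift C (res C X) n (res C Y) f"
  shows "g \<bullet> \<phi> m \<in> cocycles C (m + n) X Z"
  using lift_cocycle[OF assms(1) res_resolves[OF assms(2)] assms(4)] 
    cocyclesD(1,5)[OF assms(3)] assms(2) by simp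

lemma yoneda_closed:
  assumes "X \<in> Obj C" "Y \<in> Obj C" "Z \<in> Obj C"
    and "\<xi> \<in> carrier (Ext C m Y Z)" "\<eta> \<in> carrier (Ext C n X Y)"
  shows "yoneda C m n X Y Z \<xi> \<eta> \<in> carrier (Ext C (m + n) X Z)"
proof -
  obtain g f \<phi> where gf: "g \<in> cocycles C m Y Z" "\<xi> = ext_class C m Y Z g"
    "f \<in> cocycles C n X Y" "\<eta> = ext_class C n X Y f" "\<phi> \<in> clift C (res C X) n (res C Y) f"
    using yoneda_E[OF assms] .
  then show ?thesis
    using yoneda_eq[OF assms(1-3) gf(1,3), of \<phi>] Ext_I[OF assms(1,3) yoneda_cocycle[OF assms(1,2) gf(1,5)]]
    by (simp add: lifts_clift)
qed

lemma yoneda_add_left: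
  assumes "X \<in> Obj C" "Y \<in> Obj C" "Z \<in> Obj C"
    and \<xi>: "\<xi> \<in> carrier (Ext C m Y Z)" "\<xi>' \<in> carrier (Ext C m Y Z)" and \<eta>: "\<eta> \<in> carrier (Ext C n X Y)"
  shows "yoneda C m n X Y Z (\<xi> \<oplus>\<^bsub>Ext C m Y Z\<^esub> \<xi>') \<eta> =
    yoneda C m n X Y Z \<xi> \<eta> \<oplus>\<^bsub>Ext C (m + n) X Z\<^esub> yoneda C m n X Y Z \<xi>' \<eta>"
proof -
  obtain g f \<phi> where gf: "g \<in> cocycles C m Y Z" "\<xi> = ext_class C m Y Z g"
    "f \<in> cocycles C n X Y" "\<eta> = ext_class C n X Y f" "\<phi> \<in> clift C (res C X) n (res C Y) f"
    using yoneda_E[OF assms(1-3) \<xi>(1) \<eta>] .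
  obtain g' where g': "g' \<in> cocycles C m Y Z" "\<xi>' = ext_class C m Y Z g'"
    using Ext_E[OF assms(2,3) \<xi>(2)] .
  have signed_add: "\<phi> m \<in> homset C (resO C X (m + n)) (resO C Y m)"
    using cliftD(1)[OF gf(5), of m] assms by (simp add: add.commute)
  have l: "\<phi> \<in> lifts C n X Y f" using gf lifts_clift by simp
  show ?thesis
    unfolding gf(2,4) g'(2) Ext_add[OF assms(2,3) gf(1) g'(1)]
      yoneda_eq[OF assms(1-3) gf(1,3) l] yoneda_eq[OF assms(1-3) g'(1) gf(3) l]
      yoneda_eq[OF assms(1-3) cocycles_closed(1)[OF assms(2,3) gf(1) g'(1)] gf(3) l]
      Ext_add[OF assms(1,3) yoneda_cocycle[OF assms(1,2) gf(1,5)] yoneda_cocycle[OF assms(1,2) g'(1) gf(5)]]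
    using Comp_add_left[OF cocyclesD(1)[OF gf(1)] cocyclesD(1)[OF g'(1)] signed_add] by simp
qed

lemma clift_add:
  assumes d: "resolves C X d" and q: "resolves C Y q"
    and \<phi>: "\<phi> \<in> clift C d n q f" and \<phi>': "\<phi>' \<in> clift C d n q f'"
  shows "(\<lambda>i. \<phi> i \<oplus>\<^bsub>HomMod C (Dom C (d (n + i))) (Dom C (q i))\<^esub> \<phi>' i)
    \<in> clift C d n q (f \<oplus>\<^bsub>HomMod C (Dom C (d n)) Y\<^esub> f')"
  unfolding clift_def
proof (intro CollectI conjI allI)
  note D = resolvesD[OF d] and Q = resolvesD[OF q] and \<Phi> = cliftD[OF \<phi>] and \<Phi>' = cliftD[OF \<phi>']
  fix i
  show "\<phi> i \<oplus>\<^bsub>HomMod C (Dom C (d (n + i))) (Dom C (q i))\<^esub> \<phi>' i \<in> homset C (Dom C (d (n + i))) (Dom C (q i))"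
    using add_hom[OF \<Phi>(1) \<Phi>'(1)] .
  show "q 0 \<bullet> (\<phi> 0 \<oplus>\<^bsub>HomMod C (Dom C (d (n + 0))) (Dom C (q 0))\<^esub> \<phi>' 0) = f \<oplus>\<^bsub>HomMod C (Dom C (d n)) Y\<^esub> f'"
    using Comp_add_right[OF Q(5) \<Phi>(1)[of 0] \<Phi>'(1)[of 0]] \<Phi>(2) \<Phi>'(2) Q(2) by simp
  have ds: "d (Suc (n + i)) \<in> homset C (Dom C (d (Suc (n + i)))) (Dom C (d (n + i)))"
    using D by (auto intro!: homI)
  show "q (Suc i) \<bullet> (\<phi> (Suc i) \<oplus>\<^bsub>HomMod C (Dom C (d (n + Suc i))) (Dom C (q (Suc i)))\<^esub> \<phi>' (Suc i)) =
    (\<phi> i \<oplus>\<^bsub>HomMod C (Dom C (d (n + i))) (Dom C (q i))\<^esub> \<phi>' i) \<bullet> d (Suc (n + i))"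
    using Comp_add_right[OF Q(5) \<Phi>(1)[of "Suc i"] \<Phi>'(1)[of "Suc i"]]
      Comp_add_left[OF \<Phi>(1)[of i] \<Phi>'(1)[of i] ds] \<Phi>(3)[of i] \<Phi>'(3)[of i] Q(3) by simp
qed

lemma yoneda_add_right:
  assumes "X \<in> Obj C" "Y \<in> Obj C" "Z \<in> Obj C"
    and \<xi>: "\<xi> \<in> carrier (Ext C m Y Z)" and \<eta>: "\<eta> \<in> carrier (Ext C n X Y)" "\<eta>' \<in> carrier (Ext C n X Y)"
  shows "yoneda C m n X Y Z \<xi> (\<eta> \<oplus>\<^bsub>Ext C n X Y\<^esub> \<eta>') =
    yoneda C m n X Y Z \<xi> \<eta> \<oplus>\<^bsub>Ext C (m + n) X Z\<^esub> yoneda C m n X Y Z \<xi> \<eta>'"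
proof -
  obtain g f \<phi> where gf: "g \<in> cocycles C m Y Z" "\<xi> = ext_class C m Y Z g"
    "f \<in> cocycles C n X Y" "\<eta> = ext_class C n X Y f" "\<phi> \<in> clift C (res C X) n (res C Y) f"
    using yoneda_E[OF assms(1-3) \<xi> \<eta>(1)] .
  obtain f' where f': "f' \<in> cocycles C n X Y" "\<eta>' = ext_class C n X Y f'"
    using Ext_E[OF assms(1,2) \<eta>(2)] .
  then obtain \<phi>' where \<phi>': "\<phi>' \<in> clift C (res C X) n (res C Y) f'"
    using lifts_exist[OF assms(1,2)] lifts_clift by metis
  note add = clift_add[OF res_resolves[OF assms(1)] res_resolves[OF assms(2)] gf(5) \<phi>']
  have signed_add: "\<phi> m \<in> homset C (resO C X (m + n)) (resO C Y m)" "\<phi>' m \<in> homset C (resO C X (m + n)) (resO C Y m)"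
    using cliftD(1)[OF gf(5), of m] cliftD(1)[OF \<phi>', of m] assms by (simp_all add: add.commute)
  show ?thesis
    unfolding gf(2,4) f'(2) Ext_add[OF assms(1,2) gf(3) f'(1)]
      yoneda_eq[OF assms(1-3) gf(1,3) gf(5)[folded lifts_clift]] yoneda_eq[OF assms(1-3) gf(1) f'(1) \<phi>'[folded lifts_clift]]
      yoneda_eq[OF assms(1-3) gf(1) cocycles_closed(1)[OF assms(1,2) gf(3) f'(1)]
         add[unfolded res_simps(2)[OF assms(1)], folded lifts_clift]]
      Ext_add[OF assms(1,3) yoneda_cocycle[OF assms(1,2) gf(1,5)] yoneda_cocycle[OF assms(1,2) gf(1) \<phi>']]
    using Comp_add_right[OF cocyclesD(1)[OF gf(1)] signed_add] assms by (simp add: add.commute)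
qed

text \<open>Lifts of f and g compose to a lift of the product cocycle, so both bracketings are
  represented by the same composite of h, G and F.\<close>

lemma yoneda_assoc:
  assumes "W \<in> Obj C" "X \<in> Obj C" "Y \<in> Obj C" "Z \<in> Obj C"
    and "\<xi> \<in> carrier (Ext C l Y Z)" "\<eta> \<in> carrier (Ext C m X Y)" "\<zeta> \<in> carrier (Ext C n W X)"
  shows "yoneda C (l + m) n W X Z (yoneda C l m X Y Z \<xi> \<eta>) \<zeta> = 
    yoneda C l (m + n) W Y Z \<xi> (yoneda C m n W X Y \<eta> \<zeta>)"
proof -
  obtain h g G where hg: "h \<in> cocycles C l Y Z" "\<xi> = ext_class C l Y Z h"
    "g \<in> cocycles C m X Y" "\<eta> = ext_class C m X Y g" "G \<in> clift C (res C X) m (res C Y) g"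
    using yoneda_E[OF assms(2-6)] .
  obtain f F where f: "f \<in> cocycles C n W X" "\<zeta> = ext_class C n W X f" "F \<in> clift C (res C W) n (res C X) f"
    using yoneda_E[OF assms(1-3,6,7)] by metis
  have gF: "(\<lambda>i. G i \<bullet> F (m + i)) \<in> clift C (res C W) (m + n) (res C Y) (g \<bullet> F m)"
    using clift_comp[OF f(3) hg(5) res_resolves[OF assms(1)] res_resolves[OF assms(2)] res_resolves[OF assms(3)]]
    by (simp add: add.commute)
  note [simp] = cocyclesD(2-4)[OF hg(1)] homD[OF cliftD(1)[OF hg(5)]] homD[OF cliftD(1)[OF f(3)]] assms(1-4)
  have "yoneda C (l + m) n W X Z (yoneda C l m X Y Z \<xi> \<eta>) \<zeta> = ext_class C (l + m + n) W Z ((h \<bullet> G l) \<bullet> F (l + m))"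
    unfolding hg(2,4) f(2) yoneda_eq[OF assms(2-4) hg(1,3) hg(5)[folded lifts_clift]]
    by (rule yoneda_eq[OF assms(1,2,4) yoneda_cocycle[OF assms(2,3) hg(1,5)] f(1) f(3)[folded lifts_clift]])
  also have "\<dots> = ext_class C (l + (m + n)) W Z (h \<bullet> (G l \<bullet> F (m + l)))"
    by (simp add: ac_simps)
  also have "\<dots> = yoneda C l (m + n) W Y Z \<xi> (yoneda C m n W X Y \<eta> \<zeta>)"
    unfolding hg(2,4) f(2) yoneda_eq[OF assms(1-3) hg(3) f(1) f(3)[folded lifts_clift]]
    by (rule yoneda_eq[OF assms(1,3,4) hg(1) yoneda_cocycle[OF assms(1,2) hg(3) f(3)] gF[folded lifts_clift], symmetric])
  finally show ?thesis .
qed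

text \<open>A lift F of f satisfies \<open>res C Y 0 \<bullet> F 0 = f\<close>, so classes of degree
  0 act by composing with arrows. This yields the left unit law and the push-forward along a
  projection.\<close>

lemma yoneda_degree_0:
  assumes X: "X \<in> Obj C" and Y: "Y \<in> Obj C" and u: "u \<in> homset C Y Z" and f: "f \<in> cocycles C n X Y"
  shows "yoneda C 0 n X Y Z (ext_class C 0 Y Z (u \<bullet> res C Y 0)) (ext_class C n X Y f) = ext_class C n X Z (u \<bullet> f)"
proof -
  obtain F where F: "F \<in> lifts C n X Y f" using lifts_exist[OF X Y f] .
  note F' = cliftD[OF F[unfolded lifts_clift]]
  have "(u \<bullet> res C Y 0) \<bullet> F 0 = u \<bullet> f"
    using homD[OF u] homD[OF F'(1)] F'(2) X Y by simp
  then show ?thesis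
    using yoneda_eq[OF X Y _ cocycle_Comp[OF augmentation_cocycle[OF Y] u Y] f F] hom_Obj(2)[OF u] by simp
qed

lemma yoneda_one_left:
  assumes X: "X \<in> Obj C" and Y: "Y \<in> Obj C" and \<xi>: "\<xi> \<in> carrier (Ext C n X Y)"
  shows "yoneda C 0 n X Y Y (ext_class C 0 Y Y (res C Y 0)) \<xi> = \<xi>"
proof -
  obtain f where f: "f \<in> cocycles C n X Y" "\<xi> = ext_class C n X Y f"
    using Ext_E[OF X Y \<xi>] .
  then show ?thesis
    using yoneda_degree_0[OF X Y Ide_hom[OF Y] f(1)] Y cocyclesD[OF f(1)] by simp
qed

lemma yoneda_one_right:
  assumes X: "X \<in> Obj C" and Y: "Y \<in> Obj C" and \<xi>: "\<xi> \<in> carrier (Ext C n X Y)"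
  shows "yoneda C n 0 X X Y \<xi> (ext_class C 0 X X (res C X 0)) = \<xi>"
proof -
  obtain f where f: "f \<in> cocycles C n X Y" "\<xi> = ext_class C n X Y f"
    using Ext_E[OF X Y \<xi>] .
  have "(\<lambda>i. Ide C (resO C X i)) \<in> lifts C 0 X X (res C X 0)"
    using X Ide_hom by (simp add: lifts_def)
  then show ?thesis
    using yoneda_eq[OF X X Y f(1) augmentation_cocycle[OF X]] f cocyclesD[OF f(1)] X by simp
qed

section \<open>The tensored resolution and the homomorphism \<open>phi\<close>\<close>

lemma tensor_res_simps [simp]:
  assumes "A \<in> Obj C"
  shows "tensor_res C A i \<in> Arr C" "Dom C (tensor_res C A i) = resO C I i \<boxtimes> A"
    "Cod C (tensor_res C A 0) = A" "Cod C (tensor_res C A (Suc i)) = resO C I i \<boxtimes> A"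
  using assms by (cases i; simp add: tensor_res_def)+

lemma tensor_res_resolves:
  assumes A: "A \<in> Obj C"
  shows "resolves C A (tensor_res C A)"
  unfolding resolves_def
proof (intro conjI allI)
  have r: "resolves C I (res C I)" using res_resolves by simp
  have "epic C (res C I 0 \<star> Ide C A)" using r A tensor_epic' unfolding resolves_def by blast
  from epic_Comp[OF this iso_epic[OF LUnit_iso[OF A]]] A
  show "epic C (tensor_res C A 0)" by (simp add: tensor_res_def)
  show "Cod C (tensor_res C A 0) = A" using A by simp
  fix n
  have ex: "exact_at C (res C I (Suc n) \<star> Ide C A) (res C I n \<star> Ide C A)"
    using r tensor_exact[OF _ A] unfolding resolves_def by blast
  show "exact_at C (tensor_res C A (Suc n)) (tensor_res C A n)"
  proof (cases n)
    case 0
    then show ?thesis using exact_iso[OF ex LUnit_iso[OF A]] A by (simp add: tensor_res_def)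
  next
    case (Suc m)
    then show ?thesis using ex by (simp add: tensor_res_def)
  qed
qed

lemma tensor_lifts_clift:
  assumes "X \<in> Obj C"
  shows "tensor_lifts C X = clift C (res C X) 0 (tensor_res C X) (res C X 0)"
proof -
  have "LUnit C X \<bullet> (res C I 0 \<star> Ide C X) \<bullet> x = tensor_res C X 0 \<bullet> x"
    if "x \<in> homset C (resO C X 0) (resO C I 0 \<boxtimes> X)" for x
    using homD[OF that] assms by (simp add: tensor_res_def)
  moreover have "res C I (Suc i) \<star> Ide C X = tensor_res C X (Suc i)" for i
    by (simp add: tensor_res_def)
  ultimately show ?thesis
    using assms by (auto simp: tensor_lifts_def clift_def)
qed

lemma tensor_lifts_exist:
  assumes "X \<in> Obj C"
  obtains \<tau> where "\<tau> \<in> tensor_lifts C X"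
  using clift_exists[OF res_resolves[OF assms] res_projective[OF assms] tensor_res_resolves[OF assms]
      cocyclesD(1,5)[OF augmentation_cocycle[OF assms], folded res_simps(2)[OF assms]]]
  unfolding tensor_lifts_clift[OF assms] by blast

text \<open>Turns a cocycle on the resolution P of the unit into a cocycle on P \<otimes> X with
  values in X.\<close>

abbreviation (input) "twist X f \<equiv> LUnit C X \<bullet> (f \<star> Ide C X)"

lemma twist_cocycle:
  assumes X: "X \<in> Obj C" and f: "f \<in> cocycles C n I I"
  shows "twist X f \<in> homset C (Dom C (tensor_res C X n)) X"
    "twist X f \<bullet> tensor_res C X (Suc n) = zero_arrow C (Dom C (tensor_res C X (Suc n))) X"
proof -
  note [simp] = cocyclesD[OF f] X
  show "twist X f \<in> homset C (Dom C (tensor_res C X n)) X" by (intro homI) simp_all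
  have "twist X f \<bullet> tensor_res C X (Suc n) = LUnit C X \<bullet> ((f \<bullet> res C I (Suc n)) \<star> Ide C X)"
    by (simp add: tensor_res_def interchange)
  then show "twist X f \<bullet> tensor_res C X (Suc n) = zero_arrow C (Dom C (tensor_res C X (Suc n))) X"
    by simp
qed

lemma twist_add:
  assumes X: "X \<in> Obj C" and f: "f \<in> homset C Y I" "g \<in> homset C Y I"
  shows "twist X (f \<oplus>\<^bsub>HomMod C Y I\<^esub> g) = twist X f \<oplus>\<^bsub>HomMod C (Y \<boxtimes> X) X\<^esub> twist X g"
  using TensorA_add_left[OF f Ide_hom[OF X]]
    Comp_add_right[OF LUnit_hom[OF X] TensorA_hom[OF f(1) Ide_hom[OF X]] TensorA_hom[OF f(2) Ide_hom[OF X]]]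
  by simp

lemma twist_minus:
  assumes X: "X \<in> Obj C" and f: "f \<in> homset C Y I" "g \<in> homset C Y I"
  shows "twist X (f \<ominus>\<^bsub>HomMod C Y I\<^esub> g) = twist X f \<ominus>\<^bsub>HomMod C (Y \<boxtimes> X) X\<^esub> twist X g"
proof -
  have Y: "Y \<in> Obj C" using hom_Obj f by blast
  have t: "twist X h \<in> homset C (Y \<boxtimes> X) X" if "h \<in> homset C Y I" for h
    using Comp_hom[OF LUnit_hom[OF X] TensorA_hom[OF that Ide_hom[OF X]]] .
  show ?thesis
    using additive_map(3)[of "HomMod C Y I" "HomMod C (Y \<boxtimes> X) X" "twist X" f g]
      f X Y hom_group HomMod_carrier t twist_add[OF X, of _ Y] by simp
qed

lemma twist_cob:
  assumes X: "X \<in> Obj C" and f: "f \<in> cob C (res C I) n I"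
  shows "twist X f \<in> cob C (tensor_res C X) n X"
proof (cases n)
  case 0
  then show ?thesis using f X by (simp add: cob_def)
next
  case (Suc m)
  then obtain h where h: "h \<in> homset C (resO C I m) I" "f = h \<bullet> res C I (Suc m)"
    using f by (auto simp: cob_def)
  have "twist X f = twist X h \<bullet> tensor_res C X (Suc m)"
    using h homD[OF h(1)] X by (simp add: tensor_res_def interchange)
  moreover have "twist X h \<in> homset C (Dom C (tensor_res C X m)) X"
    using Comp_hom[OF LUnit_hom[OF X] TensorA_hom[OF h(1) Ide_hom[OF X]]] X by simp
  ultimately show ?thesis using Suc by (simp add: cob_def)
qed

text \<open>Stated for lifts of an arbitrary cocycle z from A to X: taking for z the augmentation of
  X gives well-definedness of \<open>phi_part\<close>, and general z gives the action on
  Ext.\<close>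

lemma twist_class:
  assumes A: "A \<in> Obj C" and X: "X \<in> Obj C" and f: "f \<in> cocycles C m I I" "f' \<in> cocycles C m I I"
    "ext_class C m I I f = ext_class C m I I f'"
    and z: "z \<in> cocycles C n A X" "z' \<in> cocycles C n A X" "ext_class C n A X z = ext_class C n A X z'"
    and \<psi>: "\<psi> \<in> clift C (res C A) n (tensor_res C X) z" "\<psi>' \<in> clift C (res C A) n (tensor_res C X) z'"
  shows "ext_class C (m + n) A X (twist X f \<bullet> \<psi> m) = ext_class C (m + n) A X (twist X f' \<bullet> \<psi>' m)"
proof -
  have "f \<ominus>\<^bsub>HomMod C (resO C I m) I\<^esub> f' \<in> cob C (res C I) m I"
    using ext_class_eq_iff[OF UnitO_Obj UnitO_Obj f(2,1)] f(3) by (simp add: coboundaries_cob)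
  from twist_cob[OF X this]
  have "ext_class C (m + n) A X (twist X f \<bullet> \<psi> m) = ext_class C (m + n) A X (twist X f' \<bullet> \<psi> m)"
    using twist_minus[OF X cocyclesD(1)[OF f(1)] cocyclesD(1)[OF f(2)]] X
    by (intro lift_class_unique_left[OF A tensor_res_resolves[OF X] \<psi>(1) twist_cocycle[OF X f(1)] twist_cocycle[OF X f(2)]])
      simp
  also have "\<dots> = ext_class C (m + n) A X (twist X f' \<bullet> \<psi>' m)"
    by (rule lift_class_unique[OF A tensor_res_resolves[OF X] \<psi> z twist_cocycle[OF X f(2)]])
  finally show ?thesis .
qed

lemma phi_part_eq:
  assumes X: "X \<in> Obj C" and f: "f \<in> cocycles C n I I" and \<tau>: "\<tau> \<in> tensor_lifts C X"
  shows "phi_part C X n (ext_class C n I I f) = ext_class C n X X (twist X f \<bullet> \<tau> n)"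
    "twist X f \<bullet> \<tau> n \<in> cocycles C n X X"
proof -
  have assoc: "LUnit C X \<bullet> (g \<star> Ide C X) \<bullet> \<phi> n = twist X g \<bullet> \<phi> n"
    if "g \<in> cocycles C n I I" "\<phi> \<in> tensor_lifts C X" for g \<phi>
  proof -
    have "\<phi> n \<in> homset C (resO C X n) (resO C I n \<boxtimes> X)" using that(2) by (simp add: tensor_lifts_def)
    from homD[OF this] show ?thesis using cocyclesD(2-4)[OF that(1)] X by simp
  qed
  show "phi_part C X n (ext_class C n I I f) = ext_class C n X X (twist X f \<bullet> \<tau> n)"
    unfolding phi_part_def
  proof (intro UN_const)
    show "ext_class C n I I f \<noteq> {}" using ext_class_self[OF UnitO_Obj UnitO_Obj f] by blast
    show "tensor_lifts C X \<noteq> {}" using \<tau> by blast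
    fix f' \<phi> assume f': "f' \<in> ext_class C n I I f" and \<phi>: "\<phi> \<in> tensor_lifts C X"
    note fc = ext_class_memD[OF UnitO_Obj UnitO_Obj f f']
    show "ext_class C n X X (LUnit C X \<bullet> (f' \<star> Ide C X) \<bullet> \<phi> n) = ext_class C n X X (twist X f \<bullet> \<tau> n)"
      unfolding assoc[OF fc(1) \<phi>]
      using twist_class[OF X X fc(1) f fc(2) augmentation_cocycle[OF X] augmentation_cocycle[OF X] refl
        \<phi>[unfolded tensor_lifts_clift[OF X]] \<tau>[unfolded tensor_lifts_clift[OF X]]] by simp
  qed
  show "twist X f \<bullet> \<tau> n \<in> cocycles C n X X"
    using lift_cocycle[OF X tensor_res_resolves[OF X] \<tau>[unfolded tensor_lifts_clift[OF X]] twist_cocycle[OF X f]]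
    by simp
qed

lemma phi_part_closed:
  assumes X: "X \<in> Obj C" and \<xi>: "\<xi> \<in> carrier (Ext C n I I)"
  shows "phi_part C X n \<xi> \<in> carrier (Ext C n X X)"
  using Ext_E[OF UnitO_Obj UnitO_Obj \<xi>] tensor_lifts_exist[OF X] phi_part_eq[OF X] Ext_I[OF X X] by metis

lemma phi_part_add:
  assumes X: "X \<in> Obj C" and \<xi>: "\<xi> \<in> carrier (Ext C n I I)" "\<xi>' \<in> carrier (Ext C n I I)"
  shows "phi_part C X n (\<xi> \<oplus>\<^bsub>Ext C n I I\<^esub> \<xi>') = phi_part C X n \<xi> \<oplus>\<^bsub>Ext C n X X\<^esub> phi_part C X n \<xi>'"
proof -
  obtain f where f: "f \<in> cocycles C n I I" "\<xi> = ext_class C n I I f" using Ext_E[OF _ _ \<xi>(1)] by auto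
  obtain f' where f': "f' \<in> cocycles C n I I" "\<xi>' = ext_class C n I I f'" using Ext_E[OF _ _ \<xi>(2)] by auto
  obtain \<tau> where \<tau>: "\<tau> \<in> tensor_lifts C X" using tensor_lifts_exist[OF X] .
  have tn: "\<tau> n \<in> homset C (resO C X n) (resO C I n \<boxtimes> X)" using \<tau> by (simp add: tensor_lifts_def)
  note ff = cocycles_closed(1)[OF UnitO_Obj UnitO_Obj f(1) f'(1)]
  show ?thesis
    unfolding f(2) f'(2) Ext_add[OF UnitO_Obj UnitO_Obj f(1) f'(1)]
      phi_part_eq(1)[OF X f(1) \<tau>] phi_part_eq(1)[OF X f'(1) \<tau>] phi_part_eq(1)[OF X ff \<tau>]
      Ext_add[OF X X phi_part_eq(2)[OF X f(1) \<tau>] phi_part_eq(2)[OF X f'(1) \<tau>]]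
    using twist_add[OF X cocyclesD(1)[OF f(1)] cocyclesD(1)[OF f'(1)]]
      Comp_add_left[OF _ _ tn] twist_cocycle(1)[OF X f(1)] twist_cocycle(1)[OF X f'(1)] X by simp
qed

text \<open>By definition the action lifts z to the resolution of X and then compares with P
  \<otimes> X. That composite is one lift of z into P \<otimes> X, and \<open>twist_class\<close>
  allows any other. Convenient choices of \<psi> give multiplicativity, naturality and graded
  commutativity.\<close>

lemma phi_act_eq:
  assumes A: "A \<in> Obj C" and X: "X \<in> Obj C" and f: "f \<in> cocycles C m I I" and z: "z \<in> cocycles C n A X"
    and \<psi>: "\<psi> \<in> clift C (res C A) n (tensor_res C X) z"
  shows "yoneda C m n A X X (phi_part C X m (ext_class C m I I f)) (ext_class C n A X z) =
    ext_class C (m + n) A X (twist X f \<bullet> \<psi> m)"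
proof -
  obtain \<tau> where \<tau>: "\<tau> \<in> tensor_lifts C X" using tensor_lifts_exist[OF X] .
  note \<tau>' = \<tau>[unfolded tensor_lifts_clift[OF X]]
  obtain Z where Z: "Z \<in> lifts C n A X z" using lifts_exist[OF A X z] .
  note Z' = Z[unfolded lifts_clift]
  have "(\<lambda>i. \<tau> i \<bullet> Z (0 + i)) \<in> clift C (res C A) (n + 0) (tensor_res C X) (res C X 0 \<bullet> Z 0)"
    by (rule clift_comp[OF Z' \<tau>' res_resolves[OF A] res_resolves[OF X] tensor_res_resolves[OF X]])
  then have \<psi>': "(\<lambda>i. \<tau> i \<bullet> Z i) \<in> clift C (res C A) n (tensor_res C X) z"
    using cliftD(2)[OF Z'] by simp
  note [simp] = homD[OF cliftD(1)[OF \<tau>']] homD[OF cliftD(1)[OF Z']] A X cocyclesD(2-4)[OF f]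
  have "yoneda C m n A X X (phi_part C X m (ext_class C m I I f)) (ext_class C n A X z) =
    ext_class C (m + n) A X ((twist X f \<bullet> \<tau> m) \<bullet> Z m)"
    unfolding phi_part_eq(1)[OF X f \<tau>] by (rule yoneda_eq[OF A X X phi_part_eq(2)[OF X f \<tau>] z Z])
  also have "\<dots> = ext_class C (m + n) A X (twist X f \<bullet> (\<tau> m \<bullet> Z m))"
    by simp
  also have "\<dots> = ext_class C (m + n) A X (twist X f \<bullet> \<psi> m)"
    by (rule twist_class[OF A X f f refl z z refl \<psi>' \<psi>])
  finally show ?thesis .
qed

text \<open>If F lifts f on the resolution of the unit, then F \<otimes> X is a chain map of degree
  n on P \<otimes> X lifting \<open>twist X f\<close>; preceded by \<tau> it is a lift as required
  in \<open>phi_act_eq\<close>.\<close>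

lemma phi_part_mult:
  assumes X: "X \<in> Obj C" and \<xi>: "\<xi> \<in> carrier (Ext C m I I)" and \<eta>: "\<eta> \<in> carrier (Ext C n I I)"
  shows "phi_part C X (m + n) (yoneda C m n I I I \<xi> \<eta>) =
    yoneda C m n X X X (phi_part C X m \<xi>) (phi_part C X n \<eta>)"
proof -
  obtain g f F where gf: "g \<in> cocycles C m I I" "\<xi> = ext_class C m I I g"
    "f \<in> cocycles C n I I" "\<eta> = ext_class C n I I f" "F \<in> clift C (res C I) n (res C I) f"
    using yoneda_E[OF UnitO_Obj UnitO_Obj UnitO_Obj \<xi> \<eta>] .
  obtain \<tau> where \<tau>: "\<tau> \<in> tensor_lifts C X" using tensor_lifts_exist[OF X] .
  note \<tau>' = \<tau>[unfolded tensor_lifts_clift[OF X]]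
  note [simp] = homD[OF cliftD(1)[OF \<tau>']] homD[OF cliftD(1)[OF gf(5)]] X cocyclesD(2-4)[OF gf(1)]
    cocyclesD(2-4)[OF gf(3)]
  have FX: "(\<lambda>i. F i \<star> Ide C X) \<in> clift C (tensor_res C X) n (tensor_res C X) (twist X f)"
    unfolding clift_def
  proof (intro CollectI conjI allI)
    fix i
    show "F i \<star> Ide C X \<in> homset C (Dom C (tensor_res C X (n + i))) (Dom C (tensor_res C X i))"
      by (intro homI) simp_all
    show "tensor_res C X 0 \<bullet> (F 0 \<star> Ide C X) = twist X f"
      using cliftD(2)[OF gf(5)] by (simp add: tensor_res_def interchange)
    show "tensor_res C X (Suc i) \<bullet> (F (Suc i) \<star> Ide C X) = (F i \<star> Ide C X) \<bullet> tensor_res C X (Suc (n + i))"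
      using cliftD(3)[OF gf(5), of i] by (simp add: tensor_res_def interchange)
  qed
  have \<psi>: "(\<lambda>i. (F i \<star> Ide C X) \<bullet> \<tau> (n + i)) \<in> clift C (res C X) n (tensor_res C X) (twist X f \<bullet> \<tau> n)"
    using clift_comp[OF \<tau>' FX res_resolves[OF X] tensor_res_resolves[OF X] tensor_res_resolves[OF X]] by simp
  have "yoneda C m n X X X (phi_part C X m \<xi>) (phi_part C X n \<eta>) =
     ext_class C (m + n) X X (twist X g \<bullet> ((F m \<star> Ide C X) \<bullet> \<tau> (n + m)))"
    unfolding gf(2,4) phi_part_eq(1)[OF X gf(3) \<tau>]
    by (rule phi_act_eq[OF X X gf(1) phi_part_eq(2)[OF X gf(3) \<tau>] \<psi>])
  also have "\<dots> = ext_class C (m + n) X X (twist X (g \<bullet> F m) \<bullet> \<tau> (m + n))"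
    by (simp add: Tensor_Comp_Ide add.commute)
  also have "\<dots> = phi_part C X (m + n) (yoneda C m n I I I \<xi> \<eta>)"
    unfolding gf(2,4) yoneda_eq[OF UnitO_Obj UnitO_Obj UnitO_Obj gf(1,3) gf(5)[folded lifts_clift]]
    by (rule phi_part_eq(1)[OF X yoneda_cocycle[OF UnitO_Obj UnitO_Obj gf(1,5)] \<tau>, symmetric])
  finally show ?thesis by simp
qed

lemma tensor_res_natural:
  assumes "u \<in> homset C A B"
  shows "tensor_res C B 0 \<bullet> (Ide C (resO C I 0) \<star> u) = u \<bullet> tensor_res C A 0"
    "tensor_res C B (Suc i) \<bullet> (Ide C (resO C I (Suc i)) \<star> u) = (Ide C (resO C I i) \<star> u) \<bullet> tensor_res C A (Suc i)"
proof -
  note [simp] = homD[OF assms] hom_Obj[OF assms]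
  have "tensor_res C B 0 \<bullet> (Ide C (resO C I 0) \<star> u) = (LUnit C B \<bullet> (Ide C I \<star> u)) \<bullet> (res C I 0 \<star> Ide C A)"
    by (simp add: tensor_res_def interchange)
  also have "\<dots> = u \<bullet> tensor_res C A 0"
    by (subst LUnit_nat[where X=A]) (simp_all add: tensor_res_def)
  finally show "tensor_res C B 0 \<bullet> (Ide C (resO C I 0) \<star> u) = u \<bullet> tensor_res C A 0" .
  show "tensor_res C B (Suc i) \<bullet> (Ide C (resO C I (Suc i)) \<star> u) = (Ide C (resO C I i) \<star> u) \<bullet> tensor_res C A (Suc i)"
    by (simp add: tensor_res_def interchange)
qed

text \<open>P \<otimes> p is a chain map over p, so it carries a lift of z into P \<otimes> M to a
  lift of \<open>p \<bullet> z\<close> into P \<otimes> X. This exchanges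
  \<open>phi_part C M\<close> for \<open>phi_part C X\<close>.\<close>

lemma phi_act_natural:
  assumes M: "M \<in> Obj C" and X: "X \<in> Obj C" and p: "p \<in> homset C M X"
    and \<xi>: "\<xi> \<in> carrier (Ext C m I I)" and \<eta>: "\<eta> \<in> carrier (Ext C n M M)"
  defines "\<pi> \<equiv> ext_class C 0 M X (p \<bullet> res C M 0)"
  shows "yoneda C 0 (m + n) M M X \<pi> (yoneda C m n M M M (phi_part C M m \<xi>) \<eta>) =
    yoneda C m n M X X (phi_part C X m \<xi>) (yoneda C 0 n M M X \<pi> \<eta>)"
proof -
  obtain f where f: "f \<in> cocycles C m I I" "\<xi> = ext_class C m I I f" using Ext_E[OF _ _ \<xi>] by auto
  obtain z where z: "z \<in> cocycles C n M M" "\<eta> = ext_class C n M M z" using Ext_E[OF M M \<eta>] .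
  obtain \<psi> where \<psi>: "\<psi> \<in> clift C (res C M) n (tensor_res C M) z"
    using clift_exists[OF res_resolves[OF M] res_projective[OF M] tensor_res_resolves[OF M]] 
      cocyclesD(1,5)[OF z(1)] M by auto
  note [simp] = homD[OF cliftD(1)[OF \<psi>]] M X cocyclesD(2-4)[OF f(1)] cocyclesD(2-4)[OF z(1)] homD[OF p]
  have "(\<lambda>i. Ide C (resO C I i) \<star> p) \<in> clift C (tensor_res C M) 0 (tensor_res C X) (p \<bullet> tensor_res C M 0)"
    using tensor_res_natural[OF p] by (auto simp: clift_def intro!: homI)
  from clift_comp[OF \<psi> this res_resolves[OF M] tensor_res_resolves[OF M] tensor_res_resolves[OF X]]
  have \<psi>': "(\<lambda>i. (Ide C (resO C I i) \<star> p) \<bullet> \<psi> i) \<in> clift C (res C M) n (tensor_res C X) (p \<bullet> z)"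
    using cliftD(2)[OF \<psi>] by simp
  note zc = lift_cocycle[OF M tensor_res_resolves[OF M] \<psi> twist_cocycle[OF M f(1)]]
  have "p \<bullet> (twist M f \<bullet> \<psi> m) = (p \<bullet> LUnit C M) \<bullet> ((f \<star> Ide C M) \<bullet> \<psi> m)"
    by simp
  also have "\<dots> = (LUnit C X \<bullet> (Ide C I \<star> p)) \<bullet> ((f \<star> Ide C M) \<bullet> \<psi> m)"
    by (subst LUnit_nat[where X=M]) simp_all
  also have "\<dots> = twist X f \<bullet> ((Ide C (resO C I m) \<star> p) \<bullet> \<psi> m)"
    by (simp add: interchange')
  finally have eq: "p \<bullet> (twist M f \<bullet> \<psi> m) = twist X f \<bullet> ((Ide C (resO C I m) \<star> p) \<bullet> \<psi> m)" .
  show ?thesis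
    unfolding f(2) z(2) \<pi>_def phi_act_eq[OF M M f(1) z(1) \<psi>] yoneda_degree_0[OF M M p zc] 
      yoneda_degree_0[OF M M p z(1)] eq
    by (rule phi_act_eq[OF M X f(1) cocycle_Comp[OF z(1) p M] \<psi>', symmetric])
qed

text \<open>The inverse right unit isomorphisms form a chain map from P to P \<otimes> I over the
  identity; since \<open>LUnit C I\<close> is \<open>RUnit C I\<close>, they undo the twist.\<close>

lemma phi_unit:
  assumes \<xi>: "\<xi> \<in> carrier (Ext C n I I)"
  shows "phi_part C I n \<xi> = \<xi>"
proof -
  obtain f where f: "f \<in> cocycles C n I I" "\<xi> = ext_class C n I I f" using Ext_E[OF _ _ \<xi>] by auto
  note [simp] = cocyclesD(2-4)[OF f(1)]
  have nat: "twist I g \<bullet> RUnit' W = g" if "g \<in> homset C W I" for g W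
  proof -
    note [simp] = homD[OF that] hom_Obj(1)[OF that]
    have "twist I g \<bullet> RUnit' W = RUnit C I \<bullet> ((g \<star> Ide C I) \<bullet> RUnit' W)"
      by (simp add: LUnit_eq_RUnit)
    also have "\<dots> = RUnit C I \<bullet> (RUnit' I \<bullet> g)"
      using RUnit'_nat[of g W I] by simp
    also have "\<dots> = g" using Comp_reassoc[OF Unit'_simps(10), of I g] by simp
    finally show ?thesis .
  qed
  have "(\<lambda>i. RUnit' (resO C I i)) \<in> tensor_lifts C I"
    unfolding tensor_lifts_def
  proof (intro CollectI conjI allI)
    fix i
    show "RUnit' (resO C I i) \<in> homset C (resO C I i) (resO C I i \<boxtimes> I)" by (intro homI) simp_all
    show "LUnit C I \<bullet> (res C I 0 \<star> Ide C I) \<bullet> RUnit' (resO C I 0) = res C I 0"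
      using nat[of "res C I 0" "resO C I 0"] by (simp add: homset_def)
    show "(res C I (Suc i) \<star> Ide C I) \<bullet> RUnit' (resO C I (Suc i)) = RUnit' (resO C I i) \<bullet> res C I (Suc i)"
      by (rule RUnit'_nat[symmetric]) simp_all
  qed
  from phi_part_eq(1)[OF UnitO_Obj f(1) this] show ?thesis
    using nat[OF cocyclesD(1)[OF f(1)]] f(2) by simp
qed

end

section \<open>Graded commutativity of the cohomology ring\<close>

context finite_tensor_category
begin

text \<open>This is f - (-1)^i g: the sign rule of the total complex of P \<otimes> P, solved for
  the term with d \<otimes> 1.\<close>

definition signed_add where
  "signed_add i X Y f g = (if even i then f \<ominus>\<^bsub>HomMod C X Y\<^esub> g else f \<oplus>\<^bsub>HomMod C X Y\<^esub> g)" for i :: nat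

lemma signed_add_hom: "\<lbrakk>f \<in> homset C X Y; g \<in> homset C X Y\<rbrakk> \<Longrightarrow> signed_add i X Y f g \<in> homset C X Y"
  by (simp add: signed_add_def minus_hom add_hom)

lemma signed_add_Comp_right:
  assumes "f \<in> homset C X Y" "g \<in> homset C X Y" "h \<in> homset C Y Z"
  shows "h \<bullet> signed_add i X Y f g = signed_add i X Z (h \<bullet> f) (h \<bullet> g)"
  using Comp_additive_right(3)[OF assms(3) _ assms(1,2)] Comp_add_right[OF assms(3,1,2)] hom_Obj(1)[OF assms(1)]
  by (simp add: signed_add_def)

lemma signed_add_Comp_left:
  assumes "f \<in> homset C Y Z" "g \<in> homset C Y Z" "h \<in> homset C X Y"
  shows "signed_add i Y Z f g \<bullet> h = signed_add i X Z (f \<bullet> h) (g \<bullet> h)"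
  using Comp_additive_left(3)[OF assms(3) _ assms(1,2)] Comp_add_left[OF assms] hom_Obj(2)[OF assms(1)]
  by (simp add: signed_add_def)

text \<open>The two mixed terms in the square of the total differential carry opposite
  signs.\<close>

lemma signed_add_cancel:
  assumes u: "u \<in> homset C X Y"
  shows "signed_add (Suc i) X Y (signed_add i X Y (zero_arrow C X Y) u) (signed_add i X Y u (zero_arrow C X Y)) = zero_arrow C X Y"
proof -
  interpret H: abelian_group "HomMod C X Y" using hom_group'[OF u] .
  have uc: "u \<in> carrier (HomMod C X Y)" using u hom_carrier[OF u] by simp
  show ?thesis
    by (cases "even i") (simp_all add: signed_add_def minus_zero[OF u] minus_self[OF u] uc a_minus_def[of _ "zero_arrow C X Y" u] H.l_neg)
qed

lemma signed_add_zero_right: "f \<in> homset C X Y \<Longrightarrow> signed_add i X Y f (zero_arrow C X Y) = f"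
proof -
  assume f: "f \<in> homset C X Y"
  interpret H: abelian_group "HomMod C X Y" using hom_group'[OF f] .
  show "signed_add i X Y f (zero_arrow C X Y) = f"
    using minus_zero[OF f] H.r_zero f hom_carrier[OF f] by (simp add: signed_add_def)
qed

text \<open>The components \<open>P\<^sub>i\<^sub>+\<^sub>j \<rightarrow> P\<^sub>i \<otimes> P\<^sub>j\<close> of a chain map from the resolution \<open>P\<close> of the unit to the
  total complex of \<open>P \<otimes> P\<close>. They are found by recursion on \<open>i\<close>, using only that each row
  \<open>P \<otimes> P\<^sub>j\<close> resolves \<open>P\<^sub>j\<close>, so that exactness of the total complex is not needed.\<close>

lemma diagonal_exists:
  "\<exists>\<Delta>. (\<forall>i j. \<Delta> i j \<in> homset C (resO C I (i + j)) (resO C I i \<boxtimes> resO C I j)) \<and>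
    (\<forall>j. tensor_res C (resO C I j) 0 \<bullet> \<Delta> 0 j = Ide C (resO C I j)) \<and>
    (\<forall>i j. tensor_res C (resO C I j) (Suc i) \<bullet> \<Delta> (Suc i) j =
       signed_add i (resO C I (Suc (i + j))) (resO C I i \<boxtimes> resO C I j)
         (\<Delta> i j \<bullet> res C I (Suc (i + j))) ((Ide C (resO C I i) \<star> res C I (Suc j)) \<bullet> \<Delta> i (Suc j)))"
proof -
  let ?P = "resO C I" and ?d = "res C I" and ?t = "\<lambda>j. tensor_res C (resO C I j)"
  let ?H = "\<lambda>i x. \<forall>j. x j \<in> homset C (?P (i + j)) (?P i \<boxtimes> ?P j)"
  let ?R = "\<lambda>i x j. signed_add i (?P (Suc (i + j))) (?P i \<boxtimes> ?P j) (x j \<bullet> ?d (Suc (i + j))) 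
     ((Ide C (?P i) \<star> ?d (Suc j)) \<bullet> x (Suc j))"
  \<comment> \<open>The last conjunct says that the prescribed boundary of the next component is a
    cycle in row j, as exactness of the row requires. This boundary uses the components for j and j
    + 1, so each step of the recursion builds all j at once.\<close>
  let ?S = "\<lambda>i x. ?H i x \<and> (i = 0 \<longrightarrow> (\<forall>j. ?t j 0 \<bullet> x j = Ide C (?P j))) \<and>
     (\<forall>j. ?t j i \<bullet> ?R i x j = zero_arrow C (?P (Suc (i + j))) (Cod C (?t j i)))"
  have dS: "?d (Suc j) \<in> homset C (?P (Suc j)) (?P j)" for j by (intro homI) simp_all
  have t: "?t j i \<in> homset C (?P i \<boxtimes> ?P j) (Cod C (?t j i))" for i j by (intro homI) simp_all
  have Rhom: "x j \<bullet> ?d (Suc (i + j)) \<in> homset C (?P (Suc (i + j))) (?P i \<boxtimes> ?P j)"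
    "(Ide C (?P i) \<star> ?d (Suc j)) \<bullet> x (Suc j) \<in> homset C (?P (Suc (i + j))) (?P i \<boxtimes> ?P j)"
    if "?H i x" for i x j
  proof -
    have x: "x j \<in> homset C (?P (i + j)) (?P i \<boxtimes> ?P j)" "x (Suc j) \<in> homset C (?P (i + Suc j)) (?P i \<boxtimes> ?P (Suc j))"
      using that by blast+
    show "x j \<bullet> ?d (Suc (i + j)) \<in> homset C (?P (Suc (i + j))) (?P i \<boxtimes> ?P j)"
      using Comp_hom[OF x(1) dS] .
    show "(Ide C (?P i) \<star> ?d (Suc j)) \<bullet> x (Suc j) \<in> homset C (?P (Suc (i + j))) (?P i \<boxtimes> ?P j)"
      using Comp_hom[OF TensorA_hom[OF Ide_hom dS] x(2)] by simp
  qed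
  have "\<exists>\<Delta>. \<forall>i. ?S i (\<Delta> i) \<and> (\<forall>j. ?t j (Suc i) \<bullet> \<Delta> (Suc i) j = ?R i (\<Delta> i) j)"
  proof (rule dependent_nat_choice)
    \<comment> \<open>In row j the augmentation from \<open>?P 0 \<boxtimes> ?P j\<close> is an epi
      onto the projective \<open>?P j\<close>, so it has a section.\<close>
    have "\<exists>x. x \<in> homset C (?P j) (?P 0 \<boxtimes> ?P j) \<and> ?t j 0 \<bullet> x = Ide C (?P j)" for j
      using projective_lift[OF res_projective[OF UnitO_Obj, of j], of "?t j 0" "Ide C (?P j)"]
        tensor_res_resolves[of "?P j"] Ide_hom[of "?P j"] unfolding resolves_def by auto
    then obtain x where x: "\<And>j. x j \<in> homset C (?P j) (?P 0 \<boxtimes> ?P j)" "\<And>j. ?t j 0 \<bullet> x j = Ide C (?P j)"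
      by metis
    have "?t j 0 \<bullet> ?R 0 x j = zero_arrow C (?P (Suc j)) (?P j)" for j
    proof -
      note [simp] = homD[OF x(1)]
      have H: "?H 0 x" using x(1) by simp
      have "?t j 0 \<bullet> ?R 0 x j = signed_add 0 (?P (Suc j)) (?P j) (?t j 0 \<bullet> (x j \<bullet> ?d (Suc j)))
        (?t j 0 \<bullet> ((Ide C (?P 0) \<star> ?d (Suc j)) \<bullet> x (Suc j)))"
        using signed_add_Comp_right[OF Rhom[OF H, of j] t[of j 0]] by simp
      also have "?t j 0 \<bullet> (x j \<bullet> ?d (Suc j)) = ?d (Suc j)"
        using Comp_reassoc[OF x(2)[of j], of "?d (Suc j)"] by simp
      also have "?t j 0 \<bullet> ((Ide C (?P 0) \<star> ?d (Suc j)) \<bullet> x (Suc j)) = ?d (Suc j)"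
        using Comp_reassoc[OF tensor_res_natural(1)[OF dS[of j]], of "x (Suc j)"] x(2)[of "Suc j"] by simp
      also have "signed_add 0 (?P (Suc j)) (?P j) (?d (Suc j)) (?d (Suc j)) = zero_arrow C (?P (Suc j)) (?P j)"
        using minus_self[OF dS] by (simp add: signed_add_def)
      finally show ?thesis .
    qed
    then show "\<exists>x. ?S 0 x" using x by (intro exI[of _ x]) simp
  next
    fix x i assume S: "?S i x"
    then have H: "?H i x" by blast
    note [simp] = homD[OF H[rule_format]]
    have "\<exists>y. y \<in> homset C (?P (Suc (i + j))) (Dom C (?t j (Suc i))) \<and> ?t j (Suc i) \<bullet> y = ?R i x j" for j
    proof -
      have ex: "exact_at C (?t j (Suc i)) (?t j i)"
        using tensor_res_resolves[of "?P j"] unfolding resolves_def by simp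
      have R: "?R i x j \<in> homset C (?P (Suc (i + j))) (Dom C (?t j i))"
        using signed_add_hom[OF Rhom[OF H]] by simp
      have P: "projective_obj C (?P (Suc (i + j)))"
        using res_projective[OF UnitO_Obj, of "Suc (i + j)"] by simp
      have z: "?t j i \<bullet> ?R i x j = zero_arrow C (?P (Suc (i + j))) (Cod C (?t j i))"
        using conjunct2[OF conjunct2[OF S]] by (rule spec)
      show ?thesis
        by (rule exact_lift[OF ex P R z]) (intro exI conjI)
    qed
    then obtain y where y: "\<And>j. y j \<in> homset C (?P (Suc (i + j))) (?P (Suc i) \<boxtimes> ?P j)"
      "\<And>j. ?t j (Suc i) \<bullet> y j = ?R i x j" by (simp, metis)
    have Hy: "?H (Suc i) y" using y(1) by simp
    note [simp] = homD[OF y(1)]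
    have "?t j (Suc i) \<bullet> ?R (Suc i) y j = zero_arrow C (?P (Suc (Suc i + j))) (?P i \<boxtimes> ?P j)" for j
    proof -
      let ?X = "?P (Suc (Suc (i + j)))" and ?Y = "?P i \<boxtimes> ?P j"
      \<comment> \<open>Both halves of the prescribed boundary contribute this mixed term, once for
        each order of the two differentials; \<open>signed_add_cancel\<close> removes it.\<close>
      define u where "u = (Ide C (?P i) \<star> ?d (Suc j)) \<bullet> (x (Suc j) \<bullet> ?d (Suc (Suc (i + j))))"
      have u: "u \<in> homset C ?X ?Y" unfolding u_def by (intro homI) simp_all
      have "?t j (Suc i) \<bullet> ?R (Suc i) y j = signed_add (Suc i) ?X ?Y (?t j (Suc i) \<bullet> (y j \<bullet> ?d (Suc (Suc (i + j)))))
        (?t j (Suc i) \<bullet> ((Ide C (?P (Suc i)) \<star> ?d (Suc j)) \<bullet> y (Suc j)))"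
        using signed_add_Comp_right[OF Rhom[OF Hy, of j] t[of j "Suc i"]] by simp
      also have "?t j (Suc i) \<bullet> (y j \<bullet> ?d (Suc (Suc (i + j)))) = ?R i x j \<bullet> ?d (Suc (Suc (i + j)))"
        using Comp_reassoc[OF y(2)[of j], of "?d (Suc (Suc (i + j)))"] by simp
      also have "\<dots> = signed_add i ?X ?Y (zero_arrow C ?X ?Y) u"
        using signed_add_Comp_left[OF Rhom[OF H, of j] dS] by (simp add: u_def)
      also have "?t j (Suc i) \<bullet> ((Ide C (?P (Suc i)) \<star> ?d (Suc j)) \<bullet> y (Suc j)) =
        (Ide C (?P i) \<star> ?d (Suc j)) \<bullet> ?R i x (Suc j)"
        using Comp_reassoc[OF tensor_res_natural(2)[OF dS[of j], of i], of "y (Suc j)"] y(2)[of "Suc j"] by simp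
      also have "\<dots> = signed_add i ?X ?Y u (zero_arrow C ?X ?Y)"
      proof -
        have "(Ide C (?P i) \<star> ?d (Suc j)) \<bullet> ((Ide C (?P i) \<star> ?d (Suc (Suc j))) \<bullet> x (Suc (Suc j))) = zero_arrow C ?X ?Y"
          by (simp add: interchange')
        then show ?thesis
          using signed_add_Comp_right[OF Rhom[OF H, of "Suc j"] TensorA_hom[OF Ide_hom dS, of "?P i" j]] by (simp add: u_def)
      qed
      finally show ?thesis using signed_add_cancel[OF u] by simp
    qed
    then show "\<exists>y. ?S (Suc i) y \<and> (\<forall>j. ?t j (Suc i) \<bullet> y j = ?R i x j)"
      using y by (intro exI[of _ y]) simp
  qed
  then obtain \<Delta> where \<Delta>: "\<forall>i. ?S i (\<Delta> i) \<and> (\<forall>j. ?t j (Suc i) \<bullet> \<Delta> (Suc i) j = ?R i (\<Delta> i) j)"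
    by (rule exE)
  have S: "?S i (\<Delta> i)" for i using spec[OF \<Delta>, of i] by (rule conjunct1)
  show ?thesis
  proof (intro exI[of _ \<Delta>] conjI allI)
    fix i j
    show "\<Delta> i j \<in> homset C (?P (i + j)) (?P i \<boxtimes> ?P j)"
      using conjunct1[OF S[of i]] by (rule spec)
    show "?t j 0 \<bullet> \<Delta> 0 j = Ide C (?P j)"
      using mp[OF conjunct1[OF conjunct2[OF S[of 0]]] refl] by (rule spec)
    show "?t j (Suc i) \<bullet> \<Delta> (Suc i) j = ?R i (\<Delta> i) j"
      using conjunct2[OF spec[OF \<Delta>, of i]] by (rule spec)
  qed
qed

text \<open>Both products are read off from c, the value of f \<otimes> z on the diagonal
  approximation. Applying z in the second factor gives a lift of z into P \<otimes> I, so
  \<xi>\<eta> is the class of c. Applying f in the first factor gives, after a change of signs, a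
  lift of a representative of \<xi>, so \<eta>\<xi> is the same class up to sign.\<close>

lemma yoneda_graded_commute:
  assumes \<xi>: "\<xi> \<in> carrier (Ext C m I I)" and \<eta>: "\<eta> \<in> carrier (Ext C n I I)"
  shows "yoneda C n m I I I \<eta> \<xi> = (if odd m \<and> odd n then \<ominus>\<^bsub>Ext C (m + n) I I\<^esub> yoneda C m n I I I \<xi> \<eta>
     else yoneda C m n I I I \<xi> \<eta>)"
proof -
  obtain f where f: "f \<in> cocycles C m I I" "\<xi> = ext_class C m I I f" using Ext_E[OF _ _ \<xi>] by auto
  obtain z where z: "z \<in> cocycles C n I I" "\<eta> = ext_class C n I I z" using Ext_E[OF _ _ \<eta>] by auto
  let ?P = "resO C I" and ?d = "res C I"
  obtain \<Delta> where \<Delta>':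
    "\<forall>i j. \<Delta> i j \<in> homset C (?P (i + j)) (?P i \<boxtimes> ?P j)"
    "\<forall>j. tensor_res C (?P j) 0 \<bullet> \<Delta> 0 j = Ide C (?P j)"
    "\<forall>i j. tensor_res C (?P j) (Suc i) \<bullet> \<Delta> (Suc i) j = signed_add i (?P (Suc (i + j))) (?P i \<boxtimes> ?P j)
         (\<Delta> i j \<bullet> ?d (Suc (i + j))) ((Ide C (?P i) \<star> ?d (Suc j)) \<bullet> \<Delta> i (Suc j))"
    using diagonal_exists by blast
  note \<Delta> = \<Delta>'[rule_format]
  note [simp] = homD[OF \<Delta>(1)] cocyclesD(2-4)[OF f(1)] cocyclesD(2-4)[OF z(1)]
  have dS: "?d (Suc j) \<in> homset C (?P (Suc j)) (?P j)" for j by (intro homI) simp_all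
  have rhs: "\<Delta> i j \<bullet> ?d (Suc (i + j)) \<in> homset C (?P (Suc (i + j))) (?P i \<boxtimes> ?P j)"
    "(Ide C (?P i) \<star> ?d (Suc j)) \<bullet> \<Delta> i (Suc j) \<in> homset C (?P (Suc (i + j))) (?P i \<boxtimes> ?P j)" for i j
    by (auto intro!: homI)
  define c where "c = LUnit C I \<bullet> ((f \<star> z) \<bullet> \<Delta> m n)"
  \<comment> \<open>The cocycle v kills the term with 1 \<otimes> d, so fixing the second index
    leaves a chain map without signs.\<close>
  have slice: "(\<lambda>i. (Ide C (?P i) \<star> v) \<bullet> \<Delta> i k) \<in> clift C ?d k (tensor_res C I) v"
    if v: "v \<in> cocycles C k I I" for v k
    unfolding clift_def
  proof (intro CollectI conjI allI)
    note vv = cocyclesD[OF v]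
    note [simp] = vv(2-4)
    fix i
    show "(Ide C (?P i) \<star> v) \<bullet> \<Delta> i k \<in> homset C (Dom C (?d (k + i))) (Dom C (tensor_res C I i))"
      by (intro homI) (simp_all add: add.commute)
    show "tensor_res C I 0 \<bullet> ((Ide C (?P 0) \<star> v) \<bullet> \<Delta> 0 k) = v"
      using Comp_reassoc[OF tensor_res_natural(1)[OF vv(1)], of "\<Delta> 0 k"] \<Delta>(2)[of k] by simp
    have "tensor_res C I (Suc i) \<bullet> ((Ide C (?P (Suc i)) \<star> v) \<bullet> \<Delta> (Suc i) k) =
      (Ide C (?P i) \<star> v) \<bullet> (tensor_res C (?P k) (Suc i) \<bullet> \<Delta> (Suc i) k)"
      using Comp_reassoc[OF tensor_res_natural(2)[OF vv(1), of i], of "\<Delta> (Suc i) k"] by simp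
    also have "\<dots> = signed_add i (?P (Suc (i + k))) (?P i \<boxtimes> I) ((Ide C (?P i) \<star> v) \<bullet> (\<Delta> i k \<bullet> ?d (Suc (i + k))))
       ((Ide C (?P i) \<star> v) \<bullet> ((Ide C (?P i) \<star> ?d (Suc k)) \<bullet> \<Delta> i (Suc k)))"
      unfolding \<Delta>(3) by (rule signed_add_Comp_right[OF rhs TensorA_hom[OF Ide_hom vv(1)]]) simp
    also have "(Ide C (?P i) \<star> v) \<bullet> ((Ide C (?P i) \<star> ?d (Suc k)) \<bullet> \<Delta> i (Suc k)) = 
        zero_arrow C (?P (Suc (i + k))) (?P i \<boxtimes> I)"
      using vv(5) by (simp add: interchange')
    also have "signed_add i (?P (Suc (i + k))) (?P i \<boxtimes> I) ((Ide C (?P i) \<star> v) \<bullet> (\<Delta> i k \<bullet> ?d (Suc (i + k))))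
        (zero_arrow C (?P (Suc (i + k))) (?P i \<boxtimes> I)) = (Ide C (?P i) \<star> v) \<bullet> (\<Delta> i k \<bullet> ?d (Suc (i + k)))"
      by (rule signed_add_zero_right) (auto intro!: homI)
    finally show "tensor_res C I (Suc i) \<bullet> ((Ide C (?P (Suc i)) \<star> v) \<bullet> \<Delta> (Suc i) k) =
       ((Ide C (?P i) \<star> v) \<bullet> \<Delta> i k) \<bullet> ?d (Suc (k + i))"
      by (simp add: add.commute)
  qed
  have left: "yoneda C m n I I I \<xi> \<eta> = ext_class C (m + n) I I c"
  proof -
    have "yoneda C m n I I I \<xi> \<eta> = ext_class C (m + n) I I (twist I f \<bullet> ((Ide C (?P m) \<star> z) \<bullet> \<Delta> m n))"
      using phi_act_eq[OF UnitO_Obj UnitO_Obj f(1) z(1) slice[OF z(1)]] phi_unit[OF \<xi>] by (simp add: f(2) z(2))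
    then show ?thesis by (simp add: c_def interchange')
  qed
  have c: "c \<in> cocycles C (m + n) I I"
    using lift_cocycle[OF UnitO_Obj tensor_res_resolves[OF UnitO_Obj] slice[OF z(1)] twist_cocycle[OF UnitO_Obj f(1)]]
    by (simp add: c_def interchange')
  \<comment> \<open>Evaluating f on the first factor kills the term with d \<otimes> 1 instead, so V
    commutes with the differentials only up to (-1)^m.\<close>
  define V where "V j = LUnit C (?P j) \<bullet> ((f \<star> Ide C (?P j)) \<bullet> \<Delta> m j)" for j
  have V: "V j \<in> homset C (?P (m + j)) (?P j)" for j unfolding V_def by (intro homI) simp_all
  have LV: "u \<bullet> V j = LUnit C Y \<bullet> ((f \<star> u) \<bullet> \<Delta> m j)" if u: "u \<in> homset C (?P j) Y" for u Y j
  proof -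
    note [simp] = homD[OF u] hom_Obj(2)[OF u]
    have "u \<bullet> V j = (LUnit C Y \<bullet> (Ide C I \<star> u)) \<bullet> ((f \<star> Ide C (?P j)) \<bullet> \<Delta> m j)"
      unfolding V_def by (subst LUnit_nat[where X="?P j"]) simp_all
    then show ?thesis by (simp add: interchange')
  qed
  have Vd: "?d (Suc j) \<bullet> V (Suc j) = (if even m then V j \<bullet> ?d (Suc (m + j))
      else \<ominus>\<^bsub>HomMod C (?P (Suc (m + j))) (?P j)\<^esub> (V j \<bullet> ?d (Suc (m + j))))" for j
  proof -
    let ?X = "?P (Suc (m + j))"
    let ?g = "LUnit C (?P j) \<bullet> (f \<star> Ide C (?P j))"
    have g: "?g \<in> homset C (?P m \<boxtimes> ?P j) (?P j)" by (intro homI) simp_all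
    have z: "?g \<bullet> tensor_res C (?P j) (Suc m) = zero_arrow C (Dom C (tensor_res C (?P j) (Suc m))) (?P j)"
      by (rule twist_cocycle(2)[OF _ f(1)]) simp
    have "?g \<bullet> (tensor_res C (?P j) (Suc m) \<bullet> \<Delta> (Suc m) j) = zero_arrow C ?X (?P j)"
      using Comp_reassoc[OF z, of "\<Delta> (Suc m) j"] by simp
    then have "signed_add m ?X (?P j) (?g \<bullet> (\<Delta> m j \<bullet> ?d (Suc (m + j))))
       (?g \<bullet> ((Ide C (?P m) \<star> ?d (Suc j)) \<bullet> \<Delta> m (Suc j))) = zero_arrow C ?X (?P j)"
      unfolding \<Delta>(3) signed_add_Comp_right[OF rhs g] .
    moreover have "?g \<bullet> (\<Delta> m j \<bullet> ?d (Suc (m + j))) = V j \<bullet> ?d (Suc (m + j))"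
      by (simp add: V_def)
    moreover have "?g \<bullet> ((Ide C (?P m) \<star> ?d (Suc j)) \<bullet> \<Delta> m (Suc j)) = ?d (Suc j) \<bullet> V (Suc j)"
      unfolding LV[OF dS] by (simp add: interchange')
    ultimately have e: "signed_add m ?X (?P j) (V j \<bullet> ?d (Suc (m + j))) (?d (Suc j) \<bullet> V (Suc j)) = zero_arrow C ?X (?P j)"
      by simp
    have h: "V j \<bullet> ?d (Suc (m + j)) \<in> homset C ?X (?P j)" "?d (Suc j) \<bullet> V (Suc j) \<in> homset C ?X (?P j)"
      using homD[OF V] by (auto intro!: homI)
    show ?thesis
    proof (cases "even m")
      case True
      then show ?thesis using e minus_zero_iff[OF h] by (simp add: signed_add_def)
    next
      case False
      interpret H: abelian_group "HomMod C ?X (?P j)" using hom_group'[OF h(1)] .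
      show ?thesis
        using e False h hom_carrier[OF h(1)] H.minus_equality[of "?d (Suc j) \<bullet> V (Suc j)" "V j \<bullet> ?d (Suc (m + j))"]
          H.a_comm by (simp add: signed_add_def)
    qed
  qed
  have neg2: "\<ominus>\<^bsub>HomMod C X Y\<^esub> (\<ominus>\<^bsub>HomMod C X Y\<^esub> g) = g" if "g \<in> homset C X Y" for X Y g
    using abelian_group.minus_minus[OF hom_group'[OF that]] that hom_carrier[OF that] by simp
  \<comment> \<open>The factor (-1)^(mj) turns V into a strict chain map.\<close>
  define W where "W j = (if odd m \<and> odd j then \<ominus>\<^bsub>HomMod C (?P (m + j)) (?P j)\<^esub> V j else V j)" for j
  have W: "W j \<in> homset C (?P (m + j)) (?P j)" for j
    using V[of j] neg_hom[OF V[of j]] by (simp add: W_def)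
  \<comment> \<open>W lifts this cocycle rather than f. It represents \<xi> too: the slice at the
    augmentation is a tensor lift of the unit, so f' represents the image of \<xi> under
    \<open>phi_part C I m\<close>, and \<open>phi_unit\<close> applies.\<close>
  define f' where "f' = ?d 0 \<bullet> V 0"
  have "W \<in> clift C ?d m ?d f'"
    unfolding clift_def
  proof (intro CollectI conjI allI)
    fix j
    show "W j \<in> homset C (Dom C (?d (m + j))) (Dom C (?d j))" using W by simp
    show "?d 0 \<bullet> W 0 = f'" by (simp add: W_def f'_def)
    have VS: "V (Suc j) \<in> homset C (?P (Suc (m + j))) (?P (Suc j))" using V[of "Suc j"] by simp
    have dd: "?d (Suc (m + j)) \<in> homset C (?P (Suc (m + j))) (?P (m + j))" using dS .
    have Vjd: "V j \<bullet> ?d (Suc (m + j)) \<in> homset C (?P (Suc (m + j))) (?P j)" using Comp_hom[OF V dd] .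
    show "?d (Suc j) \<bullet> W (Suc j) = W j \<bullet> ?d (Suc (m + j))"
      using Vd[of j] Comp_additive_right(2)[OF dS _ VS] Comp_additive_left(2)[OF dd _ V[of j]] neg2[OF Vjd]
      by (simp add: W_def)
  qed
  then have Wl: "W \<in> lifts C m I I f'" by (simp add: lifts_clift)
  have d0: "?d 0 \<in> homset C (?P 0) I" by (intro homI) simp_all
  have f': "f' = twist I f \<bullet> ((Ide C (?P m) \<star> ?d 0) \<bullet> \<Delta> m 0)"
    unfolding f'_def LV[OF d0] by (simp add: interchange')
  have f'c: "f' \<in> cocycles C m I I" "ext_class C m I I f' = \<xi>"
    using phi_part_eq[OF UnitO_Obj f(1), of "\<lambda>i. (Ide C (?P i) \<star> ?d 0) \<bullet> \<Delta> i 0"]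
      slice[OF augmentation_cocycle[OF UnitO_Obj]] tensor_lifts_clift[OF UnitO_Obj] phi_unit[OF \<xi>] f(2) f'
    by simp_all
  have "yoneda C n m I I I \<eta> \<xi> = ext_class C (n + m) I I (z \<bullet> W n)"
    using yoneda_eq[OF UnitO_Obj UnitO_Obj UnitO_Obj z(1) f'c(1) Wl] f'c(2) z(2) by simp
  moreover have "z \<bullet> W n = (if odd m \<and> odd n then \<ominus>\<^bsub>HomMod C (?P (m + n)) I\<^esub> c else c)"
    using LV[OF cocyclesD(1)[OF z(1)]] Comp_additive_right(2)[OF cocyclesD(1)[OF z(1)] _ V[of n]]
    by (simp add: W_def c_def)
  ultimately show ?thesis
    unfolding left using Ext_neg[OF UnitO_Obj UnitO_Obj c] by (simp add: add.commute)
qed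

text \<open>The augmentation is epic and its kernel is the image of \<open>res C X 1\<close>, so a
  cocycle of degree 0 descends to X: Ext in degree 0 is Hom.\<close>

lemma degree_0_factor:
  assumes X: "X \<in> Obj C" and f: "f \<in> cocycles C 0 X Y"
  obtains u where "u \<in> homset C X Y" "u \<bullet> res C X 0 = f"
proof -
  have r: "resolves C X (res C X)" using res_resolves[OF X] .
  have "exact_at C (res C X 1) (res C X 0)" using r unfolding resolves_def by simp
  then obtain e k where ek: "epic C e" "is_kernel C k (res C X 0)" "Cod C e = Dom C k" "res C X 1 = k \<bullet> e"
    unfolding exact_at_def by blast
  note kk = kernelD[OF ek(2)] and fc = cocyclesD[OF f]
  have [simp]: "e \<in> Arr C" "k \<in> Arr C" "Cod C k = resO C X 0" "Dom C e \<in> Obj C" "Dom C k \<in> Obj C" "Y \<in> Obj C"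
    using epic_Arr[OF ek(1)] kk Dom_Obj X hom_Obj(2)[OF fc(1)] by auto
  have "Dom C (k \<bullet> e) = Dom C e" using ek(3) by simp
  then have de: "Dom C e = resO C X 1" using ek(4) res_simps(2)[OF X, of 1] by simp
  have "(f \<bullet> k) \<bullet> e = zero_arrow C (Dom C k) Y \<bullet> e"
    using fc ek(3,4) de by simp
  then have fk: "f \<bullet> k = zero_arrow C (Dom C k) Y"
    by (rule epicD[OF ek(1), rotated -1]) (use fc ek in simp_all)
  show thesis
    using epic_factor[OF _ ek(2) _ fk] r fc(1) that X unfolding resolves_def by auto
qed

text \<open>By \<open>degree_0_factor\<close> a nonzero class comes from a nonzero endomorphism of
  the simple unit object, which is invertible by Schur's lemma.\<close>

lemma unit_End_division:
  assumes \<xi>: "\<xi> \<in> carrier (Ext C 0 I I)" "\<xi> \<noteq> \<zero>\<^bsub>Ext C 0 I I\<^esub>"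
  obtains \<eta> where "\<eta> \<in> carrier (Ext C 0 I I)" "yoneda C 0 0 I I I \<eta> \<xi> = ext_class C 0 I I (res C I 0)"
proof -
  obtain f where f: "f \<in> cocycles C 0 I I" "\<xi> = ext_class C 0 I I f" using Ext_E[OF _ _ \<xi>(1)] by auto
  obtain u where u: "u \<in> homset C I I" "u \<bullet> res C I 0 = f"
    using degree_0_factor[OF UnitO_Obj f(1)] .
  have "f \<noteq> zero_arrow C (resO C I 0) I"
    using \<xi>(2) f(2) by (auto simp: Ext_zero)
  then have "u \<noteq> zero_arrow C I I" using u by auto
  then have iso: "iso_arrow C u" using simple_endo_iso[OF UnitO_simple u(1)] by blast
  let ?v = "inv_arrow C u"
  have v: "?v \<in> homset C I I" "?v \<bullet> u = Ide C I"
    using iso_arrowD[OF iso] homD[OF u(1)] by (auto intro!: homI)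
  have "?v \<bullet> f = res C I 0"
    using Comp_reassoc[OF v(2), of "res C I 0"] u homD[OF v(1)] homD[OF u(1)] by simp
  then have "yoneda C 0 0 I I I (ext_class C 0 I I (?v \<bullet> res C I 0)) \<xi> = ext_class C 0 I I (res C I 0)"
    using yoneda_degree_0[OF UnitO_Obj UnitO_Obj v(1) f(1)] f(2) by simp
  then show thesis
    using that[of "ext_class C 0 I I (?v \<bullet> res C I 0)"] Ext_I[OF UnitO_Obj UnitO_Obj]
      cocycle_Comp[OF augmentation_cocycle[OF UnitO_Obj] v(1) UnitO_Obj] by blast
qed

text \<open>Besides the identity, a section s of the augmentation provides a second chain map over
  the identity of X: \<open>s \<bullet> res C X 0\<close> in degree 0 and zero above. By uniqueness
  of lifts, a cocycle of positive degree has the class of its composite with zero.\<close>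

lemma projective_coboundaries:
  assumes X: "projective_obj C X" and f: "f \<in> cocycles C (Suc n) X Y"
  shows "f \<in> coboundaries C (Suc n) X Y"
proof -
  have XO: "X \<in> Obj C" using X by (simp add: projective_obj_def)
  have r: "resolves C X (res C X)" using res_resolves[OF XO] .
  obtain s where s: "s \<in> homset C X (resO C X 0)" "res C X 0 \<bullet> s = Ide C X"
    using projective_lift[OF X, of "res C X 0" "Ide C X"] r Ide_hom[OF XO] XO unfolding resolves_def by auto
  note [simp] = XO homD[OF s(1)]
  note fc = cocyclesD[OF f]
  have YO: "Y \<in> Obj C" using hom_Obj(2)[OF fc(1)] .
  define \<phi> where "\<phi> i = (case i of 0 \<Rightarrow> s \<bullet> res C X 0 | Suc j \<Rightarrow> zero_arrow C (resO C X (Suc j)) (resO C X (Suc j)))" for i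
  have 1: "(\<lambda>i. Ide C (resO C X i)) \<in> clift C (res C X) 0 (res C X) (res C X 0)"
    by (auto simp: clift_def Ide_hom)
  have 2: "\<phi> \<in> clift C (res C X) 0 (res C X) (res C X 0)"
    unfolding clift_def
  proof (intro CollectI conjI allI)
    fix i
    show "\<phi> i \<in> homset C (Dom C (res C X (0 + i))) (Dom C (res C X i))"
      by (cases i) (auto simp: \<phi>_def intro!: homI)
    show "res C X 0 \<bullet> \<phi> 0 = res C X 0"
      using Comp_reassoc[OF s(2), of "res C X 0"] by (simp add: \<phi>_def)
    show "res C X (Suc i) \<bullet> \<phi> (Suc i) = \<phi> i \<bullet> res C X (Suc (0 + i))"
      by (cases i) (simp_all add: \<phi>_def)
  qed
  note eq = lift_class_unique[OF XO r 1 2 augmentation_cocycle[OF XO] augmentation_cocycle[OF XO] refl,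
      of f "Suc n" Y] 
  have "ext_class C (Suc n) X Y f = ext_class C (Suc n) X Y (zero_arrow C (resO C X (Suc n)) Y)"
    using eq fc YO by (simp add: \<phi>_def)
  then show ?thesis
    using Ext_zero_iff[OF XO YO f] YO by (simp add: Ext_zero)
qed

end

section \<open>Detecting projectivity by the vanishing of Ext\<close>

context finite_tensor_category
begin

text \<open>Vanishing of Ext in degree n, expressed on cocycles of the chosen resolution.\<close>

abbreviation "vanishes n A Y \<equiv> cocycles C n A Y \<subseteq> coboundaries C n A Y"

context
  fixes Y J Z \<iota> q
  assumes J: "projective_obj C J" "injective_obj C J"
    and \<iota>: "\<iota> \<in> homset C Y J" "monic C \<iota>" and q: "is_cokernel C q \<iota>" and Z: "Cod C q = Z"
begin

lemma ses_facts:
  shows "q \<in> homset C J Z" "epic C q" "is_kernel C \<iota> q" "q \<bullet> \<iota> = zero_arrow C Y Z" 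
    "J \<in> Obj C" "Y \<in> Obj C" "Z \<in> Obj C"
  using cokernelD[OF q] homD[OF \<iota>(1)] Z cokernel_epic[OF q] monic_kernel_of_cokernel[OF \<iota>(2) q] hom_Obj[OF \<iota>(1)]
    Cod_Obj by (auto intro!: homI)

text \<open>A piece of the long exact sequence of 0 \<rightarrow> Y \<rightarrow> J \<rightarrow> Z
  \<rightarrow> 0: a lift b of g fails to be a cocycle by an arrow f into Y, which is a cocycle one
  degree higher and so has the form h composed with the differential; subtracting
  \<open>\<iota> \<bullet> h\<close> repairs b.\<close>

lemma vanishing_lift:
  assumes A: "A \<in> Obj C" and v: "vanishes (Suc n) A Y" and g: "g \<in> cocycles C n A Z"
  obtains c where "c \<in> cocycles C n A J" "q \<bullet> c = g"
proof -
  note F = ses_facts and gc = cocyclesD[OF g] and qh = homD[OF ses_facts(1)] and ih = homD[OF \<iota>(1)]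
  obtain b where b: "b \<in> homset C (resO C A n) J" "q \<bullet> b = g"
    using projective_lift[OF res_projective[OF A, of n] F(2), of g] gc A qh by auto
  note [simp] = homD[OF b(1)] gc(2-4) qh ih A F(5-7)
  let ?d = "res C A"
  have bd: "b \<bullet> ?d (Suc n) \<in> homset C (resO C A (Suc n)) J" by (intro homI) simp_all
  have "q \<bullet> (b \<bullet> ?d (Suc n)) = zero_arrow C (resO C A (Suc n)) Z"
    using Comp_reassoc[OF b(2), of "?d (Suc n)"] gc(5) by simp
  then obtain f where f: "f \<in> homset C (resO C A (Suc n)) Y" "\<iota> \<bullet> f = b \<bullet> ?d (Suc n)"
    using kernel_factor[OF F(3), of "b \<bullet> ?d (Suc n)" "resO C A (Suc n)"] bd by auto
  note [simp] = homD[OF f(1)]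
  have "\<iota> \<bullet> (f \<bullet> ?d (Suc (Suc n))) = \<iota> \<bullet> zero_arrow C (resO C A (Suc (Suc n))) Y"
    using Comp_reassoc[OF f(2), of "?d (Suc (Suc n))"] by simp
  then have "f \<bullet> ?d (Suc (Suc n)) = zero_arrow C (resO C A (Suc (Suc n))) Y"
    by (rule monicD[OF \<iota>(2), rotated -1]) simp_all
  then have "f \<in> coboundaries C (Suc n) A Y" using cocyclesI[OF f(1)] v by blast
  then obtain h where h: "h \<in> homset C (resO C A n) Y" "f = h \<bullet> ?d (Suc n)"
    by (auto simp: coboundaries_def)
  note [simp] = homD[OF h(1)]
  have ih': "\<iota> \<bullet> h \<in> homset C (resO C A n) J" by (intro homI) simp_all
  have dh: "?d (Suc n) \<in> homset C (resO C A (Suc n)) (resO C A n)" by (intro homI) simp_all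
  let ?c = "b \<ominus>\<^bsub>HomMod C (resO C A n) J\<^esub> \<iota> \<bullet> h"
  have "?c \<bullet> ?d (Suc n) = zero_arrow C (resO C A (Suc n)) J"
    using Comp_additive_left(3)[OF dh _ b(1) ih'] f(2)[unfolded h(2)] minus_self[OF bd] by simp
  then have c: "?c \<in> cocycles C n A J" using cocyclesI[OF minus_hom[OF b(1) ih']] by blast
  have "q \<bullet> (\<iota> \<bullet> h) = zero_arrow C (resO C A n) Z"
    using Comp_reassoc[OF F(4), of h] by simp
  then have "q \<bullet> ?c = g"
    using Comp_additive_right(3)[OF F(1) _ b(1) ih'] b(2) minus_zero[OF gc(1)] by simp
  then show thesis using that c by blast
qed

text \<open>Dimension shifting: the lifted cocycle has values in J and positive degree, so
  injectivity of J makes it a coboundary.\<close>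

lemma shift_vanishing:
  assumes A: "A \<in> Obj C" and v: "vanishes (Suc (Suc n)) A Y"
  shows "vanishes (Suc n) A Z"
proof
  fix g assume "g \<in> cocycles C (Suc n) A Z"
  then obtain c where c: "c \<in> cocycles C (Suc n) A J" "q \<bullet> c = g" using vanishing_lift[OF A v] by blast
  have ex: "exact_at C (res C A (Suc (Suc n))) (res C A (Suc n))" "exact_at C (res C A (Suc n)) (res C A n)"
    using res_resolves[OF A] unfolding resolves_def by blast+
  obtain k where k: "k \<in> homset C (resO C A n) J" "k \<bullet> res C A (Suc n) = c"
    using exact_extend_injective[OF ex J(2), of c] cocyclesD[OF c(1)] A by auto
  have "g = (q \<bullet> k) \<bullet> res C A (Suc n)"
    using k c(2) homD[OF k(1)] homD[OF ses_facts(1)] A by simp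
  moreover have "q \<bullet> k \<in> homset C (resO C A n) Z" using Comp_hom[OF ses_facts(1) k(1)] .
  ultimately show "g \<in> coboundaries C (Suc n) A Z" by (auto simp: coboundaries_def)
qed

text \<open>In degree 0 the lifted cocycle descends along the augmentation to an arrow from A to
  J.\<close>

lemma degree_1_vanishing_lift:
  assumes A: "A \<in> Obj C" and v: "vanishes (Suc 0) A Y" and g: "g \<in> homset C A Z"
  shows "\<exists>k \<in> homset C A J. q \<bullet> k = g"
proof -
  obtain c where c: "c \<in> cocycles C 0 A J" "q \<bullet> c = g \<bullet> res C A 0"
    using vanishing_lift[OF A v cocycle_Comp[OF augmentation_cocycle[OF A] g A]] .
  obtain k where k: "k \<in> homset C A J" "k \<bullet> res C A 0 = c"
    using degree_0_factor[OF A c(1)] .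
  note [simp] = homD[OF k(1)] homD[OF g] homD[OF ses_facts(1)] A
  have "(q \<bullet> k) \<bullet> res C A 0 = g \<bullet> res C A 0" using c(2) k(2) by simp
  then have "q \<bullet> k = g"
    by (rule epicD[where e="res C A 0", rotated -1]) (use res_resolves[OF A] in \<open>simp_all add: resolves_def\<close>)
  then show ?thesis using k by blast
qed

text \<open>Induction along a composition series: a lift on the subobject extends to the whole
  object because J is injective, and the remaining error factors through the simple quotient, where
  it lifts by assumption.\<close>

lemma finite_length_lift:
  assumes "finite_length C A"
    and simple: "\<And>S g. \<lbrakk>simple_obj C S; g \<in> homset C S Z\<rbrakk> \<Longrightarrow> \<exists>k \<in> homset C S J. q \<bullet> k = g"
  shows "g \<in> homset C A Z \<Longrightarrow> \<exists>k \<in> homset C A J. q \<bullet> k = g"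
  using assms(1)
proof (induction arbitrary: g)
  case (step i p)
  note qh = ses_facts(1)
  have i: "i \<in> homset C (Dom C i) (Cod C i)" using step.hyps monic_Arr by (auto intro: homI)
  have p: "p \<in> homset C (Cod C i) (Cod C p)" using cokernelD[OF step.hyps(3)] by (auto intro: homI)
  have O: "Dom C i \<in> Obj C" "Cod C i \<in> Obj C" using hom_Obj[OF i] .
  obtain k where k: "k \<in> homset C (Dom C i) J" "q \<bullet> k = g \<bullet> i"
    using step.IH[OF Comp_hom[OF step.prems i]] by blast
  obtain h where h: "h \<in> homset C (Cod C i) J" "h \<bullet> i = k"
    using J(2) step.hyps(2) k(1) unfolding injective_obj_def by blast
  have qhh: "q \<bullet> h \<in> homset C (Cod C i) Z" using Comp_hom[OF qh h(1)] .
  have "(q \<bullet> h) \<bullet> i = g \<bullet> i" using h k homD[OF h(1)] homD[OF i] homD[OF qh] by simp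
  then have "(g \<ominus>\<^bsub>HomMod C (Cod C i) Z\<^esub> q \<bullet> h) \<bullet> i = zero_arrow C (Dom C i) Z"
    using Comp_additive_left(3)[OF i ses_facts(7) step.prems qhh] minus_self[OF Comp_hom[OF step.prems i]] by simp
  then obtain u where u: "u \<in> homset C (Cod C p) Z" "u \<bullet> p = g \<ominus>\<^bsub>HomMod C (Cod C i) Z\<^esub> q \<bullet> h"
    using cokernel_factor[OF step.hyps(3) minus_hom[OF step.prems qhh]] by blast
  obtain w where w: "w \<in> homset C (Cod C p) J" "q \<bullet> w = u" using simple[OF step.hyps(4) u(1)] by blast
  have wp: "w \<bullet> p \<in> homset C (Cod C i) J" using Comp_hom[OF w(1) p] .
  have "q \<bullet> (w \<bullet> p) = g \<ominus>\<^bsub>HomMod C (Cod C i) Z\<^esub> q \<bullet> h"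
    using Comp_reassoc[OF w(2), of p] u homD[OF w(1)] homD[OF p] homD[OF qh] by simp
  then have "q \<bullet> (w \<bullet> p \<oplus>\<^bsub>HomMod C (Cod C i) J\<^esub> h) = 
     (g \<ominus>\<^bsub>HomMod C (Cod C i) Z\<^esub> q \<bullet> h) \<oplus>\<^bsub>HomMod C (Cod C i) Z\<^esub> q \<bullet> h"
    using Comp_add_right[OF qh wp h(1)] by simp
  also have "\<dots> = g"
  proof -
    interpret H: abelian_group "HomMod C (Cod C i) Z" using hom_group'[OF step.prems] .
    show ?thesis
      using step.prems qhh hom_carrier[OF step.prems, symmetric] by (simp add: a_minus_def H.a_assoc H.l_neg)
  qed
  finally show ?case using add_hom[OF wp h(1)] by blast
next
  case (zero W)
  have W: "W \<in> Obj C" using zero.hyps by (simp add: zero_obj_def)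
  have "q \<bullet> zero_arrow C W J = g"
    using zero.hyps zero.prems Comp_hom[OF ses_facts(1) zero_hom[OF W ses_facts(5)]] ses_facts(7)
    unfolding zero_obj_def by blast
  then show ?case using zero_hom[OF W ses_facts(5)] by blast
qed

text \<open>A section s of q makes 1 - sq factor through \<iota>, and the factor is a retraction of
  J onto Y.\<close>

lemma projective_quotient_split:
  assumes "projective_obj C Z"
  shows "projective_obj C Y"
proof -
  note F = ses_facts
  note [simp] = homD[OF F(1)] homD[OF \<iota>(1)] F(5-7)
  obtain s where s: "s \<in> homset C Z J" "q \<bullet> s = Ide C Z"
    using projective_lift[OF assms F(2), of "Ide C Z"] Ide_hom by auto
  note [simp] = homD[OF s(1)]
  have sq: "s \<bullet> q \<in> homset C J J" and id: "Ide C J \<in> homset C J J" using Ide_hom by (auto intro!: homI)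
  let ?w = "Ide C J \<ominus>\<^bsub>HomMod C J J\<^esub> s \<bullet> q"
  have "q \<bullet> ?w = zero_arrow C J Z"
    using Comp_additive_right(3)[OF F(1) F(5) id sq] Comp_reassoc[OF s(2), of q] minus_self[OF F(1)] by simp
  then obtain r where r: "r \<in> homset C J Y" "\<iota> \<bullet> r = ?w"
    using kernel_factor[OF F(3), of ?w J] minus_hom[OF id sq] by auto
  note [simp] = homD[OF r(1)]
  have "\<iota> \<bullet> (r \<bullet> \<iota>) = ?w \<bullet> \<iota>" using Comp_reassoc[OF r(2), of \<iota>] by simp
  also have "\<dots> = \<iota> \<bullet> Ide C Y"
    using Comp_additive_left(3)[OF \<iota>(1) F(5) id sq] F(4) minus_zero[OF \<iota>(1)] by simp
  finally have "r \<bullet> \<iota> = Ide C Y" by (rule monicD[OF \<iota>(2), rotated -1]) simp_all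
  then show ?thesis using projective_retract[OF J(1) \<iota>(1) r(1)] by blast
qed

end

text \<open>Vanishing will be available only on objects that contain the simples as retracts, whence
  the family T. The induction replaces Y by its cosyzygy and lowers the degree by one. In degree 1
  every arrow from a simple to the cosyzygy lifts to J, hence by finite length so does its identity,
  and the sequence splits.\<close>

lemma projective_if_vanishing:
  assumes T: "\<And>S. simple_obj C S \<Longrightarrow> \<exists>M\<in>T. \<exists>a\<in>homset C S M. \<exists>b\<in>homset C M S. b \<bullet> a = Ide C S"
    and "Y \<in> Obj C" and "\<And>M. M \<in> T \<Longrightarrow> M \<in> Obj C" and "\<And>M. M \<in> T \<Longrightarrow> vanishes (Suc n) M Y"
  shows "projective_obj C Y"
  using assms(2,4)
proof (induction n arbitrary: Y)
  case 0
  obtain J \<iota> where J: "projective_obj C J" "injective_obj C J" "\<iota> \<in> homset C Y J" "monic C \<iota>"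
    using embed_projective_injective[OF 0(1)] .
  obtain q where q: "is_cokernel C q \<iota>" using cokernel_exists homD(1)[OF J(3)] by blast
  note F = ses_facts[OF J q refl]
  have "\<exists>k \<in> homset C S J. q \<bullet> k = g" if S: "simple_obj C S" and g: "g \<in> homset C S (Cod C q)" for S g
  proof -
    obtain M a b where M: "M \<in> T" "a \<in> homset C S M" "b \<in> homset C M S" "b \<bullet> a = Ide C S"
      using T[OF S] by blast
    obtain k where k: "k \<in> homset C M J" "q \<bullet> k = g \<bullet> b"
      using degree_1_vanishing_lift[OF J q refl assms(3)[OF M(1)] 0(2)[OF M(1)] Comp_hom[OF g M(3)]] by blast
    have "q \<bullet> (k \<bullet> a) = g"
      using Comp_reassoc[OF k(2), of a] homD[OF k(1)] homD[OF M(2)] homD[OF M(3)] homD[OF g] homD[OF F(1)] M(4)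
      by simp
    then show ?thesis using Comp_hom[OF k(1) M(2)] by blast
  qed
  then obtain s where s: "s \<in> homset C (Cod C q) J" "q \<bullet> s = Ide C (Cod C q)"
    using finite_length_lift[OF J q refl all_finite_length[OF F(7)] _ Ide_hom[OF F(7)]] by blast
  then have "projective_obj C (Cod C q)" using projective_retract[OF J(1) s(1) F(1)] by blast
  then show ?case using projective_quotient_split[OF J q refl] by blast
next
  case (Suc n)
  obtain J \<iota> where J: "projective_obj C J" "injective_obj C J" "\<iota> \<in> homset C Y J" "monic C \<iota>"
    using embed_projective_injective[OF Suc(2)] .
  obtain q where q: "is_cokernel C q \<iota>" using cokernel_exists homD(1)[OF J(3)] by blast
  have "projective_obj C (Cod C q)"
    using Suc.IH[OF ses_facts(7)[OF J q refl]] shift_vanishing[OF J q refl assms(3) Suc(3)] by blast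
  then show ?case using projective_quotient_split[OF J q refl] by blast
qed

end

section \<open>Commutative rings of Krull dimension zero and graded rings\<close>

text \<open>Zorn's lemma gives an ideal M maximal among those containing I0 and disjoint from S. For
  a and b outside M, both M + (a) and M + (b) meet S; if ab were in M, so would be the product of
  the two elements found, which lies in S.\<close>

lemma (in cring) exists_prime_avoiding:
  assumes I0: "ideal I0 R" and S: "S \<subseteq> carrier R" "\<one> \<in> S" "\<And>s t. \<lbrakk>s \<in> S; t \<in> S\<rbrakk> \<Longrightarrow> s \<otimes> t \<in> S"
    and disj: "I0 \<inter> S = {}"
  shows "\<exists>P. primeideal P R \<and> I0 \<subseteq> P \<and> P \<inter> S = {}"
proof -
  define A where "A = {J. ideal J R \<and> I0 \<subseteq> J \<and> J \<inter> S = {}}"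
  have "\<exists>M\<in>A. \<forall>X\<in>A. M \<subseteq> X \<longrightarrow> X = M"
  proof (rule subset_Zorn_nonempty)
    show "A \<noteq> {}" using I0 disj by (auto simp: A_def)
    fix \<C> assume ne: "\<C> \<noteq> {}" and ch: "subset.chain A \<C>"
    then have sub: "\<C> \<subseteq> A" by (simp add: subset.chain_def)
    have "subset.chain {I. ideal I R} \<C>"
      using ch sub unfolding subset.chain_def A_def by auto
    then have "ideal (\<Union>\<C>) R" using chain_Union_is_ideal[of \<C>] ne by simp
    then show "\<Union>\<C> \<in> A" using sub ne unfolding A_def by auto
  qed
  then obtain M where MA: "M \<in> A" and mx: "\<forall>X\<in>A. M \<subseteq> X \<longrightarrow> X = M"
    by (rule bexE)
  have M: "ideal M R" "I0 \<subseteq> M" "M \<inter> S = {}" using MA by (simp_all add: A_def)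
  have max: "X = M" if "ideal X R" "M \<subseteq> X" "X \<inter> S = {}" for X
  proof -
    have "X \<in> A" using that M(2) by (simp add: A_def)
    then show ?thesis using mx that(2) by simp
  qed
  interpret M: ideal M R by fact
  have ext: "\<exists>m\<in>M. \<exists>r\<in>carrier R. m \<oplus> r \<otimes> a \<in> S" if a: "a \<in> carrier R" "a \<notin> M" for a
  proof (rule ccontr)
    assume no: "\<not> ?thesis"
    have id: "ideal (M <+>\<^bsub>R\<^esub> PIdl a) R" using add_ideals[OF M(1) cgenideal_ideal[OF a(1)]] .
    have "M \<subseteq> M <+>\<^bsub>R\<^esub> PIdl a"
    proof
      fix m assume "m \<in> M"
      then have "m = m \<oplus> \<zero> \<otimes> a" "m \<in> M" using a M.Icarr by auto
      then show "m \<in> M <+>\<^bsub>R\<^esub> PIdl a" unfolding set_add_def' cgenideal_def by blast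
    qed
    moreover have "(M <+>\<^bsub>R\<^esub> PIdl a) \<inter> S = {}" using no unfolding set_add_def' cgenideal_def by blast
    ultimately have "M <+>\<^bsub>R\<^esub> PIdl a = M" using max id by blast
    moreover have "a = \<zero> \<oplus> \<one> \<otimes> a" using a by simp
    then have "a \<in> M <+>\<^bsub>R\<^esub> PIdl a" unfolding set_add_def' cgenideal_def using M.zero_closed by blast
    ultimately show False using a by blast
  qed
  have "primeideal M R"
  proof (rule primeidealI[OF M(1)])
    show "cring R" by unfold_locales
    show "carrier R \<noteq> M" using S M(3) by blast
    fix a b assume ab: "a \<in> carrier R" "b \<in> carrier R" "a \<otimes> b \<in> M"
    show "a \<in> M \<or> b \<in> M"
    proof (rule ccontr)
      assume "\<not> ?thesis"
      then obtain m r m' r' where mr: "m \<in> M" "r \<in> carrier R" "m \<oplus> r \<otimes> a \<in> S" "m' \<in> M" "r' \<in> carrier R" "m' \<oplus> r' \<otimes> b \<in> S"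
        using ext ab by meson
      have mc: "m \<in> carrier R" "m' \<in> carrier R" using mr M.Icarr by auto
      have "(m \<oplus> r \<otimes> a) \<otimes> (m' \<oplus> r' \<otimes> b) = m \<otimes> (m' \<oplus> r' \<otimes> b) \<oplus> (r \<otimes> a) \<otimes> m' \<oplus> (r \<otimes> r') \<otimes> (a \<otimes> b)"
        using mr ab mc by algebra
      moreover have "m \<otimes> (m' \<oplus> r' \<otimes> b) \<in> M" "(r \<otimes> a) \<otimes> m' \<in> M" "(r \<otimes> r') \<otimes> (a \<otimes> b) \<in> M"
        using M.I_r_closed[OF mr(1)] M.I_l_closed[OF mr(4)] M.I_l_closed[OF ab(3)] mr(2,5) ab mc by simp_all
      ultimately have "(m \<oplus> r \<otimes> a) \<otimes> (m' \<oplus> r' \<otimes> b) \<in> M"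
        by (simp add: M.a_closed)
      then show False using S(3)[OF mr(3,6)] M(3) by blast
    qed
  qed
  then show ?thesis using M by blast
qed

text \<open>Otherwise some prime \<open>Q\<close> avoids the multiplicative set of all \<open>a\<^sup>n (1 - a g)\<close>; then \<open>a \<notin> Q\<close> and
  \<open>Q + (a)\<close> is proper, so \<open>Q\<close> is not maximal.\<close>

lemma (in cring) krull_dim_0_power:
  assumes dim: "krull_dim R = 0" and a: "a \<in> carrier R"
  shows "\<exists>n::nat. \<exists>g\<in>carrier R. a [^] n = a [^] Suc n \<otimes> g"
proof (rule ccontr)
  assume no: "\<not> ?thesis"
  define S where "S = {a [^] n \<otimes> (\<one> \<ominus> a \<otimes> g) | (n::nat) g. g \<in> carrier R}"
  have z: "\<zero> \<notin> S"
  proof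
    assume "\<zero> \<in> S"
    then obtain n g where ng: "g \<in> carrier R" "\<zero> = a [^] (n::nat) \<otimes> (\<one> \<ominus> a \<otimes> g)" by (auto simp: S_def)
    have "a [^] n \<otimes> (\<one> \<ominus> a \<otimes> g) = a [^] n \<ominus> a [^] Suc n \<otimes> g"
      using a ng(1) nat_pow_closed[OF a, of n] by (simp add: a_minus_def r_distr r_minus m_assoc)
    then have "a [^] n = a [^] Suc n \<otimes> g"
      using ng a by (metis m_closed nat_pow_closed r_right_minus_eq)
    then show False using no ng by blast
  qed
  have "\<exists>Q. primeideal Q R \<and> {\<zero>} \<subseteq> Q \<and> Q \<inter> S = {}"
  proof (rule exists_prime_avoiding[OF zeroideal])
    show "S \<subseteq> carrier R" using a by (auto simp: S_def)
    have "\<one> = a [^] (0::nat) \<otimes> (\<one> \<ominus> a \<otimes> \<zero>)" using a by (simp add: a_minus_def)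
    then show "\<one> \<in> S" unfolding S_def by blast
    fix s t assume "s \<in> S" "t \<in> S"
    then obtain n g m h where st: "s = a [^] (n::nat) \<otimes> (\<one> \<ominus> a \<otimes> g)" "t = a [^] (m::nat) \<otimes> (\<one> \<ominus> a \<otimes> h)"
      "g \<in> carrier R" "h \<in> carrier R" by (auto simp: S_def)
    have pq: "a [^] n \<in> carrier R" "a [^] m \<in> carrier R" using a by auto
    have "s \<otimes> t = (a [^] n \<otimes> a [^] m) \<otimes> (\<one> \<ominus> a \<otimes> (g \<oplus> h \<ominus> a \<otimes> (g \<otimes> h)))"
      unfolding st(1,2) using a st(3,4) pq by algebra
    also have "a [^] n \<otimes> a [^] m = a [^] (n + m)" using a by (simp add: nat_pow_mult)
    finally show "s \<otimes> t \<in> S" using a st unfolding S_def by blast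
  qed (use z in blast)
  then obtain Q where Q: "primeideal Q R" "Q \<inter> S = {}" by blast
  interpret Q: primeideal Q R by fact
  have "a = a [^] (1::nat) \<otimes> (\<one> \<ominus> a \<otimes> \<zero>)" using a by (simp add: a_minus_def)
  then have "a \<in> S" unfolding S_def by blast
  then have aQ: "a \<notin> Q" using Q by blast
  have id: "ideal (Q <+>\<^bsub>R\<^esub> PIdl a) R" using add_ideals[OF Q.is_ideal cgenideal_ideal[OF a]] .
  have "\<one> \<notin> Q <+>\<^bsub>R\<^esub> PIdl a"
  proof
    assume "\<one> \<in> Q <+>\<^bsub>R\<^esub> PIdl a"
    then obtain q r where qr: "q \<in> Q" "r \<in> carrier R" "\<one> = q \<oplus> r \<otimes> a"
      unfolding set_add_def' cgenideal_def by blast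
    have qc: "q \<in> carrier R" using qr Q.Icarr by blast
    \<comment> \<open>This is the member of S with exponent 0, so it cannot lie in Q.\<close>
    have "\<one> \<ominus> a \<otimes> r = q" unfolding qr(3) using qr(2) qc a by algebra
    then have "a [^] (0::nat) \<otimes> (\<one> \<ominus> a \<otimes> r) = q" using qc by simp
    then have "q \<in> S" unfolding S_def using qr(2) by blast
    then show False using qr Q by blast
  qed
  then have "\<exists>P. primeideal P R \<and> Q <+>\<^bsub>R\<^esub> PIdl a \<subseteq> P \<and> P \<inter> {\<one>} = {}"
    by (intro exists_prime_avoiding[OF id]) auto
  then obtain P where P: "primeideal P R" "Q <+>\<^bsub>R\<^esub> PIdl a \<subseteq> P" by blast
  have "Q \<subseteq> P"
  proof
    fix q assume q: "q \<in> Q"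
    then have "q = q \<oplus> \<zero> \<otimes> a" using Q.Icarr a by simp
    then show "q \<in> P" using P(2) q unfolding set_add_def' cgenideal_def by blast
  qed
  moreover have "a \<in> P"
  proof -
    have "a = \<zero> \<oplus> \<one> \<otimes> a" using a by simp
    then show ?thesis using P(2) Q.zero_closed unfolding set_add_def' cgenideal_def by blast
  qed
  ultimately have "Q \<subset> P" using aQ by blast
  then have "\<exists>p. (\<forall>i\<le>1::nat. primeideal (p i) R) \<and> (\<forall>i<1. p i \<subset> p (Suc i))"
    using Q P by (intro exI[of _ "\<lambda>i. if i = 0 then Q else P"]) auto
  then have "enat 1 \<le> krull_dim R" unfolding krull_dim_def by (intro Sup_upper imageI) blast
  then show False using dim by (simp add: enat_0_iff)
qed

section \<open>Graded rings as direct sums of their components\<close>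

definition direct_sum :: "(nat \<Rightarrow> ('x, 'y) ring_scheme) \<Rightarrow> (nat \<Rightarrow> nat \<Rightarrow> 'x \<Rightarrow> 'x \<Rightarrow> 'x) \<Rightarrow> 'x \<Rightarrow> (nat \<Rightarrow> 'x) ring" where
  "direct_sum G mul u =
     \<lparr>carrier = {a. (\<forall>n. a n \<in> carrier (G n)) \<and> finite {n. a n \<noteq> \<zero>\<^bsub>G n\<^esub>}},
      monoid.mult = (\<lambda>a b n. \<Oplus>\<^bsub>G n\<^esub>i\<in>{..n}. mul i (n - i) (a i) (b (n - i))),
      monoid.one = (\<lambda>n. if n = 0 then u else \<zero>\<^bsub>G n\<^esub>),
      ring.zero = (\<lambda>n. \<zero>\<^bsub>G n\<^esub>),
      ring.add = (\<lambda>a b n. a n \<oplus>\<^bsub>G n\<^esub> b n)\<rparr>"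

lemma (in abelian_group) finsum_in_subgroup:
  assumes "additive_subgroup S G" "\<And>i. i \<in> A \<Longrightarrow> f i \<in> S"
  shows "finsum G f A \<in> S"
proof -
  interpret S: additive_subgroup S G by fact
  show ?thesis using assms(2)
  proof (induction A rule: infinite_finite_induct)
    case (insert x A)
    then have "f \<in> A \<rightarrow> carrier G" "f x \<in> carrier G" using S.a_subset by auto
    then show ?case using insert by simp
  qed auto
qed

text \<open>Both sides sum over i + j \<le> n, the left one grouped by k = i + j; this is the
  reindexing behind associativity of the convolution product.\<close>

lemma (in abelian_group) finsum_triangle:
  assumes "\<And>i j. F i j \<in> carrier G"
  shows "(\<Oplus>k\<in>{..n}. \<Oplus>i\<in>{..k}. F i (k - i)) = (\<Oplus>i\<in>{..n::nat}. \<Oplus>j\<in>{..n - i}. F i j)"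
proof (induction n)
  case 0
  then show ?case using assms by simp
next
  case (Suc n)
  have 1: "(\<Oplus>j\<in>{..Suc n - i}. F i j) = F i (Suc n - i) \<oplus> (\<Oplus>j\<in>{..n - i}. F i j)" if "i \<le> n" for i
    using that assms by (simp add: Suc_diff_le)
  have "(\<Oplus>i\<in>{..Suc n}. \<Oplus>j\<in>{..Suc n - i}. F i j) = F (Suc n) 0 \<oplus> (\<Oplus>i\<in>{..n}. \<Oplus>j\<in>{..Suc n - i}. F i j)"
    using assms by simp
  also have "(\<Oplus>i\<in>{..n}. \<Oplus>j\<in>{..Suc n - i}. F i j) = (\<Oplus>i\<in>{..n}. F i (Suc n - i) \<oplus> (\<Oplus>j\<in>{..n - i}. F i j))"
    using assms 1 by (intro finsum_cong') auto
  also have "\<dots> = (\<Oplus>i\<in>{..n}. F i (Suc n - i)) \<oplus> (\<Oplus>i\<in>{..n}. \<Oplus>j\<in>{..n - i}. F i j)"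
    using assms by (intro finsum_addf) auto
  also have "F (Suc n) 0 \<oplus> ((\<Oplus>i\<in>{..n}. F i (Suc n - i)) \<oplus> (\<Oplus>i\<in>{..n}. \<Oplus>j\<in>{..n - i}. F i j)) =
     (\<Oplus>i\<in>{..Suc n}. F i (Suc n - i)) \<oplus> (\<Oplus>i\<in>{..n}. \<Oplus>j\<in>{..n - i}. F i j)"
    using assms by (simp add: a_assoc)
  also have "\<dots> = (\<Oplus>k\<in>{..Suc n}. \<Oplus>i\<in>{..k}. F i (k - i))"
    using assms Suc.IH by simp
  finally show ?case ..
qed

lemma (in abelian_group) finsum_delta:
  fixes d n :: nat
  assumes "\<And>i. i \<noteq> d \<Longrightarrow> f i = \<zero>" "f d \<in> carrier G"
  shows "finsum G f {..n} = (if d \<le> n then f d else \<zero>)"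
proof -
  have "finsum G f {..n} = (\<Oplus>i\<in>{..n}. if d = i then f d else \<zero>)"
    using assms by (intro finsum_cong') auto
  also have "\<dots> = (if d \<le> n then f d else \<zero>)"
  proof (cases "d \<le> n")
    case True
    then show ?thesis using finsum_singleton[of d "{..n}" "\<lambda>_. f d"] assms by simp
  next
    case False
    then have "(\<Oplus>i\<in>{..n}. if d = i then f d else \<zero>) = (\<Oplus>i\<in>{..n}. \<zero>)"
      by (intro finsum_cong') auto
    then show ?thesis using False by simp
  qed
  finally show ?thesis .
qed

text \<open>The product takes the two degrees as arguments because all components share one type, so
  an element does not carry its degree.\<close>

locale graded_ring =
  fixes G :: "nat \<Rightarrow> ('x, 'y) ring_scheme" and mul :: "nat \<Rightarrow> nat \<Rightarrow> 'x \<Rightarrow> 'x \<Rightarrow> 'x" and u :: 'x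
  assumes group: "abelian_group (G n)"
    and mul_closed: "\<lbrakk>a \<in> carrier (G m); b \<in> carrier (G n)\<rbrakk> \<Longrightarrow> mul m n a b \<in> carrier (G (m + n))"
    and mul_add_left: "\<lbrakk>a \<in> carrier (G m); a' \<in> carrier (G m); b \<in> carrier (G n)\<rbrakk> \<Longrightarrow>
      mul m n (a \<oplus>\<^bsub>G m\<^esub> a') b = mul m n a b \<oplus>\<^bsub>G (m + n)\<^esub> mul m n a' b"
    and mul_add_right: "\<lbrakk>a \<in> carrier (G m); b \<in> carrier (G n); b' \<in> carrier (G n)\<rbrakk> \<Longrightarrow>
      mul m n a (b \<oplus>\<^bsub>G n\<^esub> b') = mul m n a b \<oplus>\<^bsub>G (m + n)\<^esub> mul m n a b'"
    and mul_assoc: "\<lbrakk>a \<in> carrier (G l); b \<in> carrier (G m); c \<in> carrier (G n)\<rbrakk> \<Longrightarrow>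
      mul (l + m) n (mul l m a b) c = mul l (m + n) a (mul m n b c)"
    and unit_closed: "u \<in> carrier (G 0)"
    and mul_one_left: "a \<in> carrier (G n) \<Longrightarrow> mul 0 n u a = a"
    and mul_one_right: "a \<in> carrier (G n) \<Longrightarrow> mul n 0 a u = a"
begin

abbreviation "DS \<equiv> direct_sum G mul u"

sublocale G: abelian_group "G n" for n by (rule group)

lemma mul_linear_left:
  assumes b: "b \<in> carrier (G n)"
  shows "mul m n \<zero>\<^bsub>G m\<^esub> b = \<zero>\<^bsub>G (m + n)\<^esub>"
    "a \<in> carrier (G m) \<Longrightarrow> mul m n (\<ominus>\<^bsub>G m\<^esub> a) b = \<ominus>\<^bsub>G (m + n)\<^esub> mul m n a b"
proof -
  interpret abelian_group_hom "G m" "G (m + n)" "\<lambda>a. mul m n a b"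
    using b mul_closed mul_add_left by (intro abelian_group_homI group_hom.intro group_hom_axioms.intro)
      (auto simp: hom_def G.a_group G.abelian_group_axioms)
  show "mul m n \<zero>\<^bsub>G m\<^esub> b = \<zero>\<^bsub>G (m + n)\<^esub>"
    "a \<in> carrier (G m) \<Longrightarrow> mul m n (\<ominus>\<^bsub>G m\<^esub> a) b = \<ominus>\<^bsub>G (m + n)\<^esub> mul m n a b" by simp_all
qed

lemma mul_linear_right:
  assumes a: "a \<in> carrier (G m)"
  shows "mul m n a \<zero>\<^bsub>G n\<^esub> = \<zero>\<^bsub>G (m + n)\<^esub>"
    "b \<in> carrier (G n) \<Longrightarrow> mul m n a (\<ominus>\<^bsub>G n\<^esub> b) = \<ominus>\<^bsub>G (m + n)\<^esub> mul m n a b"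
proof -
  interpret abelian_group_hom "G n" "G (m + n)" "\<lambda>b. mul m n a b"
    using a mul_closed mul_add_right by (intro abelian_group_homI group_hom.intro group_hom_axioms.intro)
      (auto simp: hom_def G.a_group G.abelian_group_axioms)
  show "mul m n a \<zero>\<^bsub>G n\<^esub> = \<zero>\<^bsub>G (m + n)\<^esub>"
    "b \<in> carrier (G n) \<Longrightarrow> mul m n a (\<ominus>\<^bsub>G n\<^esub> b) = \<ominus>\<^bsub>G (m + n)\<^esub> mul m n a b" by simp_all
qed

lemma mul_finsum_left:
  assumes b: "b \<in> carrier (G n)" and f: "\<And>i. i \<in> A \<Longrightarrow> f i \<in> carrier (G m)"
  shows "mul m n (finsum (G m) f A) b = finsum (G (m + n)) (\<lambda>i. mul m n (f i) b) A"
  using f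
proof (induction A rule: infinite_finite_induct)
  case (insert x A)
  then show ?case using mul_add_left[of "f x" m "finsum (G m) f A" b n] b mul_closed by (simp add: Pi_def)
qed (simp_all add: mul_linear_left b)

lemma mul_finsum_right:
  assumes a: "a \<in> carrier (G m)" and f: "\<And>i. i \<in> A \<Longrightarrow> f i \<in> carrier (G n)"
  shows "mul m n a (finsum (G n) f A) = finsum (G (m + n)) (\<lambda>i. mul m n a (f i)) A"
  using f
proof (induction A rule: infinite_finite_induct)
  case (insert x A)
  then show ?case using mul_add_right[of a m "f x" n "finsum (G n) f A"] a mul_closed by (simp add: Pi_def)
qed (simp_all add: mul_linear_right a)

lemma DS_simps:
  "carrier DS = {a. (\<forall>n. a n \<in> carrier (G n)) \<and> finite {n. a n \<noteq> \<zero>\<^bsub>G n\<^esub>}}"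
  "(a \<otimes>\<^bsub>DS\<^esub> b) n = (\<Oplus>\<^bsub>G n\<^esub>i\<in>{..n}. mul i (n - i) (a i) (b (n - i)))"
  "\<one>\<^bsub>DS\<^esub> n = (if n = 0 then u else \<zero>\<^bsub>G n\<^esub>)" "\<zero>\<^bsub>DS\<^esub> n = \<zero>\<^bsub>G n\<^esub>" "(a \<oplus>\<^bsub>DS\<^esub> b) n = a n \<oplus>\<^bsub>G n\<^esub> b n"
  by (simp_all add: direct_sum_def)

lemma DS_closed: "a \<in> carrier DS \<Longrightarrow> a n \<in> carrier (G n)"
  by (simp add: DS_simps)

lemma DS_bound:
  assumes "a \<in> carrier DS"
  obtains N where "\<And>n. n > N \<Longrightarrow> a n = \<zero>\<^bsub>G n\<^esub>"
proof -
  have "finite {n. a n \<noteq> \<zero>\<^bsub>G n\<^esub>}" using assms by (simp add: DS_simps)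
  then obtain N where "\<forall>n\<in>{n. a n \<noteq> \<zero>\<^bsub>G n\<^esub>}. n \<le> N" using finite_nat_set_iff_bounded_le by blast
  then show thesis using that[of N] by (metis (mono_tags, lifting) leD mem_Collect_eq)
qed

lemma DS_I:
  assumes "\<And>n. a n \<in> carrier (G n)" "\<And>n. n > N \<Longrightarrow> a n = \<zero>\<^bsub>G n\<^esub>"
  shows "a \<in> carrier DS"
proof -
  have "{n. a n \<noteq> \<zero>\<^bsub>G n\<^esub>} \<subseteq> {..N}" using assms(2) by (auto intro: leI)
  then show ?thesis using assms(1) finite_subset by (auto simp: DS_simps)
qed

lemma mul_term_closed:
  assumes "a \<in> carrier DS" "b \<in> carrier DS" "i \<le> n"
  shows "mul i (n - i) (a i) (b (n - i)) \<in> carrier (G n)"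
  using mul_closed[OF DS_closed[OF assms(1)] DS_closed[OF assms(2)], of i "n - i"] assms(3) by simp

lemma DS_mult_closed:
  assumes a: "a \<in> carrier DS" and b: "b \<in> carrier DS"
  shows "a \<otimes>\<^bsub>DS\<^esub> b \<in> carrier DS"
proof -
  obtain A B where AB: "\<And>n. n > A \<Longrightarrow> a n = \<zero>\<^bsub>G n\<^esub>" "\<And>n. n > B \<Longrightarrow> b n = \<zero>\<^bsub>G n\<^esub>"
    using DS_bound[OF a] DS_bound[OF b] by metis
  show ?thesis
  proof (rule DS_I[of _ "A + B"])
    show "(a \<otimes>\<^bsub>DS\<^esub> b) n \<in> carrier (G n)" for n
      unfolding DS_simps using mul_term_closed[OF a b] by (intro G.finsum_closed) auto
    fix n assume n: "n > A + B"
    have "mul i (n - i) (a i) (b (n - i)) = \<zero>\<^bsub>G n\<^esub>" if i: "i \<le> n" for i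
    proof (cases "i > A")
      case True
      then show ?thesis using AB(1) mul_linear_left(1)[OF DS_closed[OF b], of i "n - i"] i by simp
    next
      case False
      then have "n - i > B" using n by simp
      then show ?thesis using AB(2) mul_linear_right(1)[OF DS_closed[OF a], of i "n - i"] i by simp
    qed
    then have "(a \<otimes>\<^bsub>DS\<^esub> b) n = (\<Oplus>\<^bsub>G n\<^esub>i\<in>{..n}. \<zero>\<^bsub>G n\<^esub>)"
      unfolding DS_simps by (intro G.finsum_cong') auto
    then show "(a \<otimes>\<^bsub>DS\<^esub> b) n = \<zero>\<^bsub>G n\<^esub>" by simp
  qed
qed

lemma DS_group: "abelian_group DS"
proof (rule abelian_groupI)
  fix a b assume a: "a \<in> carrier DS" and b: "b \<in> carrier DS"
  obtain A B where AB: "\<And>n. n > A \<Longrightarrow> a n = \<zero>\<^bsub>G n\<^esub>" "\<And>n. n > B \<Longrightarrow> b n = \<zero>\<^bsub>G n\<^esub>"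
    using DS_bound[OF a] DS_bound[OF b] by metis
  show "a \<oplus>\<^bsub>DS\<^esub> b \<in> carrier DS"
    by (rule DS_I[of _ "A + B"]) (simp_all add: DS_simps(5) DS_closed a b AB)
  show "a \<oplus>\<^bsub>DS\<^esub> b = b \<oplus>\<^bsub>DS\<^esub> a"
    by (rule ext) (simp add: DS_simps(5) G.a_comm DS_closed a b)
  have "(\<lambda>n. \<ominus>\<^bsub>G n\<^esub> a n) \<in> carrier DS"
    using DS_closed[OF a] AB by (intro DS_I[of _ A]) auto
  moreover have "(\<lambda>n. \<ominus>\<^bsub>G n\<^esub> a n) \<oplus>\<^bsub>DS\<^esub> a = \<zero>\<^bsub>DS\<^esub>"
    by (rule ext) (simp add: DS_simps(4,5) G.l_neg DS_closed a)
  ultimately show "\<exists>y\<in>carrier DS. y \<oplus>\<^bsub>DS\<^esub> a = \<zero>\<^bsub>DS\<^esub>" by blast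
next
  show "\<zero>\<^bsub>DS\<^esub> \<in> carrier DS" by (rule DS_I[of _ 0]) (simp_all add: DS_simps(4))
next
  fix a b c assume "a \<in> carrier DS" "b \<in> carrier DS" "c \<in> carrier DS"
  then show "a \<oplus>\<^bsub>DS\<^esub> b \<oplus>\<^bsub>DS\<^esub> c = a \<oplus>\<^bsub>DS\<^esub> (b \<oplus>\<^bsub>DS\<^esub> c)"
    by (intro ext) (simp add: DS_simps(5) G.a_assoc DS_closed)
next
  fix a assume "a \<in> carrier DS"
  then show "\<zero>\<^bsub>DS\<^esub> \<oplus>\<^bsub>DS\<^esub> a = a" by (intro ext) (simp add: DS_simps(4,5) DS_closed)
qed

lemma DS_neg: "a \<in> carrier DS \<Longrightarrow> (\<ominus>\<^bsub>DS\<^esub> a) n = \<ominus>\<^bsub>G n\<^esub> a n"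
proof -
  assume a: "a \<in> carrier DS"
  interpret D: abelian_group DS by (rule DS_group)
  have "(\<ominus>\<^bsub>DS\<^esub> a \<oplus>\<^bsub>DS\<^esub> a) n = \<zero>\<^bsub>G n\<^esub>" using D.l_neg[OF a] by (simp add: DS_simps(4))
  then show ?thesis
    using G.minus_equality[of n "(\<ominus>\<^bsub>DS\<^esub> a) n" "a n"] DS_closed[OF a] DS_closed[OF D.a_inv_closed[OF a]]
    unfolding DS_simps(5) by metis
qed

lemma DS_ring: "ring DS"
proof (rule ringI)
  show "abelian_group DS" by (rule DS_group)
  have one: "\<one>\<^bsub>DS\<^esub> \<in> carrier DS"
    using unit_closed by (intro DS_I[of _ 0]) (auto simp: DS_simps)
  show "Group.monoid DS"
  proof (rule monoidI)
    fix a b c assume a: "a \<in> carrier DS" and b: "b \<in> carrier DS" and c: "c \<in> carrier DS"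
    show "a \<otimes>\<^bsub>DS\<^esub> b \<in> carrier DS" using DS_mult_closed a b .
    show "a \<otimes>\<^bsub>DS\<^esub> b \<otimes>\<^bsub>DS\<^esub> c = a \<otimes>\<^bsub>DS\<^esub> (b \<otimes>\<^bsub>DS\<^esub> c)"
    proof
      fix n
      \<comment> \<open>Extended by zero outside i + j \<le> n, since \<open>finsum_triangle\<close>
        asks for values in the carrier at all i and j.\<close>
      define F where "F i j = (if i + j \<le> n then mul i (n - i) (a i) (mul j (n - i - j) (b j) (c (n - i - j))) else \<zero>\<^bsub>G n\<^esub>)" for i j
      have F: "F i j \<in> carrier (G n)" for i j
      proof (cases "i + j \<le> n")
        case True
        then obtain k where "n = i + (j + k)" by (auto simp: le_iff_add add.assoc)
        then show ?thesis
          using mul_closed[OF DS_closed[OF a] mul_closed[OF DS_closed[OF b] DS_closed[OF c]], of i j k]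
          by (simp add: F_def)
      qed (simp add: F_def)
      have eq: "mul (i + j) (n - i - j) (mul i j (a i) (b j)) (c (n - i - j)) = F i j" if "i + j \<le> n" for i j
        using mul_assoc[OF DS_closed[OF a] DS_closed[OF b] DS_closed[OF c], of i j "n - i - j"] that
        by (simp add: F_def)
      have "((a \<otimes>\<^bsub>DS\<^esub> b) \<otimes>\<^bsub>DS\<^esub> c) n = (\<Oplus>\<^bsub>G n\<^esub>k\<in>{..n}. \<Oplus>\<^bsub>G n\<^esub>i\<in>{..k}. F i (k - i))"
        unfolding DS_simps
      proof (intro G.finsum_cong' refl)
        fix k assume k: "k \<in> {..n}"
        have "mul k (n - k) (\<Oplus>\<^bsub>G k\<^esub>i\<in>{..k}. mul i (k - i) (a i) (b (k - i))) (c (n - k)) =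
          (\<Oplus>\<^bsub>G n\<^esub>i\<in>{..k}. mul k (n - k) (mul i (k - i) (a i) (b (k - i))) (c (n - k)))"
          using mul_finsum_left[OF DS_closed[OF c, of "n - k"], of "{..k}" _ k] mul_term_closed[OF a b] k by simp
        also have "\<dots> = (\<Oplus>\<^bsub>G n\<^esub>i\<in>{..k}. F i (k - i))"
        proof (intro G.finsum_cong' refl)
          fix i assume i: "i \<in> {..k}"
          then show "mul k (n - k) (mul i (k - i) (a i) (b (k - i))) (c (n - k)) = F i (k - i)"
            using eq[of i "k - i"] k by simp
        qed (use F in auto)
        finally show "mul k (n - k) (\<Oplus>\<^bsub>G k\<^esub>i\<in>{..k}. mul i (k - i) (a i) (b (k - i))) (c (n - k)) =
           (\<Oplus>\<^bsub>G n\<^esub>i\<in>{..k}. F i (k - i))" .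
      qed (use F in auto)
      also have "\<dots> = (\<Oplus>\<^bsub>G n\<^esub>i\<in>{..n}. \<Oplus>\<^bsub>G n\<^esub>j\<in>{..n - i}. F i j)"
        by (rule G.finsum_triangle) (rule F)
      also have "\<dots> = (a \<otimes>\<^bsub>DS\<^esub> (b \<otimes>\<^bsub>DS\<^esub> c)) n"
        unfolding DS_simps
      proof (intro G.finsum_cong' refl)
        fix i assume i: "i \<in> {..n}"
        have "mul i (n - i) (a i) (\<Oplus>\<^bsub>G (n - i)\<^esub>j\<in>{..n - i}. mul j (n - i - j) (b j) (c (n - i - j))) =
          (\<Oplus>\<^bsub>G n\<^esub>j\<in>{..n - i}. mul i (n - i) (a i) (mul j (n - i - j) (b j) (c (n - i - j))))"
          using mul_finsum_right[OF DS_closed[OF a, of i], of "{..n - i}" "\<lambda>j. mul j (n - i - j) (b j) (c (n - i - j))" "n - i"]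
            mul_term_closed[OF b c, of _ "n - i"] i by (simp del: diff_diff_left)
        also have "\<dots> = (\<Oplus>\<^bsub>G n\<^esub>j\<in>{..n - i}. F i j)"
        proof (intro G.finsum_cong' refl)
          fix j assume "j \<in> {..n - i}"
          then show "mul i (n - i) (a i) (mul j (n - i - j) (b j) (c (n - i - j))) = F i j"
            using i by (auto simp: F_def)
        qed (use F in auto)
        finally show "(\<Oplus>\<^bsub>G n\<^esub>j\<in>{..n - i}. F i j) = 
          mul i (n - i) (a i) (\<Oplus>\<^bsub>G (n - i)\<^esub>j\<in>{..n - i}. mul j (n - i - j) (b j) (c (n - i - j)))" ..
      next
        show "(\<lambda>i. mul i (n - i) (a i) (\<Oplus>\<^bsub>G (n - i)\<^esub>j\<in>{..n - i}. mul j (n - i - j) (b j) (c (n - i - j)))) \<in> {..n} \<rightarrow> carrier (G n)"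
          using mul_term_closed[OF a DS_mult_closed[OF b c]] by (auto simp: DS_simps)
      qed
      finally show "(a \<otimes>\<^bsub>DS\<^esub> b \<otimes>\<^bsub>DS\<^esub> c) n = (a \<otimes>\<^bsub>DS\<^esub> (b \<otimes>\<^bsub>DS\<^esub> c)) n" .
    qed
  next
    show "\<one>\<^bsub>DS\<^esub> \<in> carrier DS" by (rule one)
    fix a assume a: "a \<in> carrier DS"
    show "\<one>\<^bsub>DS\<^esub> \<otimes>\<^bsub>DS\<^esub> a = a"
    proof
      fix n
      have "mul i (n - i) (\<one>\<^bsub>DS\<^esub> i) (a (n - i)) = (if 0 = i then a n else \<zero>\<^bsub>G n\<^esub>)" if "i \<le> n" for i
        using that mul_one_left mul_linear_left(1)[OF DS_closed[OF a], of i "n - i"] DS_closed[OF a]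
        by (simp add: DS_simps(3))
      then have "(\<one>\<^bsub>DS\<^esub> \<otimes>\<^bsub>DS\<^esub> a) n = (\<Oplus>\<^bsub>G n\<^esub>i\<in>{..n}. if 0 = i then a n else \<zero>\<^bsub>G n\<^esub>)"
        unfolding DS_simps(2) using DS_closed[OF a] by (intro G.finsum_cong') auto
      then show "(\<one>\<^bsub>DS\<^esub> \<otimes>\<^bsub>DS\<^esub> a) n = a n"
        by (subst (asm) G.finsum_delta[where d=0]) (use DS_closed[OF a] in auto)
    qed
    show "a \<otimes>\<^bsub>DS\<^esub> \<one>\<^bsub>DS\<^esub> = a"
    proof
      fix n
      have "mul i (n - i) (a i) (\<one>\<^bsub>DS\<^esub> (n - i)) = (if n = i then a n else \<zero>\<^bsub>G n\<^esub>)" if "i \<le> n" for i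
        using that mul_one_right mul_linear_right(1)[OF DS_closed[OF a], of i "n - i"] DS_closed[OF a]
        by (auto simp: DS_simps(3))
      then have "(a \<otimes>\<^bsub>DS\<^esub> \<one>\<^bsub>DS\<^esub>) n = (\<Oplus>\<^bsub>G n\<^esub>i\<in>{..n}. if n = i then a n else \<zero>\<^bsub>G n\<^esub>)"
        unfolding DS_simps(2) using DS_closed[OF a] by (intro G.finsum_cong') auto
      then show "(a \<otimes>\<^bsub>DS\<^esub> \<one>\<^bsub>DS\<^esub>) n = a n"
        by (subst (asm) G.finsum_delta[where d=n]) (use DS_closed[OF a] in auto)
    qed
  qed
  fix a b c assume a: "a \<in> carrier DS" and b: "b \<in> carrier DS" and c: "c \<in> carrier DS"
  show "(a \<oplus>\<^bsub>DS\<^esub> b) \<otimes>\<^bsub>DS\<^esub> c = a \<otimes>\<^bsub>DS\<^esub> c \<oplus>\<^bsub>DS\<^esub> b \<otimes>\<^bsub>DS\<^esub> c"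
  proof
    fix n
    have "((a \<oplus>\<^bsub>DS\<^esub> b) \<otimes>\<^bsub>DS\<^esub> c) n = (\<Oplus>\<^bsub>G n\<^esub>i\<in>{..n}. mul i (n - i) (a i) (c (n - i)) \<oplus>\<^bsub>G n\<^esub> mul i (n - i) (b i) (c (n - i)))"
      unfolding DS_simps
    proof (intro G.finsum_cong' refl)
      fix i assume "i \<in> {..n}"
      then show "mul i (n - i) (a i \<oplus>\<^bsub>G i\<^esub> b i) (c (n - i)) = mul i (n - i) (a i) (c (n - i)) \<oplus>\<^bsub>G n\<^esub> mul i (n - i) (b i) (c (n - i))"
        using mul_add_left[OF DS_closed[OF a] DS_closed[OF b] DS_closed[OF c], of i "n - i"] by simp
    qed (use mul_term_closed[OF a c] mul_term_closed[OF b c] in auto)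
    also have "\<dots> = (a \<otimes>\<^bsub>DS\<^esub> c \<oplus>\<^bsub>DS\<^esub> b \<otimes>\<^bsub>DS\<^esub> c) n"
      unfolding DS_simps using mul_term_closed[OF a c] mul_term_closed[OF b c] by (intro G.finsum_addf) auto
    finally show "((a \<oplus>\<^bsub>DS\<^esub> b) \<otimes>\<^bsub>DS\<^esub> c) n = (a \<otimes>\<^bsub>DS\<^esub> c \<oplus>\<^bsub>DS\<^esub> b \<otimes>\<^bsub>DS\<^esub> c) n" .
  qed
  show "c \<otimes>\<^bsub>DS\<^esub> (a \<oplus>\<^bsub>DS\<^esub> b) = c \<otimes>\<^bsub>DS\<^esub> a \<oplus>\<^bsub>DS\<^esub> c \<otimes>\<^bsub>DS\<^esub> b"
  proof
    fix n
    have "(c \<otimes>\<^bsub>DS\<^esub> (a \<oplus>\<^bsub>DS\<^esub> b)) n = (\<Oplus>\<^bsub>G n\<^esub>i\<in>{..n}. mul i (n - i) (c i) (a (n - i)) \<oplus>\<^bsub>G n\<^esub> mul i (n - i) (c i) (b (n - i)))"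
      unfolding DS_simps
    proof (intro G.finsum_cong' refl)
      fix i assume "i \<in> {..n}"
      then show "mul i (n - i) (c i) (a (n - i) \<oplus>\<^bsub>G (n - i)\<^esub> b (n - i)) = mul i (n - i) (c i) (a (n - i)) \<oplus>\<^bsub>G n\<^esub> mul i (n - i) (c i) (b (n - i))"
        using mul_add_right[OF DS_closed[OF c] DS_closed[OF a] DS_closed[OF b], of i "n - i"] by simp
    qed (use mul_term_closed[OF c a] mul_term_closed[OF c b] in auto)
    also have "\<dots> = (c \<otimes>\<^bsub>DS\<^esub> a \<oplus>\<^bsub>DS\<^esub> c \<otimes>\<^bsub>DS\<^esub> b) n"
      unfolding DS_simps using mul_term_closed[OF c a] mul_term_closed[OF c b] by (intro G.finsum_addf) auto
    finally show "(c \<otimes>\<^bsub>DS\<^esub> (a \<oplus>\<^bsub>DS\<^esub> b)) n = (c \<otimes>\<^bsub>DS\<^esub> a \<oplus>\<^bsub>DS\<^esub> c \<otimes>\<^bsub>DS\<^esub> b) n" .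
  qed
qed

definition single where "single d x = (\<lambda>n. if n = d then x else \<zero>\<^bsub>G n\<^esub>)"

lemma single_closed: "x \<in> carrier (G d) \<Longrightarrow> single d x \<in> carrier DS"
  by (rule DS_I[of _ d]) (auto simp: single_def)

lemma single_mult:
  assumes x: "x \<in> carrier (G d)" and b: "b \<in> carrier DS"
  shows "(single d x \<otimes>\<^bsub>DS\<^esub> b) n = (if d \<le> n then mul d (n - d) x (b (n - d)) else \<zero>\<^bsub>G n\<^esub>)"
proof -
  have "(single d x \<otimes>\<^bsub>DS\<^esub> b) n = (\<Oplus>\<^bsub>G n\<^esub>i\<in>{..n}. if i = d then mul d (n - d) x (b (n - d)) else \<zero>\<^bsub>G n\<^esub>)"
    unfolding DS_simps
  proof (intro G.finsum_cong' refl)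
    fix i assume "i \<in> {..n}"
    then show "mul i (n - i) (single d x i) (b (n - i)) = (if i = d then mul d (n - d) x (b (n - d)) else \<zero>\<^bsub>G n\<^esub>)"
      using mul_linear_left(1)[OF DS_closed[OF b], of i "n - i"] by (simp add: single_def)
  next
    show "(\<lambda>i. if i = d then mul d (n - d) x (b (n - d)) else \<zero>\<^bsub>G n\<^esub>) \<in> {..n} \<rightarrow> carrier (G n)"
      using mul_closed[OF x DS_closed[OF b, of "n - d"]] by auto
  qed
  also have "\<dots> = (if d \<le> n then mul d (n - d) x (b (n - d)) else \<zero>\<^bsub>G n\<^esub>)"
  proof (cases "d \<le> n")
    case True
    then show ?thesis
      using mul_closed[OF x DS_closed[OF b, of "n - d"]] by (subst G.finsum_delta[where d=d]) auto
  next
    case False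
    then have "(\<Oplus>\<^bsub>G n\<^esub>i\<in>{..n}. if i = d then mul d (n - d) x (b (n - d)) else \<zero>\<^bsub>G n\<^esub>) = (\<Oplus>\<^bsub>G n\<^esub>i\<in>{..n}. \<zero>\<^bsub>G n\<^esub>)"
      by (intro G.finsum_cong') auto
    then show ?thesis using False by simp
  qed
  finally show ?thesis .
qed

lemma single_single:
  assumes x: "x \<in> carrier (G d)" and y: "y \<in> carrier (G e)"
  shows "single d x \<otimes>\<^bsub>DS\<^esub> single e y = single (d + e) (mul d e x y)"
proof
  fix n
  show "(single d x \<otimes>\<^bsub>DS\<^esub> single e y) n = single (d + e) (mul d e x y) n"
    unfolding single_mult[OF x single_closed[OF y]]
    using mul_linear_right(1)[OF x, of "n - d"] by (auto simp: single_def)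
qed

text \<open>Powers of a homogeneous element kept inside the component of degree kd, so that no
  convolution sums intervene.\<close>

fun hpow where
  "hpow d x 0 = u"
| "hpow d x (Suc k) = mul d (k * d) x (hpow d x k)"

lemma hpow_closed: "x \<in> carrier (G d) \<Longrightarrow> hpow d x k \<in> carrier (G (k * d))"
  by (induction k) (auto simp: unit_closed intro: mul_closed)

end

section \<open>Graded commutativity, the even part and monomials\<close>

lemma FactRing_carrierE:
  assumes "c \<in> carrier (R Quot I)"
  obtains g where "g \<in> carrier R" "c = I +>\<^bsub>R\<^esub> g"
  using assms by (auto simp: FactRing_def A_RCOSETS_def')

text \<open>If \<open>two\<close> holds, as for algebras over a field of characteristic two, signs disappear and all degrees count as even.\<close>

locale graded_comm_ring = graded_ring +
  fixes two :: bool
  assumes mul_comm: "\<lbrakk>a \<in> carrier (G m); b \<in> carrier (G n)\<rbrakk> \<Longrightarrow>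
      mul n m b a = (if odd m \<and> odd n then \<ominus>\<^bsub>G (m + n)\<^esub> mul m n a b else mul m n a b)"
    and two: "\<lbrakk>two; a \<in> carrier (G n)\<rbrakk> \<Longrightarrow> a \<oplus>\<^bsub>G n\<^esub> a = \<zero>\<^bsub>G n\<^esub>"
begin

definition ev where "ev n \<longleftrightarrow> two \<or> even n" for n :: nat

definition even_part where
  "even_part = (if two then DS else DS\<lparr>carrier := {h \<in> carrier DS. \<forall>n. odd n \<longrightarrow> h n = \<zero>\<^bsub>G n\<^esub>}\<rparr>)"

lemma even_part_alt: "even_part = DS\<lparr>carrier := {h \<in> carrier DS. \<forall>n. \<not> ev n \<longrightarrow> h n = \<zero>\<^bsub>G n\<^esub>}\<rparr>"
  by (auto simp: even_part_def ev_def direct_sum_def)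

lemma even_part_simps:
  "carrier even_part = {h \<in> carrier DS. \<forall>n. \<not> ev n \<longrightarrow> h n = \<zero>\<^bsub>G n\<^esub>}"
  "monoid.mult even_part = monoid.mult DS" "monoid.one even_part = monoid.one DS"
  "ring.zero even_part = ring.zero DS" "ring.add even_part = ring.add DS"
  by (simp_all add: even_part_alt)

lemma ev_neg: "two \<Longrightarrow> a \<in> carrier (G n) \<Longrightarrow> \<ominus>\<^bsub>G n\<^esub> a = a"
  using G.minus_equality[of n a a] two by simp

lemma even_part_ring: "ring even_part"
  unfolding even_part_alt
proof (rule ring.subring_is_ring[OF DS_ring], rule ring.subringI[OF DS_ring])
  interpret D: ring DS by (rule DS_ring)
  let ?S = "{h \<in> carrier DS. \<forall>n. \<not> ev n \<longrightarrow> h n = \<zero>\<^bsub>G n\<^esub>}"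
  show "?S \<subseteq> carrier DS" by blast
  have "\<not> ev n \<Longrightarrow> \<one>\<^bsub>DS\<^esub> n = \<zero>\<^bsub>G n\<^esub>" for n by (auto simp: DS_simps(3) ev_def)
  then show "\<one>\<^bsub>DS\<^esub> \<in> ?S" using D.one_closed by blast
  have nz: "\<ominus>\<^bsub>G n\<^esub> \<zero>\<^bsub>G n\<^esub> = \<zero>\<^bsub>G n\<^esub>" for n using G.minus_equality[of n "\<zero>\<^bsub>G n\<^esub>" "\<zero>\<^bsub>G n\<^esub>"] by simp
  show "\<ominus>\<^bsub>DS\<^esub> h \<in> ?S" if h: "h \<in> ?S" for h
  proof -
    have hc: "h \<in> carrier DS" using h by blast
    have "(\<ominus>\<^bsub>DS\<^esub> h) n = \<zero>\<^bsub>G n\<^esub>" if "\<not> ev n" for n using h that nz by (simp add: DS_neg[OF hc])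
    then show ?thesis using D.a_inv_closed[OF hc] by blast
  qed
  fix g h assume gh: "g \<in> ?S" "h \<in> ?S"
  then have c: "g \<in> carrier DS" "h \<in> carrier DS" by blast+
  have "(g \<oplus>\<^bsub>DS\<^esub> h) n = \<zero>\<^bsub>G n\<^esub>" if "\<not> ev n" for n using gh that by (simp add: DS_simps(5))
  then show "g \<oplus>\<^bsub>DS\<^esub> h \<in> ?S" using D.a_closed c by blast
  have "(g \<otimes>\<^bsub>DS\<^esub> h) n = \<zero>\<^bsub>G n\<^esub>" if n: "\<not> ev n" for n
  proof -
    have "mul i (n - i) (g i) (h (n - i)) = \<zero>\<^bsub>G n\<^esub>" if i: "i \<le> n" for i
    proof (cases "ev i")
      case True
      obtain j where "n = i + j" using i le_Suc_ex by blast
      then have "\<not> ev (n - i)" using n True unfolding ev_def by simp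
      then show ?thesis using gh i mul_linear_right(1)[OF DS_closed[OF c(1)], of i "n - i"] by simp
    next
      case False
      then show ?thesis using gh i mul_linear_left(1)[OF DS_closed[OF c(2)], of i "n - i"] by simp
    qed
    then have "(g \<otimes>\<^bsub>DS\<^esub> h) n = (\<Oplus>\<^bsub>G n\<^esub>i\<in>{..n}. \<zero>\<^bsub>G n\<^esub>)"
      unfolding DS_simps(2) by (intro G.finsum_cong') auto
    then show ?thesis by simp
  qed
  then show "g \<otimes>\<^bsub>DS\<^esub> h \<in> ?S" using D.m_closed c by blast
qed

lemma even_part_cring: "cring even_part"
proof -
  interpret E: ring even_part by (rule even_part_ring)
  have "g \<otimes>\<^bsub>even_part\<^esub> h = h \<otimes>\<^bsub>even_part\<^esub> g" if gh: "g \<in> carrier even_part" "h \<in> carrier even_part" for g h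
    unfolding even_part_simps(2)
  proof
    fix n :: nat
    have c: "g \<in> carrier DS" "h \<in> carrier DS" using gh by (auto simp: even_part_simps(1))
    have inj: "inj_on (\<lambda>i. n - i) {..n}" by (auto simp: inj_on_def)
    have "i \<in> (\<lambda>i. n - i) ` {..n}" if "i \<le> n" for i
      using that by (intro image_eqI[of _ _ "n - i"]) auto
    then have im: "(\<lambda>i. n - i) ` {..n} = {..n}" by auto
    let ?f = "\<lambda>i. mul i (n - i) (h i) (g (n - i))"
    have "(h \<otimes>\<^bsub>DS\<^esub> g) n = finsum (G n) ?f ((\<lambda>i. n - i) ` {..n})"
      unfolding DS_simps(2) im ..
    also have "\<dots> = finsum (G n) (\<lambda>i. ?f (n - i)) {..n}"
    proof (rule G.finsum_reindex[OF _ inj])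
      show "?f \<in> (\<lambda>i. n - i) ` {..n} \<rightarrow> carrier (G n)"
        unfolding im using mul_term_closed[OF c(2,1)] by auto
    qed
    also have "\<dots> = (g \<otimes>\<^bsub>DS\<^esub> h) n"
      unfolding DS_simps(2)
    proof (intro G.finsum_cong' refl)
      fix i assume "i \<in> {..n}"
      then have i: "i \<le> n" by simp
      \<comment> \<open>Only two odd factors could produce a sign: it is trivial if
        \<open>two\<close> holds, and otherwise elements of the even part have no odd
        components.\<close>
      have "mul (n - i) i (h (n - i)) (g i) = mul i (n - i) (g i) (h (n - i))"
      proof (cases "odd i \<and> odd (n - i)")
        case True
        note o = this
        show ?thesis
        proof (cases two)
          case True
          then show ?thesis
            using mul_comm[OF DS_closed[OF c(1), of i] DS_closed[OF c(2), of "n - i"]] i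
              ev_neg[OF True mul_term_closed[OF c i]] by simp
        next
          case False
          then have "\<not> ev i" using o unfolding ev_def by simp
          then have "g i = \<zero>\<^bsub>G i\<^esub>" using gh(1) unfolding even_part_simps(1) by blast
          then show ?thesis
            using mul_linear_left(1)[OF DS_closed[OF c(2)], of i "n - i"]
              mul_linear_right(1)[OF DS_closed[OF c(2)], of "n - i" i] i by simp
        qed
      next
        case False
        then show ?thesis using mul_comm[OF DS_closed[OF c(1), of i] DS_closed[OF c(2), of "n - i"]] by auto
      qed
      then show "mul (n - i) (n - (n - i)) (h (n - i)) (g (n - (n - i))) = mul i (n - i) (g i) (h (n - i))"
        using i by simp
    qed (use mul_term_closed[OF c] in auto)
    finally show "(g \<otimes>\<^bsub>DS\<^esub> h) n = (h \<otimes>\<^bsub>DS\<^esub> g) n" ..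
  qed
  then have "comm_monoid even_part" by (rule E.monoid_comm_monoidI)
  then show ?thesis by (simp add: cring_def even_part_ring)
qed

lemma even_part_neg:
  assumes "a \<in> carrier even_part"
  shows "(\<ominus>\<^bsub>even_part\<^esub> a) n = \<ominus>\<^bsub>G n\<^esub> a n"
proof -
  interpret E: ring even_part by (rule even_part_ring)
  have c: "a \<in> carrier DS" "\<ominus>\<^bsub>even_part\<^esub> a \<in> carrier DS"
    using assms E.a_inv_closed[OF assms] by (auto simp: even_part_simps(1))
  have "(\<ominus>\<^bsub>even_part\<^esub> a \<oplus>\<^bsub>even_part\<^esub> a) n = \<zero>\<^bsub>G n\<^esub>"
    using E.l_neg[OF assms] by (simp add: even_part_simps(4) DS_simps(4))
  then have "(\<ominus>\<^bsub>even_part\<^esub> a) n \<oplus>\<^bsub>G n\<^esub> a n = \<zero>\<^bsub>G n\<^esub>" by (simp add: even_part_simps(5) DS_simps(5))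
  from G.minus_equality[OF this DS_closed[OF c(1)] DS_closed[OF c(2)]] show ?thesis ..
qed

lemma single_even: "\<lbrakk>x \<in> carrier (G d); ev d\<rbrakk> \<Longrightarrow> single d x \<in> carrier even_part"
  using single_closed by (auto simp: even_part_simps(1) single_def)

lemma single_pow:
  assumes "x \<in> carrier (G d)" "ev d"
  shows "single d x [^]\<^bsub>even_part\<^esub> (k::nat) = single (k * d) (hpow d x k)"
proof -
  interpret E: cring even_part by (rule even_part_cring)
  show ?thesis
  proof (induction k)
    case 0
    show ?case by (auto simp: single_def even_part_simps DS_simps(3) fun_eq_iff)
  next
    case (Suc k)
    have "single d x [^]\<^bsub>even_part\<^esub> Suc k = single d x \<otimes>\<^bsub>DS\<^esub> single (k * d) (hpow d x k)"
      using E.nat_pow_Suc2[OF single_even[OF assms], of k] Suc by (simp add: even_part_simps(2))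
    then show ?case using single_single[OF assms(1) hpow_closed[OF assms(1)]] by simp
  qed
qed

text \<open>Reduces powers of an element of odd degree to powers of its square, which has even
  degree.\<close>

lemma hpow_double:
  assumes x: "x \<in> carrier (G d)"
  shows "hpow d x (2 * k) = hpow (d + d) (mul d d x x) k"
proof (induction k)
  case (Suc k)
  have e: "2 * k * d = k * (d + d)" "Suc (2 * k) * d = d + k * (d + d)" by (simp_all add: algebra_simps)
  have "hpow d x (2 * Suc k) = mul d (d + k * (d + d)) x (mul d (k * (d + d)) x (hpow d x (2 * k)))"
    by (simp only: mult_Suc_right add_2_eq_Suc hpow.simps e)
  also have "\<dots> = mul (d + d) (k * (d + d)) (mul d d x x) (hpow d x (2 * k))"
    using mul_assoc[OF x x, of "hpow d x (2 * k)" "k * (d + d)"] hpow_closed[OF x, of "2 * k"] e(1) by simp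
  finally show ?case using Suc by simp
qed simp

text \<open>The letters in \<open>L\<close> are pairs of a degree and an element; \<open>k\<close> counts how often each letter occurs in the monomial.\<close>

inductive mono for L where
  base: "c \<in> carrier (G 0) \<Longrightarrow> mono L (\<lambda>_. 0) 0 c"
| step: "\<lbrakk>mono L k n \<xi>; (d, x) \<in> L\<rbrakk> \<Longrightarrow> mono L (k((d, x) := Suc (k (d, x)))) (d + n) (mul d n x \<xi>)"

text \<open>Coefficients of degree 0 are already absorbed by the base case of \<open>mono\<close>,
  so additive combinations suffice.\<close>

inductive span for L where
  zero: "span L n \<zero>\<^bsub>G n\<^esub>"
| mono: "mono L k n \<xi> \<Longrightarrow> span L n \<xi>"
| neg: "span L n \<xi> \<Longrightarrow> span L n (\<ominus>\<^bsub>G n\<^esub> \<xi>)"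
| add: "\<lbrakk>span L n \<xi>; span L n \<eta>\<rbrakk> \<Longrightarrow> span L n (\<xi> \<oplus>\<^bsub>G n\<^esub> \<eta>)"

context
  fixes L assumes L: "\<And>d x. (d, x) \<in> L \<Longrightarrow> x \<in> carrier (G d)"
begin

lemma mono_closed: "mono L k n \<xi> \<Longrightarrow> \<xi> \<in> carrier (G n)"
  by (induction rule: mono.induct) (auto intro: mul_closed L)

lemma span_closed: "span L n \<xi> \<Longrightarrow> \<xi> \<in> carrier (G n)"
  by (induction rule: span.induct) (auto intro: mono_closed)

text \<open>Used to bound exponents: with finitely many letters, a monomial of large degree must
  repeat one of them often.\<close>

lemma mono_degree:
  assumes "finite L"
  shows "mono L k n \<xi> \<Longrightarrow> n = (\<Sum>l\<in>L. k l * fst l)"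
proof (induction rule: mono.induct)
  case (step k n \<xi> d x)
  let ?k = "k((d, x) := Suc (k (d, x)))"
  have "(\<Sum>l\<in>L. ?k l * fst l) = ?k (d, x) * d + (\<Sum>l\<in>L - {(d, x)}. ?k l * fst l)"
    using assms step(2) by (simp add: sum.remove)
  also have "(\<Sum>l\<in>L - {(d, x)}. ?k l * fst l) = (\<Sum>l\<in>L - {(d, x)}. k l * fst l)"
    by (rule sum.cong) auto
  also have "?k (d, x) * d + (\<Sum>l\<in>L - {(d, x)}. k l * fst l) = d + (\<Sum>l\<in>L. k l * fst l)"
    using assms step(2) sum.remove[of L "(d, x)" "\<lambda>l. k l * fst l"] by simp
  finally show ?case using step.IH by simp
qed simp

text \<open>All occurrences of the letter x are collected at the front. Prepending another letter y
  means moving it past the power of x, which graded commutativity allows at the cost of a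
  sign.\<close>

lemma mono_power:
  assumes "mono L k n \<xi>" and dx: "(d, x) \<in> L"
  shows "\<exists>m \<eta>. \<eta> \<in> carrier (G m) \<and> n = k (d, x) * d + m \<and>
    (\<xi> = mul (k (d, x) * d) m (hpow d x (k (d, x))) \<eta> \<or>
     \<xi> = \<ominus>\<^bsub>G n\<^esub> mul (k (d, x) * d) m (hpow d x (k (d, x))) \<eta>)"
  using assms(1)
proof (induction rule: mono.induct)
  case (base c)
  then show ?case using mul_one_left by (intro exI[of _ 0] exI[of _ c]) simp
next
  case (step k n \<xi> e y)
  let ?j = "k (d, x)"
  obtain m \<eta> where \<eta>: "\<eta> \<in> carrier (G m)" "n = ?j * d + m"
    "\<xi> = mul (?j * d) m (hpow d x ?j) \<eta> \<or> \<xi> = \<ominus>\<^bsub>G n\<^esub> mul (?j * d) m (hpow d x ?j) \<eta>"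
    using step.IH by blast
  let ?p = "hpow d x ?j"
  have p: "?p \<in> carrier (G (?j * d))" using hpow_closed[OF L[OF dx]] .
  have y: "y \<in> carrier (G e)" using L step by blast
  let ?z = "mul (?j * d) m ?p \<eta>"
  have z: "?z \<in> carrier (G n)" using mul_closed[OF p \<eta>(1)] \<eta>(2) by simp
  have yz: "mul e n y \<xi> = mul e n y ?z \<or> mul e n y \<xi> = \<ominus>\<^bsub>G (e + n)\<^esub> mul e n y ?z"
    using \<eta>(3) mul_linear_right(2)[OF y z] by auto
  have yz2: "mul e n y ?z = mul (e + ?j * d) m (mul e (?j * d) y ?p) \<eta>"
    using mul_assoc[OF y p \<eta>(1)] \<eta>(2) by simp
  show ?case
  proof (cases "(e, y) = (d, x)")
    case True
    then show ?thesis
      using yz yz2 \<eta>(1,2) by (intro exI[of _ m] exI[of _ \<eta>]) (auto simp: add.assoc)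
  next
    case False
    have w: "mul e m y \<eta> \<in> carrier (G (e + m))" using mul_closed[OF y \<eta>(1)] .
    have py: "mul (?j * d) e ?p y \<in> carrier (G (?j * d + e))" using mul_closed[OF p y] .
    let ?v = "mul (?j * d) (e + m) ?p (mul e m y \<eta>)"
    have v: "?v \<in> carrier (G (e + n))" using mul_closed[OF p w] \<eta>(2) by (simp add: ac_simps)
    have "mul (?j * d + e) m (mul (?j * d) e ?p y) \<eta> = ?v" using mul_assoc[OF p y \<eta>(1)] .
    then have "mul e n y ?z = ?v \<or> mul e n y ?z = \<ominus>\<^bsub>G (e + n)\<^esub> ?v"
      using yz2 mul_comm[OF p y] mul_linear_left(2)[OF \<eta>(1) py] \<eta>(2) by (auto simp: ac_simps split: if_splits)
    then have "mul e n y \<xi> = ?v \<or> mul e n y \<xi> = \<ominus>\<^bsub>G (e + n)\<^esub> ?v"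
      using yz G.minus_minus[OF v] by auto
    then show ?thesis
      using False w \<eta>(2) by (intro exI[of _ "e + m"] exI[of _ "mul e m y \<eta>"]) auto
  qed
qed

lemma span_subgroup: "additive_subgroup {\<xi>. span L n \<xi>} (G n)"
  by (rule additive_subgroupI') (auto intro: span.intros span_closed G.abelian_group_axioms)

lemma span_letter:
  assumes dx: "(d, x) \<in> L"
  shows "span L n \<xi> \<Longrightarrow> span L (d + n) (mul d n x \<xi>)"
proof (induction rule: span.induct)
  case (zero n)
  then show ?case using mul_linear_right(1)[OF L[OF dx]] span.zero by simp
next
  case (mono k n \<xi>)
  then show ?case using span.mono[OF mono.step[OF _ dx]] by blast
next
  case (neg n \<xi>)
  then show ?case using mul_linear_right(2)[OF L[OF dx] span_closed[OF neg(1)]] span.neg by simp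
next
  case (add n \<xi> \<eta>)
  then show ?case using mul_add_right[OF L[OF dx] span_closed[OF add(1)] span_closed[OF add(2)]] span.add by simp
qed

text \<open>Elements of degree 0 commute with everything, so the scalar passes through the letters
  to the coefficient in the base case.\<close>

lemma mono_scalar:
  assumes c: "c \<in> carrier (G 0)"
  shows "mono L k n \<xi> \<Longrightarrow> mono L k n (mul 0 n c \<xi>)"
proof (induction rule: mono.induct)
  case (base c')
  then show ?case using mul_closed[OF c base] mono.base by simp
next
  case (step k n \<xi> d x)
  have x: "x \<in> carrier (G d)" using L step by blast
  note \<xi> = mono_closed[OF step(1)]
  have "mul 0 (d + n) c (mul d n x \<xi>) = mul (0 + d) n (mul 0 d c x) \<xi>"
    using mul_assoc[OF c x \<xi>] by simp
  also have "mul 0 d c x = mul d 0 x c" using mul_comm[OF x c] by simp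
  also have "mul (0 + d) n (mul d 0 x c) \<xi> = mul d n x (mul 0 n c \<xi>)"
    using mul_assoc[OF x c \<xi>] by simp
  finally show ?case using mono.step[OF step.IH step(2)] by (simp only:)
qed

lemma span_scalar:
  assumes c: "c \<in> carrier (G 0)"
  shows "span L n \<xi> \<Longrightarrow> span L n (mul 0 n c \<xi>)"
proof (induction rule: span.induct)
  case (zero n)
  then show ?case using mul_linear_right(1)[OF c, of n] span.zero by simp
next
  case (mono k n \<xi>)
  then show ?case using span.mono[OF mono_scalar[OF c]] by blast
next
  case (neg n \<xi>)
  then show ?case using mul_linear_right(2)[OF c span_closed[OF neg(1)]] span.neg by simp
next
  case (add n \<xi> \<eta>)
  then show ?case using mul_add_right[OF c span_closed[OF add(1)] span_closed[OF add(2)]] span.add by simp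
qed

text \<open>Ring elements act on spans from the left, so a product in \<open>generate_ring\<close>
  acts as a composite and spans never have to be multiplied with each other. Applied to u in degree
  0, this puts each component of a generated element into the span.\<close>

lemma span_generated:
  assumes gens: "H \<subseteq> carrier DS" "\<And>h n. \<lbrakk>h \<in> H; n > 0; h n \<noteq> \<zero>\<^bsub>G n\<^esub>\<rbrakk> \<Longrightarrow> (n, h n) \<in> L"
  shows "h \<in> generate_ring DS H \<Longrightarrow> span L n \<xi> \<Longrightarrow> span L (m + n) (mul m n (h m) \<xi>)"
proof (induction arbitrary: m n \<xi> rule: generate_ring.induct)
  case one
  then show ?case
    using mul_one_left span_closed mul_linear_left(1)[OF span_closed] span.zero by (simp add: DS_simps(3))
next
  case (incl h)
  note hc = DS_closed[OF subsetD[OF gens(1) incl(1)]]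
  consider "m = 0" | "m > 0" "h m = \<zero>\<^bsub>G m\<^esub>" | "m > 0" "h m \<noteq> \<zero>\<^bsub>G m\<^esub>" by blast
  then show ?case
  proof cases
    case 1
    then show ?thesis using span_scalar[OF hc] incl by simp
  next
    case 2
    then show ?thesis using mul_linear_left(1)[OF span_closed[OF incl(2)]] span.zero by simp
  next
    case 3
    then show ?thesis using span_letter[OF gens(2)] incl by blast
  qed
next
  case (a_inv h)
  have h: "h \<in> carrier DS" using ring.generate_ring_in_carrier[OF DS_ring gens(1)] a_inv by blast
  then show ?case
    using a_inv mul_linear_left(2)[OF span_closed[OF a_inv(3)] DS_closed[OF h]] span.neg by (simp add: DS_neg)
next
  case (eng_add h1 h2)
  have h: "h1 \<in> carrier DS" "h2 \<in> carrier DS" using ring.generate_ring_in_carrier[OF DS_ring gens(1)] eng_add by blast+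
  then show ?case
    using eng_add mul_add_left[OF DS_closed[OF h(1)] DS_closed[OF h(2)] span_closed[OF eng_add(5)]] span.add
    by (simp add: DS_simps(5))
next
  case (eng_mult h1 h2)
  have h: "h1 \<in> carrier DS" "h2 \<in> carrier DS" using ring.generate_ring_in_carrier[OF DS_ring gens(1)] eng_mult by blast+
  note \<xi> = span_closed[OF eng_mult(5)]
  have "mul m n ((h1 \<otimes>\<^bsub>DS\<^esub> h2) m) \<xi> = (\<Oplus>\<^bsub>G (m + n)\<^esub>i\<in>{..m}. mul m n (mul i (m - i) (h1 i) (h2 (m - i))) \<xi>)"
    unfolding DS_simps(2) using mul_term_closed[OF h] by (intro mul_finsum_left[OF \<xi>]) auto
  also have "\<dots> \<in> {\<xi>. span L (m + n) \<xi>}"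
  proof (rule G.finsum_in_subgroup[OF span_subgroup])
    fix i assume i: "i \<in> {..m}"
    have "mul (i + (m - i)) n (mul i (m - i) (h1 i) (h2 (m - i))) \<xi> = mul i (m - i + n) (h1 i) (mul (m - i) n (h2 (m - i)) \<xi>)"
      using mul_assoc[OF DS_closed[OF h(1)] DS_closed[OF h(2)] \<xi>] .
    moreover have "span L (i + (m - i + n)) (mul i (m - i + n) (h1 i) (mul (m - i) n (h2 (m - i)) \<xi>))"
      using eng_mult.IH(1)[OF eng_mult.IH(2)[OF eng_mult(5)]] .
    ultimately show "mul m n (mul i (m - i) (h1 i) (h2 (m - i))) \<xi> \<in> {\<xi>. span L (m + n) \<xi>}"
      using i by simp
  qed
  finally show ?case by simp
qed

end

section \<open>Homogeneous ideals and Krull dimension zero\<close>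

context
  fixes J
  assumes J_sub: "\<And>n. additive_subgroup (J n) (G n)"
    and J_left: "\<And>m n a b. \<lbrakk>a \<in> carrier (G m); b \<in> J n\<rbrakk> \<Longrightarrow> mul m n a b \<in> J (m + n)"
    and J_right: "\<And>m n a b. \<lbrakk>a \<in> J m; b \<in> carrier (G n)\<rbrakk> \<Longrightarrow> mul m n a b \<in> J (m + n)"
begin

text \<open>J is an ideal of the full graded ring, odd degrees included, so that powers of odd
  letters can be tested against it; this is its trace on the even part.\<close>

definition graded_ideal where "graded_ideal = {h \<in> carrier even_part. \<forall>n. h n \<in> J n}"

lemma graded_ideal_ideal: "ideal graded_ideal even_part"
proof (rule idealI)
  show "ring even_part" by (rule even_part_ring)
  interpret E: ring even_part by (rule even_part_ring)
  note Jz = additive_subgroup.zero_closed[OF J_sub] and Ja = additive_subgroup.a_closed[OF J_sub]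
    and Jn = additive_subgroup.a_inv_closed[OF J_sub]
  have "additive_subgroup graded_ideal even_part"
  proof (rule additive_subgroupI')
    show "abelian_group even_part" by unfold_locales
    show "graded_ideal \<subseteq> carrier even_part" by (auto simp: graded_ideal_def)
    show "\<zero>\<^bsub>even_part\<^esub> \<in> graded_ideal"
      using E.zero_closed Jz by (simp add: graded_ideal_def even_part_simps(4) DS_simps(4))
    show "\<ominus>\<^bsub>even_part\<^esub> h \<in> graded_ideal" if "h \<in> graded_ideal" for h
      using that Jn by (simp add: graded_ideal_def even_part_neg)
    show "g \<oplus>\<^bsub>even_part\<^esub> h \<in> graded_ideal" if "g \<in> graded_ideal" "h \<in> graded_ideal" for g h
      using that Ja E.a_closed by (simp add: graded_ideal_def even_part_simps(5) DS_simps(5))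
  qed
  then show "subgroup graded_ideal (add_monoid even_part)" by (rule additive_subgroup.a_subgroup)
  fix a x assume a: "a \<in> graded_ideal" and x: "x \<in> carrier even_part"
  have c: "a \<in> carrier DS" "x \<in> carrier DS" "a \<in> carrier even_part" using a x by (auto simp: graded_ideal_def even_part_simps(1))
  have "(x \<otimes>\<^bsub>DS\<^esub> a) n \<in> J n" for n
    unfolding DS_simps(2)
  proof (rule G.finsum_in_subgroup[OF J_sub])
    fix i assume "i \<in> {..n}"
    then show "mul i (n - i) (x i) (a (n - i)) \<in> J n"
      using J_left[OF DS_closed[OF c(2)], of "a (n - i)" "n - i" i] a by (simp add: graded_ideal_def)
  qed
  then show "x \<otimes>\<^bsub>even_part\<^esub> a \<in> graded_ideal"
    using E.m_closed[OF x c(3)] by (simp add: graded_ideal_def even_part_simps(2))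
  have "(a \<otimes>\<^bsub>DS\<^esub> x) n \<in> J n" for n
    unfolding DS_simps(2)
  proof (rule G.finsum_in_subgroup[OF J_sub])
    fix i assume "i \<in> {..n}"
    then show "mul i (n - i) (a i) (x (n - i)) \<in> J n"
      using J_right[OF _ DS_closed[OF c(2)], of "a i" i "n - i"] a by (simp add: graded_ideal_def)
  qed
  then show "a \<otimes>\<^bsub>even_part\<^esub> x \<in> graded_ideal"
    using E.m_closed[OF c(3) x] by (simp add: graded_ideal_def even_part_simps(2))
qed

text \<open>The quotient comes from the division ring in degree 0, so each nonzero ideal is
  everything and no prime lies strictly above another. If the quotient is the zero ring, there are
  no primes and the supremum is 0 as well.\<close>

lemma krull_dim_concentrated:
  assumes pos: "\<And>n. n > 0 \<Longrightarrow> J n = carrier (G n)"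
    and inv: "\<And>x. \<lbrakk>x \<in> carrier (G 0); x \<noteq> \<zero>\<^bsub>G 0\<^esub>\<rbrakk> \<Longrightarrow> \<exists>y \<in> carrier (G 0). mul 0 0 y x = u"
  shows "krull_dim (even_part Quot graded_ideal) = 0"
proof -
  interpret I: ideal graded_ideal even_part by (rule graded_ideal_ideal)
  let ?R = "even_part Quot graded_ideal"
  interpret h: ring_hom_ring even_part ?R "(+>\<^bsub>even_part\<^esub>) graded_ideal" by (rule I.rcos_ring_hom_ring)
  have "P' = carrier ?R" if P: "ideal P ?R" "ideal P' ?R" "P \<subset> P'" for P P'
  proof -
    interpret P: ideal P ?R by fact
    interpret P': ideal P' ?R by fact
    obtain c where c: "c \<in> P'" "c \<notin> P" using P(3) by blast
    obtain g where g: "g \<in> carrier even_part" "c = graded_ideal +>\<^bsub>even_part\<^esub> g"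
      using P'.Icarr[OF c(1)] by (rule FactRing_carrierE)
    have gD: "g \<in> carrier DS" using g(1) by (simp add: even_part_simps(1))
    have "c \<noteq> \<zero>\<^bsub>?R\<^esub>" using c(2) P.zero_closed by metis
    moreover have "\<zero>\<^bsub>?R\<^esub> = graded_ideal" unfolding FactRing_def by simp
    ultimately have "g \<notin> graded_ideal" using g(2) I.a_rcos_const by metis
    then obtain n where n: "g n \<notin> J n" using g(1) unfolding graded_ideal_def by blast
    then have "n = 0" using pos[of n] DS_closed[OF gD, of n] by blast
    then have "g 0 \<noteq> \<zero>\<^bsub>G 0\<^esub>" using n additive_subgroup.zero_closed[OF J_sub, of 0] by metis
    then obtain y where y: "y \<in> carrier (G 0)" "mul 0 0 y (g 0) = u" using inv[OF DS_closed[OF gD]] by blast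
    have s: "single 0 y \<in> carrier even_part" by (rule single_even[OF y(1)]) (simp add: ev_def)
    \<comment> \<open>After multiplication by the inverse y of its degree 0 part, the representative
      g has degree 0 part u and positive parts in J, so it is congruent to one.\<close>
    define p where "p = single 0 y \<otimes>\<^bsub>even_part\<^esub> g"
    have p: "p \<in> carrier even_part" unfolding p_def by (rule I.m_closed[OF s g(1)])
    have d: "\<one>\<^bsub>even_part\<^esub> \<ominus>\<^bsub>even_part\<^esub> p \<in> carrier even_part" by (rule I.minus_closed[OF I.one_closed p])
    have "(\<one>\<^bsub>even_part\<^esub> \<ominus>\<^bsub>even_part\<^esub> p) n \<in> J n" for n
    proof (cases "n = 0")
      case True
      have "p 0 = u" unfolding p_def using single_mult[OF y(1) gD, of 0] y(2) by (simp add: even_part_simps(2))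
      then have "(\<one>\<^bsub>even_part\<^esub> \<ominus>\<^bsub>even_part\<^esub> p) 0 = u \<oplus>\<^bsub>G 0\<^esub> \<ominus>\<^bsub>G 0\<^esub> u"
        using even_part_neg[OF p] by (simp add: a_minus_def even_part_simps(3,5) DS_simps(3,5))
      then show ?thesis using True unit_closed additive_subgroup.zero_closed[OF J_sub, of 0] by (simp add: G.r_neg)
    next
      case False
      have "\<one>\<^bsub>even_part\<^esub> \<ominus>\<^bsub>even_part\<^esub> p \<in> carrier DS" using d unfolding even_part_simps(1) by blast
      then show ?thesis using pos False DS_closed by blast
    qed
    then have "\<one>\<^bsub>even_part\<^esub> \<ominus>\<^bsub>even_part\<^esub> p \<in> graded_ideal" using d unfolding graded_ideal_def by blast
    then have "\<one>\<^bsub>even_part\<^esub> \<in> graded_ideal +>\<^bsub>even_part\<^esub> p"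
      using I.a_rcos_module_minus[OF even_part_ring p I.one_closed] by blast
    then have "graded_ideal +>\<^bsub>even_part\<^esub> p = graded_ideal +>\<^bsub>even_part\<^esub> \<one>\<^bsub>even_part\<^esub>"
      using I.a_repr_independence' p by blast
    then have "\<one>\<^bsub>?R\<^esub> = (graded_ideal +>\<^bsub>even_part\<^esub> single 0 y) \<otimes>\<^bsub>?R\<^esub> c"
      unfolding p_def using h.hom_mult[OF s g(1)] h.hom_one g(2) by metis
    also have "\<dots> \<in> P'" using P'.I_l_closed[OF c(1)] h.hom_closed[OF s] by blast
    finally show ?thesis using P'.one_imp_carrier by blast
  qed
  then have no: "\<not> P \<subset> P'" if "primeideal P ?R" "primeideal P' ?R" for P P'
    using that primeideal.I_notcarr[OF that(2)] primeideal.axioms(1) by metis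
  have sub: "{n. \<exists>P. (\<forall>i\<le>n. primeideal (P i) ?R) \<and> (\<forall>i<n. P i \<subset> P (Suc i))} \<subseteq> {0::nat}"
  proof
    fix n assume "n \<in> {n. \<exists>P. (\<forall>i\<le>n. primeideal (P i) ?R) \<and> (\<forall>i<n. P i \<subset> P (Suc i))}"
    then obtain P where P: "\<forall>i\<le>n. primeideal (P i) ?R" "\<forall>i<n. P i \<subset> P (Suc i)" by blast
    have False if "n > 0" using no[of "P 0" "P (Suc 0)"] P that by auto
    then show "n \<in> {0}" by blast
  qed
  have "krull_dim ?R \<le> 0"
    unfolding krull_dim_def
  proof (rule Sup_least)
    fix e assume "e \<in> enat ` {n. \<exists>P. (\<forall>i\<le>n. primeideal (P i) ?R) \<and> (\<forall>i<n. P i \<subset> P (Suc i))}"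
    then have "e \<in> enat ` {0}" using image_mono[OF sub] by (rule rev_subsetD)
    then show "e \<le> 0" by (simp add: zero_enat_def)
  qed
  then show ?thesis by simp
qed

text \<open>In the quotient, t^n = t^(n+1) c for the class t of x. In degree nd the left side has
  the part x^n, whereas multiples of x^(n+1) start in degree (n+1)d; as the ideal is homogeneous,
  x^n lies in J.\<close>

lemma nilpotent_even:
  assumes dim: "krull_dim (even_part Quot graded_ideal) = 0" and d: "d > 0" "ev d" and x: "x \<in> carrier (G d)"
  shows "\<exists>N. hpow d x N \<in> J (N * d)"
proof -
  interpret E: cring even_part by (rule even_part_cring)
  interpret I: ideal graded_ideal even_part by (rule graded_ideal_ideal)
  let ?R = "even_part Quot graded_ideal"
  interpret h: ring_hom_ring even_part ?R "(+>\<^bsub>even_part\<^esub>) graded_ideal" by (rule I.rcos_ring_hom_ring)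
  interpret R: cring ?R by (rule I.quotient_is_cring) unfold_locales
  let ?s = "single d x"
  have s: "?s \<in> carrier even_part" using single_even[OF x d(2)] .
  let ?t = "graded_ideal +>\<^bsub>even_part\<^esub> ?s"
  obtain n :: nat where "\<exists>c\<in>carrier ?R. ?t [^]\<^bsub>?R\<^esub> n = ?t [^]\<^bsub>?R\<^esub> Suc n \<otimes>\<^bsub>?R\<^esub> c"
    using R.krull_dim_0_power[OF dim h.hom_closed[OF s]] by (rule exE)
  then obtain c where n: "c \<in> carrier ?R" "?t [^]\<^bsub>?R\<^esub> n = ?t [^]\<^bsub>?R\<^esub> Suc n \<otimes>\<^bsub>?R\<^esub> c"
    by (rule bexE)
  obtain g where g: "g \<in> carrier even_part" "c = graded_ideal +>\<^bsub>even_part\<^esub> g"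
    using n(1) by (rule FactRing_carrierE)
  have gD: "g \<in> carrier DS" using g(1) by (simp add: even_part_simps(1))
  define p where "p = ?s [^]\<^bsub>even_part\<^esub> n"
  define q where "q = ?s [^]\<^bsub>even_part\<^esub> Suc n \<otimes>\<^bsub>even_part\<^esub> g"
  have pq: "p \<in> carrier even_part" "q \<in> carrier even_part"
    unfolding p_def q_def using E.nat_pow_closed[OF s] E.m_closed[OF _ g(1)] by blast+
  have p_val: "p (n * d) = hpow d x n" unfolding p_def single_pow[OF x d(2)] by (simp add: single_def)
  have q_val: "q (n * d) = \<zero>\<^bsub>G (n * d)\<^esub>"
    unfolding q_def single_pow[OF x d(2)] even_part_simps(2)
    using single_mult[OF hpow_closed[OF x] gD, of "Suc n" "n * d"] d(1) by simp
  have "graded_ideal +>\<^bsub>even_part\<^esub> q = graded_ideal +>\<^bsub>even_part\<^esub> p"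
    unfolding p_def q_def using n(2) g h.hom_nat_pow[OF s] h.hom_mult[OF E.nat_pow_closed[OF s] g(1)] by metis
  then have "p \<ominus>\<^bsub>even_part\<^esub> q \<in> graded_ideal"
    using I.a_repr_independenceD[OF pq(1)] I.a_rcos_module_minus[OF even_part_ring pq(2,1)] by blast
  then have "(p \<ominus>\<^bsub>even_part\<^esub> q) (n * d) \<in> J (n * d)" unfolding graded_ideal_def by blast
  moreover have "\<ominus>\<^bsub>G (n * d)\<^esub> \<zero>\<^bsub>G (n * d)\<^esub> = \<zero>\<^bsub>G (n * d)\<^esub>"
    using G.minus_equality[of "n * d" "\<zero>\<^bsub>G (n * d)\<^esub>" "\<zero>\<^bsub>G (n * d)\<^esub>"] by simp
  then have "(p \<ominus>\<^bsub>even_part\<^esub> q) (n * d) = hpow d x n"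
    using hpow_closed[OF x, of n]
    by (simp add: a_minus_def even_part_simps(5) DS_simps(5) even_part_neg[OF pq(2)] p_val q_val)
  ultimately have "hpow d x n \<in> J (n * d)" by (simp only:)
  then show ?thesis by blast
qed

text \<open>The square of x has degree \<open>d + d\<close>, which is even for every d, so
  \<open>nilpotent_even\<close> applies to it.\<close>

lemma nilpotent:
  assumes dim: "krull_dim (even_part Quot graded_ideal) = 0" and d: "d > 0" and x: "x \<in> carrier (G d)"
  shows "\<exists>N. hpow d x N \<in> J (N * d)"
proof -
  obtain N where "hpow (d + d) (mul d d x x) N \<in> J (N * (d + d))"
    using nilpotent_even[OF dim _ _ mul_closed[OF x x]] d by (auto simp: ev_def)
  moreover have "2 * N * d = N * (d + d)" by (simp add: algebra_simps)
  ultimately have "hpow d x (2 * N) \<in> J (2 * N * d)"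
    using hpow_double[OF x, of N] by (simp only:)
  then show ?thesis by blast
qed

lemma hpow_mono:
  assumes "x \<in> carrier (G d)" "hpow d x N \<in> J (N * d)" "N \<le> k"
  shows "hpow d x k \<in> J (k * d)"
  using assms(3)
proof (induction k rule: dec_induct)
  case (step k)
  then show ?case using J_left[OF assms(1)] by simp
qed (rule assms(2))

text \<open>In a monomial whose degree exceeds the sum of all \<open>N l * fst l\<close>, some
  letter l occurs at least \<open>N l\<close> times. Collected at the front, its power lies in J,
  and so does the whole monomial.\<close>

lemma ideal_cofinite:
  assumes dim: "krull_dim (even_part Quot graded_ideal) = 0"
    and gens: "finite A" "A \<subseteq> carrier DS" and scal: "B \<subseteq> carrier DS" "\<And>b n. \<lbrakk>b \<in> B; n > 0\<rbrakk> \<Longrightarrow> b n = \<zero>\<^bsub>G n\<^esub>"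
    and gen: "generate_ring DS (A \<union> B) = carrier DS"
  shows "\<exists>D. \<forall>n\<ge>D. J n = carrier (G n)"
proof -
  \<comment> \<open>The generators need not be homogeneous, so the letters are their nonzero
    components of positive degree; components of degree 0 act as scalars on spans.\<close>
  define L where "L = (\<Union>a\<in>A. (\<lambda>n. (n, a n)) ` {n. a n \<noteq> \<zero>\<^bsub>G n\<^esub> \<and> n > 0})"
  have "finite {n. a n \<noteq> \<zero>\<^bsub>G n\<^esub> \<and> n > 0}" if "a \<in> A" for a
  proof -
    have "finite {n. a n \<noteq> \<zero>\<^bsub>G n\<^esub>}" using gens(2) that by (auto simp: DS_simps(1))
    then show ?thesis by (rule rev_finite_subset) blast
  qed
  then have finL: "finite L" using gens(1) by (simp add: L_def)
  have L: "x \<in> carrier (G d) \<and> d > 0" if "(d, x) \<in> L" for d x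
    using that gens(2) DS_closed by (auto simp: L_def)
  then have L': "\<And>d x. (d, x) \<in> L \<Longrightarrow> x \<in> carrier (G d)" by blast
  have "\<exists>N. hpow (fst l) (snd l) N \<in> J (N * fst l)" if "l \<in> L" for l
    using nilpotent[OF dim, of "fst l" "snd l"] L[of "fst l" "snd l"] that by simp
  then obtain N where N: "\<And>l. l \<in> L \<Longrightarrow> hpow (fst l) (snd l) (N l) \<in> J (N l * fst l)" by metis
  let ?D = "\<Sum>l\<in>L. N l * fst l"
  have monoJ: "\<xi> \<in> J n" if m: "mono L k n \<xi>" and n: "n > ?D" for k n \<xi>
  proof -
    have "\<exists>l\<in>L. N l \<le> k l"
    proof (rule ccontr)
      assume "\<not> ?thesis"
      then have "(\<Sum>l\<in>L. k l * fst l) \<le> ?D" by (intro sum_mono) (auto simp: not_le)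
      then show False using mono_degree[OF L' finL m] n by simp
    qed
    then obtain d x where dx: "(d, x) \<in> L" "N (d, x) \<le> k (d, x)" by auto
    have hp: "hpow d x (k (d, x)) \<in> J (k (d, x) * d)"
      using hpow_mono[OF L'[OF dx(1)] _ dx(2)] N[OF dx(1)] by simp
    obtain m \<eta> where \<eta>: "\<eta> \<in> carrier (G m)" "n = k (d, x) * d + m" 
      "\<xi> = mul (k (d, x) * d) m (hpow d x (k (d, x))) \<eta> \<or>
       \<xi> = \<ominus>\<^bsub>G n\<^esub> mul (k (d, x) * d) m (hpow d x (k (d, x))) \<eta>"
      using mono_power[OF L' m dx(1)] by blast
    have "mul (k (d, x) * d) m (hpow d x (k (d, x))) \<eta> \<in> J n" using J_right[OF hp \<eta>(1)] \<eta>(2) by simp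
    then show ?thesis using \<eta>(3) additive_subgroup.a_inv_closed[OF J_sub] by blast
  qed
  have spanJ: "\<xi> \<in> J n" if s: "span L n \<xi>" and n: "n > ?D" for n \<xi>
    using s n
  proof (induction rule: span.induct)
    case (zero n)
    then show ?case using additive_subgroup.zero_closed[OF J_sub] by blast
  next
    case (mono k n \<xi>)
    then show ?case using monoJ by blast
  next
    case (neg n \<xi>)
    then show ?case using additive_subgroup.a_inv_closed[OF J_sub] by blast
  next
    case (add n \<xi> \<eta>)
    then show ?case using additive_subgroup.a_closed[OF J_sub] by blast
  qed
  have "J n = carrier (G n)" if n: "n \<ge> Suc ?D" for n
  proof
    show "J n \<subseteq> carrier (G n)" using additive_subgroup.a_subset[OF J_sub] by blast
    show "carrier (G n) \<subseteq> J n"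
    proof
      fix x assume x: "x \<in> carrier (G n)"
      have H: "A \<union> B \<subseteq> carrier DS" using gens(2) scal(1) by blast
      have HL: "(n, h n) \<in> L" if "h \<in> A \<union> B" "n > 0" "h n \<noteq> \<zero>\<^bsub>G n\<^esub>" for h n
        using that scal(2) by (auto simp: L_def)
      \<comment> \<open>The homogeneous element belongs to the generated ring, and its component of
        degree n acting on u gives x back.\<close>
      have "single n x \<in> generate_ring DS (A \<union> B)" using single_closed[OF x] gen by simp
      moreover have "span L 0 u" by (rule span.mono[OF mono.base[OF unit_closed]])
      ultimately have "span L (n + 0) (mul n 0 (single n x n) u)"
        by (rule span_generated[of L "A \<union> B" "single n x" 0 u n, rotated -2])
          (erule L' | rule H | erule (2) HL)+
      then have "span L n x" using mul_one_right[OF x] by (simp add: single_def)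
      then show "x \<in> J n" using spanJ n by simp
    qed
  qed
  then show ?thesis by blast
qed

end

end

section \<open>Support varieties\<close>

text \<open>\<open>Ext_module\<close> extends the record of \<open>Ext_ring\<close> by an action.
  The two share their sums and zero, but the negation of one structure still has to be identified
  with that of the other.\<close>

lemma abelian_group_transfer:
  assumes R: "abelian_group R" and eq: "carrier R' = carrier R" "ring.add R' = ring.add R" "ring.zero R' = ring.zero R"
  shows "abelian_group R'" and "x \<in> carrier R \<Longrightarrow> \<ominus>\<^bsub>R'\<^esub> x = \<ominus>\<^bsub>R\<^esub> x"
proof -
  interpret R: abelian_group R by fact
  show R': "abelian_group R'"
    by (rule abelian_groupI) (auto simp: eq R.a_ac intro: R.l_neg)
  show "\<ominus>\<^bsub>R'\<^esub> x = \<ominus>\<^bsub>R\<^esub> x" if "x \<in> carrier R"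
    using abelian_group.minus_equality[OF R', of "\<ominus>\<^bsub>R\<^esub> x" x] that by (simp add: eq R.l_neg)
qed

section \<open>The cohomology ring as a graded commutative ring\<close>

context finite_tensor_category
begin

lemma Ext_graded_ring:
  assumes "X \<in> Obj C"
  shows "graded_ring (\<lambda>n. Ext C n X X) (\<lambda>m n. yoneda C m n X X X) (ext_class C 0 X X (res C X 0))"
  by (rule graded_ring.intro)
    (simp_all add: assms Ext_group yoneda_closed yoneda_add_left yoneda_add_right yoneda_assoc
      yoneda_one_left yoneda_one_right Ext_I augmentation_cocycle)

lemma Ext_ring_direct_sum:
  "Ext_ring C X = direct_sum (\<lambda>n. Ext C n X X) (\<lambda>m n. yoneda C m n X X X) (ext_class C 0 X X (res C X 0))"
  by (simp add: Ext_ring_def direct_sum_def)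

lemma yoneda_zero:
  assumes "X \<in> Obj C" "Y \<in> Obj C" "Z \<in> Obj C"
  shows "\<eta> \<in> carrier (Ext C n X Y) \<Longrightarrow> yoneda C m n X Y Z \<zero>\<^bsub>Ext C m Y Z\<^esub> \<eta> = \<zero>\<^bsub>Ext C (m + n) X Z\<^esub>"
    and "\<xi> \<in> carrier (Ext C m Y Z) \<Longrightarrow> yoneda C m n X Y Z \<xi> \<zero>\<^bsub>Ext C n X Y\<^esub> = \<zero>\<^bsub>Ext C (m + n) X Z\<^esub>"
proof -
  show "yoneda C m n X Y Z \<zero>\<^bsub>Ext C m Y Z\<^esub> \<eta> = \<zero>\<^bsub>Ext C (m + n) X Z\<^esub>" if "\<eta> \<in> carrier (Ext C n X Y)"
    by (rule additive_map(1)[OF Ext_group[OF assms(2,3)] Ext_group[OF assms(1,3)], where h="\<lambda>\<xi>. yoneda C m n X Y Z \<xi> \<eta>"])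
      (simp_all add: yoneda_closed yoneda_add_left assms that)
  show "yoneda C m n X Y Z \<xi> \<zero>\<^bsub>Ext C n X Y\<^esub> = \<zero>\<^bsub>Ext C (m + n) X Z\<^esub>" if "\<xi> \<in> carrier (Ext C m Y Z)"
    by (rule additive_map(1)[OF Ext_group[OF assms(1,2)] Ext_group[OF assms(1,3)], where h="\<lambda>\<eta>. yoneda C m n X Y Z \<xi> \<eta>"])
      (simp_all add: yoneda_closed yoneda_add_right assms that)
qed

lemma phi_part_linear:
  assumes "X \<in> Obj C"
  shows "phi_part C X n \<zero>\<^bsub>Ext C n I I\<^esub> = \<zero>\<^bsub>Ext C n X X\<^esub>"
    "\<xi> \<in> carrier (Ext C n I I) \<Longrightarrow> phi_part C X n (\<ominus>\<^bsub>Ext C n I I\<^esub> \<xi>) = \<ominus>\<^bsub>Ext C n X X\<^esub> phi_part C X n \<xi>"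
  using additive_map(1,2)[OF Ext_group[OF UnitO_Obj UnitO_Obj] Ext_group[OF assms assms], where h="phi_part C X n",
      OF phi_part_closed[OF assms] phi_part_add[OF assms]] by simp_all

lemma phi_part_one:
  assumes "X \<in> Obj C"
  shows "phi_part C X 0 (ext_class C 0 I I (res C I 0)) = ext_class C 0 X X (res C X 0)"
proof -
  obtain \<tau> where \<tau>: "\<tau> \<in> tensor_lifts C X" using tensor_lifts_exist[OF assms] .
  have "tensor_res C X 0 \<bullet> \<tau> 0 = res C X 0"
    using cliftD(2)[OF \<tau>[unfolded tensor_lifts_clift[OF assms]]] .
  then show ?thesis
    using phi_part_eq(1)[OF assms augmentation_cocycle[OF UnitO_Obj] \<tau>] by (simp add: tensor_res_def)
qed

lemma Ext_double_char_2:
  assumes two: "\<one>\<^bsub>K\<^esub> \<oplus>\<^bsub>K\<^esub> \<one>\<^bsub>K\<^esub> = \<zero>\<^bsub>K\<^esub>" and O: "X \<in> Obj C" "Y \<in> Obj C" and \<xi>: "\<xi> \<in> carrier (Ext C n X Y)"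
  shows "\<xi> \<oplus>\<^bsub>Ext C n X Y\<^esub> \<xi> = \<zero>\<^bsub>Ext C n X Y\<^esub>"
proof -
  obtain f where f: "f \<in> cocycles C n X Y" "\<xi> = ext_class C n X Y f" using Ext_E[OF O \<xi>] .
  interpret M: module K "HomMod C (resO C X n) Y" using HomMod_module O by simp
  have fc: "f \<in> carrier (HomMod C (resO C X n) Y)" using cocycle_carrier[OF O f(1)] .
  have "(\<one>\<^bsub>K\<^esub> \<oplus>\<^bsub>K\<^esub> \<one>\<^bsub>K\<^esub>) \<odot>\<^bsub>HomMod C (resO C X n) Y\<^esub> f = f \<oplus>\<^bsub>HomMod C (resO C X n) Y\<^esub> f"
    using M.smult_l_distr[of "\<one>\<^bsub>K\<^esub>" "\<one>\<^bsub>K\<^esub>" f] fc by simp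
  then have "f \<oplus>\<^bsub>HomMod C (resO C X n) Y\<^esub> f = zero_arrow C (resO C X n) Y"
    unfolding two using M.smult_l_null[OF fc] by simp
  then show ?thesis using Ext_add[OF O f(1) f(1)] f(2) Ext_zero[OF O] by simp
qed

abbreviation "char_two \<equiv> \<one>\<^bsub>K\<^esub> \<oplus>\<^bsub>K\<^esub> \<one>\<^bsub>K\<^esub> = \<zero>\<^bsub>K\<^esub>"

lemma cohomology_graded_comm_ring:
  "graded_comm_ring (\<lambda>n. Ext C n I I) (\<lambda>m n. yoneda C m n I I I) (ext_class C 0 I I (res C I 0)) char_two"
proof -
  interpret graded_ring "\<lambda>n. Ext C n I I" "\<lambda>m n. yoneda C m n I I I" "ext_class C 0 I I (res C I 0)"
    by (rule Ext_graded_ring) simp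
  show ?thesis
    by unfold_locales (rule yoneda_graded_commute Ext_double_char_2; simp)+
qed

lemma phi_closed:
  assumes X: "X \<in> Obj C" and h: "h \<in> carrier (cohomology_ring C)"
  shows "phi C X h \<in> carrier (Ext_ring C X)"
proof -
  have h': "\<And>n. h n \<in> carrier (Ext C n I I)" "finite {n. h n \<noteq> \<zero>\<^bsub>Ext C n I I\<^esub>}"
    using h by (simp_all add: cohomology_ring_def Ext_ring_def)
  have "{n. phi_part C X n (h n) \<noteq> \<zero>\<^bsub>Ext C n X X\<^esub>} \<subseteq> {n. h n \<noteq> \<zero>\<^bsub>Ext C n I I\<^esub>}"
    using phi_part_linear(1)[OF X] by auto
  then show ?thesis
    using phi_part_closed[OF X h'(1)] finite_subset[OF _ h'(2)] by (simp add: Ext_ring_def phi_eq_parts)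
qed

lemma Ext_module_simps:
  "carrier (Ext_module C X) = carrier (Ext_ring C X)" "ring.add (Ext_module C X) = ring.add (Ext_ring C X)"
  "ring.zero (Ext_module C X) = ring.zero (Ext_ring C X)"
  "h \<odot>\<^bsub>Ext_module C X\<^esub> \<xi> = phi C X h \<otimes>\<^bsub>Ext_ring C X\<^esub> \<xi>"
  by (simp_all add: Ext_module_def ring.defs)

text \<open>Taken in every degree, odd ones included; \<open>support_ideal\<close> only sees its
  restriction to the even part.\<close>

definition phi_kernel where
  "phi_kernel X n = {\<xi> \<in> carrier (Ext C n I I). phi_part C X n \<xi> = \<zero>\<^bsub>Ext C n X X\<^esub>}"

context
  fixes X assumes X: "X \<in> Obj C"
begin

lemma phi_kernel_subgroup: "additive_subgroup (phi_kernel X n) (Ext C n I I)"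
proof (rule additive_subgroupI')
  interpret G: abelian_group "Ext C n I I" by (rule Ext_group) simp_all
  interpret H: abelian_group "Ext C n X X" using Ext_group[OF X X] .
  show "abelian_group (Ext C n I I)" by unfold_locales
  show "phi_kernel X n \<subseteq> carrier (Ext C n I I)" by (auto simp: phi_kernel_def)
  show "\<zero>\<^bsub>Ext C n I I\<^esub> \<in> phi_kernel X n" using phi_part_linear(1)[OF X] by (simp add: phi_kernel_def)
  have "\<ominus>\<^bsub>Ext C n X X\<^esub> \<zero>\<^bsub>Ext C n X X\<^esub> = \<zero>\<^bsub>Ext C n X X\<^esub>"
    using H.minus_equality[OF H.l_zero[OF H.zero_closed] H.zero_closed H.zero_closed] .
  then show "\<ominus>\<^bsub>Ext C n I I\<^esub> \<xi> \<in> phi_kernel X n" if "\<xi> \<in> phi_kernel X n" for \<xi>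
    using that phi_part_linear(2)[OF X] by (simp add: phi_kernel_def)
  show "\<xi> \<oplus>\<^bsub>Ext C n I I\<^esub> \<eta> \<in> phi_kernel X n" if "\<xi> \<in> phi_kernel X n" "\<eta> \<in> phi_kernel X n" for \<xi> \<eta>
    using that phi_part_add[OF X] by (simp add: phi_kernel_def)
qed

lemma phi_kernel_ideal:
  "\<lbrakk>a \<in> carrier (Ext C m I I); b \<in> phi_kernel X n\<rbrakk> \<Longrightarrow> yoneda C m n I I I a b \<in> phi_kernel X (m + n)"
  "\<lbrakk>a \<in> phi_kernel X m; b \<in> carrier (Ext C n I I)\<rbrakk> \<Longrightarrow> yoneda C m n I I I a b \<in> phi_kernel X (m + n)"
  using yoneda_closed[OF UnitO_Obj UnitO_Obj UnitO_Obj] phi_part_mult[OF X] phi_part_closed[OF X] yoneda_zero[OF X X X]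
  by (simp_all add: phi_kernel_def)

text \<open>Self-extensions contain the identity class, so h annihilates all of them exactly when
  \<open>phi C X h\<close> is zero, and this can be tested degree by degree.\<close>

lemma support_ideal_eq:
  "support_ideal K C X = {h \<in> carrier (even_cohomology_ring K C). \<forall>n. h n \<in> phi_kernel X n}"
  unfolding support_ideal_def
proof (intro Collect_cong conj_cong refl)
  fix h assume "h \<in> carrier (even_cohomology_ring K C)"
  then have h: "h \<in> carrier (cohomology_ring C)" by (simp add: even_cohomology_ring_def split: if_splits)
  interpret R: ring "Ext_ring C X"
    unfolding Ext_ring_direct_sum using graded_ring.DS_ring[OF Ext_graded_ring[OF X]] .
  have hn: "h n \<in> carrier (Ext C n I I)" for n using h by (simp add: cohomology_ring_def Ext_ring_def)
  have p: "phi C X h \<in> carrier (Ext_ring C X)" using phi_closed[OF X h] .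
  have "(\<forall>\<xi>\<in>carrier (Ext_ring C X). phi C X h \<otimes>\<^bsub>Ext_ring C X\<^esub> \<xi> = \<zero>\<^bsub>Ext_ring C X\<^esub>) \<longleftrightarrow> phi C X h = \<zero>\<^bsub>Ext_ring C X\<^esub>"
    using R.r_one[OF p] R.l_null by (metis R.one_closed)
  also have "\<dots> \<longleftrightarrow> (\<forall>n. phi_part C X n (h n) = \<zero>\<^bsub>Ext C n X X\<^esub>)"
    by (simp add: phi_eq_parts Ext_ring_def fun_eq_iff)
  finally show "(\<forall>\<xi>\<in>carrier (Ext_module C X). h \<odot>\<^bsub>Ext_module C X\<^esub> \<xi> = \<zero>\<^bsub>Ext_module C X\<^esub>) \<longleftrightarrow> (\<forall>n. h n \<in> phi_kernel X n)"
    using hn by (simp add: Ext_module_simps phi_kernel_def)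
qed

interpretation H: graded_comm_ring "\<lambda>n. Ext C n I I" "\<lambda>m n. yoneda C m n I I I" "ext_class C 0 I I (res C I 0)" char_two
  by (rule cohomology_graded_comm_ring)

lemma even_cohomology_ring_eq: "even_cohomology_ring K C = H.even_part"
  by (simp add: even_cohomology_ring_def H.even_part_def cohomology_ring_def Ext_ring_direct_sum)

lemma dim_support_variety_eq:
  "dim_support_variety K C X = krull_dim (H.even_part Quot H.graded_ideal (phi_kernel X))"
proof -
  have "support_ideal K C X = H.graded_ideal (phi_kernel X)"
    unfolding support_ideal_eq even_cohomology_ring_eq
    by (simp add: H.graded_ideal_def[OF phi_kernel_subgroup phi_kernel_ideal])
  then show ?thesis by (simp add: dim_support_variety_def even_cohomology_ring_eq)
qed

lemma dim_support_variety_projective: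
  assumes P: "projective_obj C X"
  shows "dim_support_variety K C X = 0"
  unfolding dim_support_variety_eq
proof (rule H.krull_dim_concentrated[OF phi_kernel_subgroup phi_kernel_ideal])
  fix n :: nat assume "n > 0"
  then obtain m where m: "n = Suc m" using gr0_implies_Suc by blast
  have "\<xi> = \<zero>\<^bsub>Ext C n X X\<^esub>" if "\<xi> \<in> carrier (Ext C n X X)" for \<xi>
    using Ext_E[OF X X that] projective_coboundaries[OF P] Ext_zero_iff[OF X X] m by metis
  then show "phi_kernel X n = carrier (Ext C n I I)"
    using phi_part_closed[OF X] by (auto simp: phi_kernel_def)
next
  fix x assume "x \<in> carrier (Ext C 0 I I)" "x \<noteq> \<zero>\<^bsub>Ext C 0 I I\<^esub>"
  then show "\<exists>y\<in>carrier (Ext C 0 I I). yoneda C 0 0 I I I y x = ext_class C 0 I I (res C I 0)"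
    using unit_End_division by metis
qed

section \<open>From dimension zero to projectivity\<close>

lemma scalars_concentrated:
  assumes "b \<in> cohomology_scalars K C"
  shows "b \<in> carrier (cohomology_ring C)" "n > 0 \<Longrightarrow> b n = \<zero>\<^bsub>Ext C n I I\<^esub>"
proof -
  obtain a where a: "a \<in> carrier K" "b = (\<lambda>n. a \<odot>\<^bsub>Ext C n I I\<^esub> \<one>\<^bsub>cohomology_ring C\<^esub> n)"
    using assms by (auto simp: cohomology_scalars_def)
  have pos: "b n = \<zero>\<^bsub>Ext C n I I\<^esub>" if "n > 0" for n
  proof -
    interpret M: module K "HomMod C (resO C I n) I" using HomMod_module by simp
    show ?thesis
      using that Ext_smult(2)[OF UnitO_Obj UnitO_Obj a(1) zero_cocycle[OF UnitO_Obj UnitO_Obj], of n] M.smult_r_null[OF a(1)]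
      by (simp add: a(2) cohomology_ring_def Ext_ring_def Ext_zero)
  qed
  then show "n > 0 \<Longrightarrow> b n = \<zero>\<^bsub>Ext C n I I\<^esub>" .
  have "b 0 \<in> carrier (Ext C 0 I I)"
    using Ext_smult[OF UnitO_Obj UnitO_Obj a(1) augmentation_cocycle[OF UnitO_Obj]] Ext_I[OF UnitO_Obj UnitO_Obj]
    by (simp add: a(2) cohomology_ring_def Ext_ring_def)
  then have "b n \<in> carrier (Ext C n I I)" for n using pos by (cases n) auto
  then show "b \<in> carrier (cohomology_ring C)"
    unfolding cohomology_ring_def Ext_ring_direct_sum using pos by (rule H.DS_I[of _ 0])
qed

text \<open>The scalars in \<open>Fg\<close> are concentrated in degree 0 and contribute no letters,
  so its finite set A of generators meets the hypotheses of \<open>ideal_cofinite\<close>.\<close>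

lemma dim_0_phi_vanishes:
  assumes Fg: "Fg K C" and dim: "dim_support_variety K C X = 0"
  shows "\<exists>D. \<forall>n\<ge>D. \<forall>\<xi>\<in>carrier (Ext C n I I). phi_part C X n \<xi> = \<zero>\<^bsub>Ext C n X X\<^esub>"
proof -
  obtain A where A: "finite A" "A \<subseteq> carrier (cohomology_ring C)"
    "generate_ring (cohomology_ring C) (A \<union> cohomology_scalars K C) = carrier (cohomology_ring C)"
    using Fg unfolding Fg_def by blast
  note eq = cohomology_ring_def[of C] Ext_ring_direct_sum[of I]
  have "\<exists>D. \<forall>n\<ge>D. phi_kernel X n = carrier (Ext C n I I)"
    by (rule H.ideal_cofinite[OF phi_kernel_subgroup phi_kernel_ideal dim[unfolded dim_support_variety_eq]
        A(1) A(2)[unfolded eq] _ _ A(3)[unfolded eq]])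
      (use scalars_concentrated in \<open>auto simp: eq\<close>)
  then show ?thesis by (auto simp: phi_kernel_def)
qed

text \<open>The classes in \<open>Ext\<^sup>n(M, M)\<close> whose image in \<open>Ext\<^sup>n(M, X)\<close> is killed by all cohomology of degree at least
  \<open>E - n\<close> form a submodule, and for a large constant \<open>E\<close> it contains the generators. In degrees \<open>n \<ge> E\<close> the unit
  kills the image.\<close>

lemma fg_vanishing:
  assumes M: "M \<in> Obj C" and p: "p \<in> homset C M X" and i: "i \<in> homset C X M" and pi: "p \<bullet> i = Ide C X"
    and fg: "fin_gen_module (cohomology_ring C) (Ext_module C M)"
    and D: "\<And>n \<xi>. \<lbrakk>n \<ge> D; \<xi> \<in> carrier (Ext C n I I)\<rbrakk> \<Longrightarrow> phi_part C X n \<xi> = \<zero>\<^bsub>Ext C n X X\<^esub>"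
  shows "\<exists>N. \<forall>n\<ge>N. vanishes n M X"
proof -
  interpret E: graded_ring "\<lambda>n. Ext C n M M" "\<lambda>m n. yoneda C m n M M M" "ext_class C 0 M M (res C M 0)"
    by (rule Ext_graded_ring[OF M])
  note DS = Ext_ring_direct_sum[of M]
  obtain B where "finite B \<and> B \<subseteq> carrier (Ext_ring C M) \<and>
    (\<forall>N. submodule N (cohomology_ring C) (Ext_module C M) \<and> B \<subseteq> N \<longrightarrow> N = carrier (Ext_ring C M))"
    using fg unfolding fin_gen_module_def Ext_module_simps by (rule exE)
  then have B: "finite B" "B \<subseteq> carrier (Ext_ring C M)"
    "\<And>N. \<lbrakk>submodule N (cohomology_ring C) (Ext_module C M); B \<subseteq> N\<rbrakk> \<Longrightarrow> N = carrier (Ext_ring C M)"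
    by simp_all
  have "\<forall>b\<in>B. \<exists>N. \<forall>n>N. b n = \<zero>\<^bsub>Ext C n M M\<^esub>"
  proof
    fix b assume "b \<in> B"
    then have "b \<in> carrier E.DS" using B(2) unfolding DS by (rule rev_subsetD)
    then show "\<exists>N. \<forall>n>N. b n = \<zero>\<^bsub>Ext C n M M\<^esub>" by (rule E.DS_bound) blast
  qed
  from bchoice[OF this] obtain bnd where "\<forall>b\<in>B. \<forall>n>bnd b. b n = \<zero>\<^bsub>Ext C n M M\<^esub>" by (rule exE)
  then have bnd: "b n = \<zero>\<^bsub>Ext C n M M\<^esub>" if "b \<in> B" "n > bnd b" for b n using that by simp
  \<comment> \<open>The sum serves as a common bound beyond which all components of the finitely
    many generators vanish.\<close>
  define D0 where "D0 = sum bnd B"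
  have D0: "b n = \<zero>\<^bsub>Ext C n M M\<^esub>" if "b \<in> B" "n > D0" for b n
    using bnd[OF that(1)] member_le_sum[OF that(1) _ B(1), of bnd] that(2) by (simp add: D0_def)
  define \<pi> where "\<pi> = ext_class C 0 M X (p \<bullet> res C M 0)"
  have \<pi>: "\<pi> \<in> carrier (Ext C 0 M X)"
    unfolding \<pi>_def using Ext_I[OF M X cocycle_Comp[OF augmentation_cocycle[OF M] p M]] .
  \<comment> \<open>h acts here after \<eta> has been pushed forward along p, so through
    \<open>phi_part C X\<close>.\<close>
  define F where "F m h n \<eta> = yoneda C m n M X X (phi_part C X m h) (yoneda C 0 n M M X \<pi> \<eta>)" for m h n \<eta>
  \<comment> \<open>The bound D + D0 is made for the generators: their components of degree n > D0
    are zero, and for n \<le> D0 the condition forces m \<ge> D, where \<open>phi_part C X m\<close>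
    vanishes. Only the total degree is constrained, so the condition survives the action.\<close>
  define R where "R n = {\<eta> \<in> carrier (Ext C n M M). \<forall>m. \<forall>h\<in>carrier (Ext C m I I). D + D0 \<le> m + n \<longrightarrow>
     F m h n \<eta> = \<zero>\<^bsub>Ext C (m + n) M X\<^esub>}" for n
  have push: "yoneda C 0 n M M X \<pi> \<eta> \<in> carrier (Ext C n M X)" if "\<eta> \<in> carrier (Ext C n M M)" for n \<eta>
    using yoneda_closed[OF M M X \<pi> that] by simp
  have Fclosed: "F m h n \<eta> \<in> carrier (Ext C (m + n) M X)"
    if "h \<in> carrier (Ext C m I I)" "\<eta> \<in> carrier (Ext C n M M)" for m h n \<eta>
    unfolding F_def using yoneda_closed[OF M X X phi_part_closed[OF X that(1)] push[OF that(2)]] .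
  have Fadd: "F m h n (\<eta> \<oplus>\<^bsub>Ext C n M M\<^esub> \<eta>') = F m h n \<eta> \<oplus>\<^bsub>Ext C (m + n) M X\<^esub> F m h n \<eta>'"
    if "h \<in> carrier (Ext C m I I)" "\<eta> \<in> carrier (Ext C n M M)" "\<eta>' \<in> carrier (Ext C n M M)" for m h n \<eta> \<eta>'
    unfolding F_def
    using yoneda_add_right[OF M M X \<pi> that(2,3)] yoneda_add_right[OF M X X phi_part_closed[OF X that(1)] push[OF that(2)] push[OF that(3)]]
    by simp
  have Flin: "F m h n \<zero>\<^bsub>Ext C n M M\<^esub> = \<zero>\<^bsub>Ext C (m + n) M X\<^esub>"
    "\<eta> \<in> carrier (Ext C n M M) \<Longrightarrow> F m h n (\<ominus>\<^bsub>Ext C n M M\<^esub> \<eta>) = \<ominus>\<^bsub>Ext C (m + n) M X\<^esub> F m h n \<eta>"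
    if h: "h \<in> carrier (Ext C m I I)" for m h n \<eta>
    using additive_map(1,2)[OF Ext_group[OF M M] Ext_group[OF M X], where h="F m h n", OF Fclosed[OF h] Fadd[OF h]]
    by simp_all
  have Rsub: "additive_subgroup (R n) (Ext C n M M)" for n
  proof (rule additive_subgroupI')
    show "abelian_group (Ext C n M M)" by (rule Ext_group[OF M M])
    show "R n \<subseteq> carrier (Ext C n M M)" by (auto simp: R_def)
    show "\<zero>\<^bsub>Ext C n M M\<^esub> \<in> R n" using Flin(1) E.G.zero_closed by (simp add: R_def)
    have z: "\<ominus>\<^bsub>Ext C k M X\<^esub> \<zero>\<^bsub>Ext C k M X\<^esub> = \<zero>\<^bsub>Ext C k M X\<^esub>"
      "\<zero>\<^bsub>Ext C k M X\<^esub> \<oplus>\<^bsub>Ext C k M X\<^esub> \<zero>\<^bsub>Ext C k M X\<^esub> = \<zero>\<^bsub>Ext C k M X\<^esub>" for k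
    proof -
      interpret H: abelian_group "Ext C k M X" by (rule Ext_group[OF M X])
      show "\<zero>\<^bsub>Ext C k M X\<^esub> \<oplus>\<^bsub>Ext C k M X\<^esub> \<zero>\<^bsub>Ext C k M X\<^esub> = \<zero>\<^bsub>Ext C k M X\<^esub>" by simp
      from H.minus_equality[OF this H.zero_closed H.zero_closed]
      show "\<ominus>\<^bsub>Ext C k M X\<^esub> \<zero>\<^bsub>Ext C k M X\<^esub> = \<zero>\<^bsub>Ext C k M X\<^esub>" .
    qed
    show "\<ominus>\<^bsub>Ext C n M M\<^esub> \<eta> \<in> R n" if "\<eta> \<in> R n" for \<eta>
      using that Flin(2) abelian_group.a_inv_closed[OF Ext_group[OF M M]] z(1) by (simp add: R_def)
    show "\<eta> \<oplus>\<^bsub>Ext C n M M\<^esub> \<eta>' \<in> R n" if "\<eta> \<in> R n" "\<eta>' \<in> R n" for \<eta> \<eta>'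
      using that Fadd E.G.a_closed z(2) by (simp add: R_def)
  qed
  \<comment> \<open>Naturality moves a from \<open>phi_part C M\<close> to
    \<open>phi_part C X\<close>, where multiplicativity merges it with h. The total degree is
    unchanged, so the condition on \<eta> applies to the merged element.\<close>
  have Ract: "yoneda C m n M M M (phi_part C M m a) \<eta> \<in> R (m + n)"
    if a: "a \<in> carrier (Ext C m I I)" and \<eta>: "\<eta> \<in> R n" for m n a \<eta>
  proof -
    have \<eta>c: "\<eta> \<in> carrier (Ext C n M M)" using \<eta> by (simp add: R_def)
    have "F k h (m + n) (yoneda C m n M M M (phi_part C M m a) \<eta>) = \<zero>\<^bsub>Ext C (k + (m + n)) M X\<^esub>"
      if h: "h \<in> carrier (Ext C k I I)" and le: "D + D0 \<le> k + (m + n)" for k h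
    proof -
      have "F k h (m + n) (yoneda C m n M M M (phi_part C M m a) \<eta>) =
        yoneda C k (m + n) M X X (phi_part C X k h) (yoneda C m n M X X (phi_part C X m a) (yoneda C 0 n M M X \<pi> \<eta>))"
        unfolding F_def \<pi>_def phi_act_natural[OF M X p a \<eta>c] ..
      also have "\<dots> = yoneda C (k + m) n M X X (yoneda C k m X X X (phi_part C X k h) (phi_part C X m a)) (yoneda C 0 n M M X \<pi> \<eta>)"
        using yoneda_assoc[OF M X X X phi_part_closed[OF X h] phi_part_closed[OF X a] push[OF \<eta>c]] by simp
      also have "\<dots> = F (k + m) (yoneda C k m I I I h a) n \<eta>"
        unfolding F_def phi_part_mult[OF X h a] ..
      also have "\<dots> = \<zero>\<^bsub>Ext C (k + m + n) M X\<^esub>"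
        using \<eta> yoneda_closed[OF UnitO_Obj UnitO_Obj UnitO_Obj h a] le by (simp add: R_def add.assoc)
      finally show ?thesis by (simp add: add.assoc)
    qed
    then show ?thesis
      using yoneda_closed[OF M M M phi_part_closed[OF M a] \<eta>c] by (simp add: R_def)
  qed
  define N where "N = {\<xi> \<in> carrier (Ext_ring C M). \<forall>n. \<xi> n \<in> R n}"
  have "submodule N (cohomology_ring C) (Ext_module C M)"
  proof (intro submodule.intro submodule_axioms.intro)
    interpret ER: ring "Ext_ring C M" unfolding DS by (rule E.DS_ring)
    note tr = abelian_group_transfer[OF ER.abelian_group_axioms Ext_module_simps(1-3)]
    note Rz = additive_subgroup.zero_closed[OF Rsub] and Ra = additive_subgroup.a_closed[OF Rsub]
      and Rn = additive_subgroup.a_inv_closed[OF Rsub]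
    have "additive_subgroup N (Ext_module C M)"
    proof (rule additive_subgroupI'[OF tr(1)])
      show "N \<subseteq> carrier (Ext_module C M)" by (auto simp: N_def Ext_module_simps)
      show "\<zero>\<^bsub>Ext_module C M\<^esub> \<in> N"
        using ER.zero_closed Rz E.DS_simps(4) by (simp add: N_def Ext_module_simps DS)
      show "\<ominus>\<^bsub>Ext_module C M\<^esub> \<xi> \<in> N" if \<xi>: "\<xi> \<in> N" for \<xi>
      proof -
        have \<xi>c: "\<xi> \<in> carrier (Ext_ring C M)" using \<xi> by (simp add: N_def)
        have "(\<ominus>\<^bsub>Ext_ring C M\<^esub> \<xi>) n = \<ominus>\<^bsub>Ext C n M M\<^esub> \<xi> n" for n
          using E.DS_neg[OF \<xi>c[unfolded DS]] by (simp add: DS)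
        then show ?thesis
          using \<xi> Rn ER.a_inv_closed[OF \<xi>c] tr(2)[OF \<xi>c] by (simp add: N_def)
      qed
      show "\<xi> \<oplus>\<^bsub>Ext_module C M\<^esub> \<eta> \<in> N" if "\<xi> \<in> N" "\<eta> \<in> N" for \<xi> \<eta>
        using that Ra ER.a_closed E.DS_simps(5) by (simp add: N_def Ext_module_simps DS)
    qed
    then show "subgroup N (add_monoid (Ext_module C M))" by (rule additive_subgroup.a_subgroup)
    fix a \<xi> assume a: "a \<in> carrier (cohomology_ring C)" and \<xi>: "\<xi> \<in> N"
    have an: "a n \<in> carrier (Ext C n I I)" for n using a by (simp add: cohomology_ring_def Ext_ring_def)
    have "(phi C M a \<otimes>\<^bsub>Ext_ring C M\<^esub> \<xi>) n \<in> R n" for n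
      unfolding DS E.DS_simps(2)
    proof (rule E.G.finsum_in_subgroup[OF Rsub])
      fix i assume "i \<in> {..n}"
      then show "yoneda C i (n - i) M M M (phi C M a i) (\<xi> (n - i)) \<in> R n"
        using Ract[OF an, of "\<xi> (n - i)" "n - i" i] \<xi> by (simp add: N_def phi_eq_parts)
    qed
    moreover have "phi C M a \<otimes>\<^bsub>Ext_ring C M\<^esub> \<xi> \<in> carrier (Ext_ring C M)"
      using ER.m_closed[OF phi_closed[OF M a]] \<xi> by (simp add: N_def)
    ultimately show "a \<odot>\<^bsub>Ext_module C M\<^esub> \<xi> \<in> N" by (simp add: N_def Ext_module_simps)
  qed
  moreover have "B \<subseteq> N"
  proof
    fix b assume b: "b \<in> B"
    have bc: "b n \<in> carrier (Ext C n M M)" for n using B(2) b by (auto simp: Ext_ring_def)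
    have "F m h n (b n) = \<zero>\<^bsub>Ext C (m + n) M X\<^esub>"
      if h: "h \<in> carrier (Ext C m I I)" and le: "D + D0 \<le> m + n" for m h n
    proof (cases "n > D0")
      case True
      then show ?thesis using D0[OF b] Flin(1)[OF h] by simp
    next
      case False
      then show ?thesis
        using D[OF _ h] le yoneda_zero(1)[OF M X X push[OF bc]] by (simp add: F_def)
    qed
    then show "b \<in> N" using B(2) b bc by (auto simp: N_def R_def)
  qed
  ultimately have N: "N = carrier (Ext_ring C M)" by (rule B(3))
  have "f \<in> coboundaries C n M X" if n: "n \<ge> D + D0" and f: "f \<in> cocycles C n M X" for n f
  proof -
    have if': "i \<bullet> f \<in> cocycles C n M M" using cocycle_Comp[OF f i M] .
    let ?\<eta> = "ext_class C n M M (i \<bullet> f)"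
    have \<eta>: "?\<eta> \<in> carrier (Ext C n M M)" using Ext_I[OF M M if'] .
    \<comment> \<open>The class of \<open>i \<bullet> f\<close> is placed in degree n. Pushed
      forward along p it becomes the class of f, because \<open>p \<bullet> i\<close> is the
      identity, and the unit of degree 0 acts on it trivially.\<close>
    have "E.single n ?\<eta> \<in> N" unfolding N DS by (rule E.single_closed[OF \<eta>])
    then have "E.single n ?\<eta> n \<in> R n" unfolding N_def by blast
    then have "?\<eta> \<in> R n" by (simp add: E.single_def)
    moreover have "ext_class C 0 I I (res C I 0) \<in> carrier (Ext C 0 I I)"
      by (rule Ext_I[OF UnitO_Obj UnitO_Obj augmentation_cocycle[OF UnitO_Obj]])
    ultimately have "F 0 (ext_class C 0 I I (res C I 0)) n ?\<eta> = \<zero>\<^bsub>Ext C (0 + n) M X\<^esub>"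
      using n unfolding R_def by simp
    moreover have "p \<bullet> (i \<bullet> f) = f"
      using Comp_reassoc[OF pi, of f] homD[OF p] homD[OF i] cocyclesD[OF f] by simp
    then have "yoneda C 0 n M M X \<pi> ?\<eta> = ext_class C n M X f"
      unfolding \<pi>_def yoneda_degree_0[OF M M p if'] by simp
    ultimately have "ext_class C n M X f = \<zero>\<^bsub>Ext C n M X\<^esub>"
      using yoneda_one_left[OF M X Ext_I[OF M X f]] by (simp add: F_def phi_part_one[OF X])
    then show ?thesis using Ext_zero_iff[OF M X f] by blast
  qed
  then show ?thesis by blast
qed

lemma projective_if_dim_0:
  assumes Fg: "Fg K C" and dim: "dim_support_variety K C X = 0"
  shows "projective_obj C X"
proof -
  obtain D where D: "\<And>n \<xi>. \<lbrakk>n \<ge> D; \<xi> \<in> carrier (Ext C n I I)\<rbrakk> \<Longrightarrow> phi_part C X n \<xi> = \<zero>\<^bsub>Ext C n X X\<^esub>"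
    using dim_0_phi_vanishes[OF Fg dim] by blast
  obtain T where T: "finite T" "T \<subseteq> Obj C" "\<And>S. simple_obj C S \<Longrightarrow> \<exists>S' \<in> T. isomorphic_obj C S S'"
    using finitely_many_simples unfolding finitely_many_simples_def by blast
  \<comment> \<open>In the biproduct of X and S, the arrows p and i feed
    \<open>fg_vanishing\<close>, while q and j exhibit S as a retract of M.\<close>
  have "\<exists>M j q N. M \<in> Obj C \<and> j \<in> homset C S M \<and> q \<in> homset C M S \<and> q \<bullet> j = Ide C S \<and>
     (\<forall>n\<ge>N. vanishes n M X)" if S: "S \<in> T" for S
  proof -
    obtain M i j p q where M: "is_biproduct C X S M i j p q" using biproduct_exists[OF X subsetD[OF T(2) S]] by blast
    then have h: "i \<in> homset C X M" "j \<in> homset C S M" "p \<in> homset C M X" "q \<in> homset C M S"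
      "p \<bullet> i = Ide C X" "q \<bullet> j = Ide C S" by (simp_all add: is_biproduct_def)
    have MO: "M \<in> Obj C" using hom_Obj h by blast
    have "fin_gen_module (cohomology_ring C) (Ext_module C M)" using Fg MO unfolding Fg_def by blast
    from fg_vanishing[OF MO h(3,1,5) this D] obtain N where "\<forall>n\<ge>N. vanishes n M X" by blast
    then show ?thesis using h MO by blast
  qed
  then obtain M j q N where M: "\<And>S. S \<in> T \<Longrightarrow> M S \<in> Obj C" "\<And>S. S \<in> T \<Longrightarrow> j S \<in> homset C S (M S)"
    "\<And>S. S \<in> T \<Longrightarrow> q S \<in> homset C (M S) S" "\<And>S. S \<in> T \<Longrightarrow> q S \<bullet> j S = Ide C S"
    "\<And>S n. \<lbrakk>S \<in> T; n \<ge> N S\<rbrakk> \<Longrightarrow> vanishes n (M S) X" by metis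
  show ?thesis
  \<comment> \<open>As T is finite, the sum bounds every \<open>N S\<close>, which gives one degree
    in which Ext to X vanishes for all these objects.\<close>
  proof (rule projective_if_vanishing[where T = "M ` T" and n = "sum N T"])
    show "X \<in> Obj C" by (rule X)
    show "A \<in> Obj C" if "A \<in> M ` T" for A using that M(1) by blast
    show "vanishes (Suc (sum N T)) A X" if A: "A \<in> M ` T" for A
    proof -
      obtain S where S: "S \<in> T" "A = M S" using A by blast
      have "N S \<le> Suc (sum N T)" using member_le_sum[OF S(1) _ T(1), of N] by simp
      then show ?thesis using M(5)[OF S(1)] S(2) by blast
    qed
    \<comment> \<open>A simple object is only isomorphic to a member of T; the isomorphism f is
      absorbed into the retraction.\<close>
    fix S assume "simple_obj C S"
    then obtain S' f where S': "S' \<in> T" "f \<in> homset C S S'" "iso_arrow C f"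
      using T(3) unfolding isomorphic_obj_def by blast
    let ?g = "inv_arrow C f"
    note ff = homD[OF S'(2)] and gg = iso_arrowD[OF S'(3)]
    have g: "?g \<in> homset C S' S" using gg ff by (auto intro: homI)
    have "(?g \<bullet> q S') \<bullet> (j S' \<bullet> f) = ?g \<bullet> ((q S' \<bullet> j S') \<bullet> f)"
      using ff gg homD[OF M(2)[OF S'(1)]] homD[OF M(3)[OF S'(1)]] by simp
    also have "\<dots> = Ide C S" unfolding M(4)[OF S'(1)] using ff gg by simp
    finally show "\<exists>A\<in>M ` T. \<exists>a\<in>homset C S A. \<exists>b\<in>homset C A S. b \<bullet> a = Ide C S"
      using S'(1) Comp_hom[OF M(2)[OF S'(1)] S'(2)] Comp_hom[OF g M(3)[OF S'(1)]] by blast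
  qed
qed

end

end

theorem corollary4p2:
  fixes K :: "('k, 'a) ring_scheme"
    and C :: "('o, 'm, 'k, 'z) tensor_category_scheme"
  assumes "algebraically_closed K"
    and "finite_tensor_category K C"
    and "Fg K C"
    and "X \<in> Obj C"
  shows "projective_obj C X \<longleftrightarrow> dim_support_variety K C X = 0"
proof -
  interpret finite_tensor_category K C by fact
  show ?thesis
    using dim_support_variety_projective[OF assms(4)] projective_if_dim_0[OF assms(4,3)] by blast
qed

end
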